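(* Let $Y$ be a solution in $\mathbb R^d$ of the stochastic differential equation $dY_s=b(Y_s)\,ds+\sigma(Y_s)\,dW_s$, where $b:\mathbb R^d\to\mathbb R^d$, $\sigma:\mathbb R^d\to\mathbb R^{d\times n}$, $n\ge1$, and $W$ is an $n$-dimensional Brownian motion; denote $a=\sigma\sigma^T$. Assume that (a) $\sigma,b$ are in $C^2(\mathbb R^d)$ with bounded derivatives of order $i=0,1,2$ on $\{-1\le\xi\le1\}$; (b) $\xi:\mathbb R^d\to\mathbb R$ is in $C^2(\mathbb R^d)$ with bounded derivatives of order $i=1,2$ on $\{-1\le\xi\le1\}$, and $A=\bar A=\{\xi\le-1\}$; (c) there exists $\delta>0$ such that $(\nabla\xi)^Ta\nabla\xi\ge\delta$ on $\{-1\le\xi\le1\}$. Then Assumptions 1, 2 and 3 (stated in the context) hold true.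
   Context: $E=\mathbb R^d$; $\{\xi\in I\}=\xi^{-1}(I)$. $\mathbb P_y,\mathbb E_y$ refer to $Y_0=y$. The initial law $\eta_0$ is, by standing assumption, supported by $\{\xi=0\}$, i.e. $\eta_0(\xi=0)=1$. For $t\ge0$, $S_t=\inf\{s\ge0:\xi(Y_s)>t\}\in[0,+\infty]$, and for $B\subset E$, $S_B=\inf\{s\ge0:Y_s\in B\}\in[0,+\infty]$ ($\inf\emptyset=+\infty$). $\mathring A,\bar A$ are the interior and closure of $A$. Convention: the process is stopped at $S_1\wedge S_A$; the random times $S_t,S_A,S_{\bar A},S_{\mathring A}$ are computed along the unstopped solution, while the Feller property in Assumption 1 is that of the process stopped at $S_1\wedge S_A$. **Assumption 1.** $E$ is locally compact, $\xi$ is continuous, $\eta_0(\xi=0)=1$, $A\subset\{\xi<0\}$, and $(Y_s)_{s\ge0}$ is a Feller process with continuous trajectories (i.e. for all $\varphi\in C_0(E)$, $s\ge0$, $y\mapsto\mathbb E_y[\varphi(Y_s)]$ is in $C_0(E)$, the continuous functions vanishing at infinity). **Assumption 2.** For any $t\in[0,1]$ and $y\in E$ with $\xi(y)=t$, $\mathbb P_y(S_t=0)=1$; and for all $y\in\{\xi=0\}$, $\mathbb P_y(S_{\bar A}=S_{\mathring A})=1$. **Assumption 3.** Almost surely $S_A\wedge S_1<+\infty$ (i.e. $\mathbb P_y$-almost surely for every $y\in\{0\le\xi\le1\}$), and $\inf_{y\in\{\xi=0\}}\mathbb P_y(S_1<S_A)>0$. *)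

theory Defs
  imports "HOL-Probability.Probability"
begin

section \<open>Second order differentiability and gradients\<close>

text \<open>The Fr\'echet derivative as a bounded linear map; meaningful where \<open>f\<close> is differentiable.\<close>

definition D1 :: "('a::real_normed_vector \<Rightarrow> 'b::real_normed_vector) \<Rightarrow> 'a \<Rightarrow> 'a \<Rightarrow>\<^sub>L 'b" where
  "D1 f x = Blinfun (frechet_derivative f (at x))"

abbreviation D2 :: "('a::real_normed_vector \<Rightarrow> 'b::real_normed_vector) \<Rightarrow> 'a \<Rightarrow> 'a \<Rightarrow>\<^sub>L ('a \<Rightarrow>\<^sub>L 'b)" where
  "D2 f \<equiv> D1 (D1 f)"

definition C2 :: "('a::real_normed_vector \<Rightarrow> 'b::real_normed_vector) \<Rightarrow> bool" where
  "C2 f \<longleftrightarrow> f differentiable_on UNIV \<and> D1 f differentiable_on UNIV \<and> continuous_on UNIV (D2 f)"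

definition grad :: "(real^'d \<Rightarrow> real) \<Rightarrow> real^'d \<Rightarrow> real^'d" where
  "grad f x = (\<chi> i. frechet_derivative f (at x) (axis i 1))"


section \<open>Brownian motion and the It\^o integral\<close>

text \<open>
  Processes and filtrations are indexed by \<open>real\<close>, but only times \<open>t \<ge> 0\<close> matter. The library
  locale \<open>filtration\<close> ranges over the whole index type; this is no restriction, because a
  filtration on the half line extends by its value at \<open>0\<close> to negative times.
  The usual conditions (completeness, right continuity) are not required.
\<close>

definition filtered_prob_space :: "'w measure \<Rightarrow> (real \<Rightarrow> 'w measure) \<Rightarrow> bool" where
  "filtered_prob_space M F \<longleftrightarrow>
     prob_space M \<and> filtration (space M) F \<and> (\<forall>t. subalgebra M (F t))"

definition continuous_paths :: "'w measure \<Rightarrow> (real \<Rightarrow> 'w \<Rightarrow> 'a::topological_space) \<Rightarrow> bool" where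
  "continuous_paths M X \<longleftrightarrow> (\<forall>\<omega>\<in>space M. continuous_on {0..} (\<lambda>t. X t \<omega>))"

definition adapted :: "(real \<Rightarrow> 'w measure) \<Rightarrow> (real \<Rightarrow> 'w \<Rightarrow> 'a::topological_space) \<Rightarrow> bool" where
  "adapted F X \<longleftrightarrow> (\<forall>t\<ge>0. X t \<in> borel_measurable (F t))"

text \<open>Standard Brownian motion relative to the filtration \<open>F\<close>: the increments over \<open>[s, t]\<close> are
  independent of \<open>F s\<close> and centred Gaussian with covariance \<open>t - s\<close> times the identity.\<close>

definition brownian_motion ::
    "'w measure \<Rightarrow> (real \<Rightarrow> 'w measure) \<Rightarrow> (real \<Rightarrow> 'w \<Rightarrow> real^'n) \<Rightarrow> bool" where
  "brownian_motion M F W \<longleftrightarrow>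
     adapted F W \<and> continuous_paths M W \<and> (AE \<omega> in M. W 0 \<omega> = 0) \<and>
     (\<forall>s t. 0 \<le> s \<and> s < t \<longrightarrow>
        distributed M lborel (\<lambda>\<omega>. W t \<omega> - W s \<omega>)
          (\<lambda>x. ennreal (\<Prod>i\<in>UNIV. normal_density 0 (sqrt (t - s)) (x $ i))) \<and>
        prob_space.indep_set M (sets (F s))
          (sets (vimage_algebra (space M) (\<lambda>\<omega>. W t \<omega> - W s \<omega>) borel)))"

text \<open>A simple integrand \<open>(N, \<tau>, h)\<close> is the matrix-valued process equal to \<open>h i\<close> on
  \<open>(\<tau> i, \<tau> (i + 1)]\<close> for \<open>i < N\<close>, and to \<open>0\<close> elsewhere.\<close>

definition simple_integrand ::
    "(real \<Rightarrow> 'w measure) \<Rightarrow> nat \<Rightarrow> (nat \<Rightarrow> real) \<Rightarrow> (nat \<Rightarrow> 'w \<Rightarrow> real^'n^'d) \<Rightarrow> bool" where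
  "simple_integrand F N \<tau> h \<longleftrightarrow>
     0 \<le> \<tau> 0 \<and> (\<forall>i<N. \<tau> i \<le> \<tau> (Suc i)) \<and>
     (\<forall>i<N. h i \<in> borel_measurable (F (\<tau> i)) \<and> (\<exists>C. \<forall>\<omega>\<in>space (F (\<tau> i)). norm (h i \<omega>) \<le> C))"

definition simple_value ::
    "nat \<Rightarrow> (nat \<Rightarrow> real) \<Rightarrow> (nat \<Rightarrow> 'w \<Rightarrow> real^'n^'d) \<Rightarrow> real \<Rightarrow> 'w \<Rightarrow> real^'n^'d" where
  "simple_value N \<tau> h s \<omega> = (\<Sum>i<N. indicator {\<tau> i<..\<tau> (Suc i)} s *\<^sub>R h i \<omega>)"

definition simple_integral ::
    "(real \<Rightarrow> 'w \<Rightarrow> real^'n) \<Rightarrow> nat \<Rightarrow> (nat \<Rightarrow> real) \<Rightarrow> (nat \<Rightarrow> 'w \<Rightarrow> real^'n^'d) \<Rightarrow>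
     real \<Rightarrow> 'w \<Rightarrow> real^'d" where
  "simple_integral W N \<tau> h t \<omega> =
     (\<Sum>i<N. h i \<omega> *v (W (min (\<tau> (Suc i)) t) \<omega> - W (min (\<tau> i) t) \<omega>))"

text \<open>\<open>has_ito_integral M F W H t I\<close>: the random vector \<open>I\<close> is (a version of) the It\^o integral of
  the progressively measurable, matrix-valued process \<open>H\<close> against \<open>W\<close> over \<open>[0, t]\<close>. It is the
  limit in probability of the integrals of simple integrands \<open>H\<^sub>k\<close> such that the integral of
  \<open>|H\<^sub>k - H|\<^sup>2\<close> over \<open>[0, t]\<close> tends to \<open>0\<close> in probability. The norm on matrices is the
  Frobenius norm.\<close>

definition has_ito_integral ::
    "'w measure \<Rightarrow> (real \<Rightarrow> 'w measure) \<Rightarrow> (real \<Rightarrow> 'w \<Rightarrow> real^'n) \<Rightarrow>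
     (real \<Rightarrow> 'w \<Rightarrow> real^'n^'d) \<Rightarrow> real \<Rightarrow> ('w \<Rightarrow> real^'d) \<Rightarrow> bool" where
  "has_ito_integral M F W H t I \<longleftrightarrow>
     (\<forall>u\<in>{0..t}. (\<lambda>(s, \<omega>). H s \<omega>) \<in> borel_measurable (restrict_space borel {0..u} \<Otimes>\<^sub>M F u)) \<and>
     (AE \<omega> in M. (\<integral>\<^sup>+ s\<in>{0..t}. ennreal ((norm (H s \<omega>))\<^sup>2) \<partial>lborel) < \<infinity>) \<and>
     I \<in> borel_measurable M \<and>
     (\<exists>N \<tau> h.
        (\<forall>k. simple_integrand F (N k) (\<tau> k) (h k)) \<and>
        (\<forall>\<epsilon>>0. (\<lambda>k. \<P>(\<omega> in M.
            (\<integral>\<^sup>+ s\<in>{0..t}. ennreal ((norm (simple_value (N k) (\<tau> k) (h k) s \<omega> - H s \<omega>))\<^sup>2) \<partial>lborel)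
              > ennreal \<epsilon>)) \<longlonglongrightarrow> 0) \<and>
        (\<forall>\<epsilon>>0. (\<lambda>k. \<P>(\<omega> in M.
            norm (simple_integral W (N k) (\<tau> k) (h k) t \<omega> - I \<omega>) > \<epsilon>)) \<longlonglongrightarrow> 0))"

text \<open>\<open>Y\<close> is a global solution of \<open>dY = b(Y) ds + \<sigma>(Y) dW\<close> with \<open>Y\<^sub>0 = y\<close>, on the filtered
  probability space \<open>(M, F)\<close> carrying the Brownian motion \<open>W\<close>.\<close>

definition sde_solution ::
    "(real^'d \<Rightarrow> real^'d) \<Rightarrow> (real^'d \<Rightarrow> real^'n^'d) \<Rightarrow> real^'d \<Rightarrow>
     'w measure \<Rightarrow> (real \<Rightarrow> 'w measure) \<Rightarrow> (real \<Rightarrow> 'w \<Rightarrow> real^'n) \<Rightarrow> (real \<Rightarrow> 'w \<Rightarrow> real^'d) \<Rightarrow> bool" where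
  "sde_solution b \<sigma> y M F W Y \<longleftrightarrow>
     filtered_prob_space M F \<and> brownian_motion M F W \<and>
     adapted F Y \<and> continuous_paths M Y \<and> (AE \<omega> in M. Y 0 \<omega> = y) \<and>
     (\<forall>t\<ge>0. (AE \<omega> in M. set_integrable lborel {0..t} (\<lambda>s. b (Y s \<omega>))) \<and>
        (\<exists>I. has_ito_integral M F W (\<lambda>s \<omega>. \<sigma> (Y s \<omega>)) t I \<and>
           (AE \<omega> in M. Y t \<omega> = y + (LBINT s:{0..t}. b (Y s \<omega>)) + I \<omega>)))"


section \<open>Hitting times, stopped processes, Feller processes\<close>

text \<open>The infimum of the empty set in \<open>ereal\<close> is \<open>\<infinity>\<close>.\<close>

definition hit :: "(real \<Rightarrow> 'a) \<Rightarrow> 'a set \<Rightarrow> ereal" where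
  "hit p B = (INF s\<in>{s. 0 \<le> s \<and> p s \<in> B}. ereal s)"

definition hit_level :: "('a \<Rightarrow> real) \<Rightarrow> (real \<Rightarrow> 'a) \<Rightarrow> real \<Rightarrow> ereal" where
  "hit_level \<xi> p t = hit p {x. \<xi> x > t}"

definition stopped_process ::
    "('a \<Rightarrow> real) \<Rightarrow> 'a set \<Rightarrow> (real \<Rightarrow> 'w \<Rightarrow> 'a) \<Rightarrow> real \<Rightarrow> 'w \<Rightarrow> 'a" where
  "stopped_process \<xi> A Y s \<omega> =
     Y (real_of_ereal (min (ereal s)
          (min (hit_level \<xi> (\<lambda>r. Y r \<omega>) 1) (hit (\<lambda>r. Y r \<omega>) A)))) \<omega>"

definition C0 :: "('a::euclidean_space \<Rightarrow> real) set" where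
  "C0 = {\<phi>. continuous_on UNIV \<phi> \<and> (\<phi> \<longlongrightarrow> 0) at_infinity}"

text \<open>
  A family of processes indexed by the starting point \<open>y\<close>, each living on its own filtered
  probability space \<open>(M y, F y)\<close>; the measure of \<open>M y\<close> plays the role of \<open>\<P>\<^sub>y\<close>. It is a Feller
  process if it is a Markov family whose transition operators preserve \<open>C0\<close>.
\<close>

definition markov_family ::
    "('a::euclidean_space \<Rightarrow> 'w measure) \<Rightarrow> ('a \<Rightarrow> real \<Rightarrow> 'w measure) \<Rightarrow>
     ('a \<Rightarrow> real \<Rightarrow> 'w \<Rightarrow> 'a) \<Rightarrow> bool" where
  "markov_family M F Z \<longleftrightarrow>
     (\<forall>y. filtered_prob_space (M y) (F y) \<and> adapted (F y) (Z y) \<and> (AE \<omega> in M y. Z y 0 \<omega> = y)) \<and>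
     (\<forall>\<phi>\<in>C0. \<forall>y. \<forall>s\<ge>0. \<forall>t\<ge>0. AE \<omega> in M y.
        real_cond_exp (M y) (F y s) (\<lambda>\<omega>'. \<phi> (Z y (s + t) \<omega>')) \<omega> =
        (\<integral>\<omega>'. \<phi> (Z (Z y s \<omega>) t \<omega>') \<partial>M (Z y s \<omega>)))"

definition feller_process ::
    "('a::euclidean_space \<Rightarrow> 'w measure) \<Rightarrow> ('a \<Rightarrow> real \<Rightarrow> 'w measure) \<Rightarrow>
     ('a \<Rightarrow> real \<Rightarrow> 'w \<Rightarrow> 'a) \<Rightarrow> bool" where
  "feller_process M F Z \<longleftrightarrow>
     markov_family M F Z \<and> (\<forall>\<phi>\<in>C0. \<forall>s\<ge>0. (\<lambda>y. \<integral>\<omega>. \<phi> (Z y s \<omega>) \<partial>M y) \<in> C0)"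


section \<open>The three assumptions\<close>

text \<open>\<open>Y\<close> is the unstopped process; only the Feller property concerns the process stopped at the
  minimum of \<open>S\<^sub>1\<close> and \<open>S\<^sub>A\<close>. Continuity of the stopped trajectories is inherited from \<open>Y\<close>.\<close>

definition assumption1 ::
    "('a::euclidean_space \<Rightarrow> real) \<Rightarrow> 'a set \<Rightarrow> 'a measure \<Rightarrow>
     ('a \<Rightarrow> 'w measure) \<Rightarrow> ('a \<Rightarrow> real \<Rightarrow> 'w measure) \<Rightarrow> ('a \<Rightarrow> real \<Rightarrow> 'w \<Rightarrow> 'a) \<Rightarrow> bool" where
  "assumption1 \<xi> A \<eta>0 M F Y \<longleftrightarrow>
     locally compact (UNIV :: 'a set) \<and> continuous_on UNIV \<xi> \<and>
     measure \<eta>0 {x. \<xi> x = 0} = 1 \<and> A \<subseteq> {x. \<xi> x < 0} \<and>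
     feller_process M F (\<lambda>y. stopped_process \<xi> A (Y y)) \<and>
     (\<forall>y. continuous_paths (M y) (Y y))"

definition assumption2 ::
    "('a::euclidean_space \<Rightarrow> real) \<Rightarrow> 'a set \<Rightarrow>
     ('a \<Rightarrow> 'w measure) \<Rightarrow> ('a \<Rightarrow> real \<Rightarrow> 'w \<Rightarrow> 'a) \<Rightarrow> bool" where
  "assumption2 \<xi> A M Y \<longleftrightarrow>
     (\<forall>t\<in>{0..1}. \<forall>y. \<xi> y = t \<longrightarrow> \<P>(\<omega> in M y. hit_level \<xi> (\<lambda>s. Y y s \<omega>) t = 0) = 1) \<and>
     (\<forall>y. \<xi> y = 0 \<longrightarrow>
        \<P>(\<omega> in M y. hit (\<lambda>s. Y y s \<omega>) (closure A) = hit (\<lambda>s. Y y s \<omega>) (interior A)) = 1)"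

definition assumption3 ::
    "('a::euclidean_space \<Rightarrow> real) \<Rightarrow> 'a set \<Rightarrow>
     ('a \<Rightarrow> 'w measure) \<Rightarrow> ('a \<Rightarrow> real \<Rightarrow> 'w \<Rightarrow> 'a) \<Rightarrow> bool" where
  "assumption3 \<xi> A M Y \<longleftrightarrow>
     (\<forall>y. 0 \<le> \<xi> y \<and> \<xi> y \<le> 1 \<longrightarrow>
        \<P>(\<omega> in M y. min (hit (\<lambda>s. Y y s \<omega>) A) (hit_level \<xi> (\<lambda>s. Y y s \<omega>) 1) < \<infinity>) = 1) \<and>
     (INF y\<in>{y. \<xi> y = 0}. \<P>(\<omega> in M y. hit_level \<xi> (\<lambda>s. Y y s \<omega>) 1 < hit (\<lambda>s. Y y s \<omega>) A)) > 0"

end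

theory Submission
  imports Defs
begin


text \<open>
  It\^o's formula is replaced by Taylor expansion along the Riemann sums of the It\^o integral, which converge to the
  solution in probability. This gives Dynkin's inequality, used with \<open>exp (\<mu> * \<xi>)\<close>: by nondegeneracy, for large
  \<open>\<bar>\<mu>\<bar>\<close> the generator maps it to a function bounded below by a positive constant on the strip. Hence the path leaves
  the strip in finite time, exceeds a level as soon as it reaches it, and leaves through \<open>\<xi> = 1\<close> with a probability
  bounded below. For the Feller property, the Euler scheme started near \<open>Y s\<close> stays close to \<open>Y\<close> because the
  coefficients are locally Lipschitz, and the scheme stopped at \<open>\<bar>\<xi>\<bar> \<ge> 1\<close> converges to the stopped solution because
  the entrance times into \<open>\<bar>\<xi>\<bar> \<ge> 1\<close> and \<open>\<bar>\<xi>\<bar> > 1\<close> agree. Its expectations are iterated Gaussian integrals that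
  depend on the starting point only, so the Markov property and the continuity of the semigroup pass to the limit.
\<close>

section \<open>Gaussian increments\<close>

text \<open>The Ito integral is given separately for each time, as a limit in probability along
  simple integrands about which nothing else is known; it comes without paths in time to which a
  maximal inequality could be applied. Uniformity in time is therefore obtained on finite grids,
  where stopping at a grid index makes the coefficients bounded and leaves second moment
  computations with Gaussian increments. Solutions for different starting points live on unrelated
  probability spaces with unrelated noises, so they cannot be coupled; what they share is the limit
  of deterministic iterated integrals. The strip may be unbounded, so test functions are cut off
  outside a ball, and the constants that must survive the removal of the ball, \<open>rate\<close>
  and \<open>gain\<close>, do not depend on its radius. Stopping is allowed at any time
  \<open>\<rho>\<close> for which \<open>u \<le> \<rho>\<close> is an event of \<open>F u\<close>, a
  condition that entrance times into open sets satisfy without right continuity of the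
  filtration.\<close>

definition gauss :: "real \<Rightarrow> (real^'n) measure" where
  "gauss h = density lborel (\<lambda>x. ennreal (\<Prod>i\<in>UNIV. normal_density 0 (sqrt h) (x $ i)))"

lemma prod_Basis_vec:
  "(\<Prod>b\<in>(Basis :: (real^'n) set). f b) = (\<Prod>i\<in>UNIV. f (axis i 1))"
proof -
  have "Basis = (\<lambda>i. axis i 1 :: real^'n) ` UNIV"
    by (auto simp: Basis_vec_def)
  moreover have "inj (\<lambda>i. axis i 1 :: real^'n)"
    by (auto simp: inj_on_def axis_eq_axis)
  ultimately show ?thesis
    by (metis (no_types, lifting) prod.reindex_cong)
qed

text \<open>\<open>lborel\<close> on \<open>real^'n\<close> is the image of a product measure
  indexed by \<open>Basis\<close>, so Fubini for finite products applies once the factors are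
  reindexed from coordinates to basis vectors (the maps \<open>g\<close> below).\<close>

lemma has_bochner_integral_prod_vec:
  fixes f :: "'n::finite \<Rightarrow> real \<Rightarrow> real"
  assumes f: "\<And>i. has_bochner_integral lborel (f i) (I i)"
  shows "has_bochner_integral lborel (\<lambda>x::real^'n. \<Prod>i\<in>UNIV. f i (x $ i)) (\<Prod>i\<in>UNIV. I i)"
proof -
  have int: "integrable lborel (f i)" for i using f by (auto simp: has_bochner_integral_iff)
  have [measurable]: "f i \<in> borel_measurable borel" for i
    using int[of i] by (auto dest: borel_measurable_integrable)
  define g where "g b = (\<lambda>x. f (THE i. b = axis i 1) x)" for b :: "real^'n"
  have g: "g (axis i 1) = f i" for i
    by (auto simp: g_def axis_eq_axis intro!: ext arg_cong[where f="\<lambda>i. f i _"])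
  have gB: "integrable lborel (g b)" "g b \<in> borel_measurable borel" if "b \<in> Basis" for b
    using that int by (auto simp: Basis_vec_def g)
  interpret product_sigma_finite "\<lambda>b::real^'n. lborel :: real measure" ..
  have fB: "finite (Basis :: (real^'n) set)" by simp
  have eq: "(\<Prod>i\<in>UNIV. f i (x $ i)) = (\<Prod>b\<in>Basis. g b (x \<bullet> b))" for x :: "real^'n"
    unfolding prod_Basis_vec g by (simp add: inner_axis)
  have eq2: "(\<Prod>b\<in>Basis. g b ((\<Sum>c\<in>Basis. y c *\<^sub>R c) \<bullet> b)) = (\<Prod>b\<in>Basis. g b (y b))"
    for y :: "real^'n \<Rightarrow> real"
    by (intro prod.cong refl) (simp add: inner_sum_left inner_Basis if_distrib cong: if_cong)
  have m: "(\<lambda>x::real^'n. \<Prod>i\<in>UNIV. f i (x $ i)) \<in> borel_measurable borel"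
    by measurable
  have "integrable lborel (\<lambda>x::real^'n. \<Prod>i\<in>UNIV. f i (x $ i))"
    unfolding lborel_eq[where 'a="real^'n"]
    apply (subst integrable_distr_eq)
    subgoal by measurable
    subgoal using m by simp
    unfolding eq eq2
    by (rule product_integrable_prod[OF fB]) (use gB in auto)
  moreover have "integral\<^sup>L lborel (\<lambda>x::real^'n. \<Prod>i\<in>UNIV. f i (x $ i)) = (\<Prod>i\<in>UNIV. I i)"
    unfolding lborel_eq[where 'a="real^'n"]
    apply (subst integral_distr)
    subgoal by measurable
    subgoal using m by simp
    unfolding eq eq2
    apply (subst product_integral_prod[OF fB])
    using gB f by (auto simp: prod_Basis_vec g has_bochner_integral_iff)
  ultimately show ?thesis by (auto simp: has_bochner_integral_iff)
qed

lemma has_bochner_integral_gauss: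
  fixes f :: "'n::finite \<Rightarrow> real \<Rightarrow> real"
  assumes "\<And>i. has_bochner_integral lborel (\<lambda>x. normal_density 0 (sqrt h) x * f i x) (I i)"
    and [measurable]: "\<And>i. f i \<in> borel_measurable borel"
  shows "has_bochner_integral (gauss h) (\<lambda>x::real^'n. \<Prod>i\<in>UNIV. f i (x $ i)) (\<Prod>i\<in>UNIV. I i)"
proof -
  have "has_bochner_integral lborel (\<lambda>x::real^'n. (\<Prod>i\<in>UNIV. normal_density 0 (sqrt h) (x $ i)) *\<^sub>R
      (\<Prod>i\<in>UNIV. f i (x $ i))) (\<Prod>i\<in>UNIV. I i)"
    using has_bochner_integral_prod_vec[OF assms(1)] by (simp add: prod.distrib)
  then show ?thesis unfolding gauss_def
    by (intro has_bochner_integral_density) (auto intro!: prod_nonneg)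
qed

context
  fixes h :: real assumes h: "h > 0"
begin

lemma prob_space_gauss: "prob_space (gauss h :: (real^'n) measure)"
proof -
  have "has_bochner_integral (gauss h) (\<lambda>x::real^'n. \<Prod>i\<in>(UNIV::'n set). 1) (\<Prod>i\<in>(UNIV::'n set). 1::real)"
    using h by (intro has_bochner_integral_gauss[where f="\<lambda>_ _. 1"]) (auto simp: has_bochner_integral_iff)
  then have "has_bochner_integral (gauss h) (\<lambda>x::real^'n. 1::real) 1" by simp
  then have "integrable (gauss h :: (real^'n) measure) (\<lambda>x. 1::real)"
    "measure (gauss h) (space (gauss h :: (real^'n) measure)) = 1"
    by (auto simp: has_bochner_integral_iff)
  then show ?thesis
    by (intro prob_spaceI) (auto simp: emeasure_eq_ennreal_measure integrable_iff_bounded top_unique less_top)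
qed

lemma gauss_moment1: "has_bochner_integral (gauss h) (\<lambda>x::real^'n. x $ j) 0"
proof -
  have "has_bochner_integral (gauss h) (\<lambda>x::real^'n. \<Prod>i\<in>UNIV. (if i = j then (\<lambda>u. u) else (\<lambda>u. 1)) (x $ i))
      (\<Prod>i\<in>(UNIV::'n set). if i = j then 0 else 1::real)"
  proof (rule has_bochner_integral_gauss)
    fix i
    show "has_bochner_integral lborel (\<lambda>x. normal_density 0 (sqrt h) x * (if i = j then \<lambda>u. u else (\<lambda>u. 1)) x) (if i = j then 0 else 1)"
      using normal_moment_nz_1[of "sqrt h" 0] h by (auto simp: has_bochner_integral_iff)
  qed auto
  moreover have "(\<Prod>i\<in>UNIV. (if i = j then (\<lambda>u. u) else (\<lambda>u. 1)) (x $ i)) = x $ j" for x :: "real^'n"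
    by (subst prod.remove[of _ j]) auto
  ultimately show ?thesis by (simp add: prod.remove[of _ j])
qed

lemma gauss_moment2: "has_bochner_integral (gauss h) (\<lambda>x::real^'n. x $ j * x $ k) (if j = k then h else 0)"
proof (cases "j = k")
  case False
  let ?f = "\<lambda>i::'n. if i = j \<or> i = k then (\<lambda>u. u) else (\<lambda>u::real. 1::real)"
  have "has_bochner_integral (gauss h) (\<lambda>x::real^'n. \<Prod>i\<in>UNIV. ?f i (x $ i))
      (\<Prod>i\<in>(UNIV::'n set). if i = j \<or> i = k then 0 else 1::real)"
  proof (rule has_bochner_integral_gauss)
    fix i
    show "has_bochner_integral lborel (\<lambda>x. normal_density 0 (sqrt h) x * ?f i x) (if i = j \<or> i = k then 0 else 1)"
      using normal_moment_nz_1[of "sqrt h" 0] h by (auto simp: has_bochner_integral_iff)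
  qed auto
  moreover have "(\<Prod>i\<in>UNIV. ?f i (x $ i)) = x $ j * x $ k" for x :: "real^'n"
    using False by (subst prod.remove[of _ j]) (auto simp: prod.remove[of _ k])
  moreover have "(\<Prod>i\<in>(UNIV::'n set). if i = j \<or> i = k then 0 else 1::real) = 0"
    by (subst prod.remove[of _ j]) auto
  ultimately show ?thesis using False by simp
next
  case True
  let ?f = "\<lambda>i::'n. if i = j then (\<lambda>u. u * u) else (\<lambda>u::real. 1::real)"
  have "has_bochner_integral (gauss h) (\<lambda>x::real^'n. \<Prod>i\<in>UNIV. ?f i (x $ i))
      (\<Prod>i\<in>(UNIV::'n set). if i = j then h else 1::real)"
  proof (rule has_bochner_integral_gauss)
    fix i
    show "has_bochner_integral lborel (\<lambda>x. normal_density 0 (sqrt h) x * ?f i x) (if i = j then h else 1)"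
      using normal_moment_even[of "sqrt h" 0 1] h by (auto simp: has_bochner_integral_iff power2_eq_square)
  qed auto
  moreover have "(\<Prod>i\<in>UNIV. ?f i (x $ i)) = x $ j * x $ j" for x :: "real^'n"
    by (subst prod.remove[of _ j]) auto
  moreover have "(\<Prod>i\<in>(UNIV::'n set). if i = j then h else 1::real) = h"
    by (subst prod.remove[of _ j]) auto
  ultimately show ?thesis using True by simp
qed

text \<open>The fourth moment is of order \<open>h\<^sup>2\<close>, so summed over the
  \<open>T / h\<close> steps of a grid it disappears with the mesh. It pays for the large increments
  in the Taylor expansion.\<close>

lemma gauss_moment4: "has_bochner_integral (gauss h) (\<lambda>x::real^'n. (x $ j)^4) (3 * h\<^sup>2)"
proof -
  let ?f = "\<lambda>i::'n. if i = j then (\<lambda>u. u^4) else (\<lambda>u::real. 1::real)"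
  have "has_bochner_integral (gauss h) (\<lambda>x::real^'n. \<Prod>i\<in>UNIV. ?f i (x $ i))
      (\<Prod>i\<in>(UNIV::'n set). if i = j then 3 * h\<^sup>2 else 1::real)"
  proof (rule has_bochner_integral_gauss)
    fix i
    show "has_bochner_integral lborel (\<lambda>x. normal_density 0 (sqrt h) x * ?f i x) (if i = j then 3 * h\<^sup>2 else 1)"
      using normal_moment_even[of "sqrt h" 0 2] h
      by (auto simp: has_bochner_integral_iff power2_eq_square fact_numeral)
  qed auto
  moreover have "(\<Prod>i\<in>UNIV. ?f i (x $ i)) = (x $ j)^4" for x :: "real^'n"
    by (subst prod.remove[of _ j]) auto
  moreover have "(\<Prod>i\<in>(UNIV::'n set). if i = j then 3 * h\<^sup>2 else 1::real) = 3 * h\<^sup>2"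
    by (subst prod.remove[of _ j]) auto
  ultimately show ?thesis by simp
qed

end

lemma sets_gauss[simp, measurable_cong]: "sets (gauss h) = sets borel"
  by (simp add: gauss_def)

lemma space_gauss[simp]: "space (gauss h) = UNIV"
  by (simp add: gauss_def)

text \<open>The noise alone. What is prescribed is the law and the independence of increments, which
  is the form in which the noise enters computations on a finite grid.\<close>

locale driven = prob_space M
  for M :: "'w measure" +
  fixes F :: "real \<Rightarrow> 'w measure" and W :: "real \<Rightarrow> 'w \<Rightarrow> real^'n"
  assumes subalg: "\<And>t. subalgebra M (F t)"
    and F_mono: "\<And>s t. s \<le> t \<Longrightarrow> sets (F s) \<subseteq> sets (F t)"
    and W_adapted: "\<And>t. 0 \<le> t \<Longrightarrow> W t \<in> borel_measurable (F t)"
    and W_increment: "\<And>s t. 0 \<le> s \<Longrightarrow> s < t \<Longrightarrow>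
        distributed M lborel (\<lambda>w. W t w - W s w)
          (\<lambda>x. ennreal (\<Prod>i\<in>UNIV. normal_density 0 (sqrt (t - s)) (x $ i)))"
    and W_indep: "\<And>s t. 0 \<le> s \<Longrightarrow> s < t \<Longrightarrow>
        indep_set (sets (F s)) (sets (vimage_algebra (space M) (\<lambda>w. W t w - W s w) borel))"
begin

lemma space_F[simp]: "space (F t) = space M"
  using subalg[of t] by (simp add: subalgebra_def)

lemma sets_F_M: "A \<in> sets (F t) \<Longrightarrow> A \<in> sets M"
  using subalg[of t] by (auto simp: subalgebra_def)

lemma measurable_F_M: "f \<in> measurable (F t) N \<Longrightarrow> f \<in> measurable M N"
  using measurable_from_subalg[OF subalg] .

lemma measurable_F_mono: "f \<in> measurable (F s) N \<Longrightarrow> s \<le> t \<Longrightarrow> f \<in> measurable (F t) N"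
  by (rule measurable_from_subalg) (auto simp: subalgebra_def F_mono)

lemma W_measurable[measurable]: "0 \<le> t \<Longrightarrow> W t \<in> borel_measurable M"
  using W_adapted measurable_F_M by blast

lemma distr_increment:
  assumes "0 \<le> s" "s < t"
  shows "distr M borel (\<lambda>w. W t w - W s w) = gauss (t - s)"
proof -
  have "distr M borel (\<lambda>w. W t w - W s w) = distr M lborel (\<lambda>w. W t w - W s w)"
    by (rule distr_cong) auto
  then show ?thesis
    using distributed_distr_eq_density[OF W_increment[OF assms]] by (simp add: gauss_def)
qed

lemma id_measurable_F: "(\<lambda>w. w) \<in> measurable M (F s)"
  using measurable_F_M[of "\<lambda>w. w" s "F s"] by simp

text \<open>Taking the identity as the first component covers every \<open>F s\<close>-measurable quantity at once.\<close>

lemma distr_pair_increment: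
  assumes st: "0 \<le> s" "s < t"
  shows "distr M (F s \<Otimes>\<^sub>M borel) (\<lambda>w. (w, W t w - W s w)) = distr M (F s) (\<lambda>w. w) \<Otimes>\<^sub>M gauss (t - s)"
proof -
  have [measurable]: "W t \<in> borel_measurable M" "W s \<in> borel_measurable M" using st by auto
  note [measurable] = id_measurable_F[of s]
  interpret G: prob_space "gauss (t - s) :: (real^'n) measure"
    by (rule prob_space_gauss) (use st in simp)
  interpret D: prob_space "distr M (F s) (\<lambda>w. w)"
    by (rule prob_space_distr) measurable
  show ?thesis
  proof (rule pair_measure_eqI[symmetric])
    fix A and B :: "(real^'n) set"
    assume "A \<in> sets (distr M (F s) (\<lambda>w. w))" "B \<in> sets (gauss (t - s))"
    then have A: "A \<in> sets (F s)" and B[measurable]: "B \<in> sets borel" by auto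
    have AM: "A \<subseteq> space M" using sets.sets_into_space[OF A] by simp
    note [measurable] = A sets_F_M[OF A]
    let ?B = "(\<lambda>w. W t w - W s w) -` B \<inter> space M"
    have "?B \<in> sets (vimage_algebra (space M) (\<lambda>w. W t w - W s w) borel)"
      by (rule in_vimage_algebra) (rule B)
    then have "prob (A \<inter> ?B) = prob A * prob ?B"
      by (rule indep_setD[OF W_indep[OF st] A])
    then have "emeasure M (A \<inter> ?B) = emeasure M A * emeasure M ?B"
      by (simp add: emeasure_eq_measure ennreal_mult)
    moreover have "emeasure (gauss (t - s)) B = emeasure M ?B"
      by (subst distr_increment[OF st, symmetric]) (rule emeasure_distr, auto)
    moreover have "emeasure (distr M (F s) (\<lambda>w. w)) A = emeasure M A"
      using AM by (subst emeasure_distr) (auto intro!: arg_cong[where f="emeasure M"] A id_measurable_F)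
    moreover have "(\<lambda>w. (w, W t w - W s w)) -` (A \<times> B) \<inter> space M = A \<inter> ?B"
      using AM by auto
    moreover have "emeasure (distr M (F s \<Otimes>\<^sub>M borel) (\<lambda>w. (w, W t w - W s w))) (A \<times> B)
        = emeasure M ((\<lambda>w. (w, W t w - W s w)) -` (A \<times> B) \<inter> space M)"
      by (rule emeasure_distr) (auto intro: A)
    ultimately show "emeasure (distr M (F s) (\<lambda>w. w)) A * emeasure (gauss (t - s)) B =
        emeasure (distr M (F s \<Otimes>\<^sub>M borel) (\<lambda>w. (w, W t w - W s w))) (A \<times> B)"
      by simp
  qed (auto intro!: sets_pair_measure_cong G.sigma_finite_measure_axioms D.sigma_finite_measure_axioms)
qed

text \<open>Fubini for the product law above: the past is frozen and the increment is integrated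
  out. This identity later turns one step of the Euler scheme into an operator on functions of the
  state.\<close>

lemma expectation_increment:
  fixes g :: "'w \<Rightarrow> real^'n \<Rightarrow> real"
  assumes st: "0 \<le> s" "s < t"
    and g[measurable]: "(\<lambda>(w, z). g w z) \<in> borel_measurable (F s \<Otimes>\<^sub>M borel)"
    and bd: "\<And>w z. w \<in> space M \<Longrightarrow> \<bar>g w z\<bar> \<le> C"
  shows "(\<integral>w. g w (W t w - W s w) \<partial>M) = (\<integral>w. (\<integral>z. g w z \<partial>gauss (t - s)) \<partial>M)"
proof -
  have [measurable]: "W t \<in> borel_measurable M" "W s \<in> borel_measurable M" using st by auto
  note [measurable] = id_measurable_F[of s]
  interpret G: prob_space "gauss (t - s) :: (real^'n) measure"
    by (rule prob_space_gauss) (use st in simp)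
  interpret D: prob_space "distr M (F s) (\<lambda>w. w)"
    by (rule prob_space_distr) measurable
  interpret P: pair_prob_space "distr M (F s) (\<lambda>w. w)" "gauss (t - s) :: (real^'n) measure" ..
  have g'[measurable]: "(\<lambda>(w, z). g w z) \<in> borel_measurable (F s \<Otimes>\<^sub>M gauss (t - s))"
    by measurable
  have m2: "(\<lambda>w. (w, W t w - W s w)) \<in> measurable M (F s \<Otimes>\<^sub>M borel)" by measurable
  have "(\<integral>w. g w (W t w - W s w) \<partial>M) = (\<integral>x. (case x of (w, z) \<Rightarrow> g w z) \<partial>distr M (F s \<Otimes>\<^sub>M borel) (\<lambda>w. (w, W t w - W s w)))"
    by (subst integral_distr[OF m2]) auto
  also have "\<dots> = (\<integral>x. (case x of (w, z) \<Rightarrow> g w z) \<partial>(distr M (F s) (\<lambda>w. w) \<Otimes>\<^sub>M gauss (t - s)))"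
    by (simp add: distr_pair_increment[OF st])
  also have "\<dots> = (\<integral>w. (\<integral>z. g w z \<partial>gauss (t - s)) \<partial>distr M (F s) (\<lambda>w. w))"
  proof (rule P.integral_fst'[symmetric, THEN trans])
    show "integrable (distr M (F s) (\<lambda>w. w) \<Otimes>\<^sub>M gauss (t - s)) (\<lambda>(w, z). g w z)"
      by (rule P.integrable_const_bound[where B=C]) (auto intro!: AE_I2 bd simp: space_pair_measure)
  qed simp
  also have "\<dots> = (\<integral>w. (\<integral>z. g w z \<partial>gauss (t - s)) \<partial>M)"
    by (subst integral_distr) auto
  finally show "(\<integral>w. g w (W t w - W s w) \<partial>M) = (\<integral>w. (\<integral>z. g w z \<partial>gauss (t - s)) \<partial>M)" .
qed

text \<open>The counterpart for unbounded functions of the increment, needed for its moments: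
  boundedness is asked of the \<open>F s\<close>-measurable factor, integrability of the
  other.\<close>

lemma expectation_increment_mult:
  fixes p :: "real^'n \<Rightarrow> real"
  assumes st: "0 \<le> s" "s < t"
    and c[measurable]: "c \<in> borel_measurable (F s)" and bd: "\<And>w. w \<in> space M \<Longrightarrow> \<bar>c w\<bar> \<le> C"
    and p: "has_bochner_integral (gauss (t - s)) p I"
  shows "has_bochner_integral M (\<lambda>w. c w * p (W t w - W s w)) (expectation c * I)"
proof -
  have [measurable]: "W t \<in> borel_measurable M" "W s \<in> borel_measurable M" using st by auto
  have pm[measurable]: "p \<in> borel_measurable borel" using p by (auto simp: has_bochner_integral_iff dest!: borel_measurable_integrable)
  note [measurable] = id_measurable_F[of s]
  interpret G: prob_space "gauss (t - s) :: (real^'n) measure"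
    by (rule prob_space_gauss) (use st in simp)
  interpret D: prob_space "distr M (F s) (\<lambda>w. w)"
    by (rule prob_space_distr) measurable
  interpret P: pair_prob_space "distr M (F s) (\<lambda>w. w)" "gauss (t - s) :: (real^'n) measure" ..
  have m2: "(\<lambda>w. (w, W t w - W s w)) \<in> measurable M (F s \<Otimes>\<^sub>M borel)" by measurable
  have ci: "integrable (distr M (F s) (\<lambda>w. w)) c"
    by (rule D.integrable_const_bound[where B=C]) (auto intro!: AE_I2 bd)
  have pi: "integrable (gauss (t - s)) p" "integral\<^sup>L (gauss (t - s)) p = I"
    using p by (auto simp: has_bochner_integral_iff)
  have i: "integrable (distr M (F s) (\<lambda>w. w) \<Otimes>\<^sub>M gauss (t - s)) (\<lambda>(w, z). c w * p z)"
  proof (rule P.Fubini_integrable)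
    show "integrable (distr M (F s) (\<lambda>w. w)) (\<lambda>x. \<integral>y. norm (case (x, y) of (w, z) \<Rightarrow> c w * p z) \<partial>gauss (t - s))"
      using ci by (simp add: abs_mult)
  qed (use pi in auto)
  have m3: "(\<lambda>(w, z). c w * p z) \<in> borel_measurable (F s \<Otimes>\<^sub>M borel)" by measurable
  show ?thesis
  proof (rule has_bochner_integral_iff[THEN iffD2], rule conjI)
    show "integrable M (\<lambda>w. c w * p (W t w - W s w))"
      using i[folded distr_pair_increment[OF st]] m3 by (subst (asm) integrable_distr_eq[OF m2]) auto
    have "(\<integral>w. c w * p (W t w - W s w) \<partial>M) = (\<integral>x. (case x of (w, z) \<Rightarrow> c w * p z) \<partial>distr M (F s \<Otimes>\<^sub>M borel) (\<lambda>w. (w, W t w - W s w)))"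
      using m3 by (subst integral_distr[OF m2]) auto
    also have "\<dots> = (\<integral>w. (\<integral>z. c w * p z \<partial>gauss (t - s)) \<partial>distr M (F s) (\<lambda>w. w))"
      unfolding distr_pair_increment[OF st] using P.integral_fst'[OF i] by simp
    also have "\<dots> = expectation c * I"
      using pi by (simp add: integral_distr)
    finally show "(\<integral>w. c w * p (W t w - W s w) \<partial>M) = expectation c * I" .
  qed
qed

end


section \<open>Frobenius norms and moments of the noise increments\<close>

lemma norm_power4_vec_le: "(norm (x :: real^'n))^4 \<le> real CARD('n) * (\<Sum>j\<in>UNIV. (x $ j)^4)"
proof -
  have "(norm x)^2 = (\<Sum>j\<in>UNIV. (x $ j)^2 * 1)"
    by (simp add: norm_eq_sqrt_inner inner_vec_def power2_eq_square sum_nonneg)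
  then have "(norm x)^4 = (\<Sum>j\<in>UNIV. (x $ j)^2 * 1)^2"
    by (metis (no_types, lifting) mult_2_right numeral_Bit0 power2_eq_square power_add power4_eq_xxxx mult.assoc)
  also have "\<dots> \<le> (\<Sum>j\<in>UNIV. ((x $ j)^2)^2) * (\<Sum>j\<in>(UNIV::'n set). 1^2)"
    by (rule Cauchy_Schwarz_ineq_sum)
  finally show ?thesis by (simp add: mult.commute power_mult[symmetric])
qed

lemma norm_matrix_sq: "(norm (H :: real^'n^'d))^2 = (\<Sum>i\<in>UNIV. \<Sum>j\<in>UNIV. (H $ i $ j)^2)"
  by (simp add: norm_eq_sqrt_inner inner_vec_def power2_eq_square sum_nonneg)

lemma norm_matrix_vector_sq:
  "(norm ((H :: real^'n^'d) *v z))^2 = (\<Sum>j\<in>UNIV. \<Sum>k\<in>UNIV. (\<Sum>i\<in>UNIV. H $ i $ j * H $ i $ k) * (z $ j * z $ k))"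
proof -
  have "(norm (H *v z))^2 = (\<Sum>i\<in>UNIV. (\<Sum>j\<in>UNIV. H $ i $ j * z $ j) * (\<Sum>k\<in>UNIV. H $ i $ k * z $ k))"
    by (simp add: norm_eq_sqrt_inner inner_vec_def matrix_vector_mult_def sum_nonneg)
  also have "\<dots> = (\<Sum>i\<in>UNIV. \<Sum>j\<in>UNIV. \<Sum>k\<in>UNIV. H $ i $ j * H $ i $ k * (z $ j * z $ k))"
    by (simp add: sum_product mult_ac)
  also have "\<dots> = (\<Sum>j\<in>UNIV. \<Sum>i\<in>UNIV. \<Sum>k\<in>UNIV. H $ i $ j * H $ i $ k * (z $ j * z $ k))"
    by (rule sum.swap)
  also have "\<dots> = (\<Sum>j\<in>UNIV. \<Sum>k\<in>UNIV. \<Sum>i\<in>UNIV. H $ i $ j * H $ i $ k * (z $ j * z $ k))"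
    by (intro sum.cong refl sum.swap)
  finally show ?thesis by (simp add: sum_distrib_right)
qed

text \<open>Cauchy-Schwarz row by row: the norm of the type \<open>real^'n^'d\<close> is the
  Frobenius norm, which dominates the operator norm.\<close>

lemma norm_matrix_vector_le: "norm ((H :: real^'n^'d) *v z) \<le> norm H * norm z"
proof -
  have "(norm (H *v z))^2 = (\<Sum>i\<in>UNIV. (H $ i \<bullet> z)^2)"
    by (simp add: norm_eq_sqrt_inner inner_vec_def matrix_vector_mult_def sum_nonneg power2_eq_square)
  also have "\<dots> \<le> (\<Sum>i\<in>UNIV. (norm (H $ i))^2 * (norm z)^2)"
    by (intro sum_mono) (metis Cauchy_Schwarz_ineq2 abs_ge_zero power2_abs power_mono power_mult_distrib)
  also have "\<dots> = (norm H * norm z)^2"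
    by (simp add: norm_vec_def L2_set_def sum_nonneg power_mult_distrib sum_distrib_right)
  finally show ?thesis by (rule power2_le_imp_le) simp
qed

lemma borel_measurable_matrix_vector_mult[measurable (raw)]:
  fixes H :: "'a \<Rightarrow> real^'n^'d"
  assumes [measurable]: "H \<in> borel_measurable N" "z \<in> borel_measurable N"
  shows "(\<lambda>x. H x *v z x) \<in> borel_measurable N"
proof -
  have "continuous_on UNIV (\<lambda>p::(real^'n^'d) \<times> (real^'n). fst p *v snd p)"
    unfolding matrix_vector_mult_def by (intro continuous_intros)
  from borel_measurable_continuous_on[OF this, of "\<lambda>x. (H x, z x)" N] show ?thesis by simp
qed

lemma borel_measurable_vec_nth'[measurable (raw)]:
  fixes f :: "'a \<Rightarrow> ('b::{second_countable_topology,real_normed_vector})^'n"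
  assumes "f \<in> borel_measurable N"
  shows "(\<lambda>x. f x $ i) \<in> borel_measurable N"
  using borel_measurable_continuous_on[OF continuous_on_component[OF continuous_on_id] assms, of i] by simp

context driven
begin

lemma
  assumes st: "0 \<le> s" "s < t" and q[measurable]: "c \<in> borel_measurable (F s)"
    and bd: "\<And>w. w \<in> space M \<Longrightarrow> \<bar>c w\<bar> \<le> C"
  shows increment_moment1: "has_bochner_integral M (\<lambda>w. c w * (W t w - W s w) $ j) 0"
    and increment_moment2: "has_bochner_integral M (\<lambda>w. c w * ((W t w - W s w) $ j * (W t w - W s w) $ k))
       (if j = k then (t - s) * expectation c else 0)"
    and increment_moment4: "has_bochner_integral M (\<lambda>w. c w * ((W t w - W s w) $ j)^4) (3 * (t - s)\<^sup>2 * expectation c)"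
  using expectation_increment_mult[OF st q bd gauss_moment1[of "t - s" j]]
    expectation_increment_mult[OF st q bd gauss_moment2[of "t - s" j k]]
    expectation_increment_mult[OF st q bd gauss_moment4[of "t - s" j]] st
  by (auto simp: mult_ac)

lemma increment_linear:
  assumes st: "0 \<le> s" "s < t" and q[measurable]: "\<beta> \<in> borel_measurable (F s)"
    and bd: "\<And>w. w \<in> space M \<Longrightarrow> norm (\<beta> w) \<le> C"
  shows "has_bochner_integral M (\<lambda>w. \<beta> w \<bullet> (W t w - W s w)) 0"
proof -
  have "has_bochner_integral M (\<lambda>w. \<Sum>j\<in>UNIV. \<beta> w $ j * (W t w - W s w) $ j) (\<Sum>j\<in>(UNIV::'n set). 0)"
    by (intro has_bochner_integral_sum increment_moment1[OF st, where C=C])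
      (measurable, auto intro: order_trans[OF component_le_norm_cart bd])
  then show ?thesis by (simp add: inner_vec_def)
qed

text \<open>Distinct coordinates of the increment are uncorrelated, so only diagonal coefficients
  survive. With half the Hessian on the columns of the noise matrix as \<open>q\<close>, this
  produces the second order part of the generator.\<close>

lemma increment_quadratic:
  assumes st: "0 \<le> s" "s < t" and q[measurable]: "\<And>j k. q j k \<in> borel_measurable (F s)"
    and bd: "\<And>j k w. w \<in> space M \<Longrightarrow> \<bar>q j k w\<bar> \<le> C"
  shows "has_bochner_integral M (\<lambda>w. \<Sum>j\<in>UNIV. \<Sum>k\<in>UNIV. q j k w * ((W t w - W s w) $ j * (W t w - W s w) $ k))
     ((t - s) * expectation (\<lambda>w. \<Sum>j\<in>UNIV. q j j w))"
proof -
  have int: "integrable M (q j k)" for j k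
    using measurable_F_M[OF q] by (intro integrable_const_bound[where B=C]) (auto intro!: AE_I2 bd)
  have "has_bochner_integral M (\<lambda>w. \<Sum>j\<in>UNIV. \<Sum>k\<in>UNIV. q j k w * ((W t w - W s w) $ j * (W t w - W s w) $ k))
     (\<Sum>j\<in>(UNIV::'n set). \<Sum>k\<in>(UNIV::'n set). if j = k then (t - s) * expectation (q j k) else 0)"
    by (intro has_bochner_integral_sum increment_moment2[OF st, where C=C]) (auto intro: bd)
  then show ?thesis using int by (simp add: sum_distrib_left)
qed

text \<open>The Ito isometry over one step: the diagonal coefficients of the quadratic form add up
  to the squared Frobenius norm.\<close>

lemma increment_norm_sq:
  assumes st: "0 \<le> s" "s < t" and H[measurable]: "(H :: 'w \<Rightarrow> real^'n^'d) \<in> borel_measurable (F s)"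
    and bd: "\<And>w. w \<in> space M \<Longrightarrow> norm (H w) \<le> C"
  shows "has_bochner_integral M (\<lambda>w. (norm (H w *v (W t w - W s w)))^2)
     ((t - s) * expectation (\<lambda>w. (norm (H w))^2))"
proof -
  have "\<bar>H w $ i $ j\<bar> \<le> C" if "w \<in> space M" for w i j
    using component_le_norm_cart[of "H w $ i" j] Finite_Cartesian_Product.norm_nth_le[of "H w" i] bd[OF that] by linarith
  then have b: "\<bar>\<Sum>i\<in>UNIV. H w $ i $ j * H w $ i $ k\<bar> \<le> (\<Sum>i\<in>(UNIV::'d set). C * C)" if "w \<in> space M" for w j k
    using that by (intro order_trans[OF sum_abs] sum_mono)
      (auto simp: abs_mult intro!: mult_mono intro: order_trans[OF abs_ge_zero])
  have "has_bochner_integral M (\<lambda>w. \<Sum>j\<in>UNIV. \<Sum>k\<in>UNIV. (\<Sum>i\<in>UNIV. H w $ i $ j * H w $ i $ k) *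
       ((W t w - W s w) $ j * (W t w - W s w) $ k))
     ((t - s) * expectation (\<lambda>w. \<Sum>j\<in>UNIV. (\<Sum>i\<in>UNIV. H w $ i $ j * H w $ i $ j)))"
    by (rule increment_quadratic[OF st _ b]) auto
  moreover have "(\<Sum>j\<in>UNIV. (\<Sum>i\<in>UNIV. H w $ i $ j * H w $ i $ j)) = (norm (H w))^2" for w
    unfolding norm_matrix_sq unfolding power2_eq_square by (rule sum.swap)
  ultimately show ?thesis unfolding norm_matrix_vector_sq by simp
qed

lemma increment_norm_4:
  assumes st: "0 \<le> s" "s < t"
  shows "integrable M (\<lambda>w. (norm (W t w - W s w))^4)"
    "expectation (\<lambda>w. (norm (W t w - W s w))^4) \<le> 3 * (real CARD('n))\<^sup>2 * (t - s)\<^sup>2"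
proof -
  have [measurable]: "W t \<in> borel_measurable M" "W s \<in> borel_measurable M" using st by auto
  have "has_bochner_integral M (\<lambda>w. real CARD('n) * (\<Sum>j\<in>UNIV. 1 * ((W t w - W s w) $ j)^4))
     (real CARD('n) * (\<Sum>j\<in>(UNIV::'n set). 3 * (t - s)\<^sup>2 * expectation (\<lambda>_. 1)))"
    by (intro has_bochner_integral_mult_right has_bochner_integral_sum increment_moment4[OF st, where C=1]) auto
  then have *: "integrable M (\<lambda>w. real CARD('n) * (\<Sum>j\<in>UNIV. ((W t w - W s w) $ j)^4))"
    "expectation (\<lambda>w. real CARD('n) * (\<Sum>j\<in>UNIV. ((W t w - W s w) $ j)^4)) = 3 * (real CARD('n))\<^sup>2 * (t - s)\<^sup>2"
    by (auto simp: has_bochner_integral_iff prob_space power2_eq_square)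
  show i: "integrable M (\<lambda>w. (norm (W t w - W s w))^4)"
    by (rule Bochner_Integration.integrable_bound[OF *(1)])
      (measurable, auto intro!: AE_I2 order_trans[OF norm_power4_vec_le] )
  show "expectation (\<lambda>w. (norm (W t w - W s w))^4) \<le> 3 * (real CARD('n))\<^sup>2 * (t - s)\<^sup>2"
    unfolding *(2)[symmetric] by (rule integral_mono[OF i *(1)]) (rule norm_power4_vec_le)
qed

lemma stopped_step_norm_sq:
  fixes Z c :: "'w \<Rightarrow> real^'d" and H :: "'w \<Rightarrow> real^'n^'d"
  assumes st: "0 \<le> s" "s < t"
    and [measurable]: "Z \<in> borel_measurable (F s)" "c \<in> borel_measurable (F s)" "H \<in> borel_measurable (F s)"
      "D \<in> sets (F s)"
    and bd: "\<And>w. w \<in> D \<Longrightarrow> norm (Z w) \<le> C \<and> norm (c w) \<le> C \<and> norm (H w) \<le> C"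
    and int: "integrable M (\<lambda>w. (norm (Z w))^2)"
  shows "has_bochner_integral M (\<lambda>w. (norm (Z w + indicator D w *\<^sub>R (c w + H w *v (W t w - W s w))))^2)
    (expectation (\<lambda>w. (norm (Z w))^2) + expectation (\<lambda>w. indicator D w * ((norm (Z w + c w))^2 - (norm (Z w))^2))
     + (t - s) * expectation (\<lambda>w. indicator D w * (norm (H w))^2))"
proof -
  have [measurable]: "Z \<in> borel_measurable M" "c \<in> borel_measurable M" "H \<in> borel_measurable M" "D \<in> sets M"
    using assms(3-6) measurable_F_M sets_F_M by blast+
  \<comment> \<open>The coefficient of the cross term after expanding the square, with the matrix
    moved to the other side of the inner product.\<close>
  define \<beta> where "\<beta> w = indicator D w *\<^sub>R (2 *\<^sub>R ((Z w + c w) v* H w))" for w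
  define H' where "H' w = indicator D w *\<^sub>R H w" for w
  have vm: "(x :: real^'d) v* (K :: real^'n^'d) = transpose K *v x" for x K by simp
  have "continuous_on UNIV (\<lambda>p::(real^'d) \<times> (real^'n^'d). fst p v* snd p)"
    unfolding vector_matrix_mult_def by (intro continuous_intros)
  from borel_measurable_continuous_on[OF this, of "\<lambda>w. (Z w + c w, H w)" "F s"]
  have [measurable]: "(\<lambda>w. (Z w + c w) v* H w) \<in> borel_measurable (F s)" by simp
  have C0: "0 \<le> C" if "w \<in> D" for w using bd[OF that] norm_ge_zero order_trans by blast
  have ad: "x \<bullet> (K *v z) = (x v* K) \<bullet> z" for x :: "real^'d" and K :: "real^'n^'d" and z
    by (simp add: dot_lmul_matrix)
  have nb: "norm (x v* (K::real^'n^'d)) \<le> norm K * norm x" for x K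
  proof -
    have "(norm (x v* K))^2 = x \<bullet> (K *v (x v* K))" by (simp add: ad power2_norm_eq_inner)
    also have "\<dots> \<le> norm x * (norm K * norm (x v* K))"
      by (rule order_trans[OF norm_cauchy_schwarz]) (intro mult_left_mono norm_matrix_vector_le norm_ge_zero)
    finally show ?thesis by (cases "norm (x v* K) = 0") (auto simp: power2_eq_square mult_ac)
  qed
  have i1: "has_bochner_integral M (\<lambda>w. \<beta> w \<bullet> (W t w - W s w)) 0"
  proof (rule increment_linear[OF st, where C="2 * (C * (C + C))"])
    fix w
    show "norm (\<beta> w) \<le> 2 * (C * (C + C))"
    proof (cases "w \<in> D")
      case True
      have "norm ((Z w + c w) v* H w) \<le> norm (H w) * norm (Z w + c w)" by (rule nb)
      also have "\<dots> \<le> C * (C + C)"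
        using bd[OF True] C0[OF True] by (intro mult_mono order_trans[OF norm_triangle_ineq] add_mono) auto
      finally show ?thesis using True by (simp add: \<beta>_def)
    next
      case False
      \<comment> \<open>\<open>C\<close> may be negative when \<open>D\<close> is empty; the bound
        \<open>2 * (C * (C + C))\<close> is nonnegative all the same.\<close>
      have "0 \<le> C * (C + C)" by (metis distrib_left mult_2 zero_le_mult_iff linear add_nonneg_nonneg add_nonpos_nonpos)
      then show ?thesis using False by (simp add: \<beta>_def)
    qed
  qed (simp add: \<beta>_def[abs_def])
  have i2: "has_bochner_integral M (\<lambda>w. (norm (H' w *v (W t w - W s w)))^2) ((t - s) * expectation (\<lambda>w. (norm (H' w))^2))"
    by (rule increment_norm_sq[OF st, where C="\<bar>C\<bar>"]) (use bd C0 in \<open>auto simp: H'_def[abs_def] indicator_def\<close>)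
  have i3: "integrable M (\<lambda>w. indicator D w * ((norm (Z w + c w))^2 - (norm (Z w))^2))"
  proof (rule integrable_const_bound[where B="(C + C)^2 + C^2"])
    have "\<bar>(norm (Z w + c w))^2 - (norm (Z w))^2\<bar> \<le> (C + C)^2 + C^2" if D: "w \<in> D" for w
    proof -
      have "norm (Z w + c w) \<le> C + C"
        using bd[OF D] by (intro order_trans[OF norm_triangle_ineq] add_mono) auto
      then have "(norm (Z w + c w))^2 \<le> (C + C)^2" "(norm (Z w))^2 \<le> C^2"
        using bd[OF D] by (blast intro: power_mono norm_ge_zero)+
      then show ?thesis by (smt (verit) zero_le_power2)
    qed
    then show "AE x in M. norm (indicator D x * ((norm (Z x + c x))\<^sup>2 - (norm (Z x))\<^sup>2)) \<le> (C + C)\<^sup>2 + C\<^sup>2"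
      by (auto intro!: AE_I2 simp: indicator_def)
  qed measurable
  have eq: "(norm (Z w + indicator D w *\<^sub>R (c w + H w *v (W t w - W s w))))^2 =
     (norm (Z w))^2 + indicator D w * ((norm (Z w + c w))^2 - (norm (Z w))^2) + \<beta> w \<bullet> (W t w - W s w) + (norm (H' w *v (W t w - W s w)))^2" for w
  proof (cases "w \<in> D")
    case True
    have "(norm (Z w + (c w + v)))^2 = (norm (Z w + c w))^2 + 2 * ((Z w + c w) \<bullet> v) + (norm v)^2" for v
      by (simp add: power2_norm_eq_inner inner_add_left inner_add_right inner_commute)
    then show ?thesis using True by (simp add: \<beta>_def H'_def ad)
  qed (simp add: \<beta>_def H'_def)
  have "has_bochner_integral M (\<lambda>w. (norm (Z w))^2 + indicator D w * ((norm (Z w + c w))^2 - (norm (Z w))^2) + \<beta> w \<bullet> (W t w - W s w) + (norm (H' w *v (W t w - W s w)))^2)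
    (expectation (\<lambda>w. (norm (Z w))^2) + expectation (\<lambda>w. indicator D w * ((norm (Z w + c w))^2 - (norm (Z w))^2)) + 0
     + (t - s) * expectation (\<lambda>w. (norm (H' w))^2))"
    by (intro has_bochner_integral_add i1 i2 has_bochner_integral_integrable int i3)
  moreover have "(\<lambda>w. (norm (H' w))^2) = (\<lambda>w. indicator D w * (norm (H w))^2)"
    by (auto simp: H'_def indicator_def)
  ultimately show ?thesis unfolding eq by simp
qed


text \<open>Lenglart's inequality for grid martingales: the sum is stopped before its bracket
  exceeds \<open>\<eta>\<close> or once its norm exceeds \<open>\<epsilon>\<close>. The stopped sum
  has second moment at most \<open>\<eta>\<close>, and Chebyshev bounds its tail; the remaining
  paths are those whose full bracket exceeds \<open>\<eta>\<close>.\<close>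

lemma lenglart:
  fixes t :: "nat \<Rightarrow> real" and H :: "nat \<Rightarrow> 'w \<Rightarrow> real^'n^'d"
  assumes t0: "0 \<le> t 0" and t_less: "\<And>i. i < N \<Longrightarrow> t i < t (Suc i)"
    and H: "\<And>i. i < N \<Longrightarrow> H i \<in> borel_measurable (F (t i))"
    and \<epsilon>: "\<epsilon> > 0" and \<eta>: "\<eta> > 0"
  shows "\<P>(w in M. \<exists>k\<le>N. norm (\<Sum>i<k. H i w *v (W (t (Suc i)) w - W (t i) w)) > \<epsilon>)
     \<le> \<eta> / \<epsilon>\<^sup>2 + \<P>(w in M. (\<Sum>i<N. (norm (H i w))\<^sup>2 * (t (Suc i) - t i)) > \<eta>)"
proof -
  have t_mono: "t i \<le> t j" if "i \<le> j" "j \<le> N" for i j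
    using that
  proof (induction j rule: dec_induct)
    case (step n) then show ?case using t_less[of n] by simp
  qed simp
  have t_nn: "0 \<le> t i" if "i \<le> N" for i using t_mono[of 0 i] that t0 by simp
  define S where "S k w = (\<Sum>i<k. H i w *v (W (t (Suc i)) w - W (t i) w))" for k w
  define V where "V k w = (\<Sum>i<k. (norm (H i w))\<^sup>2 * (t (Suc i) - t i))" for k w
  \<comment> \<open>\<open>V (Suc k)\<close> already contains the coefficient of step
    \<open>k\<close>, which is known at time \<open>t k\<close>. Testing it in advance keeps the
    bracket of the stopped sum below \<open>\<eta>\<close> without overshoot.\<close>
  define D where "D k = {w\<in>space M. V (Suc k) w \<le> \<eta> \<and> (\<forall>j\<le>k. norm (S j w) \<le> \<epsilon>)}" for k
  define St where "St k w = (\<Sum>i<k. indicator (D i) w *\<^sub>R (H i w *v (W (t (Suc i)) w - W (t i) w)))" for k w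
  have Hm: "H i \<in> borel_measurable (F (t k))" if "i \<le> k" "k \<le> N" "i < N" for i k
    by (rule measurable_F_mono[OF H t_mono]) (use that in auto)
  have Wm: "W (t i) \<in> borel_measurable (F (t k))" if "i \<le> k" "k \<le> N" for i k
    by (rule measurable_F_mono[OF W_adapted[OF t_nn] t_mono]) (use that in auto)
  have Sm: "S j \<in> borel_measurable (F (t k))" if "j \<le> k" "k \<le> N" for j k
    unfolding S_def[abs_def] using that
    by (intro borel_measurable_sum borel_measurable_matrix_vector_mult borel_measurable_diff Hm Wm) auto
  have Vm: "V (Suc k) \<in> borel_measurable (F (t k))" if "k < N" for k
    unfolding V_def[abs_def] using that
    by (intro borel_measurable_sum borel_measurable_times borel_measurable_power borel_measurable_norm[THEN measurable_compose[rotated]] Hm borel_measurable_const) auto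
  have Dm: "D k \<in> sets (F (t k))" if "k < N" for k
  proof -
    have "Measurable.pred (F (t k)) (\<lambda>w. V (Suc k) w \<le> \<eta> \<and> (\<forall>j\<in>{..k}. norm (S j w) \<le> \<epsilon>))"
      using Vm[OF that] Sm[OF _ less_imp_le[OF that]] by measurable
    moreover have "{w\<in>space (F (t k)). V (Suc k) w \<le> \<eta> \<and> (\<forall>j\<in>{..k}. norm (S j w) \<le> \<epsilon>)} = D k"
      by (auto simp: D_def)
    ultimately show ?thesis by (simp only: pred_def)
  qed
  have Stm: "St j \<in> borel_measurable (F (t k))" if "j \<le> k" "k \<le> N" for j k
    unfolding St_def[abs_def] using that
    by (intro borel_measurable_sum borel_measurable_scaleR borel_measurable_indicator
        borel_measurable_matrix_vector_mult borel_measurable_diff Hm Wm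
        subsetD[OF F_mono[OF t_mono] Dm]) auto
  have D_dec: "w \<in> D j" if "w \<in> D k" "j \<le> k" "k < N" for w j k
  proof -
    have "V (Suc j) w \<le> V (Suc k) w"
      unfolding V_def using that t_less by (intro sum_mono2) (auto intro!: mult_nonneg_nonneg simp: less_imp_le)
    then show ?thesis using that by (auto simp: D_def)
  qed
  have St_S: "St k w = S k w" if "\<And>j. j < k \<Longrightarrow> w \<in> D j" for k w
    unfolding St_def S_def by (intro sum.cong refl) (use that in auto)
  have main: "integrable M (\<lambda>w. (norm (St k w))^2) \<and>
      expectation (\<lambda>w. (norm (St k w))^2) = (\<Sum>i<k. (t (Suc i) - t i) * expectation (\<lambda>w. indicator (D i) w * (norm (H i w))^2))"
    if "k \<le> N" for k using that
  proof (induction k)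
    case 0 then show ?case by (simp add: St_def)
  next
    case (Suc k)
    then have k: "k < N" by simp
    \<comment> \<open>On \<open>D k\<close> the last summand of the bracket is at most
      \<open>\<eta>\<close>, which bounds \<open>H k\<close> in terms of the step length.\<close>
    define C where "C = max \<epsilon> (sqrt (\<eta> / (t (Suc k) - t k)))"
    have "norm (St k w) \<le> C \<and> norm (0 :: real^'d) \<le> C \<and> norm (H k w) \<le> C" if D: "w \<in> D k" for w
    proof -
      have "St k w = S k w" by (rule St_S) (use D_dec[OF D] k in auto)
      then have 1: "norm (St k w) \<le> \<epsilon>" using D by (auto simp: D_def)
      have "(norm (H k w))\<^sup>2 * (t (Suc k) - t k) \<le> V (Suc k) w"
        unfolding V_def using k t_less by (simp, intro sum_nonneg) (auto intro!: mult_nonneg_nonneg simp: less_imp_le)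
      also have "\<dots> \<le> \<eta>" using D by (auto simp: D_def)
      finally have "(norm (H k w))\<^sup>2 \<le> \<eta> / (t (Suc k) - t k)" using t_less[OF k] by (simp add: pos_le_divide_eq)
      then have "norm (H k w) \<le> sqrt (\<eta> / (t (Suc k) - t k))" by (rule real_le_rsqrt)
      then show ?thesis using 1 \<epsilon> by (auto simp: C_def)
    qed
    from stopped_step_norm_sq[OF t_nn t_less Stm[of k k] _ H Dm this] Suc k
    have "has_bochner_integral M (\<lambda>w. (norm (St k w + indicator (D k) w *\<^sub>R (0 + H k w *v (W (t (Suc k)) w - W (t k) w))))^2)
      (expectation (\<lambda>w. (norm (St k w))^2) + expectation (\<lambda>w. indicator (D k) w * ((norm (St k w + 0))^2 - (norm (St k w))^2))
     + (t (Suc k) - t k) * expectation (\<lambda>w. indicator (D k) w * (norm (H k w))^2))"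
      by auto
    then show ?case using Suc by (simp add: has_bochner_integral_iff St_def)
  qed
  have DHi: "integrable M (\<lambda>w. (t (Suc i) - t i) * (indicator (D i) w * (norm (H i w))^2))" if i: "i < N" for i
  proof (rule integrable_const_bound[where B="\<eta>"])
    have "(norm (H i w))\<^sup>2 * (t (Suc i) - t i) \<le> \<eta>" if D: "w \<in> D i" for w
    proof -
      have "(norm (H i w))\<^sup>2 * (t (Suc i) - t i) \<le> V (Suc i) w"
        unfolding V_def using i t_less by (simp, intro sum_nonneg) (auto intro!: mult_nonneg_nonneg simp: less_imp_le)
      also have "\<dots> \<le> \<eta>" using D by (auto simp: D_def)
      finally show ?thesis .
    qed
    then show "AE x in M. norm ((t (Suc i) - t i) * (indicator (D i) x * (norm (H i x))\<^sup>2)) \<le> \<eta>"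
      using t_less[OF i] \<eta> by (auto intro!: AE_I2 simp: indicator_def mult.commute)
    show "(\<lambda>w. (t (Suc i) - t i) * (indicator (D i) w * (norm (H i w))\<^sup>2)) \<in> borel_measurable M"
      using measurable_F_M[OF H[OF i]] sets_F_M[OF Dm[OF i]] by measurable
  qed
  \<comment> \<open>If step \<open>k\<close> is taken, the whole sum is dominated by
    \<open>V (Suc k)\<close>; otherwise its last term vanishes and the induction hypothesis
    applies.\<close>
  have sum_le: "(\<Sum>i<k. (t (Suc i) - t i) * (indicator (D i) w * (norm (H i w))^2)) \<le> \<eta>" if "k \<le> N" for k w
    using that
  proof (induction k)
    case (Suc k)
    show ?case
    proof (cases "w \<in> D k")
      case True
      have "(\<Sum>i<Suc k. (t (Suc i) - t i) * (indicator (D i) w * (norm (H i w))^2)) \<le> V (Suc k) w"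
        unfolding V_def using Suc.prems t_less by (intro sum_mono) (auto simp: indicator_def mult.commute intro!: mult_nonneg_nonneg less_imp_le)
      then show ?thesis using True by (auto simp: D_def)
    qed (use Suc in simp)
  qed (use \<eta> in simp)
  have "expectation (\<lambda>w. (norm (St N w))^2) = expectation (\<lambda>w. \<Sum>i<N. (t (Suc i) - t i) * (indicator (D i) w * (norm (H i w))^2))"
    using main[of N] DHi by simp
  also have "\<dots> \<le> expectation (\<lambda>w. \<eta>)"
    by (rule integral_mono) (use DHi sum_le in auto)
  finally have E: "expectation (\<lambda>w. (norm (St N w))^2) \<le> \<eta>" by (simp add: prob_space)
  have StM: "St N \<in> borel_measurable M" by (rule measurable_F_M[OF Stm[of N N]]) auto
  have VM: "V N \<in> borel_measurable M"
    unfolding V_def[abs_def] using measurable_F_M[OF H] by measurable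
  have "prob {w\<in>space M. \<epsilon>\<^sup>2 \<le> (norm (St N w))^2} \<le> expectation (\<lambda>w. (norm (St N w))^2) / \<epsilon>\<^sup>2"
    by (rule integral_Markov_inequality_measure[where A="{}"]) (use main[of N] \<epsilon> in auto)
  also have "\<dots> \<le> \<eta> / \<epsilon>\<^sup>2" using E by (intro divide_right_mono) auto
  finally have P: "prob {w\<in>space M. \<epsilon>\<^sup>2 \<le> (norm (St N w))^2} \<le> \<eta> / \<epsilon>\<^sup>2" .
  have "{w\<in>space M. \<exists>k\<le>N. norm (S k w) > \<epsilon>} \<subseteq> {w\<in>space M. \<epsilon>\<^sup>2 \<le> (norm (St N w))^2} \<union> {w\<in>space M. V N w > \<eta>}"
  proof (rule subsetI, rule ccontr)
    fix w assume a: "w \<in> {w\<in>space M. \<exists>k\<le>N. norm (S k w) > \<epsilon>}"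
      and b: "w \<notin> {w\<in>space M. \<epsilon>\<^sup>2 \<le> (norm (St N w))^2} \<union> {w\<in>space M. V N w > \<eta>}"
    from a obtain k where "w \<in> space M" "k \<le> N" "\<epsilon> < norm (S k w)" by blast
    moreover from this b have "\<not> V N w > \<eta>" and n: "\<not> \<epsilon>\<^sup>2 \<le> (norm (St N w))^2" by blast+
    ultimately have w: "w \<in> space M" "k \<le> N" "\<epsilon> < norm (S k w)" "\<not> V N w > \<eta>" by blast+
    \<comment> \<open>At the first exceedance the stopped sum still agrees with \<open>S\<close> and
      is frozen from then on, so its terminal value is large as well.\<close>
    define m where "m = (LEAST m. \<epsilon> < norm (S m w))"
    have m: "\<epsilon> < norm (S m w)"
      unfolding m_def by (rule LeastI[of "\<lambda>m. \<epsilon> < norm (S m w)", OF w(3)])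
    have mk: "m \<le> k"
      unfolding m_def by (rule Least_le) (rule w(3))
    have mj: "norm (S j w) \<le> \<epsilon>" if "j < m" for j
      using not_less_Least[of j "\<lambda>m. \<epsilon> < norm (S m w)"] that unfolding m_def by linarith
    have V: "V j w \<le> \<eta>" if "j \<le> N" for j
    proof -
      have "V j w \<le> V N w"
        unfolding V_def using that t_less by (intro sum_mono2) (auto intro!: mult_nonneg_nonneg simp: less_imp_le)
      then show ?thesis using w by simp
    qed
    have "w \<in> D j" if "j < m" for j
    proof -
      have "V (Suc j) w \<le> \<eta>" by (rule V) (use that mk w(2) in simp)
      moreover have "norm (S i w) \<le> \<epsilon>" if "i \<le> j" for i by (rule mj) (use that \<open>j < m\<close> in simp)
      ultimately show ?thesis using w(1) unfolding D_def by blast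
    qed
    then have SS: "St m w = S m w" by (rule St_S)
    have "St N w = St m w"
      unfolding St_def
    proof (rule sum.mono_neutral_right)
      have "w \<notin> D j" if "m \<le> j" for j using m that unfolding D_def by (auto simp: not_le)
      then show "\<forall>i\<in>{..<N} - {..<m}. indicator (D i) w *\<^sub>R (H i w *v (W (t (Suc i)) w - W (t i) w)) = 0"
        by auto
    qed (use mk w(2) in auto)
    then have "\<epsilon> \<le> norm (St N w)" using m SS by simp
    then have "\<epsilon>\<^sup>2 \<le> (norm (St N w))^2" using \<epsilon> by (intro power_mono) auto
    then show False using n by simp
  qed
  then have "prob {w\<in>space M. \<exists>k\<le>N. norm (S k w) > \<epsilon>}
     \<le> prob ({w\<in>space M. \<epsilon>\<^sup>2 \<le> (norm (St N w))^2} \<union> {w\<in>space M. V N w > \<eta>})"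
    using StM VM by (intro finite_measure_mono) auto
  also have "\<dots> \<le> prob {w\<in>space M. \<epsilon>\<^sup>2 \<le> (norm (St N w))^2} + prob {w\<in>space M. V N w > \<eta>}"
    using StM VM by (intro measure_Un_le) auto
  finally show ?thesis using P by (simp add: S_def V_def)
qed

end


section \<open>Convergence in probability\<close>

context prob_space
begin

text \<open>Convergence to \<open>0\<close> in probability, tested on the upper tail since it is
  applied to norms and maxima of norms.\<close>

definition tends0 :: "(nat \<Rightarrow> 'a \<Rightarrow> real) \<Rightarrow> bool" where
  "tends0 X \<longleftrightarrow> (\<forall>n. X n \<in> borel_measurable M) \<and> (\<forall>\<epsilon>>0. (\<lambda>n. \<P>(w in M. X n w > \<epsilon>)) \<longlonglongrightarrow> 0)"

lemma tends0_measurable: "tends0 X \<Longrightarrow> X n \<in> borel_measurable M"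
  by (simp add: tends0_def)

lemma tends0D: "tends0 X \<Longrightarrow> \<epsilon> > 0 \<Longrightarrow> (\<lambda>n. \<P>(w in M. X n w > \<epsilon>)) \<longlonglongrightarrow> 0"
  by (simp add: tends0_def)

lemma tends0_eventually:
  "tends0 X \<Longrightarrow> \<epsilon> > 0 \<Longrightarrow> \<kappa> > 0 \<Longrightarrow> \<forall>\<^sub>F n in sequentially. \<P>(w in M. X n w > \<epsilon>) < \<kappa>"
  using order_tendstoD(2)[OF tends0D] by auto

text \<open>Dominated convergence for the indicators of the events.\<close>

lemma prob_tendsto_0_AE:
  assumes [measurable]: "\<And>n. E n \<in> events"
    and AE: "AE w in M. \<forall>\<^sub>F n in sequentially. w \<notin> E n"
  shows "(\<lambda>n. prob (E n)) \<longlonglongrightarrow> 0"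
proof -
  have "(\<lambda>n. expectation (indicator (E n) :: 'a \<Rightarrow> real)) \<longlonglongrightarrow> expectation (\<lambda>w. 0)"
  proof (rule integral_dominated_convergence[where w="\<lambda>_. 1"])
    show "AE x in M. (\<lambda>n. indicator (E n) x :: real) \<longlonglongrightarrow> 0"
      using AE
    proof eventually_elim
      case (elim x)
      then have "\<forall>\<^sub>F n in sequentially. (indicator (E n) x :: real) = 0"
        by eventually_elim simp
      then show ?case by (rule tendsto_eventually)
    qed
  qed (auto simp: indicator_def)
  then show ?thesis by simp
qed

lemma tends0I_AE:
  assumes m: "\<And>n. X n \<in> borel_measurable M" and AE: "AE w in M. (\<lambda>n. X n w) \<longlonglongrightarrow> 0"
  shows "tends0 X"
  unfolding tends0_def
proof (intro conjI allI impI m)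
  fix \<epsilon> :: real assume \<epsilon>: "\<epsilon> > 0"
  show "(\<lambda>n. \<P>(w in M. X n w > \<epsilon>)) \<longlonglongrightarrow> 0"
  proof (rule prob_tendsto_0_AE)
    show "{w \<in> space M. X n w > \<epsilon>} \<in> events" for n using m[of n] by measurable
    show "AE w in M. \<forall>\<^sub>F n in sequentially. w \<notin> {w \<in> space M. X n w > \<epsilon>}"
      using AE by eventually_elim (auto dest!: order_tendstoD(2)[OF _ \<epsilon>] elim: eventually_mono)
  qed
qed

lemma tends0_mono:
  assumes X: "tends0 X" and Ym: "\<And>n. Y n \<in> borel_measurable M"
    and le: "\<And>n. AE w in M. Y n w \<le> X n w"
  shows "tends0 Y"
  unfolding tends0_def
proof (intro conjI allI impI Ym)
  fix \<epsilon> :: real assume \<epsilon>: "\<epsilon> > 0"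
  show "(\<lambda>n. \<P>(w in M. Y n w > \<epsilon>)) \<longlonglongrightarrow> 0"
  proof (rule Lim_null_comparison[OF _ tends0D[OF X \<epsilon>]], intro always_eventually allI)
    fix n
    have [measurable]: "X n \<in> borel_measurable M" "Y n \<in> borel_measurable M"
      using X Ym by (auto simp: tends0_def)
    have "\<P>(w in M. Y n w > \<epsilon>) \<le> \<P>(w in M. X n w > \<epsilon>)"
      by (rule finite_measure_mono_AE) (use le[of n] in auto)
    then show "norm \<P>(w in M. Y n w > \<epsilon>) \<le> \<P>(w in M. X n w > \<epsilon>)" by simp
  qed
qed

lemma tends0_add:
  assumes X: "tends0 X" and Y: "tends0 Y"
  shows "tends0 (\<lambda>n w. X n w + Y n w)"
  unfolding tends0_def
proof (intro conjI allI impI)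
  have [measurable]: "X n \<in> borel_measurable M" "Y n \<in> borel_measurable M" for n
    using X Y by (auto simp: tends0_def)
  show "(\<lambda>w. X n w + Y n w) \<in> borel_measurable M" for n by measurable
  fix \<epsilon> :: real assume \<epsilon>: "\<epsilon> > 0"
  have "(\<lambda>n. \<P>(w in M. X n w > \<epsilon> / 2) + \<P>(w in M. Y n w > \<epsilon> / 2)) \<longlonglongrightarrow> 0"
    using tendsto_add[OF tends0D[OF X, of "\<epsilon> / 2"] tends0D[OF Y, of "\<epsilon> / 2"]] \<epsilon> by simp
  then show "(\<lambda>n. \<P>(w in M. X n w + Y n w > \<epsilon>)) \<longlonglongrightarrow> 0"
  proof (rule Lim_null_comparison[rotated], intro always_eventually allI)
    fix n
    have "\<P>(w in M. X n w + Y n w > \<epsilon>) \<le> prob ({w\<in>space M. X n w > \<epsilon> / 2} \<union> {w\<in>space M. Y n w > \<epsilon> / 2})"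
      by (intro finite_measure_mono) auto
    also have "\<dots> \<le> \<P>(w in M. X n w > \<epsilon> / 2) + \<P>(w in M. Y n w > \<epsilon> / 2)"
      by (rule measure_Un_le) auto
    finally show "norm \<P>(w in M. X n w + Y n w > \<epsilon>) \<le> \<P>(w in M. X n w > \<epsilon> / 2) + \<P>(w in M. Y n w > \<epsilon> / 2)"
      by simp
  qed
qed

lemma tends0_subseq:
  assumes X: "tends0 X" and r: "strict_mono (r :: nat \<Rightarrow> nat)"
  shows "tends0 (\<lambda>n. X (r n))"
  using X r unfolding tends0_def
  by (auto intro: LIMSEQ_subseq_LIMSEQ[unfolded o_def, OF _ r])

text \<open>Indices are chosen along which a value above \<open>(1/2)^k\<close> has probability at
  most \<open>(1/2)^k\<close>; the Borel-Cantelli lemma gives almost sure convergence.\<close>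

lemma tends0_AE_subseq:
  assumes X: "tends0 X" and nn: "\<And>n w. 0 \<le> X n w"
  obtains r where "strict_mono (r :: nat \<Rightarrow> nat)" "AE w in M. (\<lambda>n. X (r n) w) \<longlonglongrightarrow> 0"
proof -
  have [measurable]: "X n \<in> borel_measurable M" for n using X by (simp add: tends0_def)
  have "\<exists>n. m < n \<and> \<P>(w in M. X n w > (1/2)^k) < (1/2)^k" for m k
  proof -
    have "\<forall>\<^sub>F n in sequentially. \<P>(w in M. X n w > (1/2)^k) < (1/2)^k \<and> m < n"
      using tends0_eventually[OF X, of "(1/2)^k" "(1/2)^k"] eventually_gt_at_top[of m] by (auto intro: eventually_conj)
    then show ?thesis using eventually_happens'[OF sequentially_bot] by blast
  qed
  then obtain g where g: "\<And>m k. m < g m k \<and> \<P>(w in M. X (g m k) w > (1/2)^k) < (1/2)^k" by metis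
  define r where "r = rec_nat (g 0 0) (\<lambda>k m. g m (Suc k))"
  have rS: "r (Suc k) = g (r k) (Suc k)" "r 0 = g 0 0" for k by (simp_all add: r_def)
  have mono: "strict_mono r" unfolding strict_mono_Suc_iff using g rS by simp
  have pr: "\<P>(w in M. X (r k) w > (1/2)^k) \<le> (1/2)^k" for k
  proof -
    have "\<exists>m. r k = g m k" by (cases k) (auto simp: rS)
    then show ?thesis using g by (metis less_imp_le)
  qed
  have s: "summable (\<lambda>k. \<P>(w in M. X (r k) w > (1/2)^k))"
    by (rule summable_comparison_test'[where g="\<lambda>k. (1/2)^k" and N=0]) (use pr in \<open>auto intro: summable_geometric\<close>)
  have "AE w in M. \<forall>\<^sub>F k in sequentially. w \<in> space M - {w\<in>space M. X (r k) w > (1/2)^k}"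
    by (rule borel_cantelli_AE1) (auto intro: s simp: emeasure_eq_measure)
  then have "AE w in M. (\<lambda>n. X (r n) w) \<longlonglongrightarrow> 0"
  proof eventually_elim
    case (elim w)
    have "\<forall>\<^sub>F k in sequentially. norm (X (r k) w) \<le> (1/2)^k"
      using elim by eventually_elim (use nn in auto)
    then show ?case
      by (rule Lim_null_comparison) (intro LIMSEQ_power_zero, simp)
  qed
  with mono that show ?thesis by blast
qed

end

section \<open>Riemann sums for the stochastic integral\<close>

text \<open>Strict monotonicity keeps the increments of the noise over the cells nondegenerate. Only
  the values up to index \<open>n\<close> are constrained.\<close>

definition partition_upto :: "real \<Rightarrow> nat \<Rightarrow> (nat \<Rightarrow> real) \<Rightarrow> bool" where
  "partition_upto t n q \<longleftrightarrow> q 0 = 0 \<and> q n = t \<and> (\<forall>i<n. q i < q (Suc i))"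

lemma partition_upto_mono:
  assumes "partition_upto t n q" "i \<le> j" "j \<le> n" shows "q i \<le> q j"
  using assms(2,3)
proof (induction j rule: dec_induct)
  case (step m)
  have "q m < q (Suc m)" using assms(1) step by (simp add: partition_upto_def)
  then show ?case using step by simp
qed simp

lemma partition_upto_strict_mono:
  assumes "partition_upto t n q" "i < j" "j \<le> n" shows "q i < q j"
proof -
  have "q i < q (Suc i)" using assms by (auto simp: partition_upto_def)
  also have "\<dots> \<le> q j" using assms by (intro partition_upto_mono) auto
  finally show ?thesis .
qed

lemma partition_upto_less_iff:
  assumes "partition_upto t n q" "i \<le> n" "j \<le> n" shows "q i < q j \<longleftrightarrow> i < j"
  by (metis assms linorder_neqE_nat not_less_iff_gr_or_eq partition_upto_strict_mono)

lemma partition_upto_le_iff: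
  assumes "partition_upto t n q" "i \<le> n" "j \<le> n" shows "q i \<le> q j \<longleftrightarrow> i \<le> j"
  using partition_upto_less_iff[OF assms(1,3,2)] by (simp add: not_less[symmetric])

lemma partition_upto_bounds:
  assumes "partition_upto t n q" "i \<le> n" shows "0 \<le> q i" "q i \<le> t"
  using partition_upto_mono[OF assms(1), of 0 i] partition_upto_mono[OF assms(1), of i n] assms
  by (auto simp: partition_upto_def)

lemma partition_of_finite_set:
  assumes "finite Q" "Q \<subseteq> {0..t}" "0 \<in> Q" "t \<in> Q"
  obtains n q where "partition_upto t n q" "Q = q ` {..n}"
proof -
  define xs where "xs = sorted_list_of_set Q"
  have xs: "set xs = Q" "sorted_wrt (<) xs"
    using assms by (auto simp: xs_def strict_sorted_list_of_set)
  then have ne: "xs \<noteq> []" using assms by auto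
  define n where "n = length xs - 1"
  have len: "length xs = Suc n" using ne by (simp add: n_def)
  have less: "xs ! i < xs ! j" if "i < j" "j \<le> n" for i j
    using sorted_wrt_nth_less[OF xs(2), of i j] that len by simp
  have Q: "Q = (!) xs ` {..n}"
    using xs(1) len by (auto simp: set_conv_nth less_Suc_eq_le)
  have le: "xs ! i \<le> xs ! j" if "i \<le> j" "j \<le> n" for i j
    using less[of i j] that by (cases "i = j") auto
  obtain i j where ij: "i \<le> n" "0 = xs ! i" "j \<le> n" "t = xs ! j"
    using assms(3,4) unfolding Q by auto
  have "xs ! 0 \<in> Q" "xs ! n \<in> Q" unfolding Q by auto
  then have "xs ! 0 = 0" "xs ! n = t"
    using assms(2) ij le[of 0 i] le[of j n] by (auto intro: antisym)
  then have "partition_upto t n ((!) xs)"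
    using less by (auto simp: partition_upto_def)
  with Q that show ?thesis by blast
qed

text \<open>Since \<open>a\<close> and \<open>b\<close> are grid points, the right end point of a
  cell lies in \<open>{a<..b}\<close> exactly if the whole cell does.\<close>

lemma telescope_indicator:
  fixes z :: "real \<Rightarrow> 'b::real_vector"
  assumes q: "partition_upto t n q" and ab: "a \<in> q ` {..n}" "b \<in> q ` {..n}" "a \<le> b"
  shows "(\<Sum>j<n. indicator {a<..b} (q (Suc j)) *\<^sub>R (z (q (Suc j)) - z (q j))) = z b - z a"
proof -
  obtain i k where ik: "i \<le> n" "a = q i" "k \<le> n" "b = q k" using ab by auto
  then have ik_le: "i \<le> k" using ab(3) partition_upto_le_iff[OF q, of i k] by simp
  have "(\<Sum>j<n. indicator {a<..b} (q (Suc j)) *\<^sub>R (z (q (Suc j)) - z (q j))) = (\<Sum>j\<in>{i..<k}. z (q (Suc j)) - z (q j))"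
  proof (rule sum.mono_neutral_cong_right)
    show "\<forall>j\<in>{..<n} - {i..<k}. indicator {a<..b} (q (Suc j)) *\<^sub>R (z (q (Suc j)) - z (q j)) = 0"
      using ik by (auto simp: indicator_def partition_upto_less_iff[OF q] partition_upto_le_iff[OF q])
    show "indicator {a<..b} (q (Suc j)) *\<^sub>R (z (q (Suc j)) - z (q j)) = z (q (Suc j)) - z (q j)"
      if "j \<in> {i..<k}" for j
      using ik that by (auto simp: indicator_def partition_upto_less_iff[OF q] partition_upto_le_iff[OF q])
  qed (use ik in auto)
  also have "\<dots> = z b - z a"
    using ik_le sum_Suc_diff'[of i k "\<lambda>j. z (q j)"] by (simp add: ik)
  finally show ?thesis .
qed

text \<open>The left-open cells cover the interval exactly once, apart from the point
  \<open>0\<close>, which has measure zero.\<close>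

lemma sum_le_nn_integral_partition:
  assumes q: "partition_upto t n q"
    and const: "\<And>j s. j < n \<Longrightarrow> s \<in> {q j<..q (Suc j)} \<Longrightarrow> g s = g (q (Suc j))"
    and nn: "\<And>s. 0 \<le> g s"
  shows "(\<integral>\<^sup>+ s\<in>{0..t}. ennreal (g s) \<partial>lborel) = ennreal (\<Sum>j<n. g (q (Suc j)) * (q (Suc j) - q j))"
proof -
  have ex: "\<exists>!j. j < n \<and> s \<in> {q j<..q (Suc j)}" if s: "0 < s" "s \<le> t" for s
  proof -
    define k where "k = (LEAST k. s \<le> q k)"
    have qn: "s \<le> q n" using s q by (simp add: partition_upto_def)
    have k: "s \<le> q k" "k \<le> n"
      unfolding k_def by (rule LeastI[of "\<lambda>k. s \<le> q k", OF qn], rule Least_le[of "\<lambda>k. s \<le> q k", OF qn])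
    have kl: "q j < s" if "j < k" for j
      using not_less_Least[of j "\<lambda>k. s \<le> q k"] that unfolding k_def by linarith
    have "k \<noteq> 0"
    proof
      assume "k = 0"
      then show False using k(1) s q by (simp add: partition_upto_def)
    qed
    then obtain j where j: "k = Suc j" by (cases k) auto
    show ?thesis
    proof (rule ex1I[of _ j])
      show "j < n \<and> s \<in> {q j<..q (Suc j)}" using k kl[of j] j by auto
      fix i assume i: "i < n \<and> s \<in> {q i<..q (Suc i)}"
      then have "q i < q (Suc j)" "q j < q (Suc i)" using k kl[of j] j by (auto intro: less_le_trans)
      then show "i = j" using i k j by (auto simp: partition_upto_less_iff[OF q])
    qed
  qed
  have "(\<integral>\<^sup>+ s\<in>{0..t}. ennreal (g s) \<partial>lborel) = (\<integral>\<^sup>+ s. (\<Sum>j<n. ennreal (g (q (Suc j))) * indicator {q j<..q (Suc j)} s) \<partial>lborel)"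
  proof (rule nn_integral_cong_AE)
    have "AE s in lborel. s \<noteq> 0" by (rule AE_lborel_singleton)
    then show "AE s in lborel. ennreal (g s) * indicator {0..t} s = (\<Sum>j<n. ennreal (g (q (Suc j))) * indicator {q j<..q (Suc j)} s)"
    proof eventually_elim
      case (elim s)
      show ?case
      proof (cases "0 < s \<and> s \<le> t")
        case True
        then have "\<exists>!j. j < n \<and> s \<in> {q j<..q (Suc j)}" using ex[of s] by simp
        then obtain j where "j < n \<and> s \<in> {q j<..q (Suc j)}"
          and "\<forall>i. i < n \<and> s \<in> {q i<..q (Suc i)} \<longrightarrow> i = j"
          by (rule ex1E)
        then have j: "j < n" "s \<in> {q j<..q (Suc j)}" and u: "\<And>i. i < n \<Longrightarrow> s \<in> {q i<..q (Suc i)} \<Longrightarrow> i = j"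
          by blast+
        have "(\<Sum>j<n. ennreal (g (q (Suc j))) * indicator {q j<..q (Suc j)} s) = (\<Sum>i\<in>{j}. ennreal (g (q (Suc i))) * indicator {q i<..q (Suc i)} s)"
        proof (rule sum.mono_neutral_right)
          show "\<forall>i\<in>{..<n} - {j}. ennreal (g (q (Suc i))) * indicator {q i<..q (Suc i)} s = 0"
          proof
            fix i assume i: "i \<in> {..<n} - {j}"
            then have "s \<notin> {q i<..q (Suc i)}" using u[of i] by blast
            then show "ennreal (g (q (Suc i))) * indicator {q i<..q (Suc i)} s = 0"
              by (simp add: indicator_def del: greaterThanAtMost_iff)
          qed
        qed (use j(1) in simp_all)
        then show ?thesis using True j(2) const[OF j] by (simp add: indicator_def)
      next
        case False
        have "s \<notin> {q j<..q (Suc j)}" if "j < n" for j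
          using False partition_upto_bounds[OF q, of j] partition_upto_bounds[OF q, of "Suc j"] that by auto
        then show ?thesis using False elim by (auto simp: indicator_def)
      qed
    qed
  qed
  also have "\<dots> = (\<Sum>j<n. ennreal (g (q (Suc j))) * ennreal (q (Suc j) - q j))"
  proof (subst nn_integral_sum)
    show "(\<Sum>i<n. \<integral>\<^sup>+ x. ennreal (g (q (Suc i))) * indicator {q i<..q (Suc i)} x \<partial>lborel) = (\<Sum>j<n. ennreal (g (q (Suc j))) * ennreal (q (Suc j) - q j))"
      using q by (intro sum.cong refl) (auto simp: nn_integral_cmult partition_upto_def less_imp_le)
  qed auto
  also have "\<dots> = ennreal (\<Sum>j<n. g (q (Suc j)) * (q (Suc j) - q j))"
    using q nn by (subst sum_ennreal[symmetric]) (auto simp: ennreal_mult partition_upto_def less_imp_le)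
  finally show ?thesis .
qed

context driven
begin

text \<open>A simple integrand without the boundedness condition: the step process of left end point
  values of an unbounded integrand is of this kind.\<close>

definition step_process :: "nat \<Rightarrow> (nat \<Rightarrow> real) \<Rightarrow> (nat \<Rightarrow> 'w \<Rightarrow> real^'n^'d) \<Rightarrow> bool" where
  "step_process N \<tau> h \<longleftrightarrow> 0 \<le> \<tau> 0 \<and> (\<forall>i<N. \<tau> i \<le> \<tau> (Suc i)) \<and> (\<forall>i<N. h i \<in> borel_measurable (F (\<tau> i)))"

lemma step_process_nonneg: "step_process N \<tau> h \<Longrightarrow> i \<le> N \<Longrightarrow> 0 \<le> \<tau> i"
  by (induction i) (auto simp: step_process_def intro: order_trans)

text \<open>On a grid that contains all jump times, cut off at \<open>t\<close>, a step process is
  constant on cells. Its value is read off at the right end point because its own intervals are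
  left-open.\<close>

lemma
  fixes h :: "nat \<Rightarrow> 'w \<Rightarrow> real^'n^'d"
  assumes st: "step_process N \<tau> h" and q: "partition_upto t n q"
    and sub: "\<And>i. i \<le> N \<Longrightarrow> min (\<tau> i) t \<in> q ` {..n}"
  shows simple_value_refine_measurable:
      "j < n \<Longrightarrow> simple_value N \<tau> h (q (Suc j)) \<in> borel_measurable (F (q j))"
    and simple_value_refine:
      "j < n \<Longrightarrow> s \<in> {q j<..q (Suc j)} \<Longrightarrow> simple_value N \<tau> h s w = simple_value N \<tau> h (q (Suc j)) w"
    and simple_integral_refine:
      "simple_integral W N \<tau> h t w =
        (\<Sum>j<n. simple_value N \<tau> h (q (Suc j)) w *v (W (q (Suc j)) w - W (q j) w))"
proof -
  have le: "u \<le> q j" if "u \<in> q ` {..n}" "u < q (Suc j)" "j < n" for u j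
    using that by (auto simp: partition_upto_less_iff[OF q] partition_upto_le_iff[OF q])
  \<comment> \<open>Jump times are grid points, so one that precedes the right end of a cell does
    not exceed its left end; the value carried by the cell is therefore known when the cell
    begins.\<close>
  have \<tau>_le: "\<tau> i \<le> q j" if "i \<le> N" "\<tau> i < q (Suc j)" "j < n" for i j
    using le[OF sub[OF that(1)], of j] that partition_upto_bounds[OF q, of "Suc j"] by (auto simp: min_def split: if_splits)
  show "simple_value N \<tau> h (q (Suc j)) \<in> borel_measurable (F (q j))" if j: "j < n"
    unfolding simple_value_def[abs_def]
  proof (rule borel_measurable_sum)
    fix i assume i: "i \<in> {..<N}"
    show "(\<lambda>w. indicator {\<tau> i<..\<tau> (Suc i)} (q (Suc j)) *\<^sub>R h i w) \<in> borel_measurable (F (q j))"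
    proof (cases "\<tau> i < q (Suc j)")
      case True
      then have "h i \<in> borel_measurable (F (q j))"
        using st i by (intro measurable_F_mono[OF _ \<tau>_le]) (auto simp: step_process_def j)
      then show ?thesis by simp
    qed simp
  qed
  show "simple_value N \<tau> h s w = simple_value N \<tau> h (q (Suc j)) w" if j: "j < n" and s: "s \<in> {q j<..q (Suc j)}"
    unfolding simple_value_def
  proof (rule sum.cong[OF refl])
    fix i assume i: "i \<in> {..<N}"
    have a: "\<tau> i < s \<longleftrightarrow> \<tau> i < q (Suc j)" using \<tau>_le[of i j] i j s by auto
    have b: "s \<le> \<tau> (Suc i) \<longleftrightarrow> q (Suc j) \<le> \<tau> (Suc i)"
    proof (cases "\<tau> (Suc i) < q (Suc j)")
      case True then show ?thesis using \<tau>_le[of "Suc i" j] i j s by auto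
    qed (use s in auto)
    show "indicator {\<tau> i<..\<tau> (Suc i)} s *\<^sub>R h i w = indicator {\<tau> i<..\<tau> (Suc i)} (q (Suc j)) *\<^sub>R h i w"
      using a b by (simp add: indicator_def)
  qed
  have "h i w *v (W (min (\<tau> (Suc i)) t) w - W (min (\<tau> i) t) w) =
      (\<Sum>j<n. (indicator {\<tau> i<..\<tau> (Suc i)} (q (Suc j)) *\<^sub>R h i w) *v (W (q (Suc j)) w - W (q j) w))" if i: "i < N" for i
  proof -
    have "W (min (\<tau> (Suc i)) t) w - W (min (\<tau> i) t) w =
       (\<Sum>j<n. indicator {min (\<tau> i) t<..min (\<tau> (Suc i)) t} (q (Suc j)) *\<^sub>R (W (q (Suc j)) w - W (q j) w))"
      using st i by (intro telescope_indicator[OF q, symmetric] sub) (auto simp: step_process_def)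
    also have "\<dots> = (\<Sum>j<n. indicator {\<tau> i<..\<tau> (Suc i)} (q (Suc j)) *\<^sub>R (W (q (Suc j)) w - W (q j) w))"
    proof (rule sum.cong[OF refl])
      fix j assume "j \<in> {..<n}"
      then have "q (Suc j) \<le> t" using partition_upto_bounds[OF q, of "Suc j"] by simp
      then show "indicator {min (\<tau> i) t<..min (\<tau> (Suc i)) t} (q (Suc j)) *\<^sub>R (W (q (Suc j)) w - W (q j) w)
         = indicator {\<tau> i<..\<tau> (Suc i)} (q (Suc j)) *\<^sub>R (W (q (Suc j)) w - W (q j) w)"
        using \<open>j \<in> {..<n}\<close> sub[of i] i
        by (cases "\<tau> i < q (Suc j)") (auto simp: indicator_def min_def dest: leD)
    qed
    finally have eq: "W (min (\<tau> (Suc i)) t) w - W (min (\<tau> i) t) w = (\<Sum>j<n. indicator {\<tau> i<..\<tau> (Suc i)} (q (Suc j)) *\<^sub>R (W (q (Suc j)) w - W (q j) w))" .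
    show ?thesis unfolding eq
      by (simp only: linear_sum[OF matrix_vector_mul_linear] matrix_vector_mult_scaleR scaleR_matrix_vector_assoc)
  qed
  then have "simple_integral W N \<tau> h t w = (\<Sum>i<N. \<Sum>j<n. (indicator {\<tau> i<..\<tau> (Suc i)} (q (Suc j)) *\<^sub>R h i w) *v (W (q (Suc j)) w - W (q j) w))"
    by (simp add: simple_integral_def)
  also have "\<dots> = (\<Sum>j<n. \<Sum>i<N. (indicator {\<tau> i<..\<tau> (Suc i)} (q (Suc j)) *\<^sub>R h i w) *v (W (q (Suc j)) w - W (q j) w))"
    by (rule sum.swap)
  also have "\<dots> = (\<Sum>j<n. simple_value N \<tau> h (q (Suc j)) w *v (W (q (Suc j)) w - W (q j) w))"
  proof (rule sum.cong[OF refl])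
    have "(\<Sum>i\<in>I. f i *v v) = (\<Sum>i\<in>I. f i) *v v" if "finite I" for I and f :: "nat \<Rightarrow> real^'n^'d" and v
      using that by (induction I rule: finite_induct) (auto simp: matrix_vector_mult_add_rdistrib)
    then show "(\<Sum>i<N. (indicator {\<tau> i<..\<tau> (Suc i)} (q (Suc j)) *\<^sub>R h i w) *v (W (q (Suc j)) w - W (q j) w)) =
       simple_value N \<tau> h (q (Suc j)) w *v (W (q (Suc j)) w - W (q j) w)" for j
      by (simp add: simple_value_def)
  qed
  finally show "simple_integral W N \<tau> h t w =
        (\<Sum>j<n. simple_value N \<tau> h (q (Suc j)) w *v (W (q (Suc j)) w - W (q j) w))" .
qed

text \<open>Over a common refinement the difference of the two integrals is again a grid martingale
  sum, and its bracket is the integral of the squared difference of the integrands;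
  \<open>lenglart\<close> applies.\<close>

lemma simple_integral_compare:
  fixes h h' :: "nat \<Rightarrow> 'w \<Rightarrow> real^'n^'d"
  assumes st: "step_process N \<tau> h" and st': "step_process N' \<tau>' h'" and t: "t > 0" and \<epsilon>: "\<epsilon> > 0" and \<eta>: "\<eta> > 0"
  shows "\<P>(w in M. norm (simple_integral W N \<tau> h t w - simple_integral W N' \<tau>' h' t w) > \<epsilon>)
    \<le> \<eta> / \<epsilon>\<^sup>2 + \<P>(w in M. (\<integral>\<^sup>+ s\<in>{0..t}. ennreal ((norm (simple_value N \<tau> h s w - simple_value N' \<tau>' h' s w))\<^sup>2) \<partial>lborel) > ennreal \<eta>)"
proof -
  define Q where "Q = {0, t} \<union> (\<lambda>i. min (\<tau> i) t) ` {..N} \<union> (\<lambda>i. min (\<tau>' i) t) ` {..N'}"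
  have "finite Q" "Q \<subseteq> {0..t}" "0 \<in> Q" "t \<in> Q"
    using t step_process_nonneg[OF st] step_process_nonneg[OF st'] by (auto simp: Q_def)
  then obtain n q where q: "partition_upto t n q" and Q: "Q = q ` {..n}"
    by (rule partition_of_finite_set)
  have sub: "i \<le> N \<Longrightarrow> min (\<tau> i) t \<in> q ` {..n}" and sub': "i \<le> N' \<Longrightarrow> min (\<tau>' i) t \<in> q ` {..n}" for i
    unfolding Q[symmetric] Q_def by auto
  define G where "G j w = simple_value N \<tau> h (q (Suc j)) w - simple_value N' \<tau>' h' (q (Suc j)) w" for j w
  have e1: "simple_integral W N \<tau> h t w = (\<Sum>j<n. simple_value N \<tau> h (q (Suc j)) w *v (W (q (Suc j)) w - W (q j) w))" for w
    by (rule simple_integral_refine[OF st q]) (rule sub)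
  have e2: "simple_integral W N' \<tau>' h' t w = (\<Sum>j<n. simple_value N' \<tau>' h' (q (Suc j)) w *v (W (q (Suc j)) w - W (q j) w))" for w
    by (rule simple_integral_refine[OF st' q]) (rule sub')
  have SI: "simple_integral W N \<tau> h t w - simple_integral W N' \<tau>' h' t w = (\<Sum>j<n. G j w *v (W (q (Suc j)) w - W (q j) w))" for w
    unfolding e1 e2 G_def
    by (simp add: sum_subtractf matrix_vector_mult_diff_rdistrib)
  have NN: "(\<integral>\<^sup>+ s\<in>{0..t}. ennreal ((norm (simple_value N \<tau> h s w - simple_value N' \<tau>' h' s w))\<^sup>2) \<partial>lborel)
     = ennreal (\<Sum>j<n. (norm (G j w))\<^sup>2 * (q (Suc j) - q j))" for w
    unfolding G_def
  proof (rule sum_le_nn_integral_partition[OF q])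
    fix j s assume js: "j < n" "s \<in> {q j<..q (Suc j)}"
    have "simple_value N \<tau> h s w = simple_value N \<tau> h (q (Suc j)) w"
      by (rule simple_value_refine[OF st q _ js]) (rule sub)
    moreover have "simple_value N' \<tau>' h' s w = simple_value N' \<tau>' h' (q (Suc j)) w"
      by (rule simple_value_refine[OF st' q _ js]) (rule sub')
    ultimately show "(norm (simple_value N \<tau> h s w - simple_value N' \<tau>' h' s w))\<^sup>2 =
      (norm (simple_value N \<tau> h (q (Suc j)) w - simple_value N' \<tau>' h' (q (Suc j)) w))\<^sup>2" by simp
  qed simp
  have Gm: "G j \<in> borel_measurable (F (q j))" if "j < n" for j
    unfolding G_def[abs_def]
    by (intro borel_measurable_diff simple_value_refine_measurable[OF st q _ that] simple_value_refine_measurable[OF st' q _ that])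
      (rule sub sub', assumption)+
  have Wm: "W (q i) \<in> borel_measurable M" if "i \<le> n" for i
    by (rule W_measurable) (use partition_upto_bounds[OF q that] in simp)
  have Sm: "(\<lambda>w. \<Sum>j<k. G j w *v (W (q (Suc j)) w - W (q j) w)) \<in> borel_measurable M" if "k \<le> n" for k
  proof (intro borel_measurable_sum borel_measurable_matrix_vector_mult borel_measurable_diff)
    fix j assume j: "j \<in> {..<k}"
    show "G j \<in> borel_measurable M" by (rule measurable_F_M[OF Gm]) (use j that in simp)
    show "W (q (Suc j)) \<in> borel_measurable M" "W (q j) \<in> borel_measurable M"
      by (rule Wm, use j that in simp)+
  qed
  have len: "\<P>(w in M. \<exists>k\<le>n. norm (\<Sum>i<k. G i w *v (W (q (Suc i)) w - W (q i) w)) > \<epsilon>)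
     \<le> \<eta> / \<epsilon>\<^sup>2 + \<P>(w in M. (\<Sum>i<n. (norm (G i w))\<^sup>2 * (q (Suc i) - q i)) > \<eta>)"
    by (rule lenglart[OF _ _ Gm \<epsilon> \<eta>]) (use q in \<open>simp_all add: partition_upto_def\<close>)
  have "\<P>(w in M. norm (\<Sum>j<n. G j w *v (W (q (Suc j)) w - W (q j) w)) > \<epsilon>)
     \<le> \<P>(w in M. \<exists>k\<le>n. norm (\<Sum>i<k. G i w *v (W (q (Suc i)) w - W (q i) w)) > \<epsilon>)"
  proof (rule finite_measure_mono)
    have "{w\<in>space M. \<exists>k\<in>{..n}. norm (\<Sum>i<k. G i w *v (W (q (Suc i)) w - W (q i) w)) > \<epsilon>} \<in> events"
      using Sm by measurable
    moreover have "{w\<in>space M. \<exists>k\<in>{..n}. norm (\<Sum>i<k. G i w *v (W (q (Suc i)) w - W (q i) w)) > \<epsilon>} =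
      {w\<in>space M. \<exists>k\<le>n. norm (\<Sum>i<k. G i w *v (W (q (Suc i)) w - W (q i) w)) > \<epsilon>}" by auto
    ultimately show "{w\<in>space M. \<exists>k\<le>n. norm (\<Sum>i<k. G i w *v (W (q (Suc i)) w - W (q i) w)) > \<epsilon>} \<in> events"
      by (simp only:)
  qed (intro subsetI CollectI conjI exI[of _ n] order_refl; elim CollectE conjE; assumption)
  from order_trans[OF this len] show ?thesis
    unfolding SI NN ennreal_less_iff[OF less_imp_le[OF \<eta>]] .
qed

end


context driven
begin

text \<open>Progressive measurability makes the integrand jointly measurable in time and outcome, as
  Tonelli requires.\<close>

lemma nn_integral_dist_measurable:
  fixes h :: "nat \<Rightarrow> 'w \<Rightarrow> real^'n^'d" and H :: "real \<Rightarrow> 'w \<Rightarrow> real^'n^'d"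
  assumes prog: "(\<lambda>(s, w). H s w) \<in> borel_measurable (restrict_space borel {0..t} \<Otimes>\<^sub>M F t)"
    and st: "step_process N \<tau> h"
  shows "(\<lambda>w. \<integral>\<^sup>+ s\<in>{0..t}. ennreal ((norm (simple_value N \<tau> h s w - H s w))\<^sup>2) \<partial>lborel) \<in> borel_measurable M"
proof -
  define R where "R = restrict_space lborel {0..t}"
  have setsR[measurable_cong]: "sets R = sets (restrict_space borel {0..t})"
    by (simp add: R_def sets_restrict_space)
  interpret R: sigma_finite_measure R
    unfolding R_def by (rule sigma_finite_measure_restrict_space) (auto intro: lborel.sigma_finite_measure_axioms)
  note [measurable] = id_measurable_F[of t]
  have sR: "(\<lambda>s. s) \<in> borel_measurable R"
    unfolding measurable_cong_sets[OF setsR refl] by (rule measurable_restrict_space1) simp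
  have sw: "(\<lambda>x. (snd x, fst x)) \<in> measurable (M \<Otimes>\<^sub>M R) (restrict_space borel {0..t} \<Otimes>\<^sub>M F t)"
    by measurable
  have Hm: "(\<lambda>x. H (snd x) (fst x)) \<in> borel_measurable (M \<Otimes>\<^sub>M R)"
    using measurable_compose[OF sw prog] by simp
  have hm: "(\<lambda>x. indicator {\<tau> i<..\<tau> (Suc i)} (snd x) *\<^sub>R h i (fst x)) \<in> borel_measurable (M \<Otimes>\<^sub>M R)" if "i < N" for i
  proof -
    have [measurable]: "h i \<in> borel_measurable M" using st that by (intro measurable_F_M) (auto simp: step_process_def)
    have [measurable]: "(\<lambda>x. snd x) \<in> borel_measurable (M \<Otimes>\<^sub>M R)"
      by (rule measurable_compose[OF measurable_snd sR])
    show ?thesis by measurable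
  qed
  have "(\<lambda>x. simple_value N \<tau> h (snd x) (fst x)) \<in> borel_measurable (M \<Otimes>\<^sub>M R)"
    unfolding simple_value_def by (intro borel_measurable_sum hm) simp
  then have "(\<lambda>x. ennreal ((norm (simple_value N \<tau> h (snd x) (fst x) - H (snd x) (fst x)))\<^sup>2)) \<in> borel_measurable (M \<Otimes>\<^sub>M R)"
    using Hm by measurable
  then have "(\<lambda>w. \<integral>\<^sup>+ s. ennreal ((norm (simple_value N \<tau> h s w - H s w))\<^sup>2) \<partial>R) \<in> borel_measurable M"
    using R.borel_measurable_nn_integral[of "\<lambda>w s. ennreal ((norm (simple_value N \<tau> h s w - H s w))\<^sup>2)" M]
    by (simp add: case_prod_beta)
  then show ?thesis
    unfolding R_def by (subst (asm) nn_integral_restrict_space) auto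
qed

lemma simple_value_partition:
  assumes q: "partition_upto t n q" and s: "i < n" "s \<in> {q i<..q (Suc i)}"
  shows "simple_value n q h s w = h i w"
proof -
  have "simple_value n q h s w = (\<Sum>j\<in>{i}. indicator {q j<..q (Suc j)} s *\<^sub>R h j w)"
    unfolding simple_value_def
  proof (rule sum.mono_neutral_right)
    show "\<forall>j\<in>{..<n} - {i}. indicator {q j<..q (Suc j)} s *\<^sub>R h j w = 0"
    proof
      fix j assume j: "j \<in> {..<n} - {i}"
      have "s \<notin> {q j<..q (Suc j)}"
      proof
        assume a: "s \<in> {q j<..q (Suc j)}"
        then have "q i < q (Suc j)" "q j < q (Suc i)" using s by auto
        then have "i = j" using j s partition_upto_less_iff[OF q, of i "Suc j"] partition_upto_less_iff[OF q, of j "Suc i"] by auto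
        then show False using j by simp
      qed
      then show "indicator {q j<..q (Suc j)} s *\<^sub>R h j w = 0"
        by (simp add: indicator_def del: greaterThanAtMost_iff)
    qed
  qed (use s in auto)
  then show ?thesis using s by (simp add: indicator_def)
qed

lemma partition_upto_cover:
  assumes q: "partition_upto t n q" and s: "0 < s" "s \<le> t"
  obtains i where "i < n" "s \<in> {q i<..q (Suc i)}"
proof -
  define k where "k = (LEAST k. s \<le> q k)"
  have qn: "s \<le> q n" using s q by (simp add: partition_upto_def)
  have k: "s \<le> q k" "k \<le> n"
    unfolding k_def by (rule LeastI[of "\<lambda>k. s \<le> q k", OF qn], rule Least_le[of "\<lambda>k. s \<le> q k", OF qn])
  have kl: "q j < s" if "j < k" for j
    using not_less_Least[of j "\<lambda>k. s \<le> q k"] that unfolding k_def by linarith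
  have "k \<noteq> 0"
  proof
    assume "k = 0"
    then show False using k(1) s q by (simp add: partition_upto_def)
  qed
  then obtain j where j: "k = Suc j" by (cases k) auto
  show ?thesis using that[of j] k kl[of j] j by auto
qed

text \<open>The simple integrands in the definition of the Ito integral are unrelated to the given
  partitions. The left end point sums are integrals of step processes that converge to
  \<open>H\<close> too, pathwise by uniform continuity, so both approximations are close to each
  other by \<open>simple_integral_compare\<close>.\<close>

lemma ito_riemann:
  fixes H :: "real \<Rightarrow> 'w \<Rightarrow> real^'n^'d" and I :: "'w \<Rightarrow> real^'d"
  assumes ito: "has_ito_integral M F W H t I" and t: "t > 0"
    and H_adapted: "\<And>s. 0 \<le> s \<Longrightarrow> H s \<in> borel_measurable (F s)"
    and H_cont: "\<And>w. w \<in> space M \<Longrightarrow> continuous_on {0..} (\<lambda>s. H s w)"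
    and q: "\<And>j. partition_upto t (n j) (q j)"
    and mesh: "\<And>e. e > 0 \<Longrightarrow> \<forall>\<^sub>F j in sequentially. \<forall>i<n j. q j (Suc i) - q j i < e"
  shows "tends0 (\<lambda>j w. norm ((\<Sum>i<n j. H (q j i) w *v (W (q j (Suc i)) w - W (q j i) w)) - I w))"
proof -
  obtain N \<tau> h where simp_int: "\<And>k. simple_integrand F (N k) (\<tau> k) (h k)"
    and L2: "\<And>\<epsilon>. \<epsilon> > 0 \<Longrightarrow> (\<lambda>k. \<P>(w in M.
            (\<integral>\<^sup>+ s\<in>{0..t}. ennreal ((norm (simple_value (N k) (\<tau> k) (h k) s w - H s w))\<^sup>2) \<partial>lborel)
              > ennreal \<epsilon>)) \<longlonglongrightarrow> 0"
    and P: "\<And>\<epsilon>. \<epsilon> > 0 \<Longrightarrow> (\<lambda>k. \<P>(w in M.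
            norm (simple_integral W (N k) (\<tau> k) (h k) t w - I w) > \<epsilon>)) \<longlonglongrightarrow> 0"
    and Im[measurable]: "I \<in> borel_measurable M"
    and prog: "(\<lambda>(s, w). H s w) \<in> borel_measurable (restrict_space borel {0..t} \<Otimes>\<^sub>M F t)"
    using ito t unfolding has_ito_integral_def by auto
  have st: "step_process (N k) (\<tau> k) (h k)" for k
    using simp_int[of k] by (auto simp: simple_integrand_def step_process_def)
  define g where "g j i = H (q j i)" for j i
  have stg: "step_process (n j) (q j) (g j)" for j
    unfolding step_process_def g_def
    using partition_upto_bounds[OF q, of _ j] q[of j] by (auto simp: partition_upto_def less_imp_le intro!: H_adapted)
  have Sg: "simple_integral W (n j) (q j) (g j) t w = (\<Sum>i<n j. H (q j i) w *v (W (q j (Suc i)) w - W (q j i) w))" for j w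
    unfolding simple_integral_def g_def
    using partition_upto_bounds(2)[OF q, of _ j] by (intro sum.cong refl) (simp add: min_absorb1)
  have Sm: "simple_integral W (N' :: nat) \<tau>' h' t \<in> borel_measurable M" if "step_process N' \<tau>' h'" for N' \<tau>' and h' :: "nat \<Rightarrow> 'w \<Rightarrow> real^'n^'d"
    unfolding simple_integral_def[abs_def]
  proof (intro borel_measurable_sum borel_measurable_matrix_vector_mult borel_measurable_diff)
    fix i assume i: "i \<in> {..<N'}"
    show "h' i \<in> borel_measurable M" using that i by (intro measurable_F_M) (auto simp: step_process_def)
    show "W (min (\<tau>' (Suc i)) t) \<in> borel_measurable M" "W (min (\<tau>' i) t) \<in> borel_measurable M"
      using step_process_nonneg[OF that, of i] step_process_nonneg[OF that, of "Suc i"] i t by (auto intro!: W_measurable)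
  qed
  define dist2 where "dist2 j w = (\<integral>\<^sup>+ s\<in>{0..t}. ennreal ((norm (simple_value (n j) (q j) (g j) s w - H s w))\<^sup>2) \<partial>lborel)" for j w
  have dist2m[measurable]: "dist2 j \<in> borel_measurable M" for j
    unfolding dist2_def by (rule nn_integral_dist_measurable[OF prog stg])
  have dist2_small: "\<forall>\<^sub>F j in sequentially. dist2 j w \<le> ennreal e" if w: "w \<in> space M" and e: "e > 0" for w e
  proof -
    define c where "c = sqrt (e / t)"
    have c: "c > 0" "c\<^sup>2 * t = e" using e t by (auto simp: c_def)
    have "uniformly_continuous_on {0..t} (\<lambda>s. H s w)"
      by (intro compact_uniformly_continuous continuous_on_subset[OF H_cont[OF w]]) auto
    then obtain d where d: "d > 0" "\<And>u v. u \<in> {0..t} \<Longrightarrow> v \<in> {0..t} \<Longrightarrow> dist v u < d \<Longrightarrow> dist (H v w) (H u w) < c"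
      using c unfolding uniformly_continuous_on_def by metis
    from mesh[OF d(1)] show ?thesis
    proof eventually_elim
      case (elim j)
      have "dist2 j w \<le> (\<integral>\<^sup>+ s. ennreal (c\<^sup>2) * indicator {0..t} s \<partial>lborel)"
        unfolding dist2_def
      proof (rule nn_integral_mono_AE)
        have "AE s in lborel. s \<noteq> (0::real)" by (rule AE_lborel_singleton)
        then show "AE s in lborel. ennreal ((norm (simple_value (n j) (q j) (g j) s w - H s w))\<^sup>2) * indicator {0..t} s
          \<le> ennreal (c\<^sup>2) * indicator {0..t} s"
        proof eventually_elim
          case (elim s)
          show ?case
          proof (cases "0 < s \<and> s \<le> t")
            case True
            then obtain i where i: "i < n j" "s \<in> {q j i<..q j (Suc i)}"
              using partition_upto_cover[OF q] by metis
            have "norm (simple_value (n j) (q j) (g j) s w - H s w) = dist (H (q j i) w) (H s w)"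
              using simple_value_partition[OF q i, of "g j" w] by (simp add: g_def dist_norm)
            also have "\<dots> \<le> c"
            proof (intro less_imp_le d(2))
              show "s \<in> {0..t}" "q j i \<in> {0..t}" using True partition_upto_bounds[OF q, of i j] i by auto
              show "dist (q j i) s < d"
                using \<open>\<forall>i<n j. q j (Suc i) - q j i < d\<close> i by (force simp: dist_real_def)
            qed
            finally have "(norm (simple_value (n j) (q j) (g j) s w - H s w))\<^sup>2 \<le> c\<^sup>2"
              by (rule power_mono) simp
            then show ?thesis by (intro mult_right_mono ennreal_leI) auto
          next
            case False
            then show ?thesis using elim by (auto simp: indicator_def)
          qed
        qed
      qed
      also have "\<dots> = ennreal (c\<^sup>2 * t)"
        using t by (simp add: nn_integral_cmult ennreal_mult)
      finally show ?case using c by simp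
    qed
  qed
  show ?thesis
    unfolding tends0_def
  proof (intro conjI allI impI)
    show "(\<lambda>w. norm ((\<Sum>i<n j. H (q j i) w *v (W (q j (Suc i)) w - W (q j i) w)) - I w)) \<in> borel_measurable M" for j
      unfolding Sg[symmetric] using Sm[OF stg] by measurable
    fix \<epsilon> :: real assume \<epsilon>: "\<epsilon> > 0"
    show "(\<lambda>j. \<P>(w in M. norm ((\<Sum>i<n j. H (q j i) w *v (W (q j (Suc i)) w - W (q j i) w)) - I w) > \<epsilon>)) \<longlonglongrightarrow> 0"
      unfolding Sg[symmetric]
    proof (rule LIMSEQ_I, goal_cases)
      case (1 \<kappa>)
      \<comment> \<open>Each of the four contributions to the probability is then at most
        \<open>\<kappa> / 5\<close>. The threshold \<open>\<eta>/4\<close> for both distances to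
        \<open>H\<close> matches \<open>\<bar>x - y\<bar>\<^sup>2 \<le> 2 \<bar>x - z\<bar>\<^sup>2
        + 2 \<bar>y - z\<bar>\<^sup>2\<close>.\<close>
      define \<eta> where "\<eta> = \<kappa> / 5 * (\<epsilon>/2)\<^sup>2"
      have \<eta>: "\<eta> > 0" "\<eta> / (\<epsilon>/2)\<^sup>2 = \<kappa> / 5" using 1 \<epsilon> by (auto simp: \<eta>_def)
      let ?E1 = "\<lambda>k. {w\<in>space M. (\<integral>\<^sup>+ s\<in>{0..t}. ennreal ((norm (simple_value (N k) (\<tau> k) (h k) s w - H s w))\<^sup>2) \<partial>lborel) > ennreal (\<eta>/4)}"
      let ?E2 = "\<lambda>k. {w\<in>space M. norm (simple_integral W (N k) (\<tau> k) (h k) t w - I w) > \<epsilon>/2}"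
      let ?E3 = "\<lambda>j. {w\<in>space M. dist2 j w > ennreal (\<eta>/4)}"
      have "\<forall>\<^sub>F k in sequentially. prob (?E1 k) < \<kappa>/5 \<and> prob (?E2 k) < \<kappa>/5"
        by (intro eventually_conj order_tendstoD(2)[OF L2] order_tendstoD(2)[OF P]) (use 1 \<epsilon> \<eta> in auto)
      then obtain k where k: "prob (?E1 k) < \<kappa>/5" "prob (?E2 k) < \<kappa>/5"
        using eventually_happens'[OF sequentially_bot] by blast
      have E1m: "?E1 k \<in> events" using nn_integral_dist_measurable[OF prog st[of k]] by measurable
      have E2m: "?E2 k \<in> events" using Sm[OF st[of k]] by measurable
      have E3m: "?E3 j \<in> events" for j by measurable
      have E3: "(\<lambda>j. prob (?E3 j)) \<longlonglongrightarrow> 0"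
      proof (rule prob_tendsto_0_AE[OF E3m], rule AE_I2)
        fix w assume "w \<in> space M"
        from dist2_small[OF this, of "\<eta>/4"] \<eta>(1) show "\<forall>\<^sub>F j in sequentially. w \<notin> ?E3 j"
          by (auto elim!: eventually_mono simp: not_less)
      qed
      have "\<forall>\<^sub>F j in sequentially. prob (?E3 j) < \<kappa>/5"
        by (rule order_tendstoD(2)[OF E3]) (use 1 in simp)
      then obtain j0 where j0: "\<And>j. j \<ge> j0 \<Longrightarrow> prob (?E3 j) < \<kappa>/5" by (auto simp: eventually_sequentially)
      show ?case
      proof (intro exI allI impI)
        fix j assume "j \<ge> j0"
        let ?D = "{w\<in>space M. norm (simple_integral W (N k) (\<tau> k) (h k) t w - simple_integral W (n j) (q j) (g j) t w) > \<epsilon>/2}"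
        let ?V = "{w\<in>space M. (\<integral>\<^sup>+ s\<in>{0..t}. ennreal ((norm (simple_value (N k) (\<tau> k) (h k) s w - simple_value (n j) (q j) (g j) s w))\<^sup>2) \<partial>lborel) > ennreal \<eta>}"
        have V: "?V \<subseteq> ?E1 k \<union> ?E3 j"
        proof (rule subsetI, rule ccontr)
          fix w assume V: "w \<in> ?V" and n: "w \<notin> ?E1 k \<union> ?E3 j"
          then have w: "w \<in> space M" by blast
          have Hc: "(\<lambda>s. indicator {0..t} s *\<^sub>R H s w) \<in> borel_measurable borel"
            using continuous_on_subset[OF H_cont[OF w], of "{0..t}"]
            by (intro borel_measurable_continuous_on_indicator) auto
          have sv: "(\<lambda>s. simple_value N' \<tau>' h' s w) \<in> borel_measurable borel" for N' \<tau>' and h' :: "nat \<Rightarrow> 'w \<Rightarrow> real^'n^'d"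
            unfolding simple_value_def by measurable
          have me: "(\<lambda>s. ennreal ((norm (simple_value N' \<tau>' h' s w - H s w))\<^sup>2) * indicator {0..t} s) \<in> borel_measurable lborel"
            for N' \<tau>' and h' :: "nat \<Rightarrow> 'w \<Rightarrow> real^'n^'d"
          proof -
            have "(\<lambda>s. ennreal ((norm (simple_value N' \<tau>' h' s w - indicator {0..t} s *\<^sub>R H s w))\<^sup>2) * indicator {0..t} s) \<in> borel_measurable lborel"
              using Hc sv[of N' \<tau>' h'] by simp
            also have "(\<lambda>s. ennreal ((norm (simple_value N' \<tau>' h' s w - indicator {0..t} s *\<^sub>R H s w))\<^sup>2) * indicator {0..t} s)
              = (\<lambda>s. ennreal ((norm (simple_value N' \<tau>' h' s w - H s w))\<^sup>2) * indicator {0..t} s)"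
              by (auto simp: indicator_def)
            finally show ?thesis .
          qed
          have ineq: "(norm (x - y))\<^sup>2 \<le> 2 * (norm (x - z))\<^sup>2 + 2 * (norm (y - z))\<^sup>2" for x y z :: "real^'n^'d"
          proof -
            have "(norm (x - y))\<^sup>2 \<le> (norm (x - z) + norm (y - z))\<^sup>2"
              using norm_triangle_ineq4[of "x - z" "y - z"] by (intro power_mono) auto
            also have "\<dots> \<le> 2 * (norm (x - z))\<^sup>2 + 2 * (norm (y - z))\<^sup>2"
              using sum_squares_bound[of "norm (x - z)" "norm (y - z)"] by (simp add: power2_sum)
            finally show ?thesis .
          qed
          have ineq': "ennreal ((norm (x - y))\<^sup>2) \<le> 2 * ennreal ((norm (x - z))\<^sup>2) + 2 * ennreal ((norm (y - z))\<^sup>2)" for x y z :: "real^'n^'d"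
            using ennreal_leI[OF ineq[of x y z]] by (simp add: ennreal_mult)
          have "(\<integral>\<^sup>+ s\<in>{0..t}. ennreal ((norm (simple_value (N k) (\<tau> k) (h k) s w - simple_value (n j) (q j) (g j) s w))\<^sup>2) \<partial>lborel)
            \<le> (\<integral>\<^sup>+ s. ennreal 2 * (ennreal ((norm (simple_value (N k) (\<tau> k) (h k) s w - H s w))\<^sup>2) * indicator {0..t} s)
                + ennreal 2 * (ennreal ((norm (simple_value (n j) (q j) (g j) s w - H s w))\<^sup>2) * indicator {0..t} s) \<partial>lborel)"
            by (intro nn_integral_mono) (auto simp: indicator_def intro!: ineq')
          also have "\<dots> = ennreal 2 * (\<integral>\<^sup>+ s\<in>{0..t}. ennreal ((norm (simple_value (N k) (\<tau> k) (h k) s w - H s w))\<^sup>2) \<partial>lborel)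
              + ennreal 2 * dist2 j w"
          proof -
            note [measurable] = me[of "N k" "\<tau> k" "h k"] me[of "n j" "q j" "g j"]
            show ?thesis unfolding dist2_def
              by (subst nn_integral_add, measurable, (subst nn_integral_cmult, measurable)+)
          qed
          also have "\<dots> \<le> ennreal 2 * ennreal (\<eta>/4) + ennreal 2 * ennreal (\<eta>/4)"
            using n w by (intro add_mono mult_left_mono) (auto simp: not_less)
          also have "\<dots> = ennreal \<eta>"
            using \<eta>(1) by (simp add: ennreal_mult[symmetric] ennreal_plus[symmetric] del: ennreal_plus ennreal_numeral)
          finally show False using V by (simp add: not_less[symmetric])
        qed
        have "prob {w\<in>space M. norm (simple_integral W (n j) (q j) (g j) t w - I w) > \<epsilon>} \<le> prob (?D \<union> ?E2 k)"
        proof (rule finite_measure_mono)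
          show "?D \<union> ?E2 k \<in> events" using E2m Sm[OF st[of k]] Sm[OF stg[of j]] by measurable
          show "{w\<in>space M. norm (simple_integral W (n j) (q j) (g j) t w - I w) > \<epsilon>} \<subseteq> ?D \<union> ?E2 k"
          proof (rule subsetI, rule ccontr)
            fix w assume a: "w \<in> {w\<in>space M. norm (simple_integral W (n j) (q j) (g j) t w - I w) > \<epsilon>}" "w \<notin> ?D \<union> ?E2 k"
            let ?x = "simple_integral W (n j) (q j) (g j) t w" and ?y = "simple_integral W (N k) (\<tau> k) (h k) t w"
            have "norm (?x - I w) \<le> norm (?y - ?x) + norm (?y - I w)"
              using norm_triangle_ineq4[of "?y - I w" "?y - ?x"] by simp
            then show False using a by auto
          qed
        qed
        also have "\<dots> \<le> prob ?D + prob (?E2 k)"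
          using E2m Sm[OF st[of k]] Sm[OF stg[of j]] by (intro measure_Un_le) measurable
        also have "prob ?D \<le> \<kappa>/5 + prob ?V"
          using simple_integral_compare[OF st[of k] stg[of j] t, of "\<epsilon>/2" \<eta>] \<epsilon> \<eta> by simp
        also have "prob ?V \<le> prob (?E1 k \<union> ?E3 j)"
          by (rule finite_measure_mono[OF V]) (use E1m E3m in auto)
        also have "\<dots> \<le> prob (?E1 k) + prob (?E3 j)"
          by (rule measure_Un_le) (use E1m E3m in auto)
        finally have "prob {w\<in>space M. norm (simple_integral W (n j) (q j) (g j) t w - I w) > \<epsilon>} < \<kappa>"
          using k j0[OF \<open>j \<ge> j0\<close>] 1 by linarith
        then show "norm (prob {w\<in>space M. norm (simple_integral W (n j) (q j) (g j) t w - I w) > \<epsilon>} - 0) < \<kappa>" by simp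
      qed
    qed
  qed
qed

end


section \<open>Riemann sums along a solution\<close>

lemma riemann_sum_bound:
  fixes f :: "real \<Rightarrow> 'a::euclidean_space"
  assumes f: "continuous_on {a..c} f" and h: "h \<ge> 0" and e: "e \<ge> 0"
    and osc: "\<And>u v. u \<in> {a..c} \<Longrightarrow> v \<in> {a..c} \<Longrightarrow> \<bar>u - v\<bar> \<le> h \<Longrightarrow> norm (f u - f v) \<le> e"
    and k: "a + real k * h \<le> c"
  shows "norm (integral {a..a + real k * h} f - (\<Sum>i<k. h *\<^sub>R f (a + real i * h))) \<le> real k * h * e"
  using k
proof (induction k)
  case (Suc k)
  let ?u = "a + real k * h" and ?v = "a + real (Suc k) * h"
  have uv: "a \<le> ?u" "?u \<le> ?v" "?v \<le> c" "?v = ?u + h" using Suc.prems h by (auto simp: algebra_simps)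
  have int: "f integrable_on {a..?v}"
    by (rule integrable_continuous_real) (rule continuous_on_subset[OF f], use uv in auto)
  have int2: "f integrable_on {?u..?v}"
    by (rule integrable_continuous_real) (rule continuous_on_subset[OF f], use uv in auto)
  have 1: "integral {a..?v} f = integral {a..?u} f + integral {?u..?v} f"
    using Henstock_Kurzweil_Integration.integral_combine[OF uv(1,2) int] by simp
  have "integral {?u..?v} (\<lambda>x. f x - f ?u) = integral {?u..?v} f - integral {?u..?v} (\<lambda>x. f ?u)"
    by (rule Henstock_Kurzweil_Integration.integral_diff) (use int2 in auto)
  also have "integral {?u..?v} (\<lambda>x. f ?u) = h *\<^sub>R f ?u"
    using uv h by (simp add: content_real)
  finally have 2: "integral {?u..?v} f - h *\<^sub>R f ?u = integral {?u..?v} (\<lambda>x. f x - f ?u)" by simp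
  have "norm (integral (cbox ?u ?v) (\<lambda>x. f x - f ?u)) \<le> e * measure lborel (cbox ?u ?v)"
  proof (rule integrable_bound[OF e])
    show "(\<lambda>x. f x - f ?u) integrable_on cbox ?u ?v" using int2 by (auto intro!: integrable_diff)
    show "norm (f x - f ?u) \<le> e" if "x \<in> cbox ?u ?v" for x
    proof -
      have "?u \<le> x" "x \<le> ?v" using that by auto
      with uv h have "a \<le> x" "x \<le> c" "\<bar>x - ?u\<bar> \<le> h" "a \<le> ?u" "?u \<le> c" by linarith+
      then show ?thesis by (intro osc) (simp_all only: atLeastAtMost_iff)
    qed
  qed
  then have 3: "norm (integral {?u..?v} f - h *\<^sub>R f ?u) \<le> e * h"
    unfolding 2 using uv h by (simp add: content_real)
  have "norm (integral {a..?v} f - (\<Sum>i<Suc k. h *\<^sub>R f (a + real i * h))) \<le>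
     norm (integral {a..?u} f - (\<Sum>i<k. h *\<^sub>R f (a + real i * h))) + norm (integral {?u..?v} f - h *\<^sub>R f ?u)"
    unfolding 1 by (rule order_trans[OF _ norm_triangle_ineq]) (simp add: algebra_simps)
  also have "\<dots> \<le> real k * h * e + e * h" using Suc uv 3 by (intro add_mono) auto
  finally show ?case by (simp add: algebra_simps)
qed simp

lemma riemann_sum_tendsto:
  fixes f :: "real \<Rightarrow> 'a::euclidean_space"
  assumes f: "continuous_on {a..c} f" and ac: "a \<le> c"
  shows "(\<lambda>N. \<Sum>i<Suc N. ((c - a) / real (Suc N)) *\<^sub>R f (a + real i * ((c - a) / real (Suc N)))) \<longlonglongrightarrow> integral {a..c} f"
proof (rule LIMSEQ_I)
  fix r :: real assume r: "r > 0"
  define K where "K = c - a + 1"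
  have K: "K > 0" "c - a \<le> K" using ac by (auto simp: K_def)
  define e where "e = r / (2 * K)"
  have e: "e > 0" "e * (c - a) < r"
  proof -
    show e: "e > 0" using r K by (simp add: e_def)
    have "e * (c - a) \<le> e * K" using K e by (intro mult_left_mono) auto
    also have "\<dots> = r / 2" using K by (simp add: e_def)
    also have "\<dots> < r" using r by simp
    finally show "e * (c - a) < r" .
  qed
  have "uniformly_continuous_on {a..c} f" by (rule compact_uniformly_continuous[OF f]) simp
  then obtain d where d: "d > 0" "\<And>u v. u \<in> {a..c} \<Longrightarrow> v \<in> {a..c} \<Longrightarrow> dist v u < d \<Longrightarrow> dist (f v) (f u) < e"
    using e unfolding uniformly_continuous_on_def by metis
  obtain N0 where N0: "(c - a) / d < real N0" using reals_Archimedean2 by blast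
  show "\<exists>no. \<forall>N\<ge>no. norm ((\<Sum>i<Suc N. ((c - a) / real (Suc N)) *\<^sub>R f (a + real i * ((c - a) / real (Suc N)))) - integral {a..c} f) < r"
  proof (intro exI[of _ N0] allI impI)
    fix N assume N: "N0 \<le> N"
    let ?h = "(c - a) / real (Suc N)"
    have "(c - a) / d < real (Suc N)" using N0 N by linarith
    then have h: "?h < d" using d(1) by (simp add: field_simps)
    have Nh: "a + real (Suc N) * ?h = c" by simp
    have "norm (integral {a..a + real (Suc N) * ?h} f - (\<Sum>i<Suc N. ?h *\<^sub>R f (a + real i * ?h))) \<le> real (Suc N) * ?h * e"
    proof (rule riemann_sum_bound[OF f])
      fix u v assume "u \<in> {a..c}" "v \<in> {a..c}" "\<bar>u - v\<bar> \<le> ?h"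
      then show "norm (f u - f v) \<le> e" using d(2)[of v u] h by (auto simp: dist_norm)
    qed (use ac e Nh in \<open>auto simp del: of_nat_Suc\<close>)
    also have "\<dots> < r" using e(2) by (simp add: mult.commute del: of_nat_Suc)
    finally show "norm ((\<Sum>i<Suc N. ?h *\<^sub>R f (a + real i * ?h)) - integral {a..c} f) < r"
      unfolding Nh by (simp add: norm_minus_commute del: of_nat_Suc sum.lessThan_Suc)
  qed
qed

text \<open>The sum of the first \<open>k\<close> Euler increments on the grid with step
  \<open>h\<close>, but with coefficients taken along the exact path \<open>Y\<close> instead of the
  scheme.\<close>

definition riemann_sum ::
  "(real^'d \<Rightarrow> real^'d) \<Rightarrow> (real^'d \<Rightarrow> real^'n^'d) \<Rightarrow> (real \<Rightarrow> 'w \<Rightarrow> real^'n) \<Rightarrow> (real \<Rightarrow> 'w \<Rightarrow> real^'d) \<Rightarrow>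
    real \<Rightarrow> real \<Rightarrow> nat \<Rightarrow> 'w \<Rightarrow> real^'d" where
  "riemann_sum b \<sigma> W Y s h k w = (\<Sum>i<k. h *\<^sub>R b (Y (s + real i * h) w) +
     \<sigma> (Y (s + real i * h) w) *v (W (s + real (Suc i) * h) w - W (s + real i * h) w))"

text \<open>The equation enters from here on only through \<open>riemann\<close>: increments of
  \<open>Y\<close> are limits in probability of Riemann sums on uniform grids, from any initial
  time.\<close>

locale sde_process = driven M F W
  for M :: "'w measure" and F and W :: "real \<Rightarrow> 'w \<Rightarrow> real^'n" +
  fixes b :: "real^'d \<Rightarrow> real^'d" and \<sigma> :: "real^'d \<Rightarrow> real^'n^'d" and Y :: "real \<Rightarrow> 'w \<Rightarrow> real^'d"
  assumes b_cont: "continuous_on UNIV b" and \<sigma>_cont: "continuous_on UNIV \<sigma>"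
    and Y_adapted: "\<And>t. 0 \<le> t \<Longrightarrow> Y t \<in> borel_measurable (F t)"
    and Y_cont: "\<And>w. w \<in> space M \<Longrightarrow> continuous_on {0..} (\<lambda>t. Y t w)"
    and riemann: "\<And>s t. 0 \<le> s \<Longrightarrow> s < t \<Longrightarrow>
      tends0 (\<lambda>N w. norm (riemann_sum b \<sigma> W Y s ((t - s) / real (Suc N)) (Suc N) w - (Y t w - Y s w)))"

lemma sde_solution_driven:
  assumes "sde_solution b \<sigma> y M F W Y"
  shows "driven M F W"
proof -
  have "filtered_prob_space M F" "brownian_motion M F W" using assms by (auto simp: sde_solution_def)
  then show ?thesis
    unfolding driven_def driven_axioms_def filtered_prob_space_def brownian_motion_def adapted_def filtration_def
    by auto
qed

text \<open>The equation speaks of integrals from time \<open>0\<close>. For \<open>s > 0\<close>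
  the sums over the interval from \<open>s\<close> to \<open>t\<close> are obtained as the
  difference of sums over two intervals starting at \<open>0\<close>, along partitions that agree up
  to \<open>s\<close>.\<close>

lemma sde_solution_sde_process:
  fixes b :: "real^'d \<Rightarrow> real^'d" and \<sigma> :: "real^'d \<Rightarrow> real^'n^'d"
  assumes sol: "sde_solution b \<sigma> y M F W Y"
    and b: "continuous_on UNIV b" and \<sigma>: "continuous_on UNIV \<sigma>"
  shows "sde_process M F W b \<sigma> Y"
proof -
  interpret driven M F W by (rule sde_solution_driven[OF sol])
  have Ya: "Y t \<in> borel_measurable (F t)" if "0 \<le> t" for t
    using sol that by (auto simp: sde_solution_def adapted_def)
  have Yc: "continuous_on {0..} (\<lambda>t. Y t w)" if "w \<in> space M" for w
    using sol that by (auto simp: sde_solution_def continuous_paths_def)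
  have YM: "Y t \<in> borel_measurable M" if "0 \<le> t" for t using Ya[OF that] measurable_F_M by blast
  have bm: "b \<in> borel_measurable borel" and \<sigma>m: "\<sigma> \<in> borel_measurable borel"
    using b \<sigma> by (auto intro: borel_measurable_continuous_onI)
  have \<sigma>Y: "(\<lambda>w. \<sigma> (Y t w)) \<in> borel_measurable (F t)" if "0 \<le> t" for t
    by (rule measurable_compose[OF Ya[OF that] \<sigma>m])
  have \<sigma>Yc: "continuous_on {0..} (\<lambda>t. \<sigma> (Y t w))" and bYc: "continuous_on {0..} (\<lambda>t. b (Y t w))" if "w \<in> space M" for w
    by (rule continuous_on_compose2[OF \<sigma> Yc[OF that]], simp, rule continuous_on_compose2[OF b Yc[OF that]], simp)
  have rmeas: "riemann_sum b \<sigma> W Y s h k \<in> borel_measurable M" if "0 \<le> s" "0 \<le> h" for s h k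
    unfolding riemann_sum_def[abs_def]
    using that YM W_measurable bm \<sigma>m
    by (intro borel_measurable_sum borel_measurable_add borel_measurable_scaleR borel_measurable_const
       borel_measurable_matrix_vector_mult borel_measurable_diff measurable_compose[OF _ bm] measurable_compose[OF _ \<sigma>m]) auto
  have main: "tends0 (\<lambda>N w. norm (riemann_sum b \<sigma> W Y s ((t - s) / real (Suc N)) (Suc N) w - (Y t w - Y s w)))"
    if st: "0 \<le> s" "s < t" for s t
  proof -
    have t: "0 < t" using st by simp
    define h where "h N = (t - s) / real (Suc N)" for N
    have h: "h N > 0" for N using st by (simp add: h_def)
    have hN: "s + real (Suc N) * h N = t" for N by (simp add: h_def)
    obtain J where J: "J \<in> borel_measurable M"
      and JY: "AE w in M. Y t w - Y s w = integral {s..t} (\<lambda>u. b (Y u w)) + J w"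
      and Jlim: "tends0 (\<lambda>N w. norm ((\<Sum>i<Suc N. \<sigma> (Y (s + real i * h N) w) *v (W (s + real (Suc i) * h N) w - W (s + real i * h N) w)) - J w))"
    proof -
      obtain I where I: "has_ito_integral M F W (\<lambda>s w. \<sigma> (Y s w)) t I"
        and YI: "AE w in M. Y t w = y + (LBINT s:{0..t}. b (Y s w)) + I w"
        using sol t unfolding sde_solution_def by (meson less_imp_le)
      have I_m: "I \<in> borel_measurable M" using I by (simp add: has_ito_integral_def)
      have lb: "(LBINT s:{0..u}. b (Y s w)) = integral {0..u} (\<lambda>r. b (Y r w))" if "w \<in> space M" for u w
        by (rule set_borel_integral_eq_integral(2)) (intro borel_integrable_atLeastAtMost' continuous_on_subset[OF bYc[OF that]], auto)
      show ?thesis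
      proof (cases "s = 0")
        case True
        have q: "partition_upto t (Suc N) (\<lambda>i. real i * h N)" for N
          using h[of N] hN[of N] True by (auto simp: partition_upto_def)
        have mesh: "\<forall>\<^sub>F N in sequentially. \<forall>i<Suc N. real (Suc i) * h N - real i * h N < e" if "e > 0" for e
        proof -
          obtain N0 where N0: "(t - s) / e < real N0" using reals_Archimedean2 by blast
          show ?thesis
          proof (rule eventually_sequentiallyI[of N0])
            fix N assume "N0 \<le> N"
            then have "(t - s) / e < real (Suc N)" using N0 by linarith
            then have "h N < e" using that by (simp add: h_def field_simps)
            then show "\<forall>i<Suc N. real (Suc i) * h N - real i * h N < e" by (simp add: algebra_simps)
          qed
        qed
        have Y0: "AE w in M. Y 0 w = y" using sol by (simp add: sde_solution_def)
        show ?thesis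
        proof (rule that[OF I_m])
          show "AE w in M. Y t w - Y s w = integral {s..t} (\<lambda>u. b (Y u w)) + I w"
            using YI Y0 AE_space
            by eventually_elim (simp add: True lb)
          show "tends0 (\<lambda>N w. norm ((\<Sum>i<Suc N. \<sigma> (Y (s + real i * h N) w) *v (W (s + real (Suc i) * h N) w - W (s + real i * h N) w)) - I w))"
            using ito_riemann[OF I t \<sigma>Y \<sigma>Yc q mesh] by (simp add: True)
        qed
      next
        case False
        then have s: "0 < s" using st by simp
        obtain I' where I': "has_ito_integral M F W (\<lambda>s w. \<sigma> (Y s w)) s I'"
          and YI': "AE w in M. Y s w = y + (LBINT u:{0..s}. b (Y u w)) + I' w"
          using sol s unfolding sde_solution_def by (meson less_imp_le)
        have I'_m: "I' \<in> borel_measurable M" using I' by (simp add: has_ito_integral_def)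
        define g where "g N = s / real (Suc N)" for N
        have g: "g N > 0" for N using s by (simp add: g_def)
        have gN: "real (Suc N) * g N = s" for N by (simp add: g_def)
        \<comment> \<open>Two uniform grids with different steps, glued at \<open>s\<close>. At the
          index \<open>Suc N\<close> both branches give \<open>s\<close>, so the steps after it have
          length \<open>h N\<close>.\<close>
        define q where "q N i = (if i \<le> Suc N then real i * g N else s + real (i - Suc N) * h N)" for N i
        have q1: "partition_upto s (Suc N) (\<lambda>i. real i * g N)" for N
          using g[of N] gN[of N] by (auto simp: partition_upto_def)
        have q_step: "q N (Suc i) - q N i = (if i < Suc N then g N else h N)" for N i
        proof (cases "i < Suc N")
          case True then show ?thesis by (simp add: q_def algebra_simps)
        next
          case False
          then have eq: "real (Suc i - Suc N) = real (i - Suc N) + 1" by (simp add: of_nat_diff)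
          have "q N i = s + real (i - Suc N) * h N" using False gN[of N] by (auto simp: q_def not_less le_Suc_eq dest!: le_antisym)
          then show ?thesis using False eq by (simp add: q_def algebra_simps)
        qed
        have q2: "partition_upto t (Suc N + Suc N) (q N)" for N
          unfolding partition_upto_def
        proof (intro conjI allI impI)
          show "q N (Suc N + Suc N) = t" using hN[of N] by (simp add: q_def)
          show "q N i < q N (Suc i)" for i using q_step[of N i] g[of N] h[of N] by (auto split: if_splits)
        qed (simp add: q_def)
        have small: "\<forall>\<^sub>F N in sequentially. g N < e \<and> h N < e" if "e > 0" for e
        proof -
          obtain N0 where N0: "t / e < real N0" using reals_Archimedean2 by blast
          show ?thesis
          proof (rule eventually_sequentiallyI[of N0])
            fix N assume "N0 \<le> N"
            then have "t / e < real (Suc N)" using N0 by linarith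
            then have "t / real (Suc N) < e" using that by (simp add: field_simps)
            moreover have "g N \<le> t / real (Suc N)" "h N \<le> t / real (Suc N)"
              using st by (auto simp: g_def h_def intro!: divide_right_mono)
            ultimately show "g N < e \<and> h N < e" by linarith
          qed
        qed
        have mesh1: "\<forall>\<^sub>F N in sequentially. \<forall>i<Suc N. real (Suc i) * g N - real i * g N < e" if "e > 0" for e
          using small[OF that] by eventually_elim (simp add: algebra_simps)
        have mesh2: "\<forall>\<^sub>F N in sequentially. \<forall>i<Suc N + Suc N. q N (Suc i) - q N i < e" if "e > 0" for e
          using small[OF that] by eventually_elim (simp add: q_step)
        note L1 = ito_riemann[OF I' s \<sigma>Y \<sigma>Yc q1 mesh1]
        note L2 = ito_riemann[OF I t \<sigma>Y \<sigma>Yc q2 mesh2]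
        let ?S1 = "\<lambda>N w. \<Sum>i<Suc N. \<sigma> (Y (real i * g N) w) *v (W (real (Suc i) * g N) w - W (real i * g N) w)"
        let ?S2 = "\<lambda>N w. \<Sum>i<Suc N + Suc N. \<sigma> (Y (q N i) w) *v (W (q N (Suc i)) w - W (q N i) w)"
        let ?S = "\<lambda>N w. \<Sum>i<Suc N. \<sigma> (Y (s + real i * h N) w) *v (W (s + real (Suc i) * h N) w - W (s + real i * h N) w)"
        have split: "?S2 N w = ?S1 N w + ?S N w" for N w
        proof -
          let ?f = "\<lambda>i. \<sigma> (Y (q N i) w) *v (W (q N (Suc i)) w - W (q N i) w)"
          have "?S2 N w = (\<Sum>i<Suc N. ?f i) + (\<Sum>i<Suc N. ?f (i + Suc N))"
            by (simp only: lessThan_atLeast0 sum.atLeastLessThan_concat[symmetric, of 0 "Suc N" "Suc N + Suc N"] zero_le le_add1 sum.shift_bounds_nat_ivl[of ?f 0 "Suc N" "Suc N", simplified add_0])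
          also have "(\<Sum>i<Suc N. ?f i) = ?S1 N w"
            by (rule sum.cong) (auto simp: q_def)
          also have "(\<Sum>i<Suc N. ?f (i + Suc N)) = ?S N w"
          proof (rule sum.cong[OF refl])
            fix i
            have "q N (i + Suc N) = s + real i * h N" using gN[of N] by (cases "i = 0") (auto simp: q_def)
            moreover have "q N (Suc (i + Suc N)) = s + real (Suc i) * h N" by (simp add: q_def)
            ultimately show "?f (i + Suc N) = \<sigma> (Y (s + real i * h N) w) *v (W (s + real (Suc i) * h N) w - W (s + real i * h N) w)"
              by simp
          qed
          finally show ?thesis .
        qed
        have Sm: "?S N \<in> borel_measurable M" for N
          using st h[of N] YM W_measurable \<sigma>m
          by (intro borel_measurable_sum borel_measurable_matrix_vector_mult borel_measurable_diff measurable_compose[OF _ \<sigma>m])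
            (auto simp: less_imp_le)
        show ?thesis
        proof (rule that[of "\<lambda>w. I w - I' w"])
          show "(\<lambda>w. I w - I' w) \<in> borel_measurable M" using I_m I'_m by simp
          show "AE w in M. Y t w - Y s w = integral {s..t} (\<lambda>u. b (Y u w)) + (I w - I' w)"
            using YI YI' AE_space
          proof eventually_elim
            case (elim w)
            have "integral {0..s} (\<lambda>u. b (Y u w)) + integral {s..t} (\<lambda>u. b (Y u w)) = integral {0..t} (\<lambda>u. b (Y u w))"
              using st by (intro Henstock_Kurzweil_Integration.integral_combine integrable_continuous_real continuous_on_subset[OF bYc[OF elim(3)]]) auto
            then show ?case using elim by (simp add: lb algebra_simps)
          qed
          show "tends0 (\<lambda>N w. norm (?S N w - (I w - I' w)))"
          proof (rule tends0_mono[OF tends0_add[OF L2 L1]])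
            show "AE w in M. norm (?S N w - (I w - I' w)) \<le> norm (?S2 N w - I w) + norm (?S1 N w - I' w)" for N
            proof (rule AE_I2)
              fix w
              have eq: "?S N w - (I w - I' w) = (?S2 N w - I w) - (?S1 N w - I' w)" unfolding split by simp
              show "norm (?S N w - (I w - I' w)) \<le> norm (?S2 N w - I w) + norm (?S1 N w - I' w)"
                unfolding eq by (rule norm_triangle_ineq4)
            qed
            show "(\<lambda>w. norm (?S N w - (I w - I' w))) \<in> borel_measurable M" for N
              using Sm[of N] I_m I'_m by measurable
          qed
        qed
      qed
    qed
    have bm': "(\<lambda>w. \<Sum>i<Suc N. h N *\<^sub>R b (Y (s + real i * h N) w)) \<in> borel_measurable M" for N
      using st h[of N] YM
      by (intro borel_measurable_sum borel_measurable_scaleR measurable_compose[OF _ bm]) (auto simp: less_imp_le)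
    have lim: "(\<lambda>N. \<Sum>i<Suc N. h N *\<^sub>R b (Y (s + real i * h N) w)) \<longlonglongrightarrow> integral {s..t} (\<lambda>u. b (Y u w))" if "w \<in> space M" for w
      unfolding h_def using st by (intro riemann_sum_tendsto continuous_on_subset[OF bYc[OF that]]) auto
    have Bm: "(\<lambda>w. integral {s..t} (\<lambda>u. b (Y u w))) \<in> borel_measurable M"
      by (rule borel_measurable_LIMSEQ_metric[OF bm' lim])
    have Blim: "tends0 (\<lambda>N w. norm ((\<Sum>i<Suc N. h N *\<^sub>R b (Y (s + real i * h N) w)) - integral {s..t} (\<lambda>u. b (Y u w))))"
    proof (rule tends0I_AE)
      show "AE w in M. (\<lambda>N. norm ((\<Sum>i<Suc N. h N *\<^sub>R b (Y (s + real i * h N) w)) - integral {s..t} (\<lambda>u. b (Y u w)))) \<longlonglongrightarrow> 0"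
        by (intro AE_I2 tendsto_norm_zero LIM_zero lim)
    qed (use bm' Bm in measurable)
    show ?thesis
      unfolding h_def[symmetric]
    proof (rule tends0_mono[OF tends0_add[OF Blim Jlim]])
      show "(\<lambda>w. norm (riemann_sum b \<sigma> W Y s (h N) (Suc N) w - (Y t w - Y s w))) \<in> borel_measurable M" for N
        using rmeas[OF st(1) less_imp_le[OF h[of N]], of "Suc N"] YM[OF st(1)] YM[OF less_imp_le[OF t]] by measurable
      show "AE w in M. norm (riemann_sum b \<sigma> W Y s (h N) (Suc N) w - (Y t w - Y s w)) \<le>
        norm ((\<Sum>i<Suc N. h N *\<^sub>R b (Y (s + real i * h N) w)) - integral {s..t} (\<lambda>u. b (Y u w))) +
        norm ((\<Sum>i<Suc N. \<sigma> (Y (s + real i * h N) w) *v (W (s + real (Suc i) * h N) w - W (s + real i * h N) w)) - J w)" for N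
        using JY
      proof eventually_elim
        case (elim w)
        have eq: "riemann_sum b \<sigma> W Y s (h N) (Suc N) w - (Y t w - Y s w) =
          ((\<Sum>i<Suc N. h N *\<^sub>R b (Y (s + real i * h N) w)) - integral {s..t} (\<lambda>u. b (Y u w))) +
          ((\<Sum>i<Suc N. \<sigma> (Y (s + real i * h N) w) *v (W (s + real (Suc i) * h N) w - W (s + real i * h N) w)) - J w)"
          unfolding elim riemann_sum_def sum.distrib by simp
        show ?case unfolding eq by (rule norm_triangle_ineq)
      qed
    qed
  qed
  show ?thesis
    by unfold_locales (use b \<sigma> Ya Yc main in auto)
qed


section \<open>Modulus of continuity and uniform convergence of the Riemann sums\<close>

lemma Rats_dense_in_Icc:
  fixes a c u d :: real
  assumes "a < c" "u \<in> {a..c}" "d > 0"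
  obtains r where "r \<in> \<rat>" "r \<in> {a..c}" "\<bar>r - u\<bar> < d"
proof -
  have "max a (u - d) < min c (u + d)" using assms by auto
  then obtain r where "r \<in> \<rat>" "max a (u - d) < r" "r < min c (u + d)"
    using Rats_dense_in_real by blast
  then show ?thesis using that[of r] by auto
qed

context prob_space
begin

text \<open>The modulus of continuity exceeds \<open>\<eta>\<close>, tested at rational times so
  that this is an event. For continuous paths outside it the bound extends to all times.\<close>

definition osc_event :: "(real \<Rightarrow> 'a \<Rightarrow> 'e::metric_space) \<Rightarrow> real \<Rightarrow> real \<Rightarrow> real \<Rightarrow> real \<Rightarrow> 'a set" where
  "osc_event X a c \<delta> \<eta> = {w\<in>space M. \<exists>u\<in>\<rat> \<inter> {a..c}. \<exists>v\<in>\<rat> \<inter> {a..c}. \<bar>u - v\<bar> < \<delta> \<and> dist (X u w) (X v w) > \<eta>}"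

lemma osc_event_measurable:
  fixes X :: "real \<Rightarrow> 'a \<Rightarrow> 'e::euclidean_space"
  assumes X: "\<And>u. u \<in> {a..c} \<Longrightarrow> X u \<in> borel_measurable M"
  shows "osc_event X a c \<delta> \<eta> \<in> events"
proof -
  have *: "countable (\<rat> \<inter> {a..c})" using countable_rat by blast
  have "osc_event X a c \<delta> \<eta> = (\<Union>u\<in>\<rat> \<inter> {a..c}. \<Union>v\<in>\<rat> \<inter> {a..c}. {w\<in>space M. \<bar>u - v\<bar> < \<delta> \<and> dist (X u w) (X v w) > \<eta>})"
    by (auto simp: osc_event_def)
  also have "\<dots> \<in> events"
  proof (intro sets.countable_UN'' * )
    fix u v assume "u \<in> \<rat> \<inter> {a..c}" "v \<in> \<rat> \<inter> {a..c}"
    then have [measurable]: "X u \<in> borel_measurable M" "X v \<in> borel_measurable M" using X by auto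
    show "{w\<in>space M. \<bar>u - v\<bar> < \<delta> \<and> dist (X u w) (X v w) > \<eta>} \<in> events" by measurable
  qed
  finally show ?thesis .
qed

lemma osc_eventD:
  fixes X :: "real \<Rightarrow> 'a \<Rightarrow> 'e::euclidean_space"
  assumes ac: "a < c" and cont: "continuous_on {a..c} (\<lambda>u. X u w)" and w: "w \<in> space M" "w \<notin> osc_event X a c \<delta> \<eta>"
    and uv: "u \<in> {a..c}" "v \<in> {a..c}" "\<bar>u - v\<bar> < \<delta>"
  shows "dist (X u w) (X v w) \<le> \<eta>"
proof (rule field_le_epsilon)
  fix e :: real assume e: "e > 0"
  have "\<exists>r\<in>\<rat> \<inter> {a..c}. \<bar>r - z\<bar> < (\<delta> - \<bar>u - v\<bar>) / 2 \<and> dist (X r w) (X z w) < e / 2" if z: "z \<in> {a..c}" for z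
  proof -
    have "\<exists>d>0. \<forall>x\<in>{a..c}. dist x z < d \<longrightarrow> dist (X x w) (X z w) < e / 2"
      using cont z e unfolding continuous_on_iff by (meson half_gt_zero)
    then obtain d where d: "d > 0" "\<And>x. x \<in> {a..c} \<Longrightarrow> dist x z < d \<Longrightarrow> dist (X x w) (X z w) < e / 2"
      by blast
    from Rats_dense_in_Icc[OF ac z, of "min d ((\<delta> - \<bar>u - v\<bar>) / 2)"] d(1) uv(3)
    obtain r where "r \<in> \<rat>" "r \<in> {a..c}" "\<bar>r - z\<bar> < min d ((\<delta> - \<bar>u - v\<bar>) / 2)" by auto
    then show ?thesis using d(2)[of r] by (auto simp: dist_real_def)
  qed
  from this[OF uv(1)] this[OF uv(2)]
  obtain r q where rq: "r \<in> \<rat> \<inter> {a..c}" "\<bar>r - u\<bar> < (\<delta> - \<bar>u - v\<bar>) / 2" "dist (X r w) (X u w) < e / 2"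
    "q \<in> \<rat> \<inter> {a..c}" "\<bar>q - v\<bar> < (\<delta> - \<bar>u - v\<bar>) / 2" "dist (X q w) (X v w) < e / 2" by blast
  have "\<bar>r - q\<bar> \<le> \<bar>r - u\<bar> + \<bar>u - v\<bar> + \<bar>q - v\<bar>" by linarith
  also have "\<dots> < (\<delta> - \<bar>u - v\<bar>) / 2 + \<bar>u - v\<bar> + (\<delta> - \<bar>u - v\<bar>) / 2"
    using rq(2,5) by (intro add_strict_mono add_strict_right_mono)
  also have "\<dots> = \<delta>" by (simp add: field_simps)
  finally have "\<bar>r - q\<bar> < \<delta>" .
  then have "dist (X r w) (X q w) \<le> \<eta>"
    using w rq(1,4) unfolding osc_event_def by (metis (mono_tags, lifting) mem_Collect_eq not_less)
  moreover have "dist (X u w) (X v w) \<le> dist (X r w) (X u w) + dist (X r w) (X q w) + dist (X q w) (X v w)"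
    using dist_triangle[of "X u w" "X v w" "X r w"] dist_triangle[of "X r w" "X v w" "X q w"]
    by (simp add: dist_commute)
  ultimately show "dist (X u w) (X v w) \<le> \<eta> + e" using rq by linarith
qed

lemma prob_osc_event_tendsto:
  fixes X :: "real \<Rightarrow> 'a \<Rightarrow> 'e::euclidean_space"
  assumes X: "\<And>u. u \<in> {a..c} \<Longrightarrow> X u \<in> borel_measurable M"
    and cont: "\<And>w. w \<in> space M \<Longrightarrow> continuous_on {a..c} (\<lambda>u. X u w)" and \<eta>: "\<eta> > 0"
    and \<delta>: "\<delta> \<longlonglongrightarrow> 0"
  shows "(\<lambda>n. prob (osc_event X a c (\<delta> n) \<eta>)) \<longlonglongrightarrow> 0"
proof (rule prob_tendsto_0_AE[OF osc_event_measurable[OF X]], assumption, rule AE_I2)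
  fix w assume w: "w \<in> space M"
  have "uniformly_continuous_on {a..c} (\<lambda>u. X u w)"
    by (rule compact_uniformly_continuous[OF cont[OF w]]) simp
  then obtain d where d: "d > 0" "\<And>u v. u \<in> {a..c} \<Longrightarrow> v \<in> {a..c} \<Longrightarrow> dist v u < d \<Longrightarrow> dist (X v w) (X u w) < \<eta>"
    using \<eta> unfolding uniformly_continuous_on_def by metis
  from order_tendstoD(2)[OF \<delta> d(1)]
  show "\<forall>\<^sub>F n in sequentially. w \<notin> osc_event X a c (\<delta> n) \<eta>"
  proof eventually_elim
    case (elim n)
    then show ?case using d(2) unfolding osc_event_def by (force simp: dist_real_def)
  qed
qed

end

text \<open>The coarse sum, written on a grid \<open>m\<close> times finer, uses the coefficients at
  the last coarse grid time, which has index \<open>i div m\<close>. This makes it comparable term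
  by term with the fine sum.\<close>

lemma riemann_sum_refine:
  fixes b :: "real^'d \<Rightarrow> real^'d" and \<sigma> :: "real^'d \<Rightarrow> real^'n^'d"
  assumes m: "m > 0"
  shows "riemann_sum b \<sigma> W Y s h k w = (\<Sum>i<k * m. (h / real m) *\<^sub>R b (Y (s + real (i div m) * h) w) +
     \<sigma> (Y (s + real (i div m) * h) w) *v (W (s + real (Suc i) * (h / real m)) w - W (s + real i * (h / real m)) w))"
proof -
  let ?f = "\<lambda>i. (h / real m) *\<^sub>R b (Y (s + real (i div m) * h) w) +
     \<sigma> (Y (s + real (i div m) * h) w) *v (W (s + real (Suc i) * (h / real m)) w - W (s + real i * (h / real m)) w)"
  have "sum ?f {j * m..<j * m + m} = h *\<^sub>R b (Y (s + real j * h) w) +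
     \<sigma> (Y (s + real j * h) w) *v (W (s + real (Suc j) * h) w - W (s + real j * h) w)" for j
  proof -
    let ?z = "\<lambda>i. W (s + real i * (h / real m)) w"
    have d: "i div m = j" if "i \<in> {j * m..<j * m + m}" for i
      using that m by (intro div_nat_eqI) (auto simp: algebra_simps)
    have "sum ?f {j * m..<j * m + m} = (\<Sum>i\<in>{j * m..<j * m + m}. (h / real m) *\<^sub>R b (Y (s + real j * h) w) +
        \<sigma> (Y (s + real j * h) w) *v (?z (Suc i) - ?z i))"
      by (intro sum.cong refl) (simp only: d)
    also have "\<dots> = (\<Sum>i\<in>{j * m..<j * m + m}. (h / real m) *\<^sub>R b (Y (s + real j * h) w)) +
        \<sigma> (Y (s + real j * h) w) *v (\<Sum>i\<in>{j * m..<j * m + m}. ?z (Suc i) - ?z i)"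
      by (simp only: sum.distrib linear_sum[OF matrix_vector_mul_linear])
    also have "(\<Sum>i\<in>{j * m..<j * m + m}. (h / real m) *\<^sub>R b (Y (s + real j * h) w)) = h *\<^sub>R b (Y (s + real j * h) w)"
      using m by (simp add: sum_constant_scaleR del: sum_constant)
    also have "(\<Sum>i\<in>{j * m..<j * m + m}. ?z (Suc i) - ?z i) = ?z (j * m + m) - ?z (j * m)"
      by (rule sum_Suc_diff') simp
    also have "?z (j * m + m) = W (s + real (Suc j) * h) w"
      using m by (intro arg_cong[where f="\<lambda>x. W x w"]) (simp add: field_simps)
    also have "?z (j * m) = W (s + real j * h) w"
      using m by (intro arg_cong[where f="\<lambda>x. W x w"]) simp
    finally show ?thesis .
  qed
  then have "riemann_sum b \<sigma> W Y s h k w = (\<Sum>j<k. sum ?f {j * m..<j * m + m})"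
    by (simp only: riemann_sum_def)
  also have "\<dots> = sum ?f {..<k * m}" by (rule sum.nat_group)
  finally show ?thesis .
qed

context sde_process
begin

lemma b_measurable[measurable]: "b \<in> borel_measurable borel"
  by (rule borel_measurable_continuous_onI[OF b_cont])

lemma \<sigma>_measurable[measurable]: "\<sigma> \<in> borel_measurable borel"
  by (rule borel_measurable_continuous_onI[OF \<sigma>_cont])

lemma Y_measurable[measurable]: "0 \<le> t \<Longrightarrow> Y t \<in> borel_measurable M"
  using Y_adapted measurable_F_M by blast

lemma Y_measurable_F: "0 \<le> s \<Longrightarrow> s \<le> t \<Longrightarrow> Y s \<in> borel_measurable (F t)"
  using Y_adapted measurable_F_mono by blast

lemma W_measurable_F: "0 \<le> s \<Longrightarrow> s \<le> t \<Longrightarrow> W s \<in> borel_measurable (F t)"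
  using W_adapted measurable_F_mono by blast

lemma bY_cont: "w \<in> space M \<Longrightarrow> continuous_on {0..} (\<lambda>t. b (Y t w))"
  and \<sigma>Y_cont: "w \<in> space M \<Longrightarrow> continuous_on {0..} (\<lambda>t. \<sigma> (Y t w))"
  by (rule continuous_on_compose2[OF b_cont Y_cont], assumption, simp,
      rule continuous_on_compose2[OF \<sigma>_cont Y_cont], assumption, simp)

abbreviation "rsum \<equiv> riemann_sum b \<sigma> W Y"

lemma rsum_Suc: "rsum s h (Suc k) w = rsum s h k w + (h *\<^sub>R b (Y (s + real k * h) w) +
     \<sigma> (Y (s + real k * h) w) *v (W (s + real (Suc k) * h) w - W (s + real k * h) w))"
  by (simp add: riemann_sum_def)

lemma rsum_0[simp]: "rsum s h 0 w = 0"
  by (simp add: riemann_sum_def)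

lemma rsum_measurable_F:
  assumes "0 \<le> s" "0 \<le> h" shows "rsum s h k \<in> borel_measurable (F (s + real k * h))"
  unfolding riemann_sum_def[abs_def]
proof (intro borel_measurable_sum borel_measurable_add borel_measurable_scaleR borel_measurable_const
       borel_measurable_matrix_vector_mult borel_measurable_diff)
  fix i assume "i \<in> {..<k}"
  then have le: "real i * h \<le> real k * h" "real (Suc i) * h \<le> real k * h"
    using assms by (auto intro!: mult_right_mono)
  show "(\<lambda>x. b (Y (s + real i * h) x)) \<in> borel_measurable (F (s + real k * h))"
    "(\<lambda>x. \<sigma> (Y (s + real i * h) x)) \<in> borel_measurable (F (s + real k * h))"
    by (rule measurable_compose[OF Y_measurable_F b_measurable] measurable_compose[OF Y_measurable_F \<sigma>_measurable];
        use assms le in simp)+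
  show "W (s + real (Suc i) * h) \<in> borel_measurable (F (s + real k * h))"
    "W (s + real i * h) \<in> borel_measurable (F (s + real k * h))"
    by (rule W_measurable_F; use assms le in simp)+
qed

lemma rsum_measurable: "0 \<le> s \<Longrightarrow> 0 \<le> h \<Longrightarrow> rsum s h k \<in> borel_measurable M"
  using rsum_measurable_F measurable_F_M by blast

text \<open>The error over all grid times at once; the single-time statement \<open>riemann\<close>
  controls only the last one.\<close>

definition rerr :: "real \<Rightarrow> real \<Rightarrow> nat \<Rightarrow> 'w \<Rightarrow> real" where
  "rerr s T N w = Max ((\<lambda>k. norm (rsum s (T / real (Suc N)) k w - (Y (s + real k * (T / real (Suc N))) w - Y s w))) ` {..Suc N})"

lemma rerr_measurable:
  assumes "0 \<le> s" "0 < T" shows "rerr s T N \<in> borel_measurable M"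
  unfolding rerr_def[abs_def]
proof (intro borel_measurable_Max)
  fix k
  have nn: "0 \<le> T / real (Suc N)" "0 \<le> s + real k * (T / real (Suc N))" using assms by auto
  note [measurable] = rsum_measurable[OF assms(1) nn(1), of k] Y_measurable[OF nn(2)] Y_measurable[OF assms(1)]
  show "(\<lambda>w. norm (rsum s (T / real (Suc N)) k w - (Y (s + real k * (T / real (Suc N))) w - Y s w))) \<in> borel_measurable M"
    by measurable
qed simp

lemma rerr_ge: "k \<le> Suc N \<Longrightarrow> norm (rsum s (T / real (Suc N)) k w - (Y (s + real k * (T / real (Suc N))) w - Y s w)) \<le> rerr s T N w"
  unfolding rerr_def by (rule Max_ge) auto

lemma rerr_nonneg: "0 \<le> rerr s T N w"
  using rerr_ge[of 0 N] by simp

lemma rerr_gtE: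
  assumes "rerr s T N w > e"
  obtains k where "k \<le> Suc N" "norm (rsum s (T / real (Suc N)) k w - (Y (s + real k * (T / real (Suc N))) w - Y s w)) > e"
proof -
  have "\<exists>x\<in>(\<lambda>k. norm (rsum s (T / real (Suc N)) k w - (Y (s + real k * (T / real (Suc N))) w - Y s w))) ` {..Suc N}. e < x"
    using assms unfolding rerr_def by (subst (asm) Max_gr_iff) auto
  then show ?thesis using that by auto
qed

lemma refine_tends0:
  assumes s: "0 \<le> s" and h: "0 < h"
  shows "tends0 (\<lambda>m w. norm (rsum s (h / real (Suc m)) (k * Suc m) w - (Y (s + real k * h) w - Y s w)))"
proof (cases "k = 0")
  case True then show ?thesis by (intro tends0I_AE) auto
next
  case False
  \<comment> \<open>The refined sum up to time \<open>k * h\<close> has \<open>k * Suc m\<close>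
    steps, while \<open>riemann\<close> counts \<open>Suc N\<close> of them; hence the shift by one,
    and \<open>k = 0\<close> is set apart.\<close>
  define r where "r m = k * Suc m - 1" for m
  have rm: "Suc (r m) = k * Suc m" for m using False by (simp add: r_def)
  have "strict_mono r"
    unfolding strict_mono_Suc_iff r_def using False by (intro allI diff_less_mono) auto
  from tends0_subseq[OF riemann[of s "s + real k * h"] this]
  have "tends0 (\<lambda>m w. norm (rsum s (real k * h / real (Suc (r m))) (Suc (r m)) w - (Y (s + real k * h) w - Y s w)))"
    using s h False by simp
  moreover have "real k * h / real (Suc (r m)) = h / real (Suc m)" for m
    unfolding rm of_nat_mult using False by (simp del: of_nat_Suc)
  ultimately show ?thesis by (simp only: rm)
qed

text \<open>The coarse minus the fine sum has as coefficients the changes of \<open>b\<close> and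
  \<open>\<sigma>\<close> along the path within one coarse step, which are at most
  \<open>\<eta>\<close> outside \<open>E\<close>. The drift part is bounded directly, the noise part
  by \<open>lenglart\<close>. \<open>E\<close> is counted twice: as an exceptional set and in the
  tail of the bracket.\<close>

lemma riemann_compare:
  fixes N :: nat
  assumes s: "0 \<le> s" and T: "0 < T" and m: "m > 0" and \<epsilon>: "\<epsilon> > 0" and \<eta>: "\<eta> > 0" "T * \<eta> \<le> \<epsilon>"
  defines "h \<equiv> T / real (Suc N)"
  defines "E \<equiv> osc_event (\<lambda>u w. (b (Y u w), \<sigma> (Y u w))) s (s + T) (2 * h) \<eta>"
  shows "\<P>(w in M. \<exists>k\<le>Suc N. norm (rsum s h k w - rsum s (h / real m) (k * m) w) > 2 * \<epsilon>)
    \<le> \<eta>\<^sup>2 * T / \<epsilon>\<^sup>2 + 2 * prob E"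
proof -
  have h: "h > 0" using T by (simp add: h_def)
  define \<delta> where "\<delta> = h / real m"
  have \<delta>: "\<delta> > 0" using h m by (simp add: \<delta>_def)
  define n where "n = Suc N * m"
  have n\<delta>: "real n * \<delta> = T" 
    unfolding n_def \<delta>_def h_def of_nat_mult using m by (simp del: of_nat_Suc)
  define t where "t i = s + real i * \<delta>" for i
  define t' where "t' i = s + real (i div m) * h" for i
  have t'_t: "t' i \<le> t i" "t i - t' i \<le> h" for i
  proof -
    have i: "real i = real (i div m) * real m + real (i mod m)"
      by (metis div_mult_mod_eq of_nat_add of_nat_mult)
    have hm: "real m * \<delta> = h" using m by (simp add: \<delta>_def)
    have d: "t i - t' i = real (i mod m) * \<delta>"
      unfolding t_def t'_def by (subst i) (simp add: hm[symmetric] algebra_simps)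
    show "t' i \<le> t i" using d \<delta> by (smt (verit) mult_nonneg_nonneg of_nat_0_le_iff)
    have "real (i mod m) * \<delta> \<le> real m * \<delta>" using m \<delta> by (intro mult_right_mono) (auto intro: less_imp_le)
    then show "t i - t' i \<le> h" using d hm by simp
  qed
  have t_bd: "t i \<in> {s..s + T}" "t' i \<in> {s..s + T}" if "i \<le> n" for i
  proof -
    have "real i * \<delta> \<le> real n * \<delta>" using that \<delta> by (intro mult_right_mono) auto
    then show 1: "t i \<in> {s..s + T}" using \<delta> n\<delta> by (simp add: t_def)
    have "s \<le> t' i" using h by (simp add: t'_def)
    then show "t' i \<in> {s..s + T}" using 1 t'_t[of i] by auto
  qed
  define c where "c i w = b (Y (t' i) w) - b (Y (t i) w)" for i w
  define H where "H i w = \<sigma> (Y (t' i) w) - \<sigma> (Y (t i) w)" for i w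
  have diff: "rsum s h k w - rsum s (h / real m) (k * m) w =
     (\<Sum>i<k * m. \<delta> *\<^sub>R c i w) + (\<Sum>i<k * m. H i w *v (W (t (Suc i)) w - W (t i) w))" for k w
    unfolding riemann_sum_refine[OF m, of b \<sigma> W Y s h k] unfolding riemann_sum_def c_def H_def t_def t'_def \<delta>_def[symmetric]
    by (simp add: sum_subtractf[symmetric] sum.distrib[symmetric] scaleR_diff_right matrix_vector_mult_diff_rdistrib algebra_simps del: of_nat_Suc)
  have Xm: "(\<lambda>w. (b (Y u w), \<sigma> (Y u w))) \<in> borel_measurable M" if "u \<in> {s..s + T}" for u
    using Y_measurable[of u] that s by (intro borel_measurable_Pair) auto
  have Em: "E \<in> events" unfolding E_def by (rule osc_event_measurable[OF Xm])
  have osc: "norm (c i w) \<le> \<eta> \<and> norm (H i w) \<le> \<eta>" if w: "w \<in> space M" "w \<notin> E" and i: "i \<le> n" for i w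
  proof -
    have "continuous_on {s..s + T} (\<lambda>u. (b (Y u w), \<sigma> (Y u w)))"
      using s by (intro continuous_on_Pair continuous_on_subset[OF bY_cont[OF w(1)]] continuous_on_subset[OF \<sigma>Y_cont[OF w(1)]]) auto
    \<comment> \<open>The two times differ by at most \<open>h\<close>, and \<open>osc_event\<close>
      asks for a strict inequality; hence its parameter \<open>2 * h\<close>.\<close>
    then have "dist (b (Y (t' i) w), \<sigma> (Y (t' i) w)) (b (Y (t i) w), \<sigma> (Y (t i) w)) \<le> \<eta>"
      using T t_bd[OF i] t'_t[of i] h w unfolding E_def by (intro osc_eventD[where \<delta>="2 * h" and a=s and c="s + T"]) auto
    then show ?thesis
      using dist_fst_le[of "(b (Y (t' i) w), \<sigma> (Y (t' i) w))" "(b (Y (t i) w), \<sigma> (Y (t i) w))"]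
        dist_snd_le[of "(b (Y (t' i) w), \<sigma> (Y (t' i) w))" "(b (Y (t i) w), \<sigma> (Y (t i) w))"]
      by (simp add: c_def H_def dist_norm)
  qed
  have Hm: "H i \<in> borel_measurable (F (t i))" for i
  proof -
    have "0 \<le> t' i" "0 \<le> t i" using s h \<delta> by (auto simp: t_def t'_def)
    then show ?thesis unfolding H_def[abs_def] using t'_t(1)[of i]
      by (intro borel_measurable_diff measurable_compose[OF Y_measurable_F \<sigma>_measurable]) auto
  qed
  have tstep: "t (Suc i) - t i = \<delta>" for i by (simp add: t_def algebra_simps)
  let ?S = "\<lambda>k w. \<Sum>i<k. H i w *v (W (t (Suc i)) w - W (t i) w)"
  have Sm: "?S k \<in> borel_measurable M" for k
  proof (intro borel_measurable_sum borel_measurable_matrix_vector_mult borel_measurable_diff)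
    fix i
    show "H i \<in> borel_measurable M" by (rule measurable_F_M[OF Hm])
    show "W (t (Suc i)) \<in> borel_measurable M" "W (t i) \<in> borel_measurable M"
      by (rule W_measurable, use s \<delta> in \<open>simp add: t_def\<close>)+
  qed
  have L: "\<P>(w in M. \<exists>k\<le>n. norm (?S k w) > \<epsilon>) \<le> (\<eta>\<^sup>2 * T) / \<epsilon>\<^sup>2 + \<P>(w in M. (\<Sum>i<n. (norm (H i w))\<^sup>2 * (t (Suc i) - t i)) > \<eta>\<^sup>2 * T)"
    by (rule lenglart[OF _ _ Hm \<epsilon>]) (use s \<delta> \<eta> T tstep in \<open>auto simp: t_def algebra_simps\<close>)
  have V: "\<P>(w in M. (\<Sum>i<n. (norm (H i w))\<^sup>2 * (t (Suc i) - t i)) > \<eta>\<^sup>2 * T) \<le> prob E"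
  proof (rule finite_measure_mono[OF subsetI Em], rule ccontr)
    fix w assume a: "w \<in> {w\<in>space M. (\<Sum>i<n. (norm (H i w))\<^sup>2 * (t (Suc i) - t i)) > \<eta>\<^sup>2 * T}" "w \<notin> E"
    have "(\<Sum>i<n. (norm (H i w))\<^sup>2 * (t (Suc i) - t i)) \<le> (\<Sum>i<n. \<eta>\<^sup>2 * \<delta>)"
    proof (rule sum_mono)
      fix i assume i: "i \<in> {..<n}"
      have "(norm (H i w))\<^sup>2 \<le> \<eta>\<^sup>2" using osc[of w i] a i by (intro power_mono) auto
      then show "(norm (H i w))\<^sup>2 * (t (Suc i) - t i) \<le> \<eta>\<^sup>2 * \<delta>"
        unfolding tstep using \<delta> by (intro mult_right_mono) auto
    qed
    also have "\<dots> = \<eta>\<^sup>2 * T" by (simp add: n\<delta>[symmetric])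
    finally show False using a by simp
  qed
  have Am: "{w\<in>space M. \<exists>k\<le>n. norm (?S k w) > \<epsilon>} \<in> events"
  proof -
    have "{w\<in>space M. \<exists>k\<in>{..n}. norm (?S k w) > \<epsilon>} \<in> events" using Sm by measurable
    moreover have "{w\<in>space M. \<exists>k\<in>{..n}. norm (?S k w) > \<epsilon>} = {w\<in>space M. \<exists>k\<le>n. norm (?S k w) > \<epsilon>}" by auto
    ultimately show ?thesis by (simp only:)
  qed
  have "\<P>(w in M. \<exists>k\<le>Suc N. norm (rsum s h k w - rsum s (h / real m) (k * m) w) > 2 * \<epsilon>) \<le>
    prob ({w\<in>space M. \<exists>k\<le>n. norm (?S k w) > \<epsilon>} \<union> E)"
  proof (rule finite_measure_mono[OF subsetI])
    fix w assume a: "w \<in> {w\<in>space M. \<exists>k\<le>Suc N. norm (rsum s h k w - rsum s (h / real m) (k * m) w) > 2 * \<epsilon>}"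
    then obtain k where k: "k \<le> Suc N" "norm (rsum s h k w - rsum s (h / real m) (k * m) w) > 2 * \<epsilon>" and w: "w \<in> space M"
      by blast
    have km: "k * m \<le> n" using k(1) by (simp only: n_def mult_le_mono1)
    show "w \<in> {w\<in>space M. \<exists>k\<le>n. norm (?S k w) > \<epsilon>} \<union> E"
    proof (cases "w \<in> E")
      case False
      have "norm (\<Sum>i<k * m. \<delta> *\<^sub>R c i w) \<le> (\<Sum>i<k * m. \<delta> * \<eta>)"
        using osc[OF w False] km \<delta> by (intro sum_norm_le) (auto intro!: mult_left_mono)
      also have "\<dots> = real (k * m) * \<delta> * \<eta>" by simp
      also have "\<dots> \<le> real n * \<delta> * \<eta>" by (intro mult_right_mono of_nat_mono km less_imp_le[OF \<delta>] less_imp_le[OF \<eta>(1)])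
      also have "\<dots> \<le> \<epsilon>" using \<eta> n\<delta> by simp
      finally have "norm (\<Sum>i<k * m. \<delta> *\<^sub>R c i w) \<le> \<epsilon>" .
      moreover have "norm (rsum s h k w - rsum s (h / real m) (k * m) w) \<le> norm (\<Sum>i<k * m. \<delta> *\<^sub>R c i w) + norm (?S (k * m) w)"
        unfolding diff by (rule norm_triangle_ineq)
      ultimately have "norm (?S (k * m) w) > \<epsilon>" using k(2) by linarith
      then show ?thesis using km w by blast
    qed simp
  qed (rule sets.Un[OF Am Em])
  also have "\<dots> \<le> \<P>(w in M. \<exists>k\<le>n. norm (?S k w) > \<epsilon>) + prob E"
    by (rule measure_Un_le[OF Am Em])
  finally show ?thesis using L V by linarith
qed

text \<open>The bound of \<open>riemann_compare\<close> does not depend on \<open>m\<close>. For a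
  fixed coarse grid there are finitely many grid times, so \<open>m\<close> can be taken so large
  that the fine sums are close to \<open>Y\<close> at all of them; then the coarse sums are close as
  well.\<close>

theorem riemann_uniform:
  assumes s: "0 \<le> s" and T: "0 < T"
  shows "tends0 (rerr s T)"
  unfolding tends0_def
proof (intro conjI allI impI)
  show "rerr s T N \<in> borel_measurable M" for N by (rule rerr_measurable[OF s T])
  fix \<epsilon> :: real assume \<epsilon>: "\<epsilon> > 0"
  define h where "h N = T / real (Suc N)" for N
  have h: "h N > 0" for N using T by (simp add: h_def)
  let ?X = "\<lambda>u w. (b (Y u w), \<sigma> (Y u w))"
  show "(\<lambda>N. \<P>(w in M. rerr s T N w > \<epsilon>)) \<longlonglongrightarrow> 0"
  proof (rule LIMSEQ_I, goal_cases)
    case (1 \<kappa>)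
    define \<epsilon>' where "\<epsilon>' = \<epsilon> / 4"
    have \<epsilon>': "\<epsilon>' > 0" using \<epsilon> by (simp add: \<epsilon>'_def)
    \<comment> \<open>The first entry controls the accumulated drift, the second makes the term from
      \<open>lenglart\<close> at most \<open>\<kappa> / 4\<close>. With
      \<open>\<epsilon>' = \<epsilon> / 4\<close> the error splits into two parts of size
      \<open>2 * \<epsilon>'\<close>.\<close>
    define \<eta> where "\<eta> = min (\<epsilon>' / T) (sqrt (\<kappa> * \<epsilon>'\<^sup>2 / (4 * T)))"
    have \<eta>: "\<eta> > 0" "T * \<eta> \<le> \<epsilon>'" "\<eta>\<^sup>2 * T / \<epsilon>'\<^sup>2 \<le> \<kappa> / 4"
    proof -
      show p: "\<eta> > 0" using \<epsilon>' T 1 by (simp add: \<eta>_def)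
      have "\<eta> \<le> \<epsilon>' / T" by (simp add: \<eta>_def)
      then show "T * \<eta> \<le> \<epsilon>'" using T by (simp add: field_simps)
      have "\<eta>\<^sup>2 \<le> (sqrt (\<kappa> * \<epsilon>'\<^sup>2 / (4 * T)))\<^sup>2" using p by (intro power_mono) (auto simp: \<eta>_def)
      also have "\<dots> = \<kappa> * \<epsilon>'\<^sup>2 / (4 * T)" using T 1 by simp
      finally show "\<eta>\<^sup>2 * T / \<epsilon>'\<^sup>2 \<le> \<kappa> / 4" using T \<epsilon>' by (simp add: field_simps)
    qed
    have Xm: "?X u \<in> borel_measurable M" if "u \<in> {s..s + T}" for u
      using Y_measurable[of u] that s by (intro borel_measurable_Pair) auto
    have "(\<lambda>N. prob (osc_event ?X s (s + T) (2 * h N) \<eta>)) \<longlonglongrightarrow> 0"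
    proof (rule prob_osc_event_tendsto[OF Xm _ \<eta>(1)])
      show "continuous_on {s..s + T} (\<lambda>u. ?X u w)" if "w \<in> space M" for w
        using s by (intro continuous_on_Pair continuous_on_subset[OF bY_cont[OF that]] continuous_on_subset[OF \<sigma>Y_cont[OF that]]) auto
      show "(\<lambda>N. 2 * h N) \<longlonglongrightarrow> 0"
        unfolding h_def using tendsto_mult_left[OF LIMSEQ_Suc[OF lim_const_over_n[of T]], of 2] by simp
    qed
    then have "\<forall>\<^sub>F N in sequentially. prob (osc_event ?X s (s + T) (2 * h N) \<eta>) < \<kappa> / 8"
      by (rule order_tendstoD(2)) (use 1 in simp)
    then obtain N0 where N0: "\<And>N. N \<ge> N0 \<Longrightarrow> prob (osc_event ?X s (s + T) (2 * h N) \<eta>) < \<kappa> / 8"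
      by (auto simp: eventually_sequentially)
    show ?case
    proof (intro exI allI impI)
      fix N assume N: "N \<ge> N0"
      let ?P = "\<lambda>m k. {w\<in>space M. norm (rsum s (h N / real (Suc m)) (k * Suc m) w - (Y (s + real k * h N) w - Y s w)) > 2 * \<epsilon>'}"
      let ?A = "\<lambda>m. {w\<in>space M. \<exists>k\<le>Suc N. norm (rsum s (h N) k w - rsum s (h N / real (Suc m)) (k * Suc m) w) > 2 * \<epsilon>'}"
      have "(\<lambda>m. \<Sum>k\<le>Suc N. prob (?P m k)) \<longlonglongrightarrow> (\<Sum>k\<le>Suc N. 0)"
        by (intro tendsto_sum tends0D[OF refine_tends0[OF s h]]) (use \<epsilon>' in simp)
      then have "\<forall>\<^sub>F m in sequentially. (\<Sum>k\<le>Suc N. prob (?P m k)) < \<kappa> / 4"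
        by (intro order_tendstoD(2)) (use 1 in auto)
      then obtain m where m: "(\<Sum>k\<le>Suc N. prob (?P m k)) < \<kappa> / 4"
        using eventually_happens'[OF sequentially_bot] by blast
      have Pm: "?P m k \<in> events" for k
      proof -
        note [measurable] = tends0_measurable[OF refine_tends0[OF s h[of N], of k], of m]
        show ?thesis by measurable
      qed
      have UPm: "(\<Union>k\<in>{..Suc N}. ?P m k) \<in> events"
        by (intro sets.finite_UN Pm) simp
      have hs: "h N / real (Suc m) \<ge> 0" "h N \<ge> 0" using h[of N] by auto
      have "{w\<in>space M. \<exists>k\<in>{..Suc N}. norm (rsum s (h N) k w - rsum s (h N / real (Suc m)) (k * Suc m) w) > 2 * \<epsilon>'} \<in> events"
        using rsum_measurable[OF s hs(1)] rsum_measurable[OF s hs(2)] by measurable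
      moreover have "{w\<in>space M. \<exists>k\<in>{..Suc N}. norm (rsum s (h N) k w - rsum s (h N / real (Suc m)) (k * Suc m) w) > 2 * \<epsilon>'} = ?A m" by auto
      ultimately have Am: "?A m \<in> events" by (simp only:)
      have r1: "\<P>(w in M. rerr s T N w > \<epsilon>) \<le> prob (?A m \<union> (\<Union>k\<in>{..Suc N}. ?P m k))"
      proof (rule finite_measure_mono[OF subsetI])
        fix w assume a: "w \<in> {w\<in>space M. rerr s T N w > \<epsilon>}"
        then obtain k where k: "k \<le> Suc N" "norm (rsum s (h N) k w - (Y (s + real k * h N) w - Y s w)) > \<epsilon>"
          unfolding h_def by (blast elim: rerr_gtE)
        have "norm (rsum s (h N) k w - (Y (s + real k * h N) w - Y s w)) \<le>
           norm (rsum s (h N) k w - rsum s (h N / real (Suc m)) (k * Suc m) w) +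
           norm (rsum s (h N / real (Suc m)) (k * Suc m) w - (Y (s + real k * h N) w - Y s w))"
          using norm_triangle_ineq[of "rsum s (h N) k w - rsum s (h N / real (Suc m)) (k * Suc m) w"
            "rsum s (h N / real (Suc m)) (k * Suc m) w - (Y (s + real k * h N) w - Y s w)"]
          by (simp only: diff_add_cancel diff_add_eq add_diff_eq)
        then have "norm (rsum s (h N) k w - rsum s (h N / real (Suc m)) (k * Suc m) w) > 2 * \<epsilon>' \<or>
           norm (rsum s (h N / real (Suc m)) (k * Suc m) w - (Y (s + real k * h N) w - Y s w)) > 2 * \<epsilon>'"
          using k(2) by (simp only: \<epsilon>'_def) linarith
        then show "w \<in> ?A m \<union> (\<Union>k\<in>{..Suc N}. ?P m k)" using a k(1) by blast
      qed (rule sets.Un[OF Am UPm])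
      have r2: "prob (?A m \<union> (\<Union>k\<in>{..Suc N}. ?P m k)) \<le> prob (?A m) + prob (\<Union>k\<in>{..Suc N}. ?P m k)"
        by (rule measure_Un_le[OF Am UPm])
      have r3: "prob (\<Union>k\<in>{..Suc N}. ?P m k) \<le> (\<Sum>k\<le>Suc N. prob (?P m k))"
        by (rule measure_UNION_le[OF finite_atMost Pm])
      have r4: "prob (?A m) \<le> \<eta>\<^sup>2 * T / \<epsilon>'\<^sup>2 + 2 * prob (osc_event ?X s (s + T) (2 * h N) \<eta>)"
        unfolding h_def by (rule riemann_compare[OF s T _ \<epsilon>' \<eta>(1,2)]) simp
      have "\<P>(w in M. rerr s T N w > \<epsilon>) < \<kappa>"
        using 1 r1 r2 r3 r4 m N0[OF N] \<eta>(3) by linarith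
      then show "norm (\<P>(w in M. rerr s T N w > \<epsilon>) - 0) < \<kappa>" by simp
    qed
  qed
qed

end


section \<open>Dynkin's inequality\<close>

text \<open>Uniform continuity of the second derivative gives a Taylor remainder that is uniform in
  the base point, wherever the scheme happens to be.\<close>

definition C2b :: "('a::euclidean_space \<Rightarrow> real) \<Rightarrow> ('a \<Rightarrow> 'a \<Rightarrow>\<^sub>L real) \<Rightarrow> ('a \<Rightarrow> 'a \<Rightarrow>\<^sub>L 'a \<Rightarrow>\<^sub>L real) \<Rightarrow> bool" where
  "C2b f f' f'' \<longleftrightarrow> (\<forall>x. (f has_derivative blinfun_apply (f' x)) (at x)) \<and>
     (\<forall>x. (f' has_derivative blinfun_apply (f'' x)) (at x)) \<and>
     bounded (range f) \<and> bounded (range f') \<and> bounded (range f'') \<and> uniformly_continuous_on UNIV f''"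

lemma taylor1_bound:
  fixes f :: "'a::euclidean_space \<Rightarrow> real"
  assumes f: "\<And>x. (f has_derivative blinfun_apply (f' x)) (at x)"
    and f': "\<And>x. (f' has_derivative blinfun_apply (f'' x)) (at x)"
    and B: "\<And>x. norm (f'' x) \<le> B"
  shows "\<bar>f (x + v) - f x - f' x v\<bar> \<le> B * (norm v)\<^sup>2"
proof -
  define g where "g t = f (x + t *\<^sub>R v) - f x - t * f' x v" for t :: real
  have B0: "B \<ge> 0" using B[of 0] norm_ge_zero order_trans by blast
  have lip: "norm (f' (x + t *\<^sub>R v) - f' x) \<le> B * norm v" if "t \<in> {0..1}" for t
  proof -
    have "norm (f' (x + t *\<^sub>R v) - f' x) \<le> B * norm (x + t *\<^sub>R v - x)"
    proof (rule differentiable_bound[where f'="\<lambda>x. blinfun_apply (f'' x)" and S=UNIV])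
      show "onorm (blinfun_apply (f'' y)) \<le> B" for y using B[of y] by (simp add: norm_blinfun.rep_eq)
    qed (use f' in \<open>auto intro: has_derivative_at_withinI\<close>)
    also have "\<dots> \<le> B * norm v" using that B0 by (intro mult_left_mono) (auto intro: mult_left_le_one_le)
    finally show ?thesis .
  qed
  have d: "(g has_derivative (\<lambda>u. u * (f' (x + t *\<^sub>R v) v - f' x v))) (at t)" for t
  proof -
    have "((\<lambda>t. f (x + t *\<^sub>R v)) has_derivative (\<lambda>u. f' (x + t *\<^sub>R v) (u *\<^sub>R v))) (at t)"
      by (rule has_derivative_compose[of "\<lambda>t. x + t *\<^sub>R v" "\<lambda>u. u *\<^sub>R v" t UNIV f, OF _ f])
        (auto intro!: derivative_eq_intros)
    then show ?thesis
      unfolding g_def by (auto intro!: derivative_eq_intros simp: blinfun.scaleR_right algebra_simps)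
  qed
  have "norm (g 1 - g 0) \<le> B * (norm v)\<^sup>2 * norm (1 - (0::real))"
  proof (rule differentiable_bound[where S="{0..1}" and f'="\<lambda>t u. u * (f' (x + t *\<^sub>R v) v - f' x v)"])
    fix t :: real assume t: "t \<in> {0..1}"
    have "norm ((f' (x + t *\<^sub>R v) - f' x) v) \<le> norm (f' (x + t *\<^sub>R v) - f' x) * norm v" by (rule norm_blinfun)
    also have "\<dots> \<le> B * norm v * norm v" by (intro mult_right_mono lip t) simp
    finally have *: "\<bar>f' (x + t *\<^sub>R v) v - f' x v\<bar> \<le> B * (norm v)\<^sup>2"
      by (simp add: blinfun.diff_left power2_eq_square mult_ac)
    show "onorm (\<lambda>u. u * (f' (x + t *\<^sub>R v) v - f' x v)) \<le> B * (norm v)\<^sup>2"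
      by (rule onorm_le) (use mult_left_mono[OF *, of "\<bar>u\<bar>" for u] in \<open>simp add: abs_mult mult_ac\<close>)
  qed (auto intro: has_derivative_at_withinI[OF d])
  then show ?thesis by (simp add: g_def)
qed

text \<open>The mean value inequality along the segment is used once for the derivative and once for
  the function. The constant is twice the optimal one, which is harmless since \<open>B\<close> will
  be small or multiply a fourth moment.\<close>

lemma taylor2_bound:
  fixes f :: "'a::euclidean_space \<Rightarrow> real"
  assumes f: "\<And>x. (f has_derivative blinfun_apply (f' x)) (at x)"
    and f': "\<And>x. (f' has_derivative blinfun_apply (f'' x)) (at x)"
    and B: "\<And>z. norm z \<le> norm v \<Longrightarrow> norm (f'' (x + z) - f'' x) \<le> B"
  shows "\<bar>f (x + v) - f x - f' x v - f'' x v v / 2\<bar> \<le> B * (norm v)\<^sup>2"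
proof -
  have B0: "B \<ge> 0" using B[of 0] by simp
  define g where "g t = f (x + t *\<^sub>R v) - f x - t * f' x v - t\<^sup>2 * f'' x v v / 2" for t :: real
  have lip: "norm (f' (x + t *\<^sub>R v) - f' x - t *\<^sub>R f'' x v) \<le> B * norm v" if t: "t \<in> {0..1}" for t
  proof -
    let ?k = "\<lambda>r::real. f' (x + r *\<^sub>R v) - r *\<^sub>R f'' x v"
    have dk: "(?k has_derivative (\<lambda>u. u *\<^sub>R (f'' (x + r *\<^sub>R v) v - f'' x v))) (at r)" for r
    proof -
      have "((\<lambda>t. f' (x + t *\<^sub>R v)) has_derivative (\<lambda>u. f'' (x + r *\<^sub>R v) (u *\<^sub>R v))) (at r)"
        by (rule has_derivative_compose[of "\<lambda>t. x + t *\<^sub>R v" "\<lambda>u. u *\<^sub>R v" r UNIV f', OF _ f'])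
          (auto intro!: derivative_eq_intros)
      then show ?thesis
        by (auto intro!: derivative_eq_intros simp: blinfun.scaleR_right algebra_simps)
    qed
    have "norm (?k t - ?k 0) \<le> (B * norm v) * norm (t - 0)"
    proof (rule differentiable_bound[where S="{0..1}" and f'="\<lambda>r u. u *\<^sub>R (f'' (x + r *\<^sub>R v) v - f'' x v)"])
      fix r :: real assume r: "r \<in> {0..1}"
      have "norm ((f'' (x + r *\<^sub>R v) - f'' x) v) \<le> norm (f'' (x + r *\<^sub>R v) - f'' x) * norm v" by (rule norm_blinfun)
      also have "\<dots> \<le> B * norm v"
        using r by (intro mult_right_mono B) (auto intro: mult_left_le_one_le)
      finally have *: "norm (f'' (x + r *\<^sub>R v) v - f'' x v) \<le> B * norm v" by (simp add: blinfun.diff_left)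
      show "onorm (\<lambda>u. u *\<^sub>R (f'' (x + r *\<^sub>R v) v - f'' x v)) \<le> B * norm v"
        by (rule onorm_le) (use mult_left_mono[OF *, of "\<bar>u\<bar>" for u] in \<open>simp add: mult_ac\<close>)
    qed (use t in \<open>auto intro: has_derivative_at_withinI[OF dk]\<close>)
    also have "\<dots> \<le> B * norm v" using t B0 by (simp add: mult_left_le)
    finally show ?thesis by (simp add: algebra_simps)
  qed
  have d: "(g has_derivative (\<lambda>u. u * (f' (x + t *\<^sub>R v) v - f' x v - t * f'' x v v))) (at t)" for t
  proof -
    have "((\<lambda>t. f (x + t *\<^sub>R v)) has_derivative (\<lambda>u. f' (x + t *\<^sub>R v) (u *\<^sub>R v))) (at t)"
      by (rule has_derivative_compose[of "\<lambda>t. x + t *\<^sub>R v" "\<lambda>u. u *\<^sub>R v" t UNIV f, OF _ f])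
        (auto intro!: derivative_eq_intros)
    then show ?thesis
      unfolding g_def by (auto intro!: derivative_eq_intros simp: blinfun.scaleR_right algebra_simps)
  qed
  have "norm (g 1 - g 0) \<le> B * (norm v)\<^sup>2 * norm (1 - (0::real))"
  proof (rule differentiable_bound[where S="{0..1}" and f'="\<lambda>t u. u * (f' (x + t *\<^sub>R v) v - f' x v - t * f'' x v v)"])
    fix t :: real assume t: "t \<in> {0..1}"
    have "norm ((f' (x + t *\<^sub>R v) - f' x - t *\<^sub>R f'' x v) v) \<le> norm (f' (x + t *\<^sub>R v) - f' x - t *\<^sub>R f'' x v) * norm v" by (rule norm_blinfun)
    also have "\<dots> \<le> B * norm v * norm v" by (intro mult_right_mono lip t) simp
    finally have *: "\<bar>f' (x + t *\<^sub>R v) v - f' x v - t * f'' x v v\<bar> \<le> B * (norm v)\<^sup>2"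
      by (simp add: blinfun.diff_left blinfun.scaleR_left power2_eq_square mult_ac)
    show "onorm (\<lambda>u. u * (f' (x + t *\<^sub>R v) v - f' x v - t * f'' x v v)) \<le> B * (norm v)\<^sup>2"
      by (rule onorm_le) (use mult_left_mono[OF *, of "\<bar>u\<bar>" for u] in \<open>simp add: abs_mult mult_ac\<close>)
  qed (auto intro: has_derivative_at_withinI[OF d])
  then show ?thesis by (simp add: g_def)
qed

lemma matrix_vector_column_sum: "(H :: real^'n^'d) *v z = (\<Sum>j\<in>UNIV. (z $ j) *\<^sub>R column j H)"
  by (simp add: vec_eq_iff matrix_vector_mult_def column_def mult.commute)

lemma norm_column_le': "norm (column j (H :: real^'n^'d)) \<le> norm H"
proof -
  have "column j H = H *v axis j 1" by (simp only: matrix_vector_mult_basis)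
  then show ?thesis using norm_matrix_vector_le[of H "axis j 1"] by simp
qed

lemma continuous_on_column: "continuous_on UNIV (\<lambda>H :: real^'n^'d. column j H)"
  unfolding column_def by (intro continuous_intros)

context driven
begin

text \<open>The drift is applied first, expanded to first order with an error of order
  \<open>h\<^sup>2\<close>; the noise is then expanded to second order around the shifted point,
  which is why the Hessian in \<open>gen\<close> sits at \<open>U w + h *\<^sub>R \<beta> w\<close>.
  Summed over a grid, the error leaves a multiple of \<open>\<epsilon>\<close> plus a term vanishing
  with \<open>h\<close>.\<close>

lemma step_gain:
  fixes f :: "real^'d \<Rightarrow> real" and U \<beta> :: "'w \<Rightarrow> real^'d" and H :: "'w \<Rightarrow> real^'n^'d"
  assumes st: "0 \<le> s" and h: "h > 0"
    and f: "\<And>x. (f has_derivative blinfun_apply (f' x)) (at x)"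
    and f': "\<And>x. (f' has_derivative blinfun_apply (f'' x)) (at x)"
    and f''c: "continuous_on UNIV f''"
    and fb: "\<And>x. \<bar>f x\<bar> \<le> B0" "\<And>x. norm (f' x) \<le> B1" "\<And>x. norm (f'' x) \<le> B2"
    and mod: "\<And>x z. norm z \<le> \<delta> \<Longrightarrow> norm (f'' (x + z) - f'' x) \<le> \<epsilon>" and \<delta>: "\<delta> > 0"
    and Um: "U \<in> borel_measurable (F s)" and \<beta>m: "\<beta> \<in> borel_measurable (F s)" and Hm: "H \<in> borel_measurable (F s)"
    and D: "D \<in> sets (F s)"
    and bd: "\<And>w. w \<in> D \<Longrightarrow> norm (\<beta> w) \<le> C \<and> norm (H w) \<le> C"
    and gen: "\<And>w. w \<in> D \<Longrightarrow> f' (U w) (\<beta> w) +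
       (\<Sum>j\<in>UNIV. f'' (U w + h *\<^sub>R \<beta> w) (column j (H w)) (column j (H w))) / 2 \<ge> c"
  shows "expectation (\<lambda>w. indicator D w * (f (U w + (h *\<^sub>R \<beta> w + H w *v (W (s + h) w - W s w))) - f (U w)))
    \<ge> h * c * prob D - (\<epsilon> * C\<^sup>2 * h + (B2 * C\<^sup>2 + 2 * B2 * C^4 / \<delta>\<^sup>2 * (3 * (real CARD('n))\<^sup>2)) * h\<^sup>2)"
proof -
  have st': "0 \<le> s" "s < s + h" using st h by auto
  define Z where "Z w = W (s + h) w - W s w" for w
  have Zm[measurable]: "Z \<in> borel_measurable M" 
    unfolding Z_def[abs_def] using st h by (intro borel_measurable_diff W_measurable) auto
  define x where "x w = U w + h *\<^sub>R \<beta> w" for w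
  define I where "I w = (indicator D w :: real)" for w
  note [measurable] = measurable_F_M[OF Um] measurable_F_M[OF \<beta>m] measurable_F_M[OF Hm] sets_F_M[OF D]
  have DM: "D \<subseteq> space M" using sets.sets_into_space[OF sets_F_M[OF D]] .
  have B1: "0 \<le> B1" and B2: "0 \<le> B2" using fb(2)[of 0] fb(3)[of 0] norm_ge_zero order_trans by blast+
  have \<epsilon>: "0 \<le> \<epsilon>" using mod[of 0 0] \<delta> by simp
  have fc: "continuous_on UNIV f" and f'c: "continuous_on UNIV f'"
    using has_derivative_continuous[OF f] has_derivative_continuous[OF f'] by (auto simp: continuous_on_eq_continuous_at)
  have fm[measurable]: "f \<in> borel_measurable borel" by (rule borel_measurable_continuous_onI[OF fc])
  have xm: "x \<in> borel_measurable (F s)" unfolding x_def[abs_def] using Um \<beta>m by measurable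
  note xM[measurable] = measurable_F_M[OF xm]
  have colm: "(\<lambda>w. column j (H w)) \<in> borel_measurable (F s)" for j
    using borel_measurable_continuous_on[OF continuous_on_column Hm] .
  have f'm: "(\<lambda>w. f' (x w) (v w)) \<in> borel_measurable (F s)" if "v \<in> borel_measurable (F s)" for v
  proof -
    have "continuous_on UNIV (\<lambda>p::(real^'d)\<times>(real^'d). f' (fst p) (snd p))"
      by (intro continuous_intros continuous_on_compose2[OF f'c]) auto
    from borel_measurable_continuous_on[OF this borel_measurable_Pair[OF xm that]] show ?thesis by simp
  qed
  have f''m: "(\<lambda>w. f'' (x w) (v w) (u w)) \<in> borel_measurable (F s)"
    if "v \<in> borel_measurable (F s)" "u \<in> borel_measurable (F s)" for v u
  proof -
    have "continuous_on UNIV (\<lambda>p::(real^'d)\<times>(real^'d)\<times>(real^'d). f'' (fst p) (fst (snd p)) (snd (snd p)))"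
      by (intro continuous_intros continuous_on_compose2[OF f''c]) auto
    from borel_measurable_continuous_on[OF this borel_measurable_Pair[OF xm borel_measurable_Pair[OF that]]] show ?thesis by simp
  qed
  have Im: "I \<in> borel_measurable (F s)" unfolding I_def[abs_def] using D by measurable
  have I01: "0 \<le> I w" "I w \<le> 1" for w by (auto simp: I_def indicator_def)
  have C0: "0 \<le> C" if "w \<in> D" for w using bd[OF that] norm_ge_zero order_trans by blast
  have CC: "0 \<le> C * C" by simp

  \<comment> \<open>The coefficient of the linear noise term, known at time \<open>s\<close>, so
    that this term has mean zero; \<open>q\<close> below is that of the quadratic term.\<close>
  define \<gamma> where "\<gamma> w = (\<chi> j. I w * f' (x w) (column j (H w)))" for w
  have lin: "has_bochner_integral M (\<lambda>w. \<gamma> w \<bullet> (W (s + h) w - W s w)) 0"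
  proof (rule increment_linear[OF st'])
    have "(\<lambda>w. \<gamma> w \<bullet> axis i 1) \<in> borel_measurable (F s)" for i
      unfolding \<gamma>_def inner_axis using Im f'm[OF colm] by simp
    then show "\<gamma> \<in> borel_measurable (F s)"
      by (subst borel_measurable_euclidean_space) (auto simp: Basis_vec_def)
    fix w
    have "norm (\<gamma> w) \<le> (\<Sum>j\<in>UNIV. \<bar>\<gamma> w $ j\<bar>)" by (rule norm_le_l1_cart)
    also have "\<dots> \<le> (\<Sum>j\<in>(UNIV::'n set). B1 * \<bar>C\<bar>)"
    proof (rule sum_mono)
      fix j
      show "\<bar>\<gamma> w $ j\<bar> \<le> B1 * \<bar>C\<bar>"
      proof (cases "w \<in> D")
        case True
        have "\<bar>f' (x w) (column j (H w))\<bar> \<le> norm (f' (x w)) * norm (column j (H w))"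
          using norm_blinfun[of "f' (x w)" "column j (H w)"] by simp
        also have "\<dots> \<le> B1 * \<bar>C\<bar>" using fb(2) bd[OF True] norm_column_le'[of j "H w"] B1 by (intro mult_mono) auto
        finally show ?thesis using True by (simp add: \<gamma>_def I_def)
      qed (simp add: \<gamma>_def I_def B1)
    qed
    finally show "norm (\<gamma> w) \<le> (\<Sum>j\<in>(UNIV::'n set). B1 * \<bar>C\<bar>)" .
  qed
  define q where "q j k w = I w * f'' (x w) (column j (H w)) (column k (H w)) / 2" for j k w
  have qm: "q j k \<in> borel_measurable (F s)" for j k
    unfolding q_def[abs_def] using Im f''m[OF colm colm, of j k] by measurable
  have qb: "\<bar>q j k w\<bar> \<le> B2 * \<bar>C\<bar> * \<bar>C\<bar>" for j k w
  proof (cases "w \<in> D")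
    case True
    have "norm (f'' (x w) (column j (H w)) (column k (H w))) \<le> norm (f'' (x w) (column j (H w))) * norm (column k (H w))"
      by (rule norm_blinfun)
    also have "\<dots> \<le> (norm (f'' (x w)) * norm (column j (H w))) * norm (column k (H w))"
      by (intro mult_right_mono norm_blinfun) simp
    also have "\<dots> \<le> B2 * \<bar>C\<bar> * \<bar>C\<bar>"
      using fb(3) bd[OF True] norm_column_le'[of j "H w"] norm_column_le'[of k "H w"] B2 by (intro mult_mono) auto
    finally show ?thesis using True by (simp add: q_def I_def)
  qed (simp add: q_def I_def B2)
  have quad: "has_bochner_integral M (\<lambda>w. \<Sum>j\<in>UNIV. \<Sum>k\<in>UNIV. q j k w * ((W (s + h) w - W s w) $ j * (W (s + h) w - W s w) $ k))
     ((s + h - s) * expectation (\<lambda>w. \<Sum>j\<in>UNIV. q j j w))"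
    by (rule increment_quadratic[OF st' qm qb])
  have sq: "has_bochner_integral M (\<lambda>w. (norm ((I w *\<^sub>R H w) *v (W (s + h) w - W s w)))\<^sup>2) ((s + h - s) * expectation (\<lambda>w. (norm (I w *\<^sub>R H w))\<^sup>2))"
  proof (rule increment_norm_sq[OF st', where C="\<bar>C\<bar>"])
    show "(\<lambda>w. I w *\<^sub>R H w) \<in> borel_measurable (F s)" using Im Hm by simp
    show "norm (I w *\<^sub>R H w) \<le> \<bar>C\<bar>" for w
      using bd[of w] C0[of w] by (cases "w \<in> D") (auto simp: I_def)
  qed
  have p4: "integrable M (\<lambda>w. (norm (Z w))^4)" "expectation (\<lambda>w. (norm (Z w))^4) \<le> 3 * (real CARD('n))\<^sup>2 * h\<^sup>2"
    using increment_norm_4[OF st'] by (simp_all add: Z_def)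

  \<comment> \<open>Outside \<open>D\<close> the left side is \<open>0\<close> and the error terms
    only lower the right side, so the inequality can be integrated over the whole space.\<close>
  have point: "I w * (f (U w + (h *\<^sub>R \<beta> w + H w *v Z w)) - f (U w)) \<ge>
      (I w * (h * f' (U w) (\<beta> w)) - B2 * C\<^sup>2 * h\<^sup>2) + \<gamma> w \<bullet> Z w + (\<Sum>j\<in>UNIV. \<Sum>k\<in>UNIV. q j k w * (Z w $ j * Z w $ k))
      - (\<epsilon> * (norm ((I w *\<^sub>R H w) *v Z w))\<^sup>2 + 2 * B2 * C^4 / \<delta>\<^sup>2 * (norm (Z w))^4)" for w
  proof (cases "w \<in> D")
    case True
    define z where "z = H w *v Z w"
    have C: "0 \<le> C" by (rule C0[OF True])
    have I: "I w = 1" using True by (simp add: I_def)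
    have wcol: "z = (\<Sum>j\<in>UNIV. (Z w $ j) *\<^sub>R column j (H w))" by (simp add: z_def matrix_vector_column_sum)
    have f'w: "f' (x w) z = \<gamma> w \<bullet> Z w"
      unfolding wcol \<gamma>_def I by (simp add: blinfun.sum_right blinfun.scaleR_right inner_vec_def mult.commute)
    have f''w: "f'' (x w) z z / 2 = (\<Sum>j\<in>UNIV. \<Sum>k\<in>UNIV. q j k w * (Z w $ j * Z w $ k))"
      unfolding wcol q_def I
      by (simp add: blinfun.sum_right blinfun.sum_left blinfun.scaleR_right blinfun.scaleR_left sum_distrib_left sum_divide_distrib mult_ac)
         (subst sum.swap, simp add: mult.left_commute)
    have 1: "\<bar>f (U w + h *\<^sub>R \<beta> w) - f (U w) - f' (U w) (h *\<^sub>R \<beta> w)\<bar> \<le> B2 * (norm (h *\<^sub>R \<beta> w))\<^sup>2"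
      by (rule taylor1_bound[OF f f' fb(3)])
    have "(norm (h *\<^sub>R \<beta> w))\<^sup>2 \<le> C\<^sup>2 * h\<^sup>2"
    proof -
      have "norm (h *\<^sub>R \<beta> w) \<le> C * h" using bd[OF True] h by (simp add: mult.commute)
      then have "(norm (h *\<^sub>R \<beta> w))\<^sup>2 \<le> (C * h)\<^sup>2" by (intro power_mono) auto
      then show ?thesis by (simp add: power_mult_distrib)
    qed
    then have "B2 * (norm (h *\<^sub>R \<beta> w))\<^sup>2 \<le> B2 * (C\<^sup>2 * h\<^sup>2)" by (intro mult_left_mono B2)
    then have 2: "f (x w) - f (U w) \<ge> h * f' (U w) (\<beta> w) - B2 * C\<^sup>2 * h\<^sup>2"
      using 1 by (simp add: x_def blinfun.scaleR_right mult.assoc abs_le_iff)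
    have nn: "0 \<le> 2 * B2 * C^4 / \<delta>\<^sup>2 * (norm (Z w))^4" using B2 C by (intro mult_nonneg_nonneg divide_nonneg_nonneg) auto
    have nn2: "0 \<le> \<epsilon> * (norm z)\<^sup>2" using \<epsilon> by (intro mult_nonneg_nonneg) auto
    have 3: "\<bar>f (x w + z) - f (x w) - f' (x w) z - f'' (x w) z z / 2\<bar> \<le> \<epsilon> * (norm z)\<^sup>2 + 2 * B2 * C^4 / \<delta>\<^sup>2 * (norm (Z w))^4"
    proof (cases "norm z \<le> \<delta>")
      case True
      have "\<bar>f (x w + z) - f (x w) - f' (x w) z - f'' (x w) z z / 2\<bar> \<le> \<epsilon> * (norm z)\<^sup>2"
      proof (rule taylor2_bound[OF f f'])
        fix u :: "real^'d" assume "norm u \<le> norm z"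
        then show "norm (f'' (x w + u) - f'' (x w)) \<le> \<epsilon>" using True by (intro mod) simp
      qed
      then show ?thesis using nn by linarith
    next
      case False
      have "\<bar>f (x w + z) - f (x w) - f' (x w) z - f'' (x w) z z / 2\<bar> \<le> (2 * B2) * (norm z)\<^sup>2"
      proof (rule taylor2_bound[OF f f'])
        fix u :: "real^'d"
        show "norm (f'' (x w + u) - f'' (x w)) \<le> 2 * B2"
          using norm_triangle_ineq4[of "f'' (x w + u)" "f'' (x w)"] fb(3)[of "x w + u"] fb(3)[of "x w"] by linarith
      qed
      \<comment> \<open>For noise larger than \<open>\<delta>\<close> the modulus of continuity is
        of no use; the crude quadratic bound is traded for a fourth power, whose mean is of order
        \<open>h\<^sup>2\<close>.\<close>
      also have "\<dots> \<le> 2 * B2 * ((norm z)^4 / \<delta>\<^sup>2)"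
      proof (intro mult_left_mono)
        have "(norm z)\<^sup>2 * \<delta>\<^sup>2 \<le> (norm z)\<^sup>2 * (norm z)\<^sup>2" using False \<delta> by (intro mult_left_mono power_mono) auto
        then show "(norm z)\<^sup>2 \<le> (norm z)^4 / \<delta>\<^sup>2" using \<delta> by (simp add: pos_le_divide_eq power_add[symmetric])
      qed (use B2 in simp)
      also have "\<dots> \<le> 2 * B2 * (C^4 * (norm (Z w))^4 / \<delta>\<^sup>2)"
      proof (intro mult_left_mono divide_right_mono)
        have "norm z \<le> norm (H w) * norm (Z w)" unfolding z_def by (rule norm_matrix_vector_le)
        also have "\<dots> \<le> C * norm (Z w)" using bd[OF True] by (intro mult_right_mono) auto
        finally have "(norm z)^4 \<le> (C * norm (Z w))^4" by (intro power_mono) auto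
        then show "(norm z)^4 \<le> C^4 * (norm (Z w))^4" by (simp add: power_mult_distrib)
      qed (use B2 in auto)
      also have "\<dots> = 2 * B2 * C^4 / \<delta>\<^sup>2 * (norm (Z w))^4" by simp
      finally show ?thesis using nn2 by linarith
    qed
    have "f (U w + (h *\<^sub>R \<beta> w + H w *v Z w)) = f (x w + z)" by (simp add: x_def z_def add.assoc)
    then show ?thesis using 2 3 f'w f''w I by (simp add: z_def abs_le_iff)
  next
    case False
    have "0 \<le> 2 * B2 * C^4 / \<delta>\<^sup>2 * (norm (Z w))^4" "0 \<le> B2 * C\<^sup>2 * h\<^sup>2"
      using B2 by (auto intro!: mult_nonneg_nonneg divide_nonneg_nonneg)
    moreover have "I w = 0" using False by (simp add: I_def)
    ultimately show ?thesis by (simp add: \<gamma>_def q_def zero_vec_def[symmetric])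
  qed

  have intD: "integrable M (\<lambda>w. I w * (h * f' (U w) (\<beta> w)))"
  proof (rule integrable_const_bound[where B="h * (B1 * \<bar>C\<bar>)"])
    have "I w * \<bar>h * f' (U w) (\<beta> w)\<bar> \<le> h * (B1 * \<bar>C\<bar>)" for w
    proof (cases "w \<in> D")
      case True
      have "\<bar>f' (U w) (\<beta> w)\<bar> \<le> norm (f' (U w)) * norm (\<beta> w)" using norm_blinfun[of "f' (U w)" "\<beta> w"] by simp
      also have "\<dots> \<le> B1 * \<bar>C\<bar>" using fb(2) bd[OF True] B1 by (intro mult_mono) auto
      finally show ?thesis using True h by (simp add: I_def abs_mult)
    qed (use B1 h in \<open>simp add: I_def\<close>)
    then show "AE w in M. norm (I w * (h * f' (U w) (\<beta> w))) \<le> h * (B1 * \<bar>C\<bar>)"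
      using I01 by (auto intro!: AE_I2 simp: abs_mult)
    have "continuous_on UNIV (\<lambda>p::(real^'d)\<times>(real^'d). f' (fst p) (snd p))"
      by (intro continuous_intros continuous_on_compose2[OF f'c]) auto
    from borel_measurable_continuous_on[OF this borel_measurable_Pair[OF Um \<beta>m]]
    have "(\<lambda>w. f' (U w) (\<beta> w)) \<in> borel_measurable M" using measurable_F_M by simp
    then show "(\<lambda>w. I w * (h * f' (U w) (\<beta> w))) \<in> borel_measurable M" using measurable_F_M[OF Im] by measurable
  qed
  have intq: "integrable M (\<lambda>w. \<Sum>j\<in>UNIV. q j j w)"
    using measurable_F_M[OF qm] qb by (intro Bochner_Integration.integrable_sum integrable_const_bound[where B="B2 * \<bar>C\<bar> * \<bar>C\<bar>"]) (auto intro!: AE_I2)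
  have sqle: "expectation (\<lambda>w. (norm (I w *\<^sub>R H w))\<^sup>2) \<le> C\<^sup>2"
  proof -
    have b: "(norm (I w *\<^sub>R H w))\<^sup>2 \<le> C\<^sup>2" for w
    proof (cases "w \<in> D")
      case True
      then show ?thesis using bd[OF True] by (auto simp: I_def intro!: power_mono)
    qed (simp add: I_def)
    have "expectation (\<lambda>w. (norm (I w *\<^sub>R H w))\<^sup>2) \<le> expectation (\<lambda>w. C\<^sup>2)"
      using b measurable_F_M[OF Im] by (intro integral_mono integrable_const_bound[where B="C\<^sup>2"]) (auto intro!: AE_I2)
    then show ?thesis by (simp add: prob_space)
  qed
  let ?low = "\<lambda>w. (I w * (h * f' (U w) (\<beta> w)) - B2 * C\<^sup>2 * h\<^sup>2) + \<gamma> w \<bullet> Z w + (\<Sum>j\<in>UNIV. \<Sum>k\<in>UNIV. q j k w * (Z w $ j * Z w $ k))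
      - (\<epsilon> * (norm ((I w *\<^sub>R H w) *v Z w))\<^sup>2 + 2 * B2 * C^4 / \<delta>\<^sup>2 * (norm (Z w))^4)"
  note lin' = lin[folded Z_def] and quad' = quad[folded Z_def] and sq' = sq[folded Z_def]
  have low: "has_bochner_integral M ?low
    ((expectation (\<lambda>w. I w * (h * f' (U w) (\<beta> w))) - B2 * C\<^sup>2 * h\<^sup>2) + 0 + (s + h - s) * expectation (\<lambda>w. \<Sum>j\<in>UNIV. q j j w)
     - (\<epsilon> * ((s + h - s) * expectation (\<lambda>w. (norm (I w *\<^sub>R H w))\<^sup>2)) + 2 * B2 * C^4 / \<delta>\<^sup>2 * expectation (\<lambda>w. (norm (Z w))^4)))"
  proof -
    have cst: "has_bochner_integral M (\<lambda>x. B2 * C\<^sup>2 * h\<^sup>2) (B2 * C\<^sup>2 * h\<^sup>2)"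
      by (simp add: has_bochner_integral_iff prob_space)
    show ?thesis
      by (intro has_bochner_integral_add has_bochner_integral_diff cst lin' quad' has_bochner_integral_mult_right sq'
          has_bochner_integral_integrable intD p4)
  qed
  have "expectation ?low \<le> expectation (\<lambda>w. I w * (f (U w + (h *\<^sub>R \<beta> w + H w *v Z w)) - f (U w)))"
  proof (rule integral_mono)
    show "integrable M ?low" using low by (auto simp: has_bochner_integral_iff)
    show "integrable M (\<lambda>w. I w * (f (U w + (h *\<^sub>R \<beta> w + H w *v Z w)) - f (U w)))"
    proof (rule integrable_const_bound[where B="B0 + B0"])
      show "(\<lambda>w. I w * (f (U w + (h *\<^sub>R \<beta> w + H w *v Z w)) - f (U w))) \<in> borel_measurable M"
        using measurable_F_M[OF Im] by measurable
      have "\<bar>f u - f v\<bar> \<le> B0 + B0" for u v using fb(1)[of u] fb(1)[of v] by linarith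
      then show "AE w in M. norm (I w * (f (U w + (h *\<^sub>R \<beta> w + H w *v Z w)) - f (U w))) \<le> B0 + B0"
        using order_trans[OF abs_ge_zero fb(1)] by (auto intro!: AE_I2 simp: I_def indicator_def)
    qed
  qed (rule point)
  moreover have "expectation (\<lambda>w. I w * (h * f' (U w) (\<beta> w))) + h * expectation (\<lambda>w. \<Sum>j\<in>UNIV. q j j w) \<ge> h * c * prob D"
  proof -
    have "expectation (\<lambda>w. h * c * I w) \<le> expectation (\<lambda>w. I w * (h * f' (U w) (\<beta> w)) + h * (\<Sum>j\<in>UNIV. q j j w))"
    proof (rule integral_mono)
      fix w
      show "h * c * I w \<le> I w * (h * f' (U w) (\<beta> w)) + h * (\<Sum>j\<in>UNIV. q j j w)"
      proof (cases "w \<in> D")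
        case True
        have "h * c \<le> h * (f' (U w) (\<beta> w) + (\<Sum>j\<in>UNIV. f'' (U w + h *\<^sub>R \<beta> w) (column j (H w)) (column j (H w))) / 2)"
          using gen[OF True] h by (intro mult_left_mono) auto
        then show ?thesis using True by (simp add: I_def q_def x_def sum_divide_distrib algebra_simps)
      qed (simp add: I_def q_def)
    qed (use intD intq in \<open>auto simp: I_def integrable_indicator_iff emeasure_eq_measure\<close>)
    also have "\<dots> = expectation (\<lambda>w. I w * (h * f' (U w) (\<beta> w))) + h * expectation (\<lambda>w. \<Sum>j\<in>UNIV. q j j w)"
      using intD intq by simp
    finally show ?thesis by (simp add: I_def)
  qed
  moreover have "\<epsilon> * (h * expectation (\<lambda>w. (norm (I w *\<^sub>R H w))\<^sup>2)) \<le> \<epsilon> * C\<^sup>2 * h"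
    using mult_left_mono[OF sqle, of "\<epsilon> * h"] \<epsilon> h by (simp add: mult_ac)
  moreover have "2 * B2 * C^4 / \<delta>\<^sup>2 * expectation (\<lambda>w. (norm (Z w))^4) \<le> 2 * B2 * C^4 / \<delta>\<^sup>2 * (3 * (real CARD('n))\<^sup>2 * h\<^sup>2)"
    using p4(2) B2 by (intro mult_left_mono) auto
  moreover have "expectation ?low = (expectation (\<lambda>w. I w * (h * f' (U w) (\<beta> w))) - B2 * C\<^sup>2 * h\<^sup>2) + 0 + (s + h - s) * expectation (\<lambda>w. \<Sum>j\<in>UNIV. q j j w)
     - (\<epsilon> * ((s + h - s) * expectation (\<lambda>w. (norm (I w *\<^sub>R H w))\<^sup>2)) + 2 * B2 * C^4 / \<delta>\<^sup>2 * expectation (\<lambda>w. (norm (Z w))^4))"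
    using low by (simp only: has_bochner_integral_iff)
  ultimately show ?thesis
    unfolding Z_def[symmetric] I_def[symmetric] by (simp add: algebra_simps)
qed

end


text \<open>The random time is approximated from below by times with values in a countable grid. The
  minimum with \<open>t\<close> never acts on these approximations; it makes \<open>X\<close>
  measurable at every grid index when the countable choice is composed.\<close>

lemma measurable_at_random_time:
  fixes X :: "real \<Rightarrow> 'w \<Rightarrow> 'a::euclidean_space"
  assumes X: "\<And>u. 0 \<le> u \<Longrightarrow> u \<le> t \<Longrightarrow> X u \<in> borel_measurable N"
    and cont: "\<And>w. w \<in> space N \<Longrightarrow> continuous_on {0..t} (\<lambda>u. X u w)"
    and \<rho>[measurable]: "\<rho> \<in> borel_measurable N" and \<rho>t: "\<And>w. w \<in> space N \<Longrightarrow> 0 \<le> \<rho> w \<and> \<rho> w \<le> t" and t: "0 \<le> t"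
  shows "(\<lambda>w. X (\<rho> w) w) \<in> borel_measurable N"
proof (rule borel_measurable_LIMSEQ_metric)
  define g where "g n w = nat \<lfloor>\<rho> w * real (Suc n)\<rfloor>" for n w
  show "(\<lambda>w. X (min (real (g n w) / real (Suc n)) t) w) \<in> borel_measurable N" for n
  proof (rule measurable_compose_countable[where f="\<lambda>i. X (min (real i / real (Suc n)) t)" and g="g n"])
    show "X (min (real i / real (Suc n)) t) \<in> borel_measurable N" for i :: nat using t by (intro X) auto
    show "g n \<in> measurable N (count_space UNIV)" unfolding g_def by measurable
  qed
  fix w assume w: "w \<in> space N"
  have lim: "(\<lambda>n. real (g n w) / real (Suc n)) \<longlonglongrightarrow> \<rho> w"
  proof (rule real_tendsto_sandwich)
    show "\<forall>\<^sub>F n in sequentially. \<rho> w - 1 / real (Suc n) \<le> real (g n w) / real (Suc n)"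
    proof (intro always_eventually allI)
      fix n
      have "\<rho> w * real (Suc n) - 1 \<le> real (g n w)" unfolding g_def by linarith
      then have "(\<rho> w * real (Suc n) - 1) / real (Suc n) \<le> real (g n w) / real (Suc n)" by (rule divide_right_mono) simp
      then show "\<rho> w - 1 / real (Suc n) \<le> real (g n w) / real (Suc n)" by (simp add: diff_divide_distrib del: of_nat_Suc)
    qed
    show "\<forall>\<^sub>F n in sequentially. real (g n w) / real (Suc n) \<le> \<rho> w"
    proof (intro always_eventually allI)
      fix n
      have "real (g n w) \<le> \<rho> w * real (Suc n)" unfolding g_def using \<rho>t[OF w] by (subst of_nat_nat) auto
      then show "real (g n w) / real (Suc n) \<le> \<rho> w" by (simp add: field_simps)
    qed
    show "(\<lambda>n. \<rho> w - 1 / real (Suc n)) \<longlonglongrightarrow> \<rho> w"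
      using tendsto_diff[OF tendsto_const LIMSEQ_Suc[OF lim_1_over_n], of "\<rho> w"] by simp
  qed simp
  then have "(\<lambda>n. min (real (g n w) / real (Suc n)) t) \<longlonglongrightarrow> min (\<rho> w) t"
    by (intro tendsto_min tendsto_const)
  moreover have "min (\<rho> w) t = \<rho> w" using \<rho>t[OF w] by simp
  ultimately have lim2: "(\<lambda>n. min (real (g n w) / real (Suc n)) t) \<longlonglongrightarrow> \<rho> w" by simp
  show "(\<lambda>n. X (min (real (g n w) / real (Suc n)) t) w) \<longlonglongrightarrow> X (\<rho> w) w"
    by (rule continuous_on_tendsto_compose[OF cont[OF w] lim2]) (use \<rho>t[OF w] t in auto)
qed

context sde_process
begin

text \<open>The operator with drift \<open>b\<close> and half the trace of \<open>\<sigma>\<close>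
  times its transpose against the Hessian, the trace being written as a sum over the columns of
  \<open>\<sigma>\<close>.\<close>

definition generator :: "(real^'d \<Rightarrow> (real^'d) \<Rightarrow>\<^sub>L real) \<Rightarrow> (real^'d \<Rightarrow> (real^'d) \<Rightarrow>\<^sub>L (real^'d) \<Rightarrow>\<^sub>L real) \<Rightarrow> real^'d \<Rightarrow> real" where
  "generator f' f'' x = f' x (b x) + (\<Sum>j\<in>UNIV. f'' x (column j (\<sigma> x)) (column j (\<sigma> x))) / 2"

text \<open>The Riemann sum \<open>u\<close> is only near the path position \<open>y\<close>, where
  the coefficients are taken; this converts the lower bound at \<open>y\<close> into the hypothesis
  \<open>gen\<close> of \<open>step_gain\<close>.\<close>

lemma generator_near:
  fixes f' :: "real^'d \<Rightarrow> (real^'d) \<Rightarrow>\<^sub>L real" and f'' :: "real^'d \<Rightarrow> (real^'d) \<Rightarrow>\<^sub>L (real^'d) \<Rightarrow>\<^sub>L real"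
  assumes f': "\<And>x. (f' has_derivative blinfun_apply (f'' x)) (at x)"
    and B2: "\<And>x. norm (f'' x) \<le> B2"
    and mod: "\<And>x z. norm z \<le> \<delta> \<Longrightarrow> norm (f'' (x + z) - f'' x) \<le> \<epsilon>'"
    and bd: "norm (b y) \<le> C" "norm (\<sigma> y) \<le> C" and h: "0 \<le> h" "h * C \<le> \<delta> / 2"
    and u: "norm (u - y) \<le> d" and d: "d \<le> \<delta> / 2" "B2 * d * C \<le> \<epsilon> / 2"
    and \<epsilon>': "real CARD('n) * \<epsilon>' * C\<^sup>2 \<le> \<epsilon>" "0 \<le> \<epsilon>'"
  shows "f' u (b y) + (\<Sum>j\<in>UNIV. f'' (u + h *\<^sub>R b y) (column j (\<sigma> y)) (column j (\<sigma> y))) / 2 \<ge> generator f' f'' y - \<epsilon>"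
proof -
  have C: "0 \<le> C" using bd norm_ge_zero order_trans by blast
  have B20: "0 \<le> B2" using B2[of 0] norm_ge_zero order_trans by blast
  have "norm (f' u - f' y) \<le> B2 * norm (u - y)"
  proof (rule differentiable_bound[where f'="\<lambda>x. blinfun_apply (f'' x)" and S=UNIV])
    show "onorm (blinfun_apply (f'' y)) \<le> B2" for y using B2[of y] by (simp add: norm_blinfun.rep_eq)
  qed (use f' in \<open>auto intro: has_derivative_at_withinI\<close>)
  also have "\<dots> \<le> B2 * d" using u B20 by (intro mult_left_mono)
  finally have l1: "norm (f' u - f' y) \<le> B2 * d" .
  have "\<bar>(f' u - f' y) (b y)\<bar> \<le> norm (f' u - f' y) * norm (b y)" using norm_blinfun[of "f' u - f' y" "b y"] by simp
  also have "\<dots> \<le> B2 * d * C"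
    using l1 bd C by (intro mult_mono) (auto intro: order_trans[OF norm_ge_zero])
  finally have 1: "\<bar>f' u (b y) - f' y (b y)\<bar> \<le> \<epsilon> / 2" using d by (simp add: blinfun.diff_left)
  have nw: "norm (u + h *\<^sub>R b y - y) \<le> \<delta>"
  proof -
    have "norm (u + h *\<^sub>R b y - y) \<le> norm (u - y) + norm (h *\<^sub>R b y)"
      using norm_triangle_ineq[of "u - y" "h *\<^sub>R b y"] by (simp add: algebra_simps)
    also have "norm (h *\<^sub>R b y) \<le> h * C" using bd h by (simp add: mult_left_mono)
    finally show ?thesis using u d h by linarith
  qed
  have m: "norm (f'' (u + h *\<^sub>R b y) - f'' y) \<le> \<epsilon>'" using mod[OF nw, of y] by simp
  have 2: "\<bar>f'' (u + h *\<^sub>R b y) v v - f'' y v v\<bar> \<le> \<epsilon>' * C\<^sup>2" if v: "norm v \<le> C" for v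
  proof -
    have "\<bar>(f'' (u + h *\<^sub>R b y) - f'' y) v v\<bar> \<le> norm ((f'' (u + h *\<^sub>R b y) - f'' y) v) * norm v"
      using norm_blinfun[of "(f'' (u + h *\<^sub>R b y) - f'' y) v" v] by simp
    also have "\<dots> \<le> (norm (f'' (u + h *\<^sub>R b y) - f'' y) * norm v) * norm v"
      by (intro mult_right_mono norm_blinfun) simp
    also have "\<dots> \<le> (\<epsilon>' * C) * C" using m v \<epsilon>' C by (intro mult_mono) auto
    finally show ?thesis by (simp add: blinfun.diff_left power2_eq_square mult.assoc)
  qed
  have "\<bar>(\<Sum>j\<in>UNIV. f'' (u + h *\<^sub>R b y) (column j (\<sigma> y)) (column j (\<sigma> y))) - (\<Sum>j\<in>UNIV. f'' y (column j (\<sigma> y)) (column j (\<sigma> y)))\<bar>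
     \<le> (\<Sum>j\<in>(UNIV::'n set). \<epsilon>' * C\<^sup>2)"
    unfolding sum_subtractf[symmetric]
    by (rule order_trans[OF sum_abs], intro sum_mono 2) (rule order_trans[OF norm_column_le' bd(2)])
  also have "\<dots> \<le> \<epsilon>" using \<epsilon>' by (simp add: mult.assoc)
  finally show ?thesis using 1 unfolding generator_def by linarith
qed

text \<open>The steps at which \<open>P\<close> holds form an initial segment, so summing the
  increments over them gives the value at the index where the segment ends.\<close>

lemma downset_telescope:
  fixes U :: "nat \<Rightarrow> real^'d" and f :: "real^'d \<Rightarrow> real"
  assumes down: "\<And>j k. k < n \<Longrightarrow> j \<le> k \<Longrightarrow> P k \<Longrightarrow> P j"
  obtains \<kappa> where "\<kappa> \<le> n" "\<And>k. k < n \<Longrightarrow> P k \<longleftrightarrow> k < \<kappa>"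
    "f (U 0) + (\<Sum>k<n. of_bool (P k) * (f (U (Suc k)) - f (U k))) = f (U \<kappa>)"
    "(\<Sum>k<n. of_bool (P k) * h) = real \<kappa> * h"
proof -
  define \<kappa> where "\<kappa> = card {k. k < n \<and> P k}"
  have "\<exists>m\<le>n. \<forall>k<n. P k \<longleftrightarrow> k < m"
    using down
  proof (induction n)
    case (Suc n)
    from Suc.IH Suc.prems obtain m where m: "m \<le> n" "\<forall>k<n. P k \<longleftrightarrow> k < m" by (meson less_SucI)
    show ?case
    proof (cases "P n")
      case True
      then have "\<forall>k<Suc n. P k" using Suc.prems[of n] by (auto simp: less_Suc_eq_le)
      then show ?thesis by (intro exI[of _ "Suc n"]) auto
    next
      case False
      then show ?thesis using m by (intro exI[of _ m]) (auto simp: less_Suc_eq)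
    qed
  qed simp
  then obtain m where m: "m \<le> n" "\<And>k. k < n \<Longrightarrow> P k \<longleftrightarrow> k < m" by blast
  have "(\<Sum>k<n. of_bool (P k) * (f (U (Suc k)) - f (U k))) = (\<Sum>k<m. f (U (Suc k)) - f (U k))"
    by (rule sum.mono_neutral_cong_right) (use m in auto)
  also have "\<dots> = f (U m) - f (U 0)" by (rule sum_lessThan_telescope)
  finally have 1: "f (U 0) + (\<Sum>k<n. of_bool (P k) * (f (U (Suc k)) - f (U k))) = f (U m)" by simp
  have "(\<Sum>k<n. of_bool (P k) * h) = (\<Sum>k<m. h)"
    by (rule sum.mono_neutral_cong_right) (use m in auto)
  then show ?thesis using that[OF m 1] by simp
qed

text \<open>The hypothesis \<open>opt\<close> says that \<open>\<rho> < u\<close> is an event of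
  \<open>F u\<close>, i.e. that \<open>\<rho>\<close> is an optional time from \<open>s\<close> on.
  On a grid this is exactly what makes the decision to take the step starting at \<open>u\<close>
  known at time \<open>u\<close>.\<close>

lemma optional_measurable:
  assumes s: "0 \<le> s" and \<rho>: "\<And>w. w \<in> space M \<Longrightarrow> s \<le> \<rho> w"
    and opt: "\<And>u. s \<le> u \<Longrightarrow> {w\<in>space M. u \<le> \<rho> w} \<in> sets (F u)"
  shows "\<rho> \<in> borel_measurable M"
  unfolding borel_measurable_iff_ge
proof
  fix u
  show "{w\<in>space M. u \<le> \<rho> w} \<in> events"
  proof (cases "s \<le> u")
    case True then show ?thesis using opt sets_F_M by blast
  next
    case False
    then have "{w\<in>space M. u \<le> \<rho> w} = space M" using \<rho> by force
    then show ?thesis by simp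
  qed
qed

lemma Y_at_optional_measurable:
  assumes s: "0 \<le> s" and \<rho>: "\<And>w. w \<in> space M \<Longrightarrow> s \<le> \<rho> w \<and> \<rho> w \<le> t" and t: "0 \<le> t"
    and opt: "\<And>u. s \<le> u \<Longrightarrow> {w\<in>space M. u \<le> \<rho> w} \<in> sets (F u)"
  shows "(\<lambda>w. Y (\<rho> w) w) \<in> borel_measurable M"
proof (rule measurable_at_random_time[where t=t])
  show "\<rho> \<in> borel_measurable M" by (rule optional_measurable[OF s _ opt]) (use \<rho> in auto)
  show "continuous_on {0..t} (\<lambda>u. Y u w)" if "w \<in> space M" for w
    by (rule continuous_on_subset[OF Y_cont[OF that]]) auto
  show "0 \<le> \<rho> w \<and> \<rho> w \<le> t" if "w \<in> space M" for w using \<rho>[OF that] s by auto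
qed (use t in auto)

lemma Y_closed_at_left:
  assumes w: "w \<in> space M" and s: "0 \<le> s" "s < u" and K: "closed K"
    and in_K: "\<And>r. s \<le> r \<Longrightarrow> r < u \<Longrightarrow> Y r w \<in> K"
  shows "Y u w \<in> K"
proof -
  define q where "q n = u - (u - s) / real (Suc n)" for n
  have q: "s \<le> q n" "q n < u" for n
  proof -
    have "(u - s) / real (Suc n) \<le> (u - s) / 1" using s by (intro divide_left_mono) auto
    then show "s \<le> q n" by (simp add: q_def)
    show "q n < u" using s by (simp add: q_def)
  qed
  have ql: "q \<longlonglongrightarrow> u"
    using tendsto_diff[OF tendsto_const LIMSEQ_Suc[OF lim_const_over_n[of "u - s"]], of u] by (simp add: q_def[abs_def])
  have "(\<lambda>n. Y (q n) w) \<longlonglongrightarrow> Y u w"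
    by (rule continuous_on_tendsto_compose[OF Y_cont[OF w] ql]) (use s order_trans[OF s(1) q(1)] in auto)
  then show ?thesis
    by (rule closed_sequentially[OF K, rotated]) (rule in_K[OF q])
qed

text \<open>\<open>step_gain\<close> is summed over the grid steps that start after
  \<open>\<rho>1\<close> but not after \<open>\<rho>2\<close>. The Riemann sums replace the path in
  this computation; as the mesh shrinks they converge uniformly, so the sums stopped on the grid
  converge to the values of \<open>f\<close> along the path at the two times.\<close>

theorem dynkin_ge:
  assumes s: "0 \<le> s" and T: "0 < T" and f: "C2b f f' f''" and K: "closed K"
    and bd: "\<And>x. x \<in> K \<Longrightarrow> norm (b x) \<le> C \<and> norm (\<sigma> x) \<le> C"
    and gen: "\<And>x. x \<in> K \<Longrightarrow> generator f' f'' x \<ge> c"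
    and \<rho>: "\<And>w. w \<in> space M \<Longrightarrow> s \<le> \<rho>1 w \<and> \<rho>1 w \<le> \<rho>2 w \<and> \<rho>2 w \<le> s + T"
    and opt1: "\<And>u. s \<le> u \<Longrightarrow> {w\<in>space M. u \<le> \<rho>1 w} \<in> sets (F u)"
    and opt2: "\<And>u. s \<le> u \<Longrightarrow> {w\<in>space M. u \<le> \<rho>2 w} \<in> sets (F u)"
    and Kin: "\<And>w r. w \<in> space M \<Longrightarrow> s \<le> r \<Longrightarrow> r < \<rho>2 w \<Longrightarrow> Y r w \<in> K"
  shows "expectation (\<lambda>w. f (Y (\<rho>2 w) w)) - expectation (\<lambda>w. f (Y (\<rho>1 w) w)) \<ge> c * expectation (\<lambda>w. \<rho>2 w - \<rho>1 w)"
proof -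
  have fd: "\<And>x. (f has_derivative blinfun_apply (f' x)) (at x)" and f'd: "\<And>x. (f' has_derivative blinfun_apply (f'' x)) (at x)"
    and uc: "uniformly_continuous_on UNIV f''"
    using f by (auto simp: C2b_def)
  obtain B0 where B0: "\<And>x. \<bar>f x\<bar> \<le> B0" using f by (auto simp: C2b_def bounded_iff)
  obtain B1 where B1: "\<And>x. norm (f' x) \<le> B1" using f by (auto simp: C2b_def bounded_iff)
  obtain B2 where B2: "\<And>x. norm (f'' x) \<le> B2" using f by (auto simp: C2b_def bounded_iff)
  have B10: "0 \<le> B1" and B20: "0 \<le> B2" using B1[of 0] B2[of 0] norm_ge_zero order_trans by blast+
  have f''c: "continuous_on UNIV f''" using uc by (rule uniformly_continuous_imp_continuous)
  have fc: "continuous_on UNIV f"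
    using has_derivative_continuous[OF fd] by (auto simp: continuous_on_eq_continuous_at)
  have fm[measurable]: "f \<in> borel_measurable borel" by (rule borel_measurable_continuous_onI[OF fc])
  have flip: "\<bar>f x - f y\<bar> \<le> B1 * norm (x - y)" for x y
  proof -
    have "norm (f x - f y) \<le> B1 * norm (x - y)"
    proof (rule differentiable_bound[where f'="\<lambda>x. blinfun_apply (f' x)" and S=UNIV])
      show "onorm (blinfun_apply (f' y)) \<le> B1" for y using B1[of y] by (simp add: norm_blinfun.rep_eq)
    qed (use fd in \<open>auto intro: has_derivative_at_withinI\<close>)
    then show ?thesis by simp
  qed
  \<comment> \<open>A positive bound to divide by; \<open>C\<close> itself is unconstrained when
    \<open>K\<close> is empty.\<close>
  define C' where "C' = \<bar>C\<bar> + 1"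
  have C': "C' > 0" "\<And>x. x \<in> K \<Longrightarrow> norm (b x) \<le> C' \<and> norm (\<sigma> x) \<le> C'"
    using bd by (force simp: C'_def)+
  have KYm[measurable]: "(\<lambda>w. Y (\<rho>1 w) w) \<in> borel_measurable M" "(\<lambda>w. Y (\<rho>2 w) w) \<in> borel_measurable M"
    by (rule Y_at_optional_measurable[OF s _ _ opt1, where t="s + T"] Y_at_optional_measurable[OF s _ _ opt2, where t="s + T"];
        use \<rho> s T in force)+
  have \<rho>m[measurable]: "\<rho>1 \<in> borel_measurable M" "\<rho>2 \<in> borel_measurable M"
    by (rule optional_measurable[OF s _ opt1] optional_measurable[OF s _ opt2]; use \<rho> in force)+
  define \<Delta> where "\<Delta> = expectation (\<lambda>w. f (Y (\<rho>2 w) w)) - expectation (\<lambda>w. f (Y (\<rho>1 w) w))"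
  define m where "m = expectation (\<lambda>w. \<rho>2 w - \<rho>1 w)"
  have key: "\<Delta> \<ge> (c - \<epsilon>) * m - \<epsilon> * T" if \<epsilon>: "\<epsilon> > 0" for \<epsilon>
  proof -
    \<comment> \<open>The modulus of the second derivative enters the generator once for each column
      of \<open>\<sigma>\<close>, each time with weight \<open>C'\<^sup>2\<close>.\<close>
    define \<epsilon>' where "\<epsilon>' = \<epsilon> / (real CARD('n) * C'\<^sup>2)"
    have n1: "1 \<le> real CARD('n)" by (simp add: Suc_leI)
    have \<epsilon>': "\<epsilon>' > 0" "real CARD('n) * \<epsilon>' * C'\<^sup>2 = \<epsilon>" using \<epsilon> C' by (auto simp: \<epsilon>'_def)
    have \<epsilon>'2: "\<epsilon>' * C'\<^sup>2 \<le> \<epsilon>"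
    proof -
      have "1 * (\<epsilon>' * C'\<^sup>2) \<le> real CARD('n) * (\<epsilon>' * C'\<^sup>2)" using n1 \<epsilon>' by (intro mult_right_mono) auto
      then show ?thesis using \<epsilon>'(2) by (simp add: mult.assoc)
    qed
    obtain \<delta>0 where \<delta>0: "\<delta>0 > 0" "\<And>x x'. dist x' x < \<delta>0 \<Longrightarrow> dist (f'' x') (f'' x) < \<epsilon>'"
      using uc \<epsilon>'(1) unfolding uniformly_continuous_on_def by blast
    define \<delta> where "\<delta> = \<delta>0 / 2"
    have \<delta>: "\<delta> > 0" using \<delta>0 by (simp add: \<delta>_def)
    have mod: "norm (f'' (x + z) - f'' x) \<le> \<epsilon>'" if "norm z \<le> \<delta>" for x z
      using \<delta>0(2)[of "x + z" x] that \<delta>0(1) by (auto simp: dist_norm \<delta>_def)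
    define B where "B = B2 + 1"
    have B: "B > 0" "B2 \<le> B" using B20 by (auto simp: B_def)
    define d where "d = min (\<delta> / 2) (\<epsilon> / (2 * B * C'))"
    have d: "d > 0" "d \<le> \<delta> / 2" "B2 * d * C' \<le> \<epsilon> / 2"
    proof -
      show d0: "d > 0" using \<delta> \<epsilon> C' B by (simp add: d_def)
      have "B2 * d * C' \<le> B * d * C'" using C' d0 B by (intro mult_right_mono) auto
      also have "\<dots> \<le> B * (\<epsilon> / (2 * B * C')) * C'"
        using C' B by (intro mult_right_mono mult_left_mono) (auto simp: d_def)
      also have "\<dots> = \<epsilon> / 2" using C' B by (simp add: field_simps)
      finally show "B2 * d * C' \<le> \<epsilon> / 2" .
    qed (simp add: d_def)
    define hh where "hh N = T / real (Suc N)" for N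
    have hh: "hh N > 0" for N using T by (simp add: hh_def)
    have hh0: "hh \<longlonglongrightarrow> 0" unfolding hh_def using LIMSEQ_Suc[OF lim_const_over_n[of T]] by simp
    define t where "t N k = s + real k * hh N" for N k
    have t_Suc: "t N (Suc k) = t N k + hh N" for N k by (simp add: t_def algebra_simps)
    have t_ge: "s \<le> t N k" for N k using hh[of N] by (simp add: t_def)
    have t_mono: "t N j \<le> t N k" if "j \<le> k" for N j k
      using that hh[of N] by (auto simp: t_def intro!: mult_right_mono)
    have t_end: "t N (Suc N) = s + T" for N by (simp add: t_def hh_def)
    define U where "U N k w = Y s w + rsum s (hh N) k w" for N k w
    have U_Suc: "U N (Suc k) w = U N k w + (hh N *\<^sub>R b (Y (t N k) w) + \<sigma> (Y (t N k) w) *v (W (t N k + hh N) w - W (t N k) w))" for N k w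
      unfolding U_def rsum_Suc t_Suc[symmetric] by (simp add: t_def add.assoc)
    have Ym: "Y (t N j) \<in> borel_measurable (F (t N k))" if "j \<le> k" for N j k
      by (rule Y_measurable_F) (use s t_ge[of N j] t_mono[OF that] in auto)
    have Um: "U N j \<in> borel_measurable (F (t N k))" if "j \<le> k" for N j k
    proof -
      have "rsum s (hh N) j \<in> borel_measurable (F (t N j))"
        unfolding t_def by (rule rsum_measurable_F) (use s hh[of N] in auto)
      moreover have "Y s \<in> borel_measurable (F (t N j))" using s t_ge by (intro Y_measurable_F)
      ultimately have "U N j \<in> borel_measurable (F (t N j))" unfolding U_def[abs_def] by measurable
      then show ?thesis by (rule measurable_F_mono) (rule t_mono[OF that])
    qed
    \<comment> \<open>Known at grid time \<open>k\<close>, and inherited by earlier grid times. Once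
      \<open>rerr\<close> is at most \<open>d\<close>, closeness is automatic, and membership in
      \<open>K\<close> holds as long as \<open>\<rho>2\<close> has not been passed, so
      \<open>G\<close> then imposes no further stopping.\<close>
    define G where "G N k w \<longleftrightarrow> (\<forall>j\<in>{..k}. Y (t N j) w \<in> K \<and> norm (U N j w - Y (t N j) w) \<le> d)" for N k w
    define D where "D \<rho> N k = {w\<in>space M. t N k \<le> \<rho> w \<and> G N k w}" for \<rho> :: "'w \<Rightarrow> real" and N k
    have Dm: "D \<rho> N k \<in> sets (F (t N k))" if opt: "\<And>u. s \<le> u \<Longrightarrow> {w\<in>space M. u \<le> \<rho> w} \<in> sets (F u)" for \<rho> N k
    proof -
      have "Measurable.pred (F (t N k)) (\<lambda>w. Y (t N j) w \<in> K)" if "j \<in> {..k}" for j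
        by (rule pred_sets2[OF borel_closed[OF K] Ym]) (use that in simp)
      moreover have "Measurable.pred (F (t N k)) (\<lambda>w. norm (U N j w - Y (t N j) w) \<le> d)" if "j \<in> {..k}" for j
      proof -
        have jk: "j \<le> k" using that by simp
        note [measurable] = Um[OF jk, of N] Ym[OF jk, of N]
        show ?thesis by measurable
      qed
      ultimately have "Measurable.pred (F (t N k)) (\<lambda>w. G N k w)"
        unfolding G_def by measurable
      then have "{w\<in>space (F (t N k)). G N k w} \<in> sets (F (t N k))" by (simp add: pred_def)
      then have "{w\<in>space M. t N k \<le> \<rho> w} \<inter> {w\<in>space M. G N k w} \<in> sets (F (t N k))"
        using opt[OF t_ge[of N k]] by (intro sets.Int) auto
      also have "{w\<in>space M. t N k \<le> \<rho> w} \<inter> {w\<in>space M. G N k w} = D \<rho> N k" by (auto simp: D_def)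
      finally show ?thesis .
    qed
    have D12: "D \<rho>1 N k \<subseteq> D \<rho>2 N k" for N k using \<rho> by (force simp: D_def)
    have D_down: "w \<in> D \<rho> N j" if "w \<in> D \<rho> N k" "j \<le> k" for w \<rho> N j k
      using that t_mono[OF that(2), of N] by (auto simp: D_def G_def)
    define \<Phi> where "\<Phi> \<rho> N w = f (U N 0 w) + (\<Sum>k<Suc N. of_bool (w \<in> D \<rho> N k) * (f (U N (Suc k) w) - f (U N k w)))" for \<rho> N w
    define \<Lambda> where "\<Lambda> \<rho> N w = (\<Sum>k<Suc N. of_bool (w \<in> D \<rho> N k) * hh N)" for \<rho> N w
    \<comment> \<open>The stopped sum is \<open>f\<close> at a random grid index, and on paths with
      small error the time of that index is within one step of \<open>\<rho>\<close>.\<close>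
    have shape: "\<exists>\<kappa>\<le>Suc N. \<Phi> \<rho> N w = f (U N \<kappa> w) \<and> \<Lambda> \<rho> N w = real \<kappa> * hh N \<and>
        (rerr s T N w \<le> d \<longrightarrow> \<bar>t N \<kappa> - \<rho> w\<bar> \<le> hh N)"
      if w: "w \<in> space M" and \<rho>b: "s \<le> \<rho> w" "\<rho> w \<le> \<rho>2 w" for \<rho> N w
    proof -
      obtain \<kappa> where \<kappa>: "\<kappa> \<le> Suc N" "\<And>k. k < Suc N \<Longrightarrow> w \<in> D \<rho> N k \<longleftrightarrow> k < \<kappa>"
        "\<Phi> \<rho> N w = f (U N \<kappa> w)" "\<Lambda> \<rho> N w = real \<kappa> * hh N"
        unfolding \<Phi>_def \<Lambda>_def
        by (rule downset_telescope[where n="Suc N" and P="\<lambda>k. w \<in> D \<rho> N k" and f=f and U="\<lambda>k. U N k w" and h="hh N"]) (auto intro: D_down)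
      have "\<bar>t N \<kappa> - \<rho> w\<bar> \<le> hh N" if good: "rerr s T N w \<le> d"
      proof -
        have near: "norm (U N j w - Y (t N j) w) \<le> d" if "j \<le> Suc N" for j
          using rerr_ge[OF that, of s T w] good by (simp add: U_def t_def hh_def algebra_simps)
        have up: "t N \<kappa> \<le> \<rho> w + hh N"
        proof (cases \<kappa>)
          case 0 then show ?thesis using \<rho>b hh[of N] by (simp add: t_def)
        next
          case (Suc k)
          then have "w \<in> D \<rho> N k" using \<kappa>(1) \<kappa>(2)[of k] by simp
          then have "t N k \<le> \<rho> w" by (simp add: D_def)
          then show ?thesis using Suc t_Suc by simp
        qed
        have low: "\<rho> w \<le> t N \<kappa> + hh N"
        proof (cases "\<kappa> = Suc N")
          case True then show ?thesis using t_end[of N] \<rho>[OF w] \<rho>b hh[of N] by simp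
        next
          case False
          then have k: "\<kappa> < Suc N" using \<kappa> by simp
          then have nD: "w \<notin> D \<rho> N \<kappa>" using \<kappa>(2)[OF k] by simp
          show ?thesis
          proof (cases "t N \<kappa> \<le> \<rho> w")
            case True
            then have "\<not> G N \<kappa> w" using nD w by (simp add: D_def)
            then obtain j where j: "j \<le> \<kappa>" "Y (t N j) w \<notin> K" using near k unfolding G_def by force
            have tj: "t N j \<le> \<rho>2 w" using t_mono[OF j(1), of N] True \<rho>b by linarith
            \<comment> \<open>\<open>Kin\<close> says nothing about the position at \<open>s\<close>
              when \<open>\<rho>2 w = s\<close>, so the path may start outside \<open>K\<close>;
              then \<open>\<rho> w = s\<close> and the bound holds anyway. In all other cases
              closedness of \<open>K\<close> covers the grid time that coincides with
              \<open>\<rho>2 w\<close>.\<close>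
            have "\<rho> w \<le> s"
            proof (rule ccontr)
              assume "\<not> \<rho> w \<le> s"
              then have s2: "s < \<rho>2 w" using \<rho>b by simp
              have "Y (t N j) w \<in> K"
              proof (cases "t N j < \<rho>2 w")
                case True then show ?thesis using Kin[OF w t_ge] by blast
              next
                case False
                then have e: "t N j = \<rho>2 w" using tj by simp
                show ?thesis unfolding e
                  by (rule Y_closed_at_left[OF w s s2 K]) (rule Kin[OF w])
              qed
              then show False using j by simp
            qed
            then show ?thesis using t_ge[of N \<kappa>] hh[of N] by linarith
          qed (use hh[of N] in linarith)
        qed
        show ?thesis using up low by linarith
      qed
      with \<kappa> show ?thesis by blast
    qed
    have \<Phi>m: "\<Phi> \<rho> N \<in> borel_measurable M" and \<Lambda>m: "\<Lambda> \<rho> N \<in> borel_measurable M"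
      if opt: "\<And>u. s \<le> u \<Longrightarrow> {w\<in>space M. u \<le> \<rho> w} \<in> sets (F u)" for \<rho> N
    proof -
      have [measurable]: "U N k \<in> borel_measurable M" for k using measurable_F_M[OF Um[of k k N]] by simp
      have [measurable]: "D \<rho> N k \<in> events" for k using sets_F_M[OF Dm[OF opt]] by simp
      show "\<Phi> \<rho> N \<in> borel_measurable M" "\<Lambda> \<rho> N \<in> borel_measurable M"
        unfolding \<Phi>_def[abs_def] \<Lambda>_def[abs_def] by measurable
    qed
    have \<Phi>b: "\<bar>\<Phi> \<rho> N w\<bar> \<le> B0" if "w \<in> space M" "s \<le> \<rho> w" "\<rho> w \<le> \<rho>2 w" for \<rho> N w
      using shape[of w \<rho> N, OF that] B0 by metis
    have \<Lambda>b: "\<bar>\<Lambda> \<rho> N w\<bar> \<le> T" for \<rho> N w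
    proof -
      have "0 \<le> \<Lambda> \<rho> N w" unfolding \<Lambda>_def using hh[of N] by (intro sum_nonneg) auto
      moreover have "\<Lambda> \<rho> N w \<le> (\<Sum>k<Suc N. hh N)" unfolding \<Lambda>_def using hh[of N] by (intro sum_mono) auto
      moreover have "(\<Sum>k<Suc N. hh N) = T" by (simp add: hh_def)
      ultimately show ?thesis by linarith
    qed
    define K' where "K' = B2 * C'\<^sup>2 + 2 * B2 * C'^4 / \<delta>\<^sup>2 * (3 * (real CARD('n))\<^sup>2)"
    have ineq: "expectation (\<lambda>w. \<Phi> \<rho>2 N w) - expectation (\<lambda>w. \<Phi> \<rho>1 N w) \<ge>
        (c - \<epsilon>) * (expectation (\<lambda>w. \<Lambda> \<rho>2 N w) - expectation (\<lambda>w. \<Lambda> \<rho>1 N w)) - (\<epsilon> * T + K' * hh N * T)"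
      if hN: "hh N * C' \<le> \<delta> / 2" for N
    proof -
      \<comment> \<open>The step starting at \<open>t N k\<close> is taken for
        \<open>\<rho>2\<close> but no longer for \<open>\<rho>1\<close>; this is decided at the
        start of the step.\<close>
      define E where "E k = D \<rho>2 N k - D \<rho>1 N k" for k
      have Em: "E k \<in> sets (F (t N k))" for k unfolding E_def by (intro sets.Diff Dm opt1 opt2)
    have ofb: "of_bool (w \<in> D \<rho>2 N k) - of_bool (w \<in> D \<rho>1 N k) = (indicator (E k) w :: real)" for w k
        using D12 by (auto simp: E_def indicator_def)
      have i\<Phi>: "integrable M (\<Phi> \<rho>2 N)" "integrable M (\<Phi> \<rho>1 N)"
        by (rule integrable_const_bound[where B=B0], use \<Phi>b \<rho> in \<open>force intro!: AE_I2\<close>, rule \<Phi>m, rule opt2 opt1, assumption)+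
      have i\<Lambda>: "integrable M (\<Lambda> \<rho>2 N)" "integrable M (\<Lambda> \<rho>1 N)"
        by (rule integrable_const_bound[where B=T], use \<Lambda>b in \<open>force intro!: AE_I2\<close>, rule \<Lambda>m, rule opt2 opt1, assumption)+
      have UM[measurable]: "U N k \<in> borel_measurable M" for k using measurable_F_M[OF Um[of k k N]] by simp
      have EM[measurable]: "E k \<in> events" for k using sets_F_M[OF Em] .
      have iE: "integrable M (\<lambda>w. indicator (E k) w * (f (U N (Suc k) w) - f (U N k w)))" for k
      proof (rule integrable_const_bound[where B="B0 + B0"])
        have "\<bar>f u - f v\<bar> \<le> B0 + B0" for u v using B0[of u] B0[of v] by linarith
        then show "AE w in M. norm (indicator (E k) w * (f (U N (Suc k) w) - f (U N k w))) \<le> B0 + B0"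
          using order_trans[OF abs_ge_zero B0] by (auto intro!: AE_I2 simp: indicator_def)
      qed measurable
      have "expectation (\<lambda>w. \<Phi> \<rho>2 N w) - expectation (\<lambda>w. \<Phi> \<rho>1 N w) = expectation (\<lambda>w. \<Phi> \<rho>2 N w - \<Phi> \<rho>1 N w)"
        using i\<Phi> by simp
      also have "\<dots> = expectation (\<lambda>w. \<Sum>k<Suc N. indicator (E k) w * (f (U N (Suc k) w) - f (U N k w)))"
        unfolding \<Phi>_def by (simp only: add_diff_add diff_self add_0 sum_subtractf[symmetric] left_diff_distrib[symmetric] ofb)
      also have "\<dots> = (\<Sum>k<Suc N. expectation (\<lambda>w. indicator (E k) w * (f (U N (Suc k) w) - f (U N k w))))"
        using iE by (intro Bochner_Integration.integral_sum)
      also have "\<dots> \<ge> (\<Sum>k<Suc N. hh N * (c - \<epsilon>) * prob (E k) - (\<epsilon>' * C'\<^sup>2 * hh N + K' * (hh N)\<^sup>2))"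
      proof (rule sum_mono)
        fix k
        have YK: "Y (t N k) w \<in> K" "norm (U N k w - Y (t N k) w) \<le> d" if "w \<in> E k" for w
          using that by (auto simp: E_def D_def G_def)
        show "hh N * (c - \<epsilon>) * prob (E k) - (\<epsilon>' * C'\<^sup>2 * hh N + K' * (hh N)\<^sup>2) \<le>
          expectation (\<lambda>w. indicator (E k) w * (f (U N (Suc k) w) - f (U N k w)))"
          unfolding U_Suc K'_def
        proof (rule step_gain[OF _ hh fd f'd f''c B0 B1 B2 mod \<delta> Um _ _ Em])
          show "0 \<le> t N k" using s t_ge order_trans by blast
          show "(\<lambda>w. b (Y (t N k) w)) \<in> borel_measurable (F (t N k))"
            by (rule measurable_compose[OF Ym b_measurable]) simp
          show "(\<lambda>w. \<sigma> (Y (t N k) w)) \<in> borel_measurable (F (t N k))"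
            by (rule measurable_compose[OF Ym \<sigma>_measurable]) simp
          show "norm (b (Y (t N k) w)) \<le> C' \<and> norm (\<sigma> (Y (t N k) w)) \<le> C'" if "w \<in> E k" for w
            using C'(2)[OF YK(1)[OF that]] .
          show "c - \<epsilon> \<le> f' (U N k w) (b (Y (t N k) w)) +
              (\<Sum>j\<in>UNIV. f'' (U N k w + hh N *\<^sub>R b (Y (t N k) w)) (column j (\<sigma> (Y (t N k) w))) (column j (\<sigma> (Y (t N k) w)))) / 2"
            if "w \<in> E k" for w
          proof -
            have "generator f' f'' (Y (t N k) w) - \<epsilon> \<le> f' (U N k w) (b (Y (t N k) w)) +
              (\<Sum>j\<in>UNIV. f'' (U N k w + hh N *\<^sub>R b (Y (t N k) w)) (column j (\<sigma> (Y (t N k) w))) (column j (\<sigma> (Y (t N k) w)))) / 2"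
              by (rule generator_near[OF f'd B2 mod _ _ _ hN YK(2)[OF that] d(2,3)])
                (use C'(2)[OF YK(1)[OF that]] hh[of N] \<epsilon>' in auto)
            then show ?thesis using gen[OF YK(1)[OF that]] by linarith
          qed
        qed simp_all
      qed
      also have "(\<Sum>k<Suc N. hh N * (c - \<epsilon>) * prob (E k) - (\<epsilon>' * C'\<^sup>2 * hh N + K' * (hh N)\<^sup>2)) =
         (c - \<epsilon>) * (\<Sum>k<Suc N. hh N * prob (E k)) - real (Suc N) * (\<epsilon>' * C'\<^sup>2 * hh N + K' * (hh N)\<^sup>2)"
        by (simp add: sum_subtractf sum_distrib_left mult_ac del: sum.lessThan_Suc of_nat_Suc)
      also have "(\<Sum>k<Suc N. hh N * prob (E k)) = expectation (\<lambda>w. \<Lambda> \<rho>2 N w) - expectation (\<lambda>w. \<Lambda> \<rho>1 N w)"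
      proof -
        have "expectation (\<lambda>w. \<Lambda> \<rho>2 N w) - expectation (\<lambda>w. \<Lambda> \<rho>1 N w) = expectation (\<lambda>w. \<Lambda> \<rho>2 N w - \<Lambda> \<rho>1 N w)"
          using i\<Lambda> by simp
        also have "\<dots> = expectation (\<lambda>w. \<Sum>k<Suc N. indicator (E k) w * hh N)"
          unfolding \<Lambda>_def by (simp only: sum_subtractf[symmetric] left_diff_distrib[symmetric] ofb)
        also have "\<dots> = (\<Sum>k<Suc N. expectation (\<lambda>w. indicator (E k) w * hh N))"
          by (rule Bochner_Integration.integral_sum) (auto simp: emeasure_eq_measure)
        also have "\<dots> = (\<Sum>k<Suc N. hh N * prob (E k))" by (simp add: mult.commute del: sum.lessThan_Suc)
        finally show ?thesis by simp
      qed
      also have "real (Suc N) * (\<epsilon>' * C'\<^sup>2 * hh N + K' * (hh N)\<^sup>2) = \<epsilon>' * C'\<^sup>2 * T + K' * hh N * T"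
      proof -
        have NT: "real (Suc N) * hh N = T" by (simp add: hh_def)
        have "real (Suc N) * (\<epsilon>' * C'\<^sup>2 * hh N + K' * (hh N)\<^sup>2) =
          \<epsilon>' * C'\<^sup>2 * (real (Suc N) * hh N) + K' * hh N * (real (Suc N) * hh N)"
          by (simp add: algebra_simps power2_eq_square del: of_nat_Suc)
        then show ?thesis unfolding NT .
      qed
      finally have "(c - \<epsilon>) * (expectation (\<lambda>w. \<Lambda> \<rho>2 N w) - expectation (\<lambda>w. \<Lambda> \<rho>1 N w)) - (\<epsilon>' * C'\<^sup>2 * T + K' * hh N * T)
        \<le> expectation (\<lambda>w. \<Phi> \<rho>2 N w) - expectation (\<lambda>w. \<Phi> \<rho>1 N w)" .
      moreover have "\<epsilon>' * C'\<^sup>2 * T \<le> \<epsilon> * T" using \<epsilon>'2 T by (intro mult_right_mono) auto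
      ultimately show ?thesis by linarith
    qed
    \<comment> \<open>The stopping index depends on the whole path, so almost sure convergence along
      a subsequence is used, followed by dominated convergence.\<close>
    obtain r where r: "strict_mono (r :: nat \<Rightarrow> nat)" "AE w in M. (\<lambda>n. rerr s T (r n) w) \<longlonglongrightarrow> 0"
      by (rule tends0_AE_subseq[OF riemann_uniform[OF s T]]) (rule rerr_nonneg)
    have hr: "(\<lambda>n. hh (r n)) \<longlonglongrightarrow> 0" using LIMSEQ_subseq_LIMSEQ[OF hh0 r(1)] by (simp add: o_def)
    have lims: "AE w in M. (\<lambda>n. \<Phi> \<rho> (r n) w) \<longlonglongrightarrow> f (Y (\<rho> w) w) \<and> (\<lambda>n. \<Lambda> \<rho> (r n) w) \<longlonglongrightarrow> \<rho> w - s"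
      if \<rho>b: "\<And>w. w \<in> space M \<Longrightarrow> s \<le> \<rho> w \<and> \<rho> w \<le> \<rho>2 w" for \<rho>
      using r(2) AE_space
    proof eventually_elim
      case (elim w)
      have "\<forall>n. \<exists>\<kappa>\<le>Suc (r n). \<Phi> \<rho> (r n) w = f (U (r n) \<kappa> w) \<and> \<Lambda> \<rho> (r n) w = real \<kappa> * hh (r n) \<and>
        (rerr s T (r n) w \<le> d \<longrightarrow> \<bar>t (r n) \<kappa> - \<rho> w\<bar> \<le> hh (r n))"
        using shape[OF elim(2)] \<rho>b[OF elim(2)] by blast
      then obtain \<kappa> where \<kappa>: "\<And>n. \<kappa> n \<le> Suc (r n)" "\<And>n. \<Phi> \<rho> (r n) w = f (U (r n) (\<kappa> n) w)"
        "\<And>n. \<Lambda> \<rho> (r n) w = real (\<kappa> n) * hh (r n)"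
        "\<And>n. rerr s T (r n) w \<le> d \<Longrightarrow> \<bar>t (r n) (\<kappa> n) - \<rho> w\<bar> \<le> hh (r n)" by metis
      have "\<forall>\<^sub>F n in sequentially. rerr s T (r n) w < d" by (rule order_tendstoD(2)[OF elim(1) d(1)])
      then have "\<forall>\<^sub>F n in sequentially. norm (t (r n) (\<kappa> n) - \<rho> w) \<le> hh (r n)"
        by eventually_elim (use \<kappa>(4) in auto)
      then have "(\<lambda>n. t (r n) (\<kappa> n) - \<rho> w) \<longlonglongrightarrow> 0" by (rule Lim_null_comparison[OF _ hr])
      then have tl: "(\<lambda>n. t (r n) (\<kappa> n)) \<longlonglongrightarrow> \<rho> w" by (simp add: LIM_zero_iff)
      have Yl: "(\<lambda>n. Y (t (r n) (\<kappa> n)) w) \<longlonglongrightarrow> Y (\<rho> w) w"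
      proof (rule continuous_on_tendsto_compose[OF Y_cont[OF elim(2)] tl])
        show "\<rho> w \<in> {0..}" using \<rho>b[OF elim(2)] s by simp
        have "0 \<le> t (r n) (\<kappa> n)" for n using s t_ge[of "r n" "\<kappa> n"] by linarith
        then show "\<forall>\<^sub>F n in sequentially. t (r n) (\<kappa> n) \<in> {0..}" by simp
      qed
      have fY: "(\<lambda>n. f (Y (t (r n) (\<kappa> n)) w)) \<longlonglongrightarrow> f (Y (\<rho> w) w)"
        by (rule continuous_on_tendsto_compose[OF fc Yl]) auto
      have "(\<lambda>n. \<Phi> \<rho> (r n) w - f (Y (t (r n) (\<kappa> n)) w)) \<longlonglongrightarrow> 0"
      proof (rule Lim_null_comparison)
        show "\<forall>\<^sub>F n in sequentially. norm (\<Phi> \<rho> (r n) w - f (Y (t (r n) (\<kappa> n)) w)) \<le> B1 * rerr s T (r n) w"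
        proof (intro always_eventually allI)
          fix n
          have "norm (\<Phi> \<rho> (r n) w - f (Y (t (r n) (\<kappa> n)) w)) \<le> B1 * norm (U (r n) (\<kappa> n) w - Y (t (r n) (\<kappa> n)) w)"
            unfolding \<kappa>(2) using flip by simp
          also have "\<dots> \<le> B1 * rerr s T (r n) w"
            using rerr_ge[OF \<kappa>(1)[of n], of s T w] B10 by (intro mult_left_mono) (simp add: U_def t_def hh_def algebra_simps)
          finally show "norm (\<Phi> \<rho> (r n) w - f (Y (t (r n) (\<kappa> n)) w)) \<le> B1 * rerr s T (r n) w" .
        qed
        show "(\<lambda>n. B1 * rerr s T (r n) w) \<longlonglongrightarrow> 0" using tendsto_mult_left[OF elim(1), of B1] by simp
      qed
      from tendsto_add[OF this fY] have "(\<lambda>n. \<Phi> \<rho> (r n) w) \<longlonglongrightarrow> f (Y (\<rho> w) w)" by simp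
      moreover have "(\<lambda>n. \<Lambda> \<rho> (r n) w) \<longlonglongrightarrow> \<rho> w - s"
        using tendsto_diff[OF tl tendsto_const, of s] by (simp add: \<kappa>(3) t_def)
      ultimately show ?case by blast
    qed
    have E\<Phi>: "(\<lambda>n. expectation (\<Phi> \<rho> (r n))) \<longlonglongrightarrow> expectation (\<lambda>w. f (Y (\<rho> w) w))"
      and E\<Lambda>: "(\<lambda>n. expectation (\<Lambda> \<rho> (r n))) \<longlonglongrightarrow> expectation (\<lambda>w. \<rho> w - s)"
      if opt: "\<And>u. s \<le> u \<Longrightarrow> {w\<in>space M. u \<le> \<rho> w} \<in> sets (F u)"
        and \<rho>b: "\<And>w. w \<in> space M \<Longrightarrow> s \<le> \<rho> w \<and> \<rho> w \<le> \<rho>2 w"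
        and m: "(\<lambda>w. Y (\<rho> w) w) \<in> borel_measurable M" "\<rho> \<in> borel_measurable M" for \<rho>
    proof -
      note [measurable] = m \<Phi>m[OF opt] \<Lambda>m[OF opt]
      show "(\<lambda>n. expectation (\<Phi> \<rho> (r n))) \<longlonglongrightarrow> expectation (\<lambda>w. f (Y (\<rho> w) w))"
      proof (rule integral_dominated_convergence[where w="\<lambda>_. B0"])
        show "AE w in M. (\<lambda>n. \<Phi> \<rho> (r n) w) \<longlonglongrightarrow> f (Y (\<rho> w) w)"
          using lims[of \<rho>] \<rho>b by auto
        show "AE w in M. norm (\<Phi> \<rho> (r n) w) \<le> B0" for n using \<Phi>b \<rho>b by (auto intro!: AE_I2)
      qed auto
      show "(\<lambda>n. expectation (\<Lambda> \<rho> (r n))) \<longlonglongrightarrow> expectation (\<lambda>w. \<rho> w - s)"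
      proof (rule integral_dominated_convergence[where w="\<lambda>_. T"])
        show "AE w in M. (\<lambda>n. \<Lambda> \<rho> (r n) w) \<longlonglongrightarrow> \<rho> w - s"
          using lims[of \<rho>] \<rho>b by auto
        show "AE w in M. norm (\<Lambda> \<rho> (r n) w) \<le> T" for n using \<Lambda>b by (auto intro!: AE_I2)
      qed auto
    qed
    have \<rho>b1: "s \<le> \<rho>1 w \<and> \<rho>1 w \<le> \<rho>2 w" and \<rho>b2: "s \<le> \<rho>2 w \<and> \<rho>2 w \<le> \<rho>2 w" if "w \<in> space M" for w
      using \<rho>[OF that] by auto
    have "\<forall>\<^sub>F n in sequentially. hh (r n) < \<delta> / 2 / C'"
      by (rule order_tendstoD(2)[OF hr]) (use \<delta> C' in simp)
    then have ev: "\<forall>\<^sub>F n in sequentially. (c - \<epsilon>) * (expectation (\<Lambda> \<rho>2 (r n)) - expectation (\<Lambda> \<rho>1 (r n))) - (\<epsilon> * T + K' * hh (r n) * T)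
        \<le> expectation (\<Phi> \<rho>2 (r n)) - expectation (\<Phi> \<rho>1 (r n))"
    proof eventually_elim
      case (elim n)
      then show ?case using C' by (intro ineq) (simp add: field_simps)
    qed
    have "(c - \<epsilon>) * (expectation (\<lambda>w. \<rho>2 w - s) - expectation (\<lambda>w. \<rho>1 w - s)) - (\<epsilon> * T + K' * 0 * T)
       \<le> expectation (\<lambda>w. f (Y (\<rho>2 w) w)) - expectation (\<lambda>w. f (Y (\<rho>1 w) w))"
    proof (rule tendsto_le[OF sequentially_bot _ _ ev])
      show "(\<lambda>n. expectation (\<Phi> \<rho>2 (r n)) - expectation (\<Phi> \<rho>1 (r n))) \<longlonglongrightarrow>
          expectation (\<lambda>w. f (Y (\<rho>2 w) w)) - expectation (\<lambda>w. f (Y (\<rho>1 w) w))"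
        by (intro tendsto_diff E\<Phi> opt1 opt2 \<rho>b1 \<rho>b2 KYm \<rho>m)
      show "(\<lambda>n. (c - \<epsilon>) * (expectation (\<Lambda> \<rho>2 (r n)) - expectation (\<Lambda> \<rho>1 (r n))) - (\<epsilon> * T + K' * hh (r n) * T))
        \<longlonglongrightarrow> (c - \<epsilon>) * (expectation (\<lambda>w. \<rho>2 w - s) - expectation (\<lambda>w. \<rho>1 w - s)) - (\<epsilon> * T + K' * 0 * T)"
        by (intro tendsto_intros E\<Lambda> opt1 opt2 \<rho>b1 \<rho>b2 KYm \<rho>m hr)
    qed
    moreover have "expectation (\<lambda>w. \<rho>2 w - s) - expectation (\<lambda>w. \<rho>1 w - s) = m"
    proof -
      have "integrable M (\<lambda>w. \<rho>2 w - s)" "integrable M (\<lambda>w. \<rho>1 w - s)"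
        by (rule integrable_const_bound[where B=T], use \<rho> in \<open>force intro!: AE_I2\<close>, measurable)+
      then show ?thesis unfolding m_def by (subst Bochner_Integration.integral_diff[symmetric]) auto
    qed
    ultimately show ?thesis by (simp add: \<Delta>_def)
  qed
  have "\<Delta> \<ge> c * m"
  proof (rule field_le_epsilon)
    fix e :: real assume e: "e > 0"
    have mT: "0 \<le> m" "m \<le> T"
    proof -
      show "0 \<le> m" unfolding m_def by (rule integral_nonneg_AE) (use \<rho> in \<open>force intro!: AE_I2\<close>)
      have "m \<le> expectation (\<lambda>w. T)"
        unfolding m_def by (rule integral_mono_AE, rule integrable_const_bound[where B=T]) (use \<rho> in \<open>force intro!: AE_I2\<close>)+
      then show "m \<le> T" by (simp add: prob_space)
    qed
    have "(c - e / (2 * T)) * m - e / (2 * T) * T \<le> \<Delta>" by (rule key) (use e T in simp)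
    moreover have "e / (2 * T) * m \<le> e / (2 * T) * T" using mT e T by (intro mult_left_mono) auto
    moreover have "e / (2 * T) * T = e / 2" using T by simp
    ultimately show "c * m \<le> \<Delta> + e" by (simp add: left_diff_distrib)
  qed
  then show ?thesis by (simp add: \<Delta>_def m_def)
qed

end


section \<open>Test functions\<close>

text \<open>The derivatives are carried as explicit maps, so that chain and product rule yield terms
  in which they can be estimated or shown to vanish.\<close>

definition C2f :: "('a::euclidean_space \<Rightarrow> real) \<Rightarrow> ('a \<Rightarrow> 'a \<Rightarrow>\<^sub>L real) \<Rightarrow> ('a \<Rightarrow> 'a \<Rightarrow>\<^sub>L 'a \<Rightarrow>\<^sub>L real) \<Rightarrow> bool" where
  "C2f f f' f'' \<longleftrightarrow> (\<forall>x. (f has_derivative blinfun_apply (f' x)) (at x)) \<and>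
     (\<forall>x. (f' has_derivative blinfun_apply (f'' x)) (at x)) \<and> continuous_on UNIV f''"

lemma C2_has_derivative:
  assumes "C2 f"
  shows "(f has_derivative blinfun_apply (D1 f x)) (at x)" "(D1 f has_derivative blinfun_apply (D2 f x)) (at x)"
proof -
  have *: "(h has_derivative blinfun_apply (D1 h x)) (at x)" if "h differentiable_on UNIV" for h :: "'a \<Rightarrow> 'c::real_normed_vector"
  proof -
    have d: "(h has_derivative frechet_derivative h (at x)) (at x)"
      using that frechet_derivative_works by (auto simp: differentiable_on_def)
    then show ?thesis by (simp add: D1_def bounded_linear_Blinfun_apply[OF has_derivative_bounded_linear])
  qed
  show "(f has_derivative blinfun_apply (D1 f x)) (at x)" "(D1 f has_derivative blinfun_apply (D2 f x)) (at x)"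
    using assms by (auto simp: C2_def intro: *)
qed

lemma C2_continuous_on: "C2 f \<Longrightarrow> continuous_on UNIV f"
  by (auto simp: C2_def intro: differentiable_imp_continuous_on)

lemma C2_C2f: "C2 f \<Longrightarrow> C2f f (D1 f) (D2 f)"
  using C2_has_derivative by (auto simp: C2f_def C2_def)

lemma C2f_continuous:
  assumes "C2f f f' f''" shows "continuous_on UNIV f" "continuous_on UNIV f'" "continuous_on UNIV f''"
proof -
  have "isCont f x" "isCont f' x" for x
    using assms has_derivative_continuous by (force simp: C2f_def)+
  then show "continuous_on UNIV f" "continuous_on UNIV f'" "continuous_on UNIV f''"
    using assms by (auto simp: C2f_def continuous_on_eq_continuous_at)
qed

text \<open>The rank one bilinear form \<open>p v * q u\<close>, the shape of products of first
  derivatives inside a second derivative.\<close>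

definition tensor :: "('a::real_normed_vector \<Rightarrow>\<^sub>L real) \<Rightarrow> ('a \<Rightarrow>\<^sub>L real) \<Rightarrow> 'a \<Rightarrow>\<^sub>L 'a \<Rightarrow>\<^sub>L real" where
  "tensor p q = blinfun_scaleR_left q o\<^sub>L p"

lemma tensor_apply[simp]: "tensor p q v = p v *\<^sub>R q"
  by (simp add: tensor_def)

lemma norm_tensor_le: "norm (tensor p q) \<le> norm p * norm q"
proof (rule norm_blinfun_bound)
  fix v
  have "norm (p v) * norm q \<le> (norm p * norm v) * norm q" by (intro mult_right_mono norm_blinfun) simp
  then show "norm (tensor p q v) \<le> norm p * norm q * norm v" by (simp add: mult_ac)
qed simp

lemma continuous_on_tensor[continuous_intros]:
  fixes p q :: "'b::topological_space \<Rightarrow> 'a::real_normed_vector \<Rightarrow>\<^sub>L real"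
  assumes "continuous_on S p" "continuous_on S q" shows "continuous_on S (\<lambda>x. tensor (p x) (q x))"
proof -
  have "bounded_bilinear (tensor :: ('a \<Rightarrow>\<^sub>L real) \<Rightarrow> ('a \<Rightarrow>\<^sub>L real) \<Rightarrow> 'a \<Rightarrow>\<^sub>L 'a \<Rightarrow>\<^sub>L real)"
    by standard (auto intro!: blinfun_eqI exI[of _ 1] order_trans[OF norm_tensor_le]
      simp: blinfun.add_left blinfun.add_right blinfun.scaleR_left scaleR_add_left scaleR_add_right)
  then show ?thesis by (rule bounded_bilinear.continuous_on[OF _ assms])
qed

lemma C2f_compose:
  assumes f: "C2f f f' f''" and h: "\<And>u. (h has_real_derivative h' u) (at u)" "\<And>u. (h' has_real_derivative h'' u) (at u)"
    and hc: "continuous_on UNIV h''"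
  shows "C2f (\<lambda>x. h (f x)) (\<lambda>x. h' (f x) *\<^sub>R f' x) (\<lambda>x. h'' (f x) *\<^sub>R tensor (f' x) (f' x) + h' (f x) *\<^sub>R f'' x)"
  unfolding C2f_def
proof (intro conjI allI)
  fix x
  have fd: "(f has_derivative blinfun_apply (f' x)) (at x)" and fd': "(f' has_derivative blinfun_apply (f'' x)) (at x)"
    using f by (auto simp: C2f_def)
  have hf: "((\<lambda>x. h (f x)) has_derivative (\<lambda>v. f' x v * h' (f x))) (at x)"
    and hf': "((\<lambda>x. h' (f x)) has_derivative (\<lambda>v. f' x v * h'' (f x))) (at x)"
    using has_derivative_compose[OF fd, of h] has_derivative_compose[OF fd, of h'] h
    by (auto simp: has_field_derivative_def mult.commute)
  show "((\<lambda>x. h (f x)) has_derivative blinfun_apply (h' (f x) *\<^sub>R f' x)) (at x)"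
    by (rule has_derivative_eq_rhs[OF hf]) (auto simp: blinfun.scaleR_left)
  have "((\<lambda>x. h' (f x) *\<^sub>R f' x) has_derivative (\<lambda>v. h' (f x) *\<^sub>R f'' x v + (f' x v * h'' (f x)) *\<^sub>R f' x)) (at x)"
    by (rule has_derivative_scaleR[OF hf' fd'])
  then show "((\<lambda>x. h' (f x) *\<^sub>R f' x) has_derivative blinfun_apply (h'' (f x) *\<^sub>R tensor (f' x) (f' x) + h' (f x) *\<^sub>R f'' x)) (at x)"
    by (rule has_derivative_eq_rhs) (auto simp: blinfun.add_left blinfun.scaleR_left add.commute mult.commute)
next
  have h'c: "continuous_on UNIV h'"
    using h(2) by (auto simp: continuous_on_eq_continuous_at intro: DERIV_isCont)
  show "continuous_on UNIV (\<lambda>x. h'' (f x) *\<^sub>R tensor (f' x) (f' x) + h' (f x) *\<^sub>R f'' x)"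
    by (intro continuous_intros C2f_continuous[OF f] continuous_on_compose2[OF hc] continuous_on_compose2[OF h'c]) auto
qed

lemma C2f_mult:
  assumes f: "C2f f f' f''" and g: "C2f g g' g''"
  shows "C2f (\<lambda>x. f x * g x) (\<lambda>x. f x *\<^sub>R g' x + g x *\<^sub>R f' x)
    (\<lambda>x. f x *\<^sub>R g'' x + tensor (f' x) (g' x) + g x *\<^sub>R f'' x + tensor (g' x) (f' x))"
  unfolding C2f_def
proof (intro conjI allI)
  fix x
  have d: "(f has_derivative blinfun_apply (f' x)) (at x)" "(f' has_derivative blinfun_apply (f'' x)) (at x)"
    "(g has_derivative blinfun_apply (g' x)) (at x)" "(g' has_derivative blinfun_apply (g'' x)) (at x)"
    using f g by (auto simp: C2f_def)
  show "((\<lambda>x. f x * g x) has_derivative blinfun_apply (f x *\<^sub>R g' x + g x *\<^sub>R f' x)) (at x)"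
    by (rule has_derivative_eq_rhs[OF has_derivative_mult[OF d(1,3)]]) (auto simp: blinfun.add_left blinfun.scaleR_left)
  show "((\<lambda>x. f x *\<^sub>R g' x + g x *\<^sub>R f' x) has_derivative
     blinfun_apply (f x *\<^sub>R g'' x + tensor (f' x) (g' x) + g x *\<^sub>R f'' x + tensor (g' x) (f' x))) (at x)"
    by (rule has_derivative_eq_rhs[OF has_derivative_add[OF has_derivative_scaleR[OF d(1,4)] has_derivative_scaleR[OF d(3,2)]]])
      (auto simp: blinfun.add_left blinfun.scaleR_left add.assoc)
next
  show "continuous_on UNIV (\<lambda>x. f x *\<^sub>R g'' x + tensor (f' x) (g' x) + g x *\<^sub>R f'' x + tensor (g' x) (f' x))"
    by (intro continuous_intros C2f_continuous[OF f] C2f_continuous[OF g])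
qed

text \<open>The inner product as a bounded bilinear form, i.e. the Hessian of half the squared
  norm.\<close>

definition inner_form :: "'a::euclidean_space \<Rightarrow>\<^sub>L 'a \<Rightarrow>\<^sub>L real" where
  "inner_form = Blinfun blinfun_inner_left"

lemma inner_form_apply[simp]: "inner_form v = blinfun_inner_left v"
  by (simp add: inner_form_def bounded_linear_Blinfun_apply bounded_linear_blinfun_inner_left)

lemma C2f_dist_sq:
  "C2f (\<lambda>x::'a::euclidean_space. (norm (x - y))\<^sup>2 * c) (\<lambda>x. (2 * c) *\<^sub>R blinfun_inner_left (x - y)) (\<lambda>x. (2 * c) *\<^sub>R inner_form)"
  unfolding C2f_def
proof (intro conjI allI)
  fix x :: 'a
  show "((\<lambda>x. (norm (x - y))\<^sup>2 * c) has_derivative blinfun_apply ((2 * c) *\<^sub>R blinfun_inner_left (x - y))) (at x)"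
    unfolding power2_norm_eq_inner
    by (auto intro!: derivative_eq_intros simp: blinfun.scaleR_left inner_commute algebra_simps)
  have "((\<lambda>x. (2 * c) *\<^sub>R blinfun_inner_left (x - y)) has_derivative (\<lambda>v. (2 * c) *\<^sub>R blinfun_inner_left v)) (at x)"
    by (rule has_derivative_scaleR_right bounded_linear.has_derivative[OF bounded_linear_blinfun_inner_left] |
       rule derivative_eq_intros refl | simp)+
  then show "((\<lambda>x. (2 * c) *\<^sub>R blinfun_inner_left (x - y)) has_derivative blinfun_apply ((2 * c) *\<^sub>R inner_form)) (at x)"
    by (rule has_derivative_eq_rhs) (auto simp: blinfun.scaleR_left)
qed simp

text \<open>The cubic ramp vanishes to second order at \<open>0\<close>, which makes the cutoffs below \<open>C\<^sup>2\<close>.\<close>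

definition ramp :: "real \<Rightarrow> real" where "ramp u = (max 0 u)^3"

lemma ramp_derivative:
  "(ramp has_real_derivative 3 * (max 0 u)\<^sup>2) (at u)"
  "((\<lambda>u. 3 * (max 0 u)\<^sup>2) has_real_derivative 6 * max 0 u) (at u)"
proof -
  have pw: "((\<lambda>u::real. (max 0 u)^(Suc (Suc n))) has_real_derivative real (Suc (Suc n)) * (max 0 u)^(Suc n)) (at u)" for n
  proof (cases "u = 0")
    case False
    then consider "u > 0" | "u < 0" by linarith
    then show ?thesis
    proof cases
      case 1
      have "((\<lambda>u::real. u^(Suc (Suc n))) has_real_derivative real (Suc (Suc n)) * (max 0 u)^(Suc n)) (at u)"
        using DERIV_pow[of "Suc (Suc n)" u] 1 by (simp add: max_def)
      then show ?thesis
        by (rule has_field_derivative_transform_within_open[where S="{0<..}"]) (use 1 in auto)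
    next
      case 2
      have "((\<lambda>u::real. 0) has_real_derivative real (Suc (Suc n)) * (max 0 u)^(Suc n)) (at u)"
        using 2 by (auto intro!: derivative_eq_intros)
      then show ?thesis
        by (rule has_field_derivative_transform_within_open[where S="{..<0}"]) (use 2 in auto)
    qed
  next
    case True
    \<comment> \<open>At the kink the difference quotient is dominated by a positive power of
      \<open>max 0 h\<close>, so the derivative is \<open>0\<close> from both sides.\<close>
    have "((\<lambda>h::real. ((max 0 (0 + h))^(Suc (Suc n)) - (max 0 0)^(Suc (Suc n))) / h) \<longlongrightarrow> 0) (at 0)"
    proof (rule Lim_null_comparison)
      show "\<forall>\<^sub>F h in at (0::real). norm (((max 0 (0 + h))^(Suc (Suc n)) - (max 0 0)^(Suc (Suc n))) / h) \<le> (max 0 h)^(Suc n)"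
        by (intro always_eventually allI) (auto simp: max_def)
      show "((\<lambda>h::real. (max 0 h)^(Suc n)) \<longlongrightarrow> 0) (at 0)"
        using tendsto_power[OF tendsto_max[OF tendsto_const tendsto_ident_at], of "0::real" "Suc n" "0::real" UNIV] by simp
    qed
    then show ?thesis using True by (simp add: DERIV_def)
  qed
  show "(ramp has_real_derivative 3 * (max 0 u)\<^sup>2) (at u)"
    using pw[of 1] by (simp add: ramp_def[abs_def] numeral_3_eq_3 numeral_2_eq_2)
  show "((\<lambda>u. 3 * (max 0 u)\<^sup>2) has_real_derivative 6 * max 0 u) (at u)"
    using DERIV_cmult[OF pw[of 0], of 3] by (simp add: numeral_2_eq_2)
qed

text \<open>The ball is enlarged by one so that two points at distance below \<open>1\<close> either
  both lie in the compact set or both lie where \<open>F\<close> vanishes.\<close>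

lemma uniformly_continuous_vanishing:
  fixes F :: "'a::euclidean_space \<Rightarrow> 'b::real_normed_vector"
  assumes F: "continuous_on UNIV F" and z: "\<And>x. R < dist a x \<Longrightarrow> F x = 0"
  shows "uniformly_continuous_on UNIV F" "bounded (range F)"
proof -
  have c: "continuous_on (cball a (R + 1)) F" using F continuous_on_subset by blast
  then have u: "uniformly_continuous_on (cball a (R + 1)) F" by (intro compact_uniformly_continuous) auto
  show "uniformly_continuous_on UNIV F"
    unfolding uniformly_continuous_on_def
  proof (intro allI impI)
    fix e :: real assume "e > 0"
    then obtain d where d: "d > 0" "\<And>x y. x \<in> cball a (R + 1) \<Longrightarrow> y \<in> cball a (R + 1) \<Longrightarrow> dist y x < d \<Longrightarrow> dist (F y) (F x) < e"
      using u unfolding uniformly_continuous_on_def by metis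
    show "\<exists>d>0. \<forall>x\<in>UNIV. \<forall>x'\<in>UNIV. dist x' x < d \<longrightarrow> dist (F x') (F x) < e"
    proof (intro exI[of _ "min d 1"] conjI ballI impI)
      fix x y :: 'a assume xy: "dist y x < min d 1"
      show "dist (F y) (F x) < e"
      proof (cases "x \<in> cball a (R + 1) \<and> y \<in> cball a (R + 1)")
        case True then show ?thesis using d xy by auto
      next
        case False
        have "dist a x \<le> dist a y + dist y x" "dist a y \<le> dist a x + dist y x"
          using dist_triangle[of a x y] dist_triangle[of a y x] by (auto simp: dist_commute)
        then have "R < dist a x" "R < dist a y" using False xy by auto
        then show ?thesis using z \<open>e > 0\<close> by simp
      qed
    qed (use d in auto)
  qed
  have "bounded (F ` cball a (R + 1))" by (intro compact_imp_bounded compact_continuous_image c) simp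
  moreover have "range F \<subseteq> insert 0 (F ` cball a (R + 1))"
  proof
    fix v assume "v \<in> range F"
    then obtain x where "v = F x" by auto
    then show "v \<in> insert 0 (F ` cball a (R + 1))" using z[of x] by (cases "R < dist a x") auto
  qed
  ultimately show "bounded (range F)" by (meson bounded_insert bounded_subset)
qed

lemma C2b_of_vanishing:
  assumes f: "C2f f f' f''" and z: "\<And>x. R < dist a x \<Longrightarrow> f x = 0 \<and> f' x = 0 \<and> f'' x = 0"
  shows "C2b f f' f''"
proof -
  note c = C2f_continuous[OF f]
  show ?thesis
    using f uniformly_continuous_vanishing[OF c(1), of R a] uniformly_continuous_vanishing[OF c(2), of R a]
      uniformly_continuous_vanishing[OF c(3), of R a] z
    by (auto simp: C2b_def C2f_def)
qed

text \<open>The cubic ramp of \<open>1 - \<bar>x - y\<bar>\<^sup>2 / r\<^sup>2\<close>. Its outer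
  derivatives are at most \<open>3\<close> and \<open>6\<close>, and the inner gradient at most
  \<open>2 / r\<close>, whence \<open>3 * 2 = 6\<close> and \<open>6 * 4 + 3 * 2 = 30\<close>. The
  decay in \<open>r\<close> is what shows that the stopped process rarely travels far.\<close>

lemma bump_exists:
  fixes y :: "'a::euclidean_space"
  assumes r: "r > 0"
  obtains f f' f'' where "C2b f f' f''" "f y = 1" "\<And>x. 0 \<le> f x" "\<And>x. f x \<le> 1" "\<And>x. r \<le> dist x y \<Longrightarrow> f x = 0"
    "\<And>x. norm (f' x) \<le> 6 / r" "\<And>x. norm (f'' x) \<le> 30 / r\<^sup>2"
proof -
  define h where "h u = ramp (1 - u)" for u
  define h1 where "h1 u = - (3 * (max 0 (1 - u))\<^sup>2)" for u :: real
  define h2 where "h2 u = 6 * max 0 (1 - u)" for u :: real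
  have h: "(h has_real_derivative h1 u) (at u)" "(h1 has_real_derivative h2 u) (at u)" for u
  proof -
    have i: "((\<lambda>u. 1 - u) has_real_derivative -1) (at u)" by (auto intro!: derivative_eq_intros)
    show "(h has_real_derivative h1 u) (at u)"
      unfolding h_def[abs_def] h1_def using DERIV_chain2[OF ramp_derivative(1) i] by simp
    show "(h1 has_real_derivative h2 u) (at u)"
      unfolding h1_def[abs_def] h2_def using DERIV_minus[OF DERIV_chain2[OF ramp_derivative(2) i]] by simp
  qed
  have h2c: "continuous_on UNIV h2" unfolding h2_def[abs_def] by (intro continuous_intros)
  let ?u = "\<lambda>x. (norm (x - y))\<^sup>2 * (1 / r\<^sup>2)"
  let ?p = "\<lambda>x. (2 * (1 / r\<^sup>2)) *\<^sub>R blinfun_inner_left (x - y)"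
  let ?f' = "\<lambda>x. h1 (?u x) *\<^sub>R ?p x"
  let ?f'' = "\<lambda>x. h2 (?u x) *\<^sub>R tensor (?p x) (?p x) + h1 (?u x) *\<^sub>R ((2 * (1 / r\<^sup>2)) *\<^sub>R inner_form)"
  have C: "C2f (\<lambda>x. h (?u x)) ?f' ?f''" by (rule C2f_compose[OF C2f_dist_sq h h2c])
  have u1: "1 \<le> ?u x" if "r \<le> dist x y" for x
  proof -
    have "r\<^sup>2 \<le> (norm (x - y))\<^sup>2" using that r by (intro power_mono) (auto simp: dist_norm)
    then show ?thesis using r by (simp add: field_simps)
  qed
  have z: "h (?u x) = 0 \<and> ?f' x = 0 \<and> ?f'' x = 0" if "r \<le> dist x y" for x
    using u1[OF that] by (simp add: h_def h1_def h2_def ramp_def max_def)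
  have h01: "0 \<le> h u" "h u \<le> 1" "\<bar>h1 u\<bar> \<le> 3" "\<bar>h2 u\<bar> \<le> 6" if "0 \<le> u" for u
    using that power_le_one[of "max 0 (1 - u)" 2] power_le_one[of "max 0 (1 - u)" 3]
    by (auto simp: h_def h1_def h2_def ramp_def)
  have np: "norm (?p x) \<le> 2 / r" if "dist x y < r" for x
  proof -
    have "norm (blinfun_inner_left (x - y)) \<le> norm (x - y)"
      by (rule norm_blinfun_bound) (auto simp: Cauchy_Schwarz_ineq2 inner_commute mult.commute)
    also have "\<dots> \<le> r" using that by (simp add: dist_norm)
    finally have "2 * (1 / r\<^sup>2) * norm (blinfun_inner_left (x - y)) \<le> 2 * (1 / r\<^sup>2) * r"
      by (intro mult_left_mono) auto
    then show ?thesis using r by (simp add: power2_eq_square)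
  qed
  have ni: "norm (inner_form :: 'a \<Rightarrow>\<^sub>L 'a \<Rightarrow>\<^sub>L real) \<le> 1"
    by (rule norm_blinfun_bound) (auto intro!: norm_blinfun_bound simp: Cauchy_Schwarz_ineq2 inner_commute mult.commute)
  show ?thesis
  proof (rule that[of "\<lambda>x. h (?u x)" ?f' ?f''])
    show "C2b (\<lambda>x. h (?u x)) ?f' ?f''"
      by (rule C2b_of_vanishing[OF C, of r y]) (rule z, simp add: dist_commute)
    show "h (?u y) = 1" by (simp add: h_def ramp_def)
    show "0 \<le> h (?u x)" "h (?u x) \<le> 1" for x by (rule h01, simp)+
    show "r \<le> dist x y \<Longrightarrow> h (?u x) = 0" for x using z by blast
    show "norm (?f' x) \<le> 6 / r" for x
    proof (cases "dist x y < r")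
      case True
      have "\<bar>h1 (?u x)\<bar> * norm (?p x) \<le> 3 * (2 / r)" using h01(3)[of "?u x"] np[OF True] by (intro mult_mono) auto
      also have "3 * (2 / r) = 6 / r" by simp
      finally show ?thesis by (simp only: norm_scaleR)
    next
      case False
      then have e: "?f' x = 0" using z[of x] by (meson not_less)
      show ?thesis unfolding e using r by simp
    qed
    show "norm (?f'' x) \<le> 30 / r\<^sup>2" for x
    proof (cases "dist x y < r")
      case True
      have "norm (tensor (?p x) (?p x)) \<le> (2 / r) * (2 / r)"
        using np[OF True] r by (intro order_trans[OF norm_tensor_le] mult_mono) auto
      then have "\<bar>h2 (?u x)\<bar> * norm (tensor (?p x) (?p x)) \<le> 6 * ((2 / r) * (2 / r))"
        using h01(4)[of "?u x"] by (intro mult_mono) auto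
      moreover have "\<bar>h1 (?u x)\<bar> * (\<bar>2 * (1 / r\<^sup>2)\<bar> * norm (inner_form :: 'a \<Rightarrow>\<^sub>L 'a \<Rightarrow>\<^sub>L real)) \<le> 3 * (2 / r\<^sup>2 * 1)"
        using h01(3)[of "?u x"] ni by (intro mult_mono) auto
      moreover have "norm (?f'' x) \<le> \<bar>h2 (?u x)\<bar> * norm (tensor (?p x) (?p x)) + \<bar>h1 (?u x)\<bar> * (\<bar>2 * (1 / r\<^sup>2)\<bar> * norm (inner_form :: 'a \<Rightarrow>\<^sub>L 'a \<Rightarrow>\<^sub>L real))"
        by (rule order_trans[OF norm_triangle_ineq]) (simp only: norm_scaleR order_refl)
      ultimately show ?thesis by (simp add: power2_eq_square)
    next
      case False
      then have e: "?f'' x = 0" using z[of x] by (meson not_less)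
      show ?thesis unfolding e by simp
    qed
  qed
qed

text \<open>The exponential of \<open>\<xi>\<close> need not be bounded, so it is multiplied by a
  function that is constantly \<open>1\<close> on the ball. Value and both derivatives are then
  unchanged there, and the product has compact support.\<close>

lemma exp_cutoff_exists:
  fixes \<xi> :: "'a::euclidean_space \<Rightarrow> real"
  assumes \<xi>: "C2f \<xi> \<xi>' \<xi>''" and R: "R > 0"
  obtains f f' f'' where "C2b f f' f''"
    "\<And>x. x \<in> cball 0 R \<Longrightarrow> f x = exp (\<mu> * \<xi> x)"
    "\<And>x. x \<in> cball 0 R \<Longrightarrow> f' x = (\<mu> * exp (\<mu> * \<xi> x)) *\<^sub>R \<xi>' x"
    "\<And>x. x \<in> cball 0 R \<Longrightarrow> f'' x = (\<mu>\<^sup>2 * exp (\<mu> * \<xi> x)) *\<^sub>R tensor (\<xi>' x) (\<xi>' x) + (\<mu> * exp (\<mu> * \<xi> x)) *\<^sub>R \<xi>'' x"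
proof -
  \<comment> \<open>Equal to \<open>1\<close> for \<open>u \<le> 1\<close> and to \<open>0\<close>
    for \<open>u \<ge> 2\<close>; the two nested ramps keep both transitions twice continuously
    differentiable.\<close>
  define k where "k u = ramp (1 - ramp (u - 1))" for u
  define k1 where "k1 u = - (3 * (max 0 (1 - ramp (u - 1)))\<^sup>2) * (3 * (max 0 (u - 1))\<^sup>2)" for u
  define k2 where "k2 u = (6 * max 0 (1 - ramp (u - 1))) * (3 * (max 0 (u - 1))\<^sup>2)\<^sup>2 - (3 * (max 0 (1 - ramp (u - 1)))\<^sup>2) * (6 * max 0 (u - 1))" for u
  have k: "(k has_real_derivative k1 u) (at u)" "(k1 has_real_derivative k2 u) (at u)" for u
  proof -
    have i: "((\<lambda>u. u - 1) has_real_derivative 1) (at u)" by (auto intro!: derivative_eq_intros)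
    have r1: "((\<lambda>u. ramp (u - 1)) has_real_derivative 3 * (max 0 (u - 1))\<^sup>2) (at u)"
      using DERIV_chain2[OF ramp_derivative(1) i] by simp
    have r2: "((\<lambda>u. 3 * (max 0 (u - 1))\<^sup>2) has_real_derivative 6 * max 0 (u - 1)) (at u)"
      using DERIV_chain2[OF ramp_derivative(2) i] by simp
    have j: "((\<lambda>u. 1 - ramp (u - 1)) has_real_derivative - (3 * (max 0 (u - 1))\<^sup>2)) (at u)"
      using DERIV_diff[OF DERIV_const r1] by simp
    show "(k has_real_derivative k1 u) (at u)"
      unfolding k_def[abs_def] k1_def using DERIV_chain2[OF ramp_derivative(1) j] by simp
    show "(k1 has_real_derivative k2 u) (at u)"
      unfolding k1_def[abs_def] k2_def
      using DERIV_mult[OF DERIV_minus[OF DERIV_chain2[OF ramp_derivative(2) j]] r2]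
      by (rule DERIV_cong) (simp add: power2_eq_square)
  qed
  have rc: "continuous_on UNIV (\<lambda>u. ramp (u - 1))" unfolding ramp_def by (intro continuous_intros)
  have k2c: "continuous_on UNIV k2" unfolding k2_def[abs_def] by (intro continuous_intros rc)
  have e: "((\<lambda>u. exp (\<mu> * u)) has_real_derivative \<mu> * exp (\<mu> * u)) (at u)"
    "((\<lambda>u. \<mu> * exp (\<mu> * u)) has_real_derivative \<mu>\<^sup>2 * exp (\<mu> * u)) (at u)" for u
    by (auto intro!: derivative_eq_intros simp: power2_eq_square)
  have ec: "continuous_on UNIV (\<lambda>u. \<mu>\<^sup>2 * exp (\<mu> * u))" by (intro continuous_intros)
  let ?u = "\<lambda>x::'a. (norm (x - 0))\<^sup>2 * (1 / R\<^sup>2)"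
  note Q = C2f_mult[OF C2f_compose[OF \<xi> e ec] C2f_compose[OF C2f_dist_sq k k2c], of 0 "1 / R\<^sup>2"]
  have in_ball: "?u x \<le> 1" if "x \<in> cball 0 R" for x :: 'a
  proof -
    have "(norm x)\<^sup>2 \<le> R\<^sup>2" using that by (intro power_mono) auto
    then show ?thesis using R by (simp add: field_simps)
  qed
  have k_in: "k u = 1 \<and> k1 u = 0 \<and> k2 u = 0" if "u \<le> 1" for u
    using that by (simp add: k_def k1_def k2_def ramp_def max_def)
  have k_out: "k u = 0 \<and> k1 u = 0 \<and> k2 u = 0" if "2 \<le> u" for u
  proof -
    have "1 \<le> ramp (u - 1)" using that one_le_power[of "u - 1" 3] by (simp add: ramp_def max_def)
    then show ?thesis by (simp add: k_def k1_def k2_def ramp_def[of "1 - ramp (u - 1)"] max_def)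
  qed
  have out: "2 \<le> ?u x" if "2 * R < dist 0 x" for x :: 'a
  proof -
    have "(2 * R)\<^sup>2 \<le> (norm x)\<^sup>2" using that R by (intro power_mono) (auto simp: dist_norm)
    then have "4 * R\<^sup>2 \<le> (norm x)\<^sup>2" by (simp add: power_mult_distrib)
    then have "2 * R\<^sup>2 \<le> (norm x)\<^sup>2" using zero_le_power2[of R] by linarith
    then show ?thesis using R by (simp add: field_simps)
  qed
  note cb = C2b_of_vanishing[OF Q, of "2 * R" 0]
  show ?thesis
  proof (rule that, rule cb)
    fix x :: 'a assume "2 * R < dist 0 x"
    from k_out[OF out[OF this]] show "exp (\<mu> * \<xi> x) * k (?u x) = 0 \<and>
        exp (\<mu> * \<xi> x) *\<^sub>R k1 (?u x) *\<^sub>R (2 * (1 / R\<^sup>2)) *\<^sub>R blinfun_inner_left (x - 0) + k (?u x) *\<^sub>R (\<mu> * exp (\<mu> * \<xi> x)) *\<^sub>R \<xi>' x = 0 \<and>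
        exp (\<mu> * \<xi> x) *\<^sub>R (k2 (?u x) *\<^sub>R tensor ((2 * (1 / R\<^sup>2)) *\<^sub>R blinfun_inner_left (x - 0)) ((2 * (1 / R\<^sup>2)) *\<^sub>R blinfun_inner_left (x - 0)) + k1 (?u x) *\<^sub>R (2 * (1 / R\<^sup>2)) *\<^sub>R inner_form) +
        tensor ((\<mu> * exp (\<mu> * \<xi> x)) *\<^sub>R \<xi>' x) (k1 (?u x) *\<^sub>R (2 * (1 / R\<^sup>2)) *\<^sub>R blinfun_inner_left (x - 0)) +
        k (?u x) *\<^sub>R ((\<mu>\<^sup>2 * exp (\<mu> * \<xi> x)) *\<^sub>R tensor (\<xi>' x) (\<xi>' x) + (\<mu> * exp (\<mu> * \<xi> x)) *\<^sub>R \<xi>'' x) +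
        tensor (k1 (?u x) *\<^sub>R (2 * (1 / R\<^sup>2)) *\<^sub>R blinfun_inner_left (x - 0)) ((\<mu> * exp (\<mu> * \<xi> x)) *\<^sub>R \<xi>' x) = 0"
      by (auto intro!: blinfun_eqI simp: blinfun.add_left blinfun.scaleR_left)
  qed (use k_in[OF in_ball] in \<open>auto intro!: blinfun_eqI simp: blinfun.add_left blinfun.scaleR_left\<close>)
qed


section \<open>Entrance times\<close>

text \<open>An entrance time after \<open>s\<close>, cut off at the horizon \<open>T\<close>.
  Inserting \<open>T\<close> keeps the set nonempty, so the time is a real number and the path can
  be evaluated at it.\<close>

definition ent :: "real \<Rightarrow> real \<Rightarrow> (real \<Rightarrow> bool) \<Rightarrow> real" where
  "ent s T P = Inf (insert T {r. s \<le> r \<and> r \<le> T \<and> P r})"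

lemma ent_bdd: "bdd_below (insert T {r. s \<le> r \<and> r \<le> T \<and> P r})" for T :: real
  by (rule bdd_belowI[of _ "min s T"]) auto

lemma ent_le_T: "ent s T P \<le> T"
  unfolding ent_def by (rule cInf_lower[OF _ ent_bdd]) simp

lemma ent_ge_s: "s \<le> T \<Longrightarrow> s \<le> ent s T P"
  unfolding ent_def by (rule cInf_greatest) auto

lemma ent_le: "s \<le> r \<Longrightarrow> r \<le> T \<Longrightarrow> P r \<Longrightarrow> ent s T P \<le> r"
  unfolding ent_def by (rule cInf_lower[OF _ ent_bdd]) simp

lemma not_before_ent: "s \<le> r \<Longrightarrow> r < ent s T P \<Longrightarrow> \<not> P r"
  using ent_le[of s r T P] ent_le_T[of s T P] by force

lemma ent_geI: "u \<le> T \<Longrightarrow> (\<And>r. s \<le> r \<Longrightarrow> r < u \<Longrightarrow> \<not> P r) \<Longrightarrow> u \<le> ent s T P"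
  unfolding ent_def by (rule cInf_greatest) (force simp: not_less[symmetric])+

text \<open>Only times strictly before \<open>u\<close> occur on the right, which is why the
  entrance time is optional for open and closed sets alike.\<close>

lemma ent_ge_iff: "s \<le> u \<Longrightarrow> u \<le> ent s T P \<longleftrightarrow> u \<le> T \<and> (\<forall>r. s \<le> r \<and> r < u \<longrightarrow> \<not> P r)"
  using ent_le_T[of s T P] not_before_ent[of s _ T P] ent_geI[of u T s P] by fastforce

lemma ent_less: "ent s T P < v \<Longrightarrow> v \<le> T \<Longrightarrow> s \<le> T \<Longrightarrow> \<exists>r. ent s T P \<le> r \<and> r < v \<and> P r"
proof (rule ccontr)
  assume a: "ent s T P < v" "v \<le> T" "s \<le> T" and n: "\<not> (\<exists>r. ent s T P \<le> r \<and> r < v \<and> P r)"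
  have "v \<le> ent s T P"
  proof (rule ent_geI[OF a(2)])
    fix r assume "s \<le> r" "r < v"
    then show "\<not> P r" using n not_before_ent[of s r T P] by force
  qed
  then show False using a by simp
qed

lemma ent_antimono: "(\<And>r. s \<le> r \<Longrightarrow> r \<le> T \<Longrightarrow> P r \<Longrightarrow> Q r) \<Longrightarrow> s \<le> T \<Longrightarrow> ent s T Q \<le> ent s T P"
  by (rule ent_geI[OF ent_le_T]) (meson ent_le_T less_imp_le less_le_trans not_before_ent)

lemma ent_eqI: "s \<le> u \<Longrightarrow> u \<le> T \<Longrightarrow> P u \<Longrightarrow> (\<And>r. s \<le> r \<Longrightarrow> r < u \<Longrightarrow> \<not> P r) \<Longrightarrow> ent s T P = u"
  by (intro antisym ent_le ent_geI)

text \<open>The infimum is attained by continuity; only the cut-off at \<open>T\<close> could be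
  taken without the condition holding.\<close>

lemma ent_closed_ge:
  assumes z: "continuous_on {s..T} z" and s: "s \<le> T" and e: "ent s T (\<lambda>r. z r \<ge> c) < T"
  shows "z (ent s T (\<lambda>r. z r \<ge> c)) \<ge> (c::real)"
proof (rule ccontr)
  let ?u = "ent s T (\<lambda>r. z r \<ge> c)"
  assume "\<not> z ?u \<ge> c"
  then have u: "z ?u < c" by simp
  have uI: "?u \<in> {s..T}" using ent_ge_s[OF s] ent_le_T by auto
  then obtain d where d: "d > 0" "\<And>r. r \<in> {s..T} \<Longrightarrow> dist r ?u < d \<Longrightarrow> dist (z r) (z ?u) < c - z ?u"
    using z u unfolding continuous_on_iff by (metis diff_gt_0_iff_gt)
  obtain r where r: "?u \<le> r" "r < min T (?u + d)" "z r \<ge> c"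
    using ent_less[of s T "\<lambda>r. z r \<ge> c" "min T (?u + d)"] e d(1) s by auto
  then have "dist (z r) (z ?u) < c - z ?u" using uI by (intro d(2)) (auto simp: dist_real_def)
  then show False using r by (auto simp: dist_real_def)
qed

lemma continuous_le_from_rationals:
  fixes z :: "real \<Rightarrow> real"
  assumes z: "continuous_on {s..v} z" and sv: "s < v" and q: "\<And>r. r \<in> \<rat> \<Longrightarrow> s \<le> r \<Longrightarrow> r \<le> v \<Longrightarrow> z r \<le> c"
    and r: "s \<le> r" "r \<le> v"
  shows "z r \<le> c"
proof (rule ccontr)
  assume n: "\<not> z r \<le> c"
  have rI: "r \<in> {s..v}" using r by simp
  obtain d where d: "d > 0" "\<And>x. x \<in> {s..v} \<Longrightarrow> dist x r < d \<Longrightarrow> dist (z x) (z r) < z r - c"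
    using z rI n unfolding continuous_on_iff by (metis diff_gt_0_iff_gt not_le)
  obtain x where "x \<in> \<rat>" "x \<in> {s..v}" "\<bar>x - r\<bar> < d"
    using Rats_dense_in_Icc[OF sv rI d(1)] by blast
  then show False using d(2)[of x] q[of x] by (auto simp: dist_real_def)
qed

context sde_process
begin

lemma gY_cont: "continuous_on UNIV g \<Longrightarrow> w \<in> space M \<Longrightarrow> 0 \<le> s \<Longrightarrow> continuous_on {s..t} (\<lambda>r. g (Y r w))"
  by (rule continuous_on_compose2[OF _ continuous_on_subset[OF Y_cont]]) auto

lemma gY_measurable_F:
  fixes g :: "real^'d \<Rightarrow> real"
  assumes "continuous_on UNIV g" "0 \<le> r" "r \<le> u"
  shows "(\<lambda>w. g (Y r w)) \<in> borel_measurable (F u)"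
  using measurable_compose[OF Y_measurable_F[OF assms(2,3)] borel_measurable_continuous_onI[OF assms(1)]] .

text \<open>By continuity an exceedance of an open level occurs at a rational time as well, leaving
  countably many conditions known at time \<open>u\<close>.\<close>

lemma not_open_before:
  fixes g :: "real^'d \<Rightarrow> real"
  assumes g: "continuous_on UNIV g" and s: "0 \<le> s" "s \<le> u"
  shows "{w\<in>space M. \<forall>r. s \<le> r \<and> r < u \<longrightarrow> \<not> g (Y r w) > c} \<in> sets (F u)"
proof (cases "s = u")
  case True
  then have "{w\<in>space M. \<forall>r. s \<le> r \<and> r < u \<longrightarrow> \<not> g (Y r w) > c} = space (F u)" by auto
  then show ?thesis by (simp only: sets.top)
next
  case False
  have "{w\<in>space (F u). \<forall>r\<in>\<rat> \<inter> {s..<u}. g (Y r w) \<le> c} \<in> sets (F u)"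
  proof (rule sets.sets_Collect_countable_All')
    show "countable (\<rat> \<inter> {s..<u})" using countable_rat by blast
    fix r assume r: "r \<in> \<rat> \<inter> {s..<u}"
    have "(\<lambda>w. g (Y r w)) \<in> borel_measurable (F u)" using r s by (intro gY_measurable_F[OF g]) auto
    then show "{w\<in>space (F u). g (Y r w) \<le> c} \<in> sets (F u)" by measurable
  qed
  also have "{w\<in>space (F u). \<forall>r\<in>\<rat> \<inter> {s..<u}. g (Y r w) \<le> c} = {w\<in>space M. \<forall>r. s \<le> r \<and> r < u \<longrightarrow> \<not> g (Y r w) > c}"
  proof (intro Collect_cong iffI conjI; elim conjE)
    fix w assume w: "w \<in> space (F u)" and q: "\<forall>r\<in>\<rat> \<inter> {s..<u}. g (Y r w) \<le> c"
    show "\<forall>r. s \<le> r \<and> r < u \<longrightarrow> \<not> g (Y r w) > c"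
    proof (intro allI impI)
      fix r assume r: "s \<le> r \<and> r < u"
      obtain v where v: "r < v" "v < u" using dense r by blast
      have "g (Y r w) \<le> c"
        by (rule continuous_le_from_rationals[OF gY_cont[OF g _ s(1)], of w v]) (use w r v q in auto)
      then show "\<not> g (Y r w) > c" by simp
    qed
  qed (auto simp: not_less)
  finally show ?thesis .
qed

text \<open>A closed condition cannot be tested at rational times. Up to a time
  \<open>v < u\<close>, however, compactness leaves a positive margin below the level, so the event
  is a countable combination of those for the open levels
  \<open>c - 1 / real (Suc k)\<close>.\<close>

lemma not_closed_before:
  fixes g :: "real^'d \<Rightarrow> real"
  assumes g: "continuous_on UNIV g" and s: "0 \<le> s" "s \<le> u"
  shows "{w\<in>space M. \<forall>r. s \<le> r \<and> r < u \<longrightarrow> \<not> g (Y r w) \<ge> c} \<in> sets (F u)"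
proof -
  let ?B = "\<lambda>v k. {w\<in>space M. \<forall>r. s \<le> r \<and> r < v \<longrightarrow> \<not> g (Y r w) > c - 1 / real (Suc k)}"
  have B: "?B v k \<in> sets (F u)" if "v \<in> \<rat> \<inter> {s<..<u}" for v k
    using not_open_before[OF g s(1), of v] F_mono[of v u] that by auto
  have "space (F u) \<inter> (\<Inter>v\<in>\<rat> \<inter> {s<..<u}. \<Union>k. ?B v k) \<in> sets (F u)"
  proof (cases "\<rat> \<inter> {s<..<u} = {}")
    case False
    have "countable (\<rat> \<inter> {s<..<u})" using countable_rat by blast
    then have "(\<Inter>v\<in>\<rat> \<inter> {s<..<u}. \<Union>k. ?B v k) \<in> sets (F u)"
      using B False by (intro sets.countable_INT' sets.countable_UN) auto
    then show ?thesis by (intro sets.Int sets.top)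
  next
    case True
    show ?thesis unfolding True using sets.top[of "F u"] by simp
  qed
  also have "space (F u) \<inter> (\<Inter>v\<in>\<rat> \<inter> {s<..<u}. \<Union>k. ?B v k) = {w\<in>space M. \<forall>r. s \<le> r \<and> r < u \<longrightarrow> \<not> g (Y r w) \<ge> c}"
  proof (intro set_eqI iffI)
    fix w assume a: "w \<in> space (F u) \<inter> (\<Inter>v\<in>\<rat> \<inter> {s<..<u}. \<Union>k. ?B v k)"
    have "\<not> g (Y r w) \<ge> c" if r: "s \<le> r \<and> r < u" for r
    proof -
      obtain v where v: "v \<in> \<rat>" "r < v" "v < u" using Rats_dense_in_real r by blast
      then obtain k where "w \<in> ?B v k" using a r by fastforce
      then have "g (Y r w) \<le> c - 1 / real (Suc k)" using r v by (auto simp: not_less)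
      moreover have "0 < 1 / real (Suc k)" by simp
      ultimately show ?thesis by linarith
    qed
    then show "w \<in> {w\<in>space M. \<forall>r. s \<le> r \<and> r < u \<longrightarrow> \<not> g (Y r w) \<ge> c}" using a by auto
  next
    fix w assume a: "w \<in> {w\<in>space M. \<forall>r. s \<le> r \<and> r < u \<longrightarrow> \<not> g (Y r w) \<ge> c}"
    have "\<exists>k. w \<in> ?B v k" if v: "v \<in> \<rat> \<inter> {s<..<u}" for v
    proof -
      have "continuous_on {s..v} (\<lambda>r. g (Y r w))" using a s by (intro gY_cont[OF g]) auto
      then obtain x where x: "x \<in> {s..v}" "\<And>r. r \<in> {s..v} \<Longrightarrow> g (Y r w) \<le> g (Y x w)"
        using continuous_attains_sup[of "{s..v}" "\<lambda>r. g (Y r w)"] v by auto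
      have "0 < c - g (Y x w)" using a x v by auto
      then obtain k where "1 / real (Suc k) < c - g (Y x w)" using nat_approx_posE by blast
      then have "w \<in> ?B v k" using a x(2) by (force simp: not_less)
      then show ?thesis ..
    qed
    then show "w \<in> space (F u) \<inter> (\<Inter>v\<in>\<rat> \<inter> {s<..<u}. \<Union>k. ?B v k)" using a by auto
  qed
  finally show ?thesis .
qed

lemma opt_open:
  fixes g :: "real^'d \<Rightarrow> real"
  assumes "continuous_on UNIV g" "0 \<le> s" "s \<le> u"
  shows "{w\<in>space M. u \<le> ent s T (\<lambda>r. g (Y r w) > c)} \<in> sets (F u)"
  using not_open_before[OF assms, of c] by (cases "u \<le> T") (simp_all add: ent_ge_iff[OF assms(3)])

lemma opt_closed:
  fixes g :: "real^'d \<Rightarrow> real"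
  assumes "continuous_on UNIV g" "0 \<le> s" "s \<le> u"
  shows "{w\<in>space M. u \<le> ent s T (\<lambda>r. g (Y r w) \<ge> c)} \<in> sets (F u)"
  using not_closed_before[OF assms, of c] by (cases "u \<le> T") (simp_all add: ent_ge_iff[OF assms(3)])

lemma opt_min:
  assumes "{w\<in>space M. u \<le> \<rho> w} \<in> sets (F u)" "{w\<in>space M. u \<le> \<rho>' w} \<in> sets (F u)"
  shows "{w\<in>space M. u \<le> min (\<rho> w) (\<rho>' w :: real)} \<in> sets (F u)"
proof -
  have "{w\<in>space M. u \<le> min (\<rho> w) (\<rho>' w)} = {w\<in>space M. u \<le> \<rho> w} \<inter> {w\<in>space M. u \<le> \<rho>' w}" by auto
  then show ?thesis using assms by simp
qed

end

section \<open>Exit from the strip\<close>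

text \<open>The form \<open>nondeg\<close> is the quadratic form of the diffusion matrix at the
  gradient, i.e. the squared length of the noise seen by \<open>\<xi>\<close>.\<close>

locale strip_process = sde_process M F W b \<sigma> Y
  for M :: "'w measure" and F and W :: "real \<Rightarrow> 'w \<Rightarrow> real^'n"
    and b :: "real^'d \<Rightarrow> real^'d" and \<sigma> :: "real^'d \<Rightarrow> real^'n^'d" and Y +
  fixes \<xi> :: "real^'d \<Rightarrow> real" and \<xi>' \<xi>'' and \<delta> C :: real
  assumes \<xi>: "C2f \<xi> \<xi>' \<xi>''"
    and bounds: "\<And>x. \<bar>\<xi> x\<bar> \<le> 1 \<Longrightarrow> norm (b x) \<le> C \<and> norm (\<sigma> x) \<le> C \<and> norm (\<xi>' x) \<le> C \<and> norm (\<xi>'' x) \<le> C"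
    and \<delta>: "\<delta> > 0" and C: "C \<ge> 0"
    and nondeg: "\<And>x. \<bar>\<xi> x\<bar> \<le> 1 \<Longrightarrow> (\<Sum>j\<in>UNIV. (\<xi>' x (column j (\<sigma> x)))\<^sup>2) \<ge> \<delta>"
begin

lemma \<xi>_cont: "continuous_on UNIV \<xi>" by (rule C2f_continuous[OF \<xi>])

lemma generator_bound:
  assumes "norm (b x) \<le> B" "norm (\<sigma> x) \<le> B" "norm (f' x) \<le> p" "norm (f'' x) \<le> q"
  shows "\<bar>generator f' f'' x\<bar> \<le> p * B + real CARD('n) * (q * B\<^sup>2)"
proof -
  have p: "0 \<le> p" and q: "0 \<le> q" and B: "0 \<le> B" using assms norm_ge_zero order_trans by blast+
  have "\<bar>f' x (b x)\<bar> \<le> norm (f' x) * norm (b x)" using norm_blinfun[of "f' x" "b x"] by simp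
  also have "\<dots> \<le> p * B" using assms p by (intro mult_mono) auto
  finally have 1: "\<bar>f' x (b x)\<bar> \<le> p * B" .
  have 2: "\<bar>f'' x v v\<bar> \<le> q * B\<^sup>2" if "norm v \<le> B" for v
  proof -
    have "\<bar>f'' x v v\<bar> \<le> norm (f'' x v) * norm v" using norm_blinfun[of "f'' x v" v] by simp
    also have "\<dots> \<le> (norm (f'' x) * norm v) * norm v" by (intro mult_right_mono norm_blinfun) simp
    also have "\<dots> \<le> (q * B) * B" using assms that q B by (intro mult_mono) auto
    finally show ?thesis by (simp add: power2_eq_square mult.assoc)
  qed
  have "\<bar>\<Sum>j\<in>UNIV. f'' x (column j (\<sigma> x)) (column j (\<sigma> x))\<bar> \<le> (\<Sum>j\<in>(UNIV::'n set). q * B\<^sup>2)"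
    by (rule order_trans[OF sum_abs]) (intro sum_mono 2 order_trans[OF norm_column_le' assms(2)])
  then have "\<bar>\<Sum>j\<in>UNIV. f'' x (column j (\<sigma> x)) (column j (\<sigma> x))\<bar> \<le> real CARD('n) * (q * B\<^sup>2)" by simp
  then show ?thesis using 1 unfolding generator_def by linarith
qed

text \<open>With \<open>C1 = C * C + real CARD('n) * (C * C\<^sup>2)\<close> bounding the generator
  of \<open>\<xi>\<close> on the strip, \<open>rate * \<delta> / 2 = C1 + 1\<close>. For
  \<open>\<bar>\<mu>\<bar> = rate\<close> the second order term beats the first order one, so the
  generator of \<open>exp (\<mu> * \<xi>)\<close> is at least \<open>rate\<close> times the function
  itself, and the function is at least \<open>exp (- rate)\<close> on the strip.\<close>

definition rate :: real where "rate = 2 * (C * C + real CARD('n) * (C * C\<^sup>2) + 1) / \<delta>"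
definition gain :: real where "gain = rate * exp (- rate)"

lemma rate_pos: "rate > 0"
proof -
  have "0 \<le> C * C + real CARD('n) * (C * C\<^sup>2)" using C by (intro add_nonneg_nonneg mult_nonneg_nonneg) auto
  then show ?thesis using \<delta> by (simp add: rate_def)
qed

lemma gain_pos: "gain > 0" using rate_pos by (simp add: gain_def)

lemma exp_test_function:
  assumes R: "R > 0" and \<mu>: "\<bar>\<mu>\<bar> = rate"
  obtains f f' f'' where "C2b f f' f''" "\<And>x. x \<in> cball 0 R \<Longrightarrow> f x = exp (\<mu> * \<xi> x)"
    "\<And>x. x \<in> cball 0 R \<Longrightarrow> \<bar>\<xi> x\<bar> \<le> 1 \<Longrightarrow> generator f' f'' x \<ge> gain"
proof -
  obtain f f' f'' where f: "C2b f f' f''"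
    "\<And>x. x \<in> cball 0 R \<Longrightarrow> f x = exp (\<mu> * \<xi> x)"
    "\<And>x. x \<in> cball 0 R \<Longrightarrow> f' x = (\<mu> * exp (\<mu> * \<xi> x)) *\<^sub>R \<xi>' x"
    "\<And>x. x \<in> cball 0 R \<Longrightarrow> f'' x = (\<mu>\<^sup>2 * exp (\<mu> * \<xi> x)) *\<^sub>R tensor (\<xi>' x) (\<xi>' x) + (\<mu> * exp (\<mu> * \<xi> x)) *\<^sub>R \<xi>'' x"
    by (rule exp_cutoff_exists[OF \<xi> R]) blast
  have "generator f' f'' x \<ge> gain" if x: "x \<in> cball 0 R" "\<bar>\<xi> x\<bar> \<le> 1" for x
  proof -
    define e where "e = exp (\<mu> * \<xi> x)"
    define a where "a = (\<Sum>j\<in>UNIV. (\<xi>' x (column j (\<sigma> x)))\<^sup>2)"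
    define L where "L = generator \<xi>' \<xi>'' x"
    define C1 where "C1 = C * C + real CARD('n) * (C * C\<^sup>2)"
    have L: "\<bar>L\<bar> \<le> C1" unfolding L_def C1_def using bounds[OF x(2)] by (intro generator_bound) auto
    have g: "generator f' f'' x = e * (\<mu> * L + rate\<^sup>2 * a / 2)"
      unfolding generator_def f(3)[OF x(1)] f(4)[OF x(1)] L_def a_def e_def[symmetric] \<mu>[symmetric]
      by (simp add: blinfun.scaleR_left blinfun.add_left sum.distrib sum_distrib_left[symmetric] power2_eq_square algebra_simps add_divide_distrib mult.assoc)
    \<comment> \<open>Together with the bound \<open>rate * C1\<close> on the first order term, this
      leaves \<open>rate * (C1 + 1) - rate * C1 = rate\<close>.\<close>
    have "rate * \<delta> / 2 = C1 + 1" using \<delta> by (simp add: rate_def C1_def field_simps)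
    moreover have "rate * (rate * \<delta> / 2) \<le> rate * (rate * a / 2)"
      using nondeg[OF x(2)] rate_pos by (intro mult_left_mono divide_right_mono) (auto simp: a_def)
    moreover have "\<bar>\<mu> * L\<bar> \<le> rate * C1" using L \<mu> rate_pos by (simp add: abs_mult)
    ultimately have "rate \<le> \<mu> * L + rate\<^sup>2 * a / 2" by (simp add: power2_eq_square algebra_simps abs_le_iff)
    moreover have "exp (- rate) \<le> e"
    proof -
      have "\<bar>\<mu> * \<xi> x\<bar> \<le> rate * 1" using \<mu> x(2) rate_pos by (simp add: abs_mult)
      then show ?thesis by (simp add: e_def abs_le_iff)
    qed
    ultimately have "exp (- rate) * rate \<le> e * (\<mu> * L + rate\<^sup>2 * a / 2)"
      using rate_pos by (intro mult_mono) (auto simp: e_def)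
    then show ?thesis unfolding g gain_def by (simp add: mult.commute)
  qed
  with f(1,2) that show ?thesis by blast
qed

lemma strip_closed: "closed {x. \<bar>\<xi> x\<bar> \<le> 1}"
  using \<xi>_cont by (intro closed_Collect_le continuous_intros) auto

text \<open>The test function depends on the cut-off radius, so it is returned existentially with
  its values on the ball; the constant \<open>gain\<close> does not depend on the radius.\<close>

lemma strip_dynkin:
  assumes R: "R > 0" and \<mu>: "\<bar>\<mu>\<bar> = rate" and s: "0 \<le> s" and T: "0 < T"
    and \<rho>: "\<And>w. w \<in> space M \<Longrightarrow> s \<le> \<rho>1 w \<and> \<rho>1 w \<le> \<rho>2 w \<and> \<rho>2 w \<le> s + T"
    and opt1: "\<And>u. s \<le> u \<Longrightarrow> {w\<in>space M. u \<le> \<rho>1 w} \<in> sets (F u)"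
    and opt2: "\<And>u. s \<le> u \<Longrightarrow> {w\<in>space M. u \<le> \<rho>2 w} \<in> sets (F u)"
    and Kin: "\<And>w r. w \<in> space M \<Longrightarrow> s \<le> r \<Longrightarrow> r < \<rho>2 w \<Longrightarrow> \<bar>\<xi> (Y r w)\<bar> \<le> 1 \<and> norm (Y r w) \<le> R"
  obtains f where "\<And>x. norm x \<le> R \<Longrightarrow> f x = exp (\<mu> * \<xi> x)"
    "integrable M (\<lambda>w. f (Y (\<rho>2 w) w))" "integrable M (\<lambda>w. f (Y (\<rho>1 w) w))"
    "expectation (\<lambda>w. f (Y (\<rho>2 w) w)) - expectation (\<lambda>w. f (Y (\<rho>1 w) w)) \<ge> gain * expectation (\<lambda>w. \<rho>2 w - \<rho>1 w)"
proof -
  obtain f f' f'' where f: "C2b f f' f''" "\<And>x. x \<in> cball 0 R \<Longrightarrow> f x = exp (\<mu> * \<xi> x)"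
    "\<And>x. x \<in> cball 0 R \<Longrightarrow> \<bar>\<xi> x\<bar> \<le> 1 \<Longrightarrow> generator f' f'' x \<ge> gain"
    using exp_test_function[OF R \<mu>] by blast
  let ?K = "{x. \<bar>\<xi> x\<bar> \<le> 1} \<inter> cball 0 R"
  have main: "expectation (\<lambda>w. f (Y (\<rho>2 w) w)) - expectation (\<lambda>w. f (Y (\<rho>1 w) w)) \<ge> gain * expectation (\<lambda>w. \<rho>2 w - \<rho>1 w)"
  proof (rule dynkin_ge[OF s T f(1), of ?K C])
    show "closed ?K" by (intro closed_Int strip_closed closed_cball)
    show "norm (b x) \<le> C \<and> norm (\<sigma> x) \<le> C" "gain \<le> generator f' f'' x" if "x \<in> ?K" for x
      using that bounds f(3) by auto
  qed (use \<rho> opt1 opt2 Kin in auto)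
  obtain B where B: "\<And>x. \<bar>f x\<bar> \<le> B" using f(1) by (auto simp: C2b_def bounded_iff)
  have "continuous_on UNIV f"
    using f(1) has_derivative_continuous by (force simp: C2b_def continuous_on_eq_continuous_at)
  then have [measurable]: "f \<in> borel_measurable borel" by (rule borel_measurable_continuous_onI)
  have i: "integrable M (\<lambda>w. f (Y (\<rho> w) w))"
    if "\<And>w. w \<in> space M \<Longrightarrow> s \<le> \<rho> w \<and> \<rho> w \<le> s + T" "\<And>u. s \<le> u \<Longrightarrow> {w\<in>space M. u \<le> \<rho> w} \<in> sets (F u)" for \<rho>
  proof -
    have [measurable]: "(\<lambda>w. Y (\<rho> w) w) \<in> borel_measurable M"
      by (rule Y_at_optional_measurable[OF s that(1) _ that(2)]) (use s T in auto)
    show ?thesis by (rule integrable_const_bound[where B=B]) (use B in auto)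
  qed
  show ?thesis
  proof (rule that[OF _ i i main])
    show "f x = exp (\<mu> * \<xi> x)" if "norm x \<le> R" for x using f(2)[of x] that by simp
    show "s \<le> \<rho>2 w \<and> \<rho>2 w \<le> s + T" "s \<le> \<rho>1 w \<and> \<rho>1 w \<le> s + T" if "w \<in> space M" for w
      using \<rho>[OF that] by linarith+
  qed (use opt1 opt2 in auto)
qed

text \<open>With \<open>\<mu> = sg * rate\<close> the test function is largest at the level \<open>c\<close> among the values the path can take until it
  exceeds \<open>c\<close>, so its expectation cannot grow between reaching and exceeding \<open>c\<close>; hence no time passes.\<close>

lemma reach_exceed_AE:
  assumes sg: "sg = 1 \<or> sg = -1" and c: "c \<le> 1" and s: "0 \<le> s" and T: "0 < T" and R: "R > 0"
  defines "\<rho>' \<equiv> \<lambda>w. min (ent s (s + T) (\<lambda>r. - (sg * \<xi> (Y r w)) > 1)) (ent s (s + T) (\<lambda>r. norm (Y r w) > R))"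
  shows "AE w in M. min (ent s (s + T) (\<lambda>r. sg * \<xi> (Y r w) \<ge> c)) (\<rho>' w) = min (ent s (s + T) (\<lambda>r. sg * \<xi> (Y r w) > c)) (\<rho>' w)"
proof -
  define g where "g x = sg * \<xi> x" for x
  have gc: "continuous_on UNIV g" "continuous_on UNIV (\<lambda>x. - g x)" unfolding g_def using \<xi>_cont by (auto intro!: continuous_intros)
  have nc: "continuous_on UNIV (norm :: real^'d \<Rightarrow> real)" by (intro continuous_intros)
  define \<eta> where "\<eta> w = ent s (s + T) (\<lambda>r. g (Y r w) \<ge> c)" for w
  define \<theta> where "\<theta> w = ent s (s + T) (\<lambda>r. g (Y r w) > c)" for w
  define \<rho>1 where "\<rho>1 w = min (\<eta> w) (\<rho>' w)" for w
  define \<rho>2 where "\<rho>2 w = min (\<theta> w) (\<rho>' w)" for w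
  have sT: "s \<le> s + T" using T by simp
  have \<eta>\<theta>: "\<eta> w \<le> \<theta> w" for w unfolding \<eta>_def \<theta>_def by (rule ent_antimono) (use T in auto)
  have \<rho>: "s \<le> \<rho>1 w \<and> \<rho>1 w \<le> \<rho>2 w \<and> \<rho>2 w \<le> s + T" for w
    using \<eta>\<theta>[of w] ent_ge_s[OF sT] ent_le_T[of s "s + T"] by (auto simp: \<rho>1_def \<rho>2_def \<eta>_def \<theta>_def \<rho>'_def min_le_iff_disj)
  have opt': "{w\<in>space M. u \<le> \<rho>' w} \<in> sets (F u)" if "s \<le> u" for u
    unfolding \<rho>'_def g_def[symmetric] by (intro opt_min opt_open[OF gc(2) s that] opt_open[OF nc s that])
  have opt1: "{w\<in>space M. u \<le> \<rho>1 w} \<in> sets (F u)" and opt2: "{w\<in>space M. u \<le> \<rho>2 w} \<in> sets (F u)" if "s \<le> u" for u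
    unfolding \<rho>1_def \<rho>2_def \<eta>_def \<theta>_def
    by (intro opt_min opt'[OF that] opt_closed[OF gc(1) s that], intro opt_min opt'[OF that] opt_open[OF gc(1) s that])
  have in_K: "g (Y r w) \<le> c \<and> \<bar>\<xi> (Y r w)\<bar> \<le> 1 \<and> norm (Y r w) \<le> R" if "s \<le> r" "r < \<rho>2 w" for r w
  proof -
    have "\<not> g (Y r w) > c" "\<not> - (sg * \<xi> (Y r w)) > 1" "\<not> norm (Y r w) > R"
      using that by (auto simp: \<rho>2_def \<theta>_def \<rho>'_def dest: not_before_ent)
    then show ?thesis using sg c by (auto simp: g_def)
  qed
  define \<mu> where "\<mu> = sg * rate"
  have \<mu>: "\<bar>\<mu>\<bar> = rate" using sg rate_pos by (auto simp: \<mu>_def)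
  obtain f where f: "\<And>x. norm x \<le> R \<Longrightarrow> f x = exp (\<mu> * \<xi> x)"
    "integrable M (\<lambda>w. f (Y (\<rho>2 w) w))" "integrable M (\<lambda>w. f (Y (\<rho>1 w) w))"
    "expectation (\<lambda>w. f (Y (\<rho>2 w) w)) - expectation (\<lambda>w. f (Y (\<rho>1 w) w)) \<ge> gain * expectation (\<lambda>w. \<rho>2 w - \<rho>1 w)"
    using strip_dynkin[OF R \<mu> s T \<rho> opt1 opt2] in_K by blast
  \<comment> \<open>If the two times differ, the path has reached the level \<open>c\<close> at the
    first and has not risen above it up to the second, by continuity also at the second
    itself.\<close>
  have le: "f (Y (\<rho>2 w) w) \<le> f (Y (\<rho>1 w) w)" if w: "w \<in> space M" for w
  proof (cases "\<rho>1 w = \<rho>2 w")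
    case False
    then have less: "\<rho>1 w < \<rho>2 w" using \<rho>[of w] by simp
    then have \<eta>1: "\<rho>1 w = \<eta> w" "\<eta> w < s + T" using \<rho>[of w] by (auto simp: \<rho>1_def \<rho>2_def min_def split: if_splits)
    have "g (Y (\<eta> w) w) \<ge> c"
      unfolding \<eta>_def by (rule ent_closed_ge[OF gY_cont[OF gc(1) w s] sT]) (use \<eta>1 in \<open>simp add: \<eta>_def\<close>)
    then have 1: "f (Y (\<rho>1 w) w) \<ge> exp (rate * c)"
      using in_K[of "\<rho>1 w" w] less \<rho>[of w] f(1)[of "Y (\<rho>1 w) w"] \<eta>1 rate_pos by (simp add: g_def \<mu>_def mult_ac)
    have "closed ({x. g x \<le> c} \<inter> cball 0 R)" using gc(1) by (intro closed_Int closed_Collect_le continuous_intros) auto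
    from Y_closed_at_left[OF w s _ this, of "\<rho>2 w"] in_K less \<rho>[of w]
    have "g (Y (\<rho>2 w) w) \<le> c" "norm (Y (\<rho>2 w) w) \<le> R" by auto
    then have "f (Y (\<rho>2 w) w) \<le> exp (rate * c)"
      using f(1)[of "Y (\<rho>2 w) w"] rate_pos by (simp add: g_def \<mu>_def mult_ac)
    then show ?thesis using 1 by linarith
  qed simp
  have "expectation (\<lambda>w. f (Y (\<rho>2 w) w)) \<le> expectation (\<lambda>w. f (Y (\<rho>1 w) w))"
    by (rule integral_mono[OF f(2,3) le])
  then have "gain * expectation (\<lambda>w. \<rho>2 w - \<rho>1 w) \<le> 0" using f(4) by linarith
  then have E: "expectation (\<lambda>w. \<rho>2 w - \<rho>1 w) \<le> 0" using gain_pos by (simp add: mult_le_0_iff)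
  have \<rho>s: "s \<le> \<rho>1 w" "s \<le> \<rho>2 w" for w using \<rho>[of w] by linarith+
  note [measurable] = optional_measurable[OF s \<rho>s(1) opt1] optional_measurable[OF s \<rho>s(2) opt2]
  have i: "integrable M (\<lambda>w. \<rho>2 w - \<rho>1 w)"
  proof (rule integrable_const_bound[where B=T])
    have "norm (\<rho>2 w - \<rho>1 w) \<le> T" for w using \<rho>[of w] by auto
    then show "AE w in M. norm (\<rho>2 w - \<rho>1 w) \<le> T" by simp
  qed measurable
  have "AE w in M. \<rho>2 w - \<rho>1 w = 0"
  proof (subst integral_nonneg_eq_0_iff_AE[OF i, symmetric])
    show "AE w in M. 0 \<le> \<rho>2 w - \<rho>1 w" using \<rho> by simp
    show "expectation (\<lambda>w. \<rho>2 w - \<rho>1 w) = 0"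
      by (intro antisym E integral_nonneg_AE) (use \<rho> in simp)
  qed
  then show ?thesis
    by eventually_elim (simp add: \<rho>1_def \<rho>2_def \<eta>_def \<theta>_def g_def)
qed

text \<open>The horizon and the radius are removed by taking countably many of each; a given path
  needs only one pair that is large enough. Since \<open>c\<close> lies above \<open>-1\<close>, the
  path stays away from the other end of the strip shortly after time \<open>u\<close>, so the times
  at which observation stops do not interfere.\<close>

theorem exceed_immediately:
  assumes sg: "sg = 1 \<or> sg = -1" and c: "-1 < c" "c \<le> 1" and s: "0 \<le> s"
  shows "AE w in M. \<forall>u\<ge>s. sg * \<xi> (Y u w) = c \<and> (\<forall>r. s \<le> r \<and> r < u \<longrightarrow> -1 \<le> sg * \<xi> (Y r w) \<and> sg * \<xi> (Y r w) < c) \<longrightarrow>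
     (\<forall>e>0. \<exists>r. u < r \<and> r < u + e \<and> sg * \<xi> (Y r w) > c)"
proof -
  let ?E = "\<lambda>T R w. ent s (s + T) (\<lambda>r. norm (Y r w) > R)"
  let ?m = "\<lambda>T R w. min (ent s (s + T) (\<lambda>r. - (sg * \<xi> (Y r w)) > 1)) (?E T R w)"
  have "AE w in M. \<forall>n m :: nat. min (ent s (s + real (Suc n)) (\<lambda>r. sg * \<xi> (Y r w) \<ge> c)) (?m (real (Suc n)) (real (Suc m)) w) =
      min (ent s (s + real (Suc n)) (\<lambda>r. sg * \<xi> (Y r w) > c)) (?m (real (Suc n)) (real (Suc m)) w)"
    unfolding AE_all_countable by (intro allI reach_exceed_AE[OF sg c(2) s]) auto
  then show ?thesis
    using AE_space
  proof eventually_elim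
    case (elim w)
    have zc: "continuous_on {s..t} (\<lambda>r. sg * \<xi> (Y r w))" for t
      by (rule gY_cont[OF _ elim(2) s, where g="\<lambda>x. sg * \<xi> x"]) (intro continuous_intros \<xi>_cont)
    show ?case
    proof (intro allI impI)
      fix u e :: real
      assume us: "s \<le> u" and e: "0 < e"
        and a: "sg * \<xi> (Y u w) = c \<and> (\<forall>r. s \<le> r \<and> r < u \<longrightarrow> -1 \<le> sg * \<xi> (Y r w) \<and> sg * \<xi> (Y r w) < c)"
      obtain n where n: "u - s + 1 < real n" using reals_Archimedean2 by blast
      have "compact ((\<lambda>r. norm (Y r w)) ` {s..u + 1})"
        by (intro compact_continuous_image gY_cont[OF _ elim(2) s] continuous_intros) auto
      then have "bounded ((\<lambda>r. norm (Y r w)) ` {s..u + 1})" by (rule compact_imp_bounded)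
      then obtain B where B: "\<And>r. r \<in> {s..u + 1} \<Longrightarrow> norm (Y r w) \<le> B" by (force simp: bounded_iff)
      obtain m where m: "B < real m" using reals_Archimedean2 by blast
      have "u \<in> {s..u + 1}" using us by simp
      moreover have "0 < c + 1" using c(1) by simp
      ultimately obtain d where d: "d > 0" "\<And>r. r \<in> {s..u + 1} \<Longrightarrow> dist r u < d \<Longrightarrow> dist (sg * \<xi> (Y r w)) (sg * \<xi> (Y u w)) < c + 1"
        using zc[of "u + 1"] unfolding continuous_on_iff by blast
      \<comment> \<open>Up to \<open>v\<close> the path differs from the level \<open>c\<close> by
        less than \<open>c + 1\<close>, hence stays above \<open>-1\<close>, and it remains in the
        ball chosen for the interval up to \<open>u + 1\<close>.\<close>
      define v where "v = u + min (min d e) 1"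
      have v: "u < v" "v \<le> u + d" "v \<le> u + e" "v \<le> u + 1" using d(1) e by (auto simp: v_def)
      let ?T = "s + real (Suc n)"
      have vT: "v \<le> ?T" using v n by simp
      have \<eta>: "ent s ?T (\<lambda>r. sg * \<xi> (Y r w) \<ge> c) = u"
        by (rule ent_eqI) (use us a v vT in \<open>auto simp: not_le\<close>)
      have "v \<le> ent s ?T (\<lambda>r. - (sg * \<xi> (Y r w)) > 1)"
      proof (rule ent_geI[OF vT])
        fix r assume r: "s \<le> r" "r < v"
        show "\<not> - (sg * \<xi> (Y r w)) > 1"
        proof (cases "r < u")
          case False
          then have "dist (sg * \<xi> (Y r w)) (sg * \<xi> (Y u w)) < c + 1"
            using r v by (intro d(2)) (auto simp: dist_real_def)
          then show ?thesis using a by (auto simp: dist_real_def)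
        qed (use a r in force)
      qed
      moreover have "v \<le> ?E (real (Suc n)) (real (Suc m)) w"
      proof (rule ent_geI[OF vT])
        fix r assume "s \<le> r" "r < v"
        then have "norm (Y r w) \<le> B" using v by (intro B) auto
        then show "\<not> norm (Y r w) > real (Suc m)" using m by simp
      qed
      ultimately have "ent s ?T (\<lambda>r. sg * \<xi> (Y r w) > c) = u"
        using elim(1)[rule_format, of n m] v unfolding \<eta> by (auto simp: min_def split: if_splits)
      then obtain r where r: "u \<le> r" "r < v" "sg * \<xi> (Y r w) > c"
        using ent_less[of s ?T "\<lambda>r. sg * \<xi> (Y r w) > c" v] v vT by auto
      moreover have "r \<noteq> u" using r(3) a by auto
      ultimately show "\<exists>r. u < r \<and> r < u + e \<and> sg * \<xi> (Y r w) > c"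
        using v by (intro exI[of _ r]) auto
    qed
  qed
qed

end


section \<open>Hitting times, immediate crossing and exit probabilities\<close>

lemma hit_le: "0 \<le> s \<Longrightarrow> p s \<in> B \<Longrightarrow> hit p B \<le> ereal s"
  unfolding hit_def by (rule INF_lower) simp

lemma hit_ge: "(\<And>s. 0 \<le> s \<Longrightarrow> p s \<in> B \<Longrightarrow> e \<le> ereal s) \<Longrightarrow> e \<le> hit p B"
  unfolding hit_def by (rule INF_greatest) auto

lemma hit_nonneg: "0 \<le> hit p B"
  by (rule hit_ge) simp

lemma hit_less_iff: "hit p B < e \<longleftrightarrow> (\<exists>s\<ge>0. p s \<in> B \<and> ereal s < e)"
  unfolding hit_def INF_less_iff by auto

text \<open>A time arbitrarily close after \<open>u\<close> bounds the infimum, although it need not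
  be attained.\<close>

lemma hit_le_immediate:
  assumes u: "0 \<le> u" and r: "\<And>e. e > 0 \<Longrightarrow> \<exists>r. u < r \<and> r < u + e \<and> p r \<in> B"
  shows "hit p B \<le> ereal u"
proof (rule ccontr)
  assume "\<not> hit p B \<le> ereal u"
  then obtain z where z: "ereal u < ereal z" "ereal z < hit p B" using ereal_dense2[of "ereal u" "hit p B"] by (auto simp: not_le)
  then obtain r where "u < r" "r < u + (z - u)" "p r \<in> B" using r[of "z - u"] by auto
  then have "hit p B \<le> ereal r" "ereal r < ereal z" using u by (auto intro!: hit_le)
  then show False using z by (meson leD less_trans)
qed

context sde_process
begin

lemma hit_measurable:
  assumes B: "\<And>u. 0 \<le> u \<Longrightarrow> {w\<in>space M. \<forall>r. 0 \<le> r \<and> r < u \<longrightarrow> \<not> Y r w \<in> B} \<in> events"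
  shows "(\<lambda>w. hit (\<lambda>s. Y s w) B) \<in> borel_measurable M"
proof (rule borel_measurableI_less)
  have real: "{w\<in>space M. hit (\<lambda>s. Y s w) B < ereal u} \<in> events" for u
  proof (cases "0 \<le> u")
    case True
    have "{w\<in>space M. hit (\<lambda>s. Y s w) B < ereal u} = space M - {w\<in>space M. \<forall>r. 0 \<le> r \<and> r < u \<longrightarrow> \<not> Y r w \<in> B}"
      by (auto simp: hit_less_iff)
    then show ?thesis using B[OF True] by auto
  next
    case False
    then have "{w\<in>space M. hit (\<lambda>s. Y s w) B < ereal u} = {}" by (auto simp: hit_less_iff)
    then show ?thesis by (simp only: sets.empty_sets)
  qed
  fix y :: ereal
  show "{w\<in>space M. hit (\<lambda>s. Y s w) B < y} \<in> events"
  proof (cases y)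
    case PInf
    have "{w\<in>space M. hit (\<lambda>s. Y s w) B < y} = (\<Union>n. {w\<in>space M. hit (\<lambda>s. Y s w) B < ereal (real n)})"
    proof (intro set_eqI iffI)
      fix w assume a: "w \<in> {w\<in>space M. hit (\<lambda>s. Y s w) B < y}"
      then obtain s where s: "0 \<le> s" "Y s w \<in> B" unfolding hit_less_iff by blast
      obtain n :: nat where "s < real n" using reals_Archimedean2 by blast
      then have "hit (\<lambda>s. Y s w) B < ereal (real n)" using s unfolding hit_less_iff by auto
      then show "w \<in> (\<Union>n. {w\<in>space M. hit (\<lambda>s. Y s w) B < ereal (real n)})" using a by blast
    qed (auto simp: PInf intro: less_trans)
    then show ?thesis using real by auto
  next
    case MInf
    then have "{w\<in>space M. hit (\<lambda>s. Y s w) B < y} = {}" by (auto simp: hit_less_iff)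
    then show ?thesis by (simp only: sets.empty_sets)
  qed (simp add: real)
qed

lemma hit_measurable_greater:
  assumes "continuous_on UNIV g" shows "(\<lambda>w. hit (\<lambda>s. Y s w) {x. g x > (c::real)}) \<in> borel_measurable M"
proof (rule hit_measurable)
  fix u :: real assume "0 \<le> u"
  from sets_F_M[OF not_open_before[OF assms order_refl this, of c]]
  show "{w\<in>space M. \<forall>r. 0 \<le> r \<and> r < u \<longrightarrow> \<not> Y r w \<in> {x. g x > c}} \<in> events" by simp
qed

lemma hit_measurable_ge:
  assumes "continuous_on UNIV g" shows "(\<lambda>w. hit (\<lambda>s. Y s w) {x. g x \<ge> (c::real)}) \<in> borel_measurable M"
proof (rule hit_measurable)
  fix u :: real assume "0 \<le> u"
  from sets_F_M[OF not_closed_before[OF assms order_refl this, of c]]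
  show "{w\<in>space M. \<forall>r. 0 \<le> r \<and> r < u \<longrightarrow> \<not> Y r w \<in> {x. g x \<ge> c}} \<in> events" by simp
qed

lemma hit_measurable_open:
  assumes "open B" "B \<noteq> UNIV" shows "(\<lambda>w. hit (\<lambda>s. Y s w) B) \<in> borel_measurable M"
proof -
  \<comment> \<open>An open set becomes a strict superlevel set of a continuous function. The
    distance to the empty set is \<open>0\<close> by convention, so \<open>B = UNIV\<close> is
    excluded.\<close>
  have eq: "B = {x. infdist x (- B) > 0}"
    using assms infdist_nonneg[of _ "- B"] in_closed_iff_infdist_zero[of "- B"]
    by (auto simp: less_le)
  show ?thesis
    by (subst eq) (intro hit_measurable_greater continuous_intros)
qed

end

context strip_process
begin

lemma abs_\<xi>_cont: "continuous_on UNIV (\<lambda>x. \<bar>\<xi> x\<bar>)" by (intro continuous_intros \<xi>_cont)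

lemma \<xi>Y_near:
  assumes w: "w \<in> space M" and u: "0 \<le> u" and e: "e > 0"
  obtains d where "d > 0" "\<And>r. 0 \<le> r \<Longrightarrow> \<bar>r - u\<bar> < d \<Longrightarrow> \<bar>\<xi> (Y r w) - \<xi> (Y u w)\<bar> < e"
proof -
  have "continuous_on {0..} (\<lambda>r. \<xi> (Y r w))" by (rule continuous_on_compose2[OF \<xi>_cont Y_cont[OF w]]) simp
  moreover have "u \<in> {0..}" using u by simp
  ultimately obtain d where "d > 0" "\<And>r. r \<in> {0..} \<Longrightarrow> dist r u < d \<Longrightarrow> dist (\<xi> (Y r w)) (\<xi> (Y u w)) < e"
    using e unfolding continuous_on_iff by blast
  then show ?thesis using that[of d] by (auto simp: dist_real_def)
qed

text \<open>At the first time with \<open>\<bar>\<xi>\<bar> \<ge> 1\<close> either the inequality is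
  strict already, which happens when starting outside, or \<open>\<xi>\<close> equals
  \<open>1\<close> or \<open>-1\<close> and \<open>exceed_immediately\<close> applies with the
  corresponding sign.\<close>

lemma exit_closed_eq_open:
  assumes s: "0 \<le> s" and T: "0 < T"
  shows "AE w in M. ent s (s + T) (\<lambda>r. \<bar>\<xi> (Y r w)\<bar> \<ge> 1) = ent s (s + T) (\<lambda>r. \<bar>\<xi> (Y r w)\<bar> > 1)"
proof -
  have e1: "1 = 1 \<or> 1 = (-1::real)" and e2: "-1 = 1 \<or> -1 = (-1::real)" by auto
  have c: "-1 < (1::real)" "1 \<le> (1::real)" by auto
  show ?thesis
    using exceed_immediately[OF e1 c s] exceed_immediately[OF e2 c s] AE_space
  proof eventually_elim
    case (elim w)
    let ?u = "ent s (s + T) (\<lambda>r. \<bar>\<xi> (Y r w)\<bar> \<ge> 1)" and ?v = "ent s (s + T) (\<lambda>r. \<bar>\<xi> (Y r w)\<bar> > 1)"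
    have uv: "?u \<le> ?v" by (rule ent_antimono) (use T in auto)
    have us: "s \<le> ?u" using T by (intro ent_ge_s) simp
    have "?v \<le> ?u"
    proof (cases "?u < s + T")
      case True
      have cl: "\<bar>\<xi> (Y ?u w)\<bar> \<ge> 1"
        by (rule ent_closed_ge[OF gY_cont[OF abs_\<xi>_cont elim(3) s]]) (use T True in auto)
      have before: "\<bar>\<xi> (Y r w)\<bar> < 1" if "s \<le> r" "r < ?u" for r
        using not_before_ent[OF that] by simp
      show ?thesis
      proof (cases "\<bar>\<xi> (Y ?u w)\<bar> > 1")
        case True then show ?thesis using us \<open>?u < s + T\<close> by (intro ent_le[where P="\<lambda>r. \<bar>\<xi> (Y r w)\<bar> > 1", OF us]) auto
      next
        case False
        have imm: "\<exists>r. ?u < r \<and> r < ?u + e \<and> \<bar>\<xi> (Y r w)\<bar> > 1" if e: "e > 0" for e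
        proof (cases "\<xi> (Y ?u w) = 1")
          case True
          have "\<exists>r. ?u < r \<and> r < ?u + e \<and> 1 * \<xi> (Y r w) > 1"
            using elim(1)[rule_format, OF us _ e] True before by force
          then show ?thesis by force
        next
          case f: False
          then have "\<xi> (Y ?u w) = -1" using False cl by linarith
          then have "\<exists>r. ?u < r \<and> r < ?u + e \<and> -1 * \<xi> (Y r w) > 1"
            using elim(2)[rule_format, OF us _ e] before by force
          then show ?thesis by force
        qed
        show ?thesis
        proof (rule ccontr)
          assume "\<not> ?v \<le> ?u"
          then obtain r where "?u < r" "r < ?u + (?v - ?u)" "\<bar>\<xi> (Y r w)\<bar> > 1" using imm[of "?v - ?u"] by auto
          then show False using not_before_ent[of s r "s + T" "\<lambda>r. \<bar>\<xi> (Y r w)\<bar> > 1"] us by auto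
        qed
      qed
    qed (use ent_le_T[of s "s + T"] in \<open>auto simp: not_less intro: order_trans\<close>)
    then show ?case using uv by simp
  qed
qed

text \<open>\<open>exceed_immediately\<close> at \<open>u = 0\<close>, where the condition on
  earlier times is vacuous.\<close>

lemma hit_level_0:
  assumes Y0: "AE w in M. Y 0 w = y" and t: "0 \<le> t" "t \<le> 1" and y: "\<xi> y = t"
  shows "\<P>(w in M. hit_level \<xi> (\<lambda>s. Y s w) t = 0) = 1"
proof -
  note [measurable] = hit_measurable_greater[OF \<xi>_cont, of t]
  have E: "AE w in M. \<forall>u\<ge>0. \<xi> (Y u w) = t \<and> (\<forall>r. 0 \<le> r \<and> r < u \<longrightarrow> -1 \<le> \<xi> (Y r w) \<and> \<xi> (Y r w) < t) \<longrightarrow>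
     (\<forall>e>0. \<exists>r. u < r \<and> r < u + e \<and> \<xi> (Y r w) > t)"
    using exceed_immediately[of 1 t 0] t by simp
  have "AE w in M. hit_level \<xi> (\<lambda>s. Y s w) t = 0"
    using E Y0
  proof eventually_elim
    case (elim w)
    have "hit_level \<xi> (\<lambda>s. Y s w) t \<le> ereal 0"
      unfolding hit_level_def by (rule hit_le_immediate) (use elim(1)[rule_format, of 0] elim(2) y in auto)
    moreover have "0 \<le> hit_level \<xi> (\<lambda>s. Y s w) t" unfolding hit_level_def by (rule hit_nonneg)
    ultimately show ?case by (simp add: zero_ereal_def)
  qed
  moreover have "{w\<in>space M. hit_level \<xi> (\<lambda>s. Y s w) t = 0} \<in> events"
    unfolding hit_level_def by measurable
  ultimately show ?thesis by (subst prob_Collect_eq_1) auto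
qed

text \<open>The unstopped path may have been above \<open>\<xi> = 1\<close> before it first reaches
  \<open>A\<close>, so \<open>exceed_immediately\<close> cannot be started at time \<open>0\<close>.
  It is started at a rational time shortly before the entrance, when the path is already in the
  strip.\<close>

lemma hit_closure_interior:
  assumes Y0: "AE w in M. Y 0 w = y" and y: "\<xi> y = 0"
    and A: "A = {x. \<xi> x \<le> -1}"
  shows "\<P>(w in M. hit (\<lambda>s. Y s w) (closure A) = hit (\<lambda>s. Y s w) (interior A)) = 1"
proof -
  have cl: "closed A" unfolding A by (intro closed_Collect_le \<xi>_cont continuous_intros)
  have "closure A = {x. - \<xi> x \<ge> 1}" using cl by (auto simp: A)
  then have m1[measurable]: "(\<lambda>w. hit (\<lambda>s. Y s w) (closure A)) \<in> borel_measurable M"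
    using hit_measurable_ge[of "\<lambda>x. - \<xi> x" 1] \<xi>_cont by (auto intro: continuous_intros)
  have m2[measurable]: "(\<lambda>w. hit (\<lambda>s. Y s w) (interior A)) \<in> borel_measurable M"
  proof (rule hit_measurable_open)
    have "y \<notin> interior A" using interior_subset[of A] y by (auto simp: A)
    then show "interior A \<noteq> UNIV" by auto
  qed simp
  have sub: "{x. \<xi> x < -1} \<subseteq> interior A"
    by (rule interior_maximal) (auto simp: A intro!: open_Collect_less \<xi>_cont continuous_intros)
  have cq: "countable (\<rat> \<inter> {0::real..})" using countable_rat by blast
  \<comment> \<open>All rational starting times at once, since the one that is used depends on the
    path.\<close>
  have "AE w in M. \<forall>s\<in>\<rat> \<inter> {0..}. \<forall>u\<ge>s. -1 * \<xi> (Y u w) = 1 \<and> (\<forall>r. s \<le> r \<and> r < u \<longrightarrow> -1 \<le> -1 * \<xi> (Y r w) \<and> -1 * \<xi> (Y r w) < 1) \<longrightarrow>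
     (\<forall>e>0. \<exists>r. u < r \<and> r < u + e \<and> -1 * \<xi> (Y r w) > 1)"
    unfolding AE_ball_countable[OF cq] by (intro ballI exceed_immediately) auto
  then have "AE w in M. hit (\<lambda>s. Y s w) (closure A) = hit (\<lambda>s. Y s w) (interior A)"
    using Y0 AE_space
  proof eventually_elim
    case (elim w)
    show ?case
    proof (rule antisym)
      show "hit (\<lambda>s. Y s w) (closure A) \<le> hit (\<lambda>s. Y s w) (interior A)"
        using interior_subset[of A] closure_subset[of A] by (intro hit_ge hit_le) auto
      show "hit (\<lambda>s. Y s w) (interior A) \<le> hit (\<lambda>s. Y s w) (closure A)"
      proof (rule hit_ge)
        fix s assume s: "0 \<le> s" "Y s w \<in> closure A"
        then have s1: "- \<xi> (Y s w) \<ge> 1" using cl by (simp add: A)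
        let ?u = "ent 0 (s + 1) (\<lambda>r. - \<xi> (Y r w) \<ge> 1)"
        have zc: "continuous_on {0..s + 1} (\<lambda>r. - \<xi> (Y r w))"
          by (rule gY_cont[OF _ elim(3), where g="\<lambda>x. - \<xi> x"]) (auto intro!: continuous_intros \<xi>_cont)
        have us: "?u \<le> s" by (rule ent_le) (use s s1 in auto)
        have u0: "0 \<le> ?u" using s by (intro ent_ge_s) simp
        have uge: "- \<xi> (Y ?u w) \<ge> 1" by (rule ent_closed_ge[OF zc]) (use s us in auto)
        have before: "- \<xi> (Y r w) < 1" if "0 \<le> r" "r < ?u" for r using not_before_ent[OF that] by simp
        have upos: "?u > 0" using u0 uge elim(2) y by (cases "?u = 0") auto
        have ule: "- \<xi> (Y ?u w) \<le> 1"
        proof -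
          have "closed {x. - \<xi> x \<le> 1}" by (intro closed_Collect_le continuous_intros \<xi>_cont)
          from Y_closed_at_left[OF elim(3) order_refl upos this] before show ?thesis by force
        qed
        \<comment> \<open>Distance below \<open>2\<close> from the value \<open>-1\<close> keeps
          \<open>\<xi>\<close> below \<open>1\<close>, i.e. inside the strip.\<close>
        obtain d where d: "d > 0" "\<And>r. 0 \<le> r \<Longrightarrow> \<bar>r - ?u\<bar> < d \<Longrightarrow> \<bar>\<xi> (Y r w) - \<xi> (Y ?u w)\<bar> < 2"
          by (rule \<xi>Y_near[OF elim(3) u0, of 2]) auto
        obtain q where q: "q \<in> \<rat>" "max 0 (?u - d) < q" "q < ?u"
          using Rats_dense_in_real[of "max 0 (?u - d)" ?u] upos d(1) by auto
        have strip: "-1 \<le> -1 * \<xi> (Y r w) \<and> -1 * \<xi> (Y r w) < 1" if "q \<le> r \<and> r < ?u" for r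
          using before[of r] d(2)[of r] that q uge by auto
        have imm: "\<exists>r. ?u < r \<and> r < ?u + e \<and> -1 * \<xi> (Y r w) > 1" if "e > 0" for e
        proof -
          have "-1 * \<xi> (Y ?u w) = 1" using uge ule by simp
          then show ?thesis using elim(1)[rule_format, of q ?u e] q strip that by auto
        qed
        have "hit (\<lambda>s. Y s w) (interior A) \<le> ereal ?u"
        proof (rule hit_le_immediate[OF u0])
          fix e :: real assume "0 < e"
          then obtain r where r: "?u < r" "r < ?u + e" "\<xi> (Y r w) < -1" using imm by force
          then show "\<exists>r. ?u < r \<and> r < ?u + e \<and> Y r w \<in> interior A" using sub by (intro exI[of _ r]) auto
        qed
        also have "\<dots> \<le> ereal s" using us by simp
        finally show "hit (\<lambda>s. Y s w) (interior A) \<le> ereal s" .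
      qed
    qed
  qed
  moreover have "{w\<in>space M. hit (\<lambda>s. Y s w) (closure A) = hit (\<lambda>s. Y s w) (interior A)} \<in> events"
    by measurable
  ultimately show ?thesis by (subst prob_Collect_eq_1) auto
qed

lemma norm_cont: "continuous_on UNIV (norm :: real^'d \<Rightarrow> real)" by (intro continuous_intros)

text \<open>The exit time from the strip, cut off by a horizon and by a ball, as the test functions
  require.\<close>

definition exit_time :: "nat \<Rightarrow> nat \<Rightarrow> 'w \<Rightarrow> real" where
  "exit_time n m w = min (ent 0 (real (Suc n)) (\<lambda>r. \<bar>\<xi> (Y r w)\<bar> > 1)) (ent 0 (real (Suc n)) (\<lambda>r. norm (Y r w) > real (Suc m)))"

lemma exit_time_bounds: "0 \<le> exit_time n m w" "exit_time n m w \<le> real (Suc n)"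
  unfolding exit_time_def using ent_ge_s[of 0 "real (Suc n)"] ent_le_T[of 0 "real (Suc n)"] by (auto simp: min_le_iff_disj)

text \<open>\<open>strip_dynkin\<close> between time \<open>0\<close> and the exit time. At the exit
  time itself the path is still in the closed strip and ball, so the test function is the exact
  exponential there.\<close>

lemma exit_time_dynkin:
  assumes Y0: "AE w in M. Y 0 w = y" and y: "\<bar>\<xi> y\<bar> \<le> 1" "norm y \<le> real (Suc m)"
  obtains f where "\<And>x. norm x \<le> real (Suc m) \<Longrightarrow> f x = exp (rate * \<xi> x)" "integrable M (\<lambda>w. f (Y (exit_time n m w) w))"
    "AE w in M. \<bar>\<xi> (Y (exit_time n m w) w)\<bar> \<le> 1 \<and> norm (Y (exit_time n m w) w) \<le> real (Suc m)"
    "expectation (\<lambda>w. f (Y (exit_time n m w) w)) \<ge> exp (rate * \<xi> y) + gain * expectation (exit_time n m)"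
    "exit_time n m \<in> borel_measurable M"
proof -
  let ?T = "real (Suc n)" and ?R = "real (Suc m)"
  have opt: "{w\<in>space M. u \<le> exit_time n m w} \<in> sets (F u)" if "0 \<le> u" for u
    unfolding exit_time_def by (intro opt_min opt_open[OF abs_\<xi>_cont order_refl that] opt_open[OF norm_cont order_refl that])
  have opt0: "{w\<in>space M. u \<le> 0} \<in> sets (F u)" for u :: real using sets.top[of "F u"] by (cases "u \<le> 0") auto
  have before: "\<bar>\<xi> (Y r w)\<bar> \<le> 1 \<and> norm (Y r w) \<le> ?R" if "0 \<le> r" "r < exit_time n m w" for r w
    using that not_before_ent[of 0 r ?T "\<lambda>r. \<bar>\<xi> (Y r w)\<bar> > 1"] not_before_ent[of 0 r ?T "\<lambda>r. norm (Y r w) > ?R"]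
    by (auto simp: exit_time_def simp del: of_nat_Suc)
  have R: "0 < ?R" and T: "0 < ?T" and a: "\<bar>rate\<bar> = rate" using rate_pos by simp_all
  have b: "0 \<le> (0::real) \<and> 0 \<le> exit_time n m w \<and> exit_time n m w \<le> 0 + ?T" for w using exit_time_bounds[of n m w] by simp
  obtain f where f: "\<And>x. norm x \<le> ?R \<Longrightarrow> f x = exp (rate * \<xi> x)"
    "integrable M (\<lambda>w. f (Y (exit_time n m w) w))" "integrable M (\<lambda>w. f (Y 0 w))"
    "expectation (\<lambda>w. f (Y (exit_time n m w) w)) - expectation (\<lambda>w. f (Y 0 w)) \<ge> gain * expectation (\<lambda>w. exit_time n m w - 0)"
    by (rule strip_dynkin[OF R a order_refl T b opt0 opt before]) (assumption, assumption, assumption, rule that, assumption+)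
  have "expectation (\<lambda>w. f (Y 0 w)) = expectation (\<lambda>w. exp (rate * \<xi> y))"
  proof (rule integral_cong_AE)
    show "AE w in M. f (Y 0 w) = exp (rate * \<xi> y)" using Y0 by eventually_elim (simp only: f(1)[OF y(2)])
  qed (use f(3) in auto)
  then have E: "expectation (\<lambda>w. f (Y 0 w)) = exp (rate * \<xi> y)" by (simp add: prob_space)
  have in_K: "AE w in M. \<bar>\<xi> (Y (exit_time n m w) w)\<bar> \<le> 1 \<and> norm (Y (exit_time n m w) w) \<le> ?R"
    using Y0 AE_space
  proof eventually_elim
    case (elim w)
    show ?case
    proof (cases "0 < exit_time n m w")
      case True
      have "closed ({x. \<bar>\<xi> x\<bar> \<le> 1} \<inter> cball 0 ?R)" by (intro closed_Int strip_closed closed_cball)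
      from Y_closed_at_left[OF elim(2) order_refl True this] before show ?thesis by auto
    next
      case False
      then have "exit_time n m w = 0" using exit_time_bounds[of n m w] by simp
      then show ?thesis using elim y by simp
    qed
  qed
  have m: "exit_time n m \<in> borel_measurable M"
    by (rule optional_measurable[OF order_refl _ opt]) (rule exit_time_bounds)
  show ?thesis
    by (rule that[OF f(1) f(2) in_K _ m]) (use f(4) E in auto)
qed

lemma paths_bounded:
  assumes w: "w \<in> space M"
  shows "\<forall>\<^sub>F m in sequentially. \<forall>r. 0 \<le> r \<and> r \<le> T \<longrightarrow> norm (Y r w) < real (Suc m)"
proof -
  have "compact ((\<lambda>r. norm (Y r w)) ` {0..T})"
    by (intro compact_continuous_image gY_cont[OF norm_cont w]) auto
  then have "bounded ((\<lambda>r. norm (Y r w)) ` {0..T})" by (rule compact_imp_bounded)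
  then obtain B where B: "\<And>r. r \<in> {0..T} \<Longrightarrow> norm (Y r w) \<le> B" by (force simp: bounded_iff)
  obtain k0 where k0: "B \<le> real k0" using real_arch_simple by blast
  show ?thesis
  proof (rule eventually_sequentiallyI[of k0], intro allI impI)
    fix m r assume "k0 \<le> m" "0 \<le> r \<and> r \<le> T"
    then show "norm (Y r w) < real (Suc m)" using B[of r] k0 by simp
  qed
qed

text \<open>Phrased as the absence of a strict exceedance before the horizon, the form of event that
  \<open>not_open_before\<close> makes measurable.\<close>

definition bounded_event :: "nat \<Rightarrow> nat \<Rightarrow> 'w set" where
  "bounded_event n m = {w\<in>space M. \<forall>r. 0 \<le> r \<and> r < real (Suc n) \<longrightarrow> \<not> norm (Y r w) > real (Suc m)}"

definition inside_event :: "nat \<Rightarrow> 'w set" where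
  "inside_event n = {w\<in>space M. \<forall>r. 0 \<le> r \<and> r < real (Suc n) \<longrightarrow> \<not> \<bar>\<xi> (Y r w)\<bar> > 1}"

lemma events: "bounded_event n m \<in> events" "inside_event n \<in> events"
  unfolding bounded_event_def inside_event_def
  by (rule sets_F_M[OF not_open_before[OF norm_cont order_refl]] sets_F_M[OF not_open_before[OF abs_\<xi>_cont order_refl]], simp)+

lemma prob_unbounded: "(\<lambda>m. prob (space M - bounded_event n m)) \<longlonglongrightarrow> 0"
proof (rule prob_tendsto_0_AE)
  show "space M - bounded_event n m \<in> events" for m using events by auto
  show "AE w in M. \<forall>\<^sub>F m in sequentially. w \<notin> space M - bounded_event n m"
  proof (rule AE_I2)
    fix w assume w: "w \<in> space M"
    from paths_bounded[OF w, of "real (Suc n)"] show "\<forall>\<^sub>F m in sequentially. w \<notin> space M - bounded_event n m"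
      by eventually_elim (use w in \<open>auto simp: bounded_event_def less_imp_le not_less\<close>)
  qed
qed

text \<open>The test function is at most \<open>exp rate\<close> on the strip, so
  \<open>gain\<close> times the mean exit time is at most that. A path that stays inside up to the
  horizon contributes the whole horizon; the ball disappears as its radius grows.\<close>

lemma prob_inside:
  assumes Y0: "AE w in M. Y 0 w = y" and y: "\<bar>\<xi> y\<bar> \<le> 1"
  shows "prob (inside_event n) \<le> exp rate / gain / real (Suc n)"
proof -
  have bound: "real (Suc n) * prob (inside_event n \<inter> bounded_event n m) \<le> exp rate / gain" if m: "norm y \<le> real (Suc m)" for m
  proof -
    from exit_time_dynkin[OF Y0 y m, of n] obtain f where f: "\<And>x. norm x \<le> real (Suc m) \<Longrightarrow> f x = exp (rate * \<xi> x)" "integrable M (\<lambda>w. f (Y (exit_time n m w) w))"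
      "AE w in M. \<bar>\<xi> (Y (exit_time n m w) w)\<bar> \<le> 1 \<and> norm (Y (exit_time n m w) w) \<le> real (Suc m)"
      "expectation (\<lambda>w. f (Y (exit_time n m w) w)) \<ge> exp (rate * \<xi> y) + gain * expectation (exit_time n m)"
      "exit_time n m \<in> borel_measurable M" by blast
    have "expectation (\<lambda>w. f (Y (exit_time n m w) w)) \<le> expectation (\<lambda>w. exp rate)"
    proof (rule integral_mono_AE[OF f(2)])
      show "AE w in M. f (Y (exit_time n m w) w) \<le> exp rate"
        using f(3) by eventually_elim (use f(1) rate_pos in \<open>auto simp: abs_le_iff\<close>)
    qed simp
    also have "\<dots> = exp rate" by (simp add: prob_space)
    finally have "gain * expectation (exit_time n m) \<le> exp rate" using f(4) exp_gt_zero[of "rate * \<xi> y"] by linarith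
    moreover have "real (Suc n) * prob (inside_event n \<inter> bounded_event n m) \<le> expectation (exit_time n m)"
    proof -
      have "expectation (\<lambda>w. real (Suc n) * indicator (inside_event n \<inter> bounded_event n m) w) \<le> expectation (exit_time n m)"
      proof (rule integral_mono)
        show "integrable M (exit_time n m)"
          by (rule integrable_const_bound[where B="real (Suc n)"]) (use f(5) exit_time_bounds in auto)
        fix w assume "w \<in> space M"
        show "real (Suc n) * indicator (inside_event n \<inter> bounded_event n m) w \<le> exit_time n m w"
        proof (cases "w \<in> inside_event n \<inter> bounded_event n m")
          case True
          then have "real (Suc n) \<le> exit_time n m w"
            unfolding exit_time_def min.bounded_iff by (intro conjI ent_geI) (auto simp: inside_event_def bounded_event_def)
          then show ?thesis using True by simp
        qed (use exit_time_bounds in auto)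
      qed (use events in \<open>auto simp: emeasure_eq_measure\<close>)
      then show ?thesis using events by simp
    qed
    ultimately have "gain * (real (Suc n) * prob (inside_event n \<inter> bounded_event n m)) \<le> exp rate"
      using mult_left_mono[OF _ less_imp_le[OF gain_pos]] order_trans by blast
    then show ?thesis using gain_pos by (simp only: pos_le_divide_eq mult.commute)
  qed
  obtain m0 where m0: "norm y \<le> real m0" using real_arch_simple by blast
  have "prob (inside_event n) \<le> exp rate / gain / real (Suc n) + prob (space M - bounded_event n m)" if "m0 \<le> m" for m
  proof -
    have "prob (inside_event n) \<le> prob ((inside_event n \<inter> bounded_event n m) \<union> (space M - bounded_event n m))"
      by (rule finite_measure_mono) (use events in \<open>auto simp: inside_event_def\<close>)
    also have "\<dots> \<le> prob (inside_event n \<inter> bounded_event n m) + prob (space M - bounded_event n m)"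
      by (rule measure_Un_le) (use events in auto)
    finally have "prob (inside_event n) \<le> prob (inside_event n \<inter> bounded_event n m) + prob (space M - bounded_event n m)" .
    moreover have "prob (inside_event n \<inter> bounded_event n m) \<le> exp rate / gain / real (Suc n)"
      using bound[of m] m0 that by (simp only: pos_le_divide_eq mult.commute of_nat_0_less_iff zero_less_Suc)
    ultimately show ?thesis by linarith
  qed
  then show ?thesis
    using prob_unbounded[of n] by (intro tendsto_lowerbound[where f="\<lambda>m. exp rate / gain / real (Suc n) + prob (space M - bounded_event n m)" and F=sequentially])
      (auto intro!: tendsto_eq_intros eventually_sequentiallyI[of m0])
qed

lemma prob_inside_tendsto:
  assumes Y0: "AE w in M. Y 0 w = y" and y: "\<bar>\<xi> y\<bar> \<le> 1"
  shows "(\<lambda>n. prob (inside_event n)) \<longlonglongrightarrow> 0"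
proof (rule Lim_null_comparison)
  show "\<forall>\<^sub>F n in sequentially. norm (prob (inside_event n)) \<le> exp rate / gain / real (Suc n)"
    by (intro always_eventually allI) (simp only: real_norm_def abs_of_nonneg measure_nonneg prob_inside[OF Y0 y])
qed (rule LIMSEQ_Suc[OF lim_const_over_n])

lemma exit_AE:
  assumes Y0: "AE w in M. Y 0 w = y" and y: "\<bar>\<xi> y\<bar> \<le> 1"
  shows "AE w in M. \<exists>r\<ge>0. \<bar>\<xi> (Y r w)\<bar> > 1"
proof -
  define N where "N = (\<Inter>n. inside_event n)"
  have N: "N \<in> events" unfolding N_def using events by blast
  have "prob N \<le> prob (inside_event n)" for n by (rule finite_measure_mono) (auto simp: N_def events)
  then have "prob N \<le> 0"
    by (intro tendsto_lowerbound[OF prob_inside_tendsto[OF Y0 y]]) auto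
  then have "N \<in> null_sets M" using N by (auto simp: emeasure_eq_measure null_sets_def measure_le_0_iff)
  then show ?thesis
    by (rule AE_I') (auto simp: N_def inside_event_def)
qed

lemma exit_finite:
  assumes Y0: "AE w in M. Y 0 w = y" and y: "\<bar>\<xi> y\<bar> \<le> 1" and A: "A = {x. \<xi> x \<le> -1}"
  shows "\<P>(w in M. min (hit (\<lambda>s. Y s w) A) (hit_level \<xi> (\<lambda>s. Y s w) 1) < \<infinity>) = 1"
proof -
  have "A = {x. - \<xi> x \<ge> 1}" by (auto simp: A)
  then have [measurable]: "(\<lambda>w. hit (\<lambda>s. Y s w) A) \<in> borel_measurable M"
    using hit_measurable_ge[of "\<lambda>x. - \<xi> x" 1] \<xi>_cont by (auto intro: continuous_intros)
  note [measurable] = hit_measurable_greater[OF \<xi>_cont, of 1]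
  have "AE w in M. min (hit (\<lambda>s. Y s w) A) (hit_level \<xi> (\<lambda>s. Y s w) 1) < \<infinity>"
    using exit_AE[OF Y0 y]
  proof eventually_elim
    case (elim w)
    then obtain r where r: "r \<ge> 0" "\<bar>\<xi> (Y r w)\<bar> > 1" by auto
    show ?case
    proof (cases "\<xi> (Y r w) > 1")
      case True
      then have "hit_level \<xi> (\<lambda>s. Y s w) 1 \<le> ereal r" unfolding hit_level_def using r by (intro hit_le) auto
      then have "min (hit (\<lambda>s. Y s w) A) (hit_level \<xi> (\<lambda>s. Y s w) 1) \<le> ereal r" by (simp add: min_le_iff_disj)
      then show ?thesis by (rule le_less_trans) simp
    next
      case False
      then have "hit (\<lambda>s. Y s w) A \<le> ereal r" using r by (intro hit_le) (auto simp: A)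
      then have "min (hit (\<lambda>s. Y s w) A) (hit_level \<xi> (\<lambda>s. Y s w) 1) \<le> ereal r" by (simp add: min_le_iff_disj)
      then show ?thesis by (rule le_less_trans) simp
    qed
  qed
  moreover have "{w\<in>space M. min (hit (\<lambda>s. Y s w) A) (hit_level \<xi> (\<lambda>s. Y s w) 1) < \<infinity>} \<in> events"
    unfolding hit_level_def by measurable
  ultimately show ?thesis by (subst prob_Collect_eq_1) auto
qed

text \<open>The mean of \<open>exp (rate * \<xi>)\<close> at the exit is at least its initial value
  \<open>1\<close>. Leaving at the bottom contributes only \<open>exp (- rate)\<close> and leaving
  at the top at most \<open>exp rate\<close>, so \<open>1 \<le> exp (- rate) + exp rate * p\<close>
  for the probability \<open>p\<close> of the top.\<close>

lemma exit_above_prob: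
  assumes Y0: "AE w in M. Y 0 w = y" and y: "\<xi> y = 0" and A: "A = {x. \<xi> x \<le> -1}"
  shows "\<P>(w in M. hit_level \<xi> (\<lambda>s. Y s w) 1 < hit (\<lambda>s. Y s w) A) \<ge> (1 - exp (- rate)) / exp rate"
proof -
  have "A = {x. - \<xi> x \<ge> 1}" by (auto simp: A)
  then have [measurable]: "(\<lambda>w. hit (\<lambda>s. Y s w) A) \<in> borel_measurable M"
    using hit_measurable_ge[of "\<lambda>x. - \<xi> x" 1] \<xi>_cont by (auto intro: continuous_intros)
  note [measurable] = hit_measurable_greater[OF \<xi>_cont, of 1]
  define B where "B = {w\<in>space M. hit_level \<xi> (\<lambda>s. Y s w) 1 < hit (\<lambda>s. Y s w) A}"
  have B: "B \<in> events" unfolding B_def hit_level_def by measurable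
  have y1: "\<bar>\<xi> y\<bar> \<le> 1" using y by simp
  have bound: "1 \<le> exp (- rate) + exp rate * (prob B + prob (inside_event n) + prob (space M - bounded_event n m))"
    if m: "norm y \<le> real (Suc m)" for n m
  proof -
    from exit_time_dynkin[OF Y0 y1 m, of n] obtain f where f: "\<And>x. norm x \<le> real (Suc m) \<Longrightarrow> f x = exp (rate * \<xi> x)" "integrable M (\<lambda>w. f (Y (exit_time n m w) w))"
      "AE w in M. \<bar>\<xi> (Y (exit_time n m w) w)\<bar> \<le> 1 \<and> norm (Y (exit_time n m w) w) \<le> real (Suc m)"
      "expectation (\<lambda>w. f (Y (exit_time n m w) w)) \<ge> exp (rate * \<xi> y) + gain * expectation (exit_time n m)" by blast
    \<comment> \<open>Paths that leave through the top or are cut off by horizon or ball. Off this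
      set the exit value of \<open>\<xi>\<close> is \<open>-1\<close>; on it the crude bound
      \<open>exp rate\<close> is used.\<close>
    define G where "G = B \<union> inside_event n \<union> (space M - bounded_event n m)"
    have G: "G \<in> events" unfolding G_def using B events by auto
    have "0 \<le> expectation (exit_time n m)" by (rule integral_nonneg_AE) (use exit_time_bounds in auto)
    then have "0 \<le> gain * expectation (exit_time n m)" using gain_pos by simp
    moreover have "exp (rate * \<xi> y) = 1" using y by simp
    ultimately have "1 \<le> expectation (\<lambda>w. f (Y (exit_time n m w) w))" using f(4) by linarith
    also have "\<dots> \<le> expectation (\<lambda>w. exp (- rate) + exp rate * indicator G w)"
    proof (rule integral_mono_AE[OF f(2)])
      have sT: "0 < real (Suc n)" by simp
      have imm: "AE w in M. \<forall>u\<ge>0. \<xi> (Y u w) = 1 \<and> (\<forall>r. 0 \<le> r \<and> r < u \<longrightarrow> -1 \<le> \<xi> (Y r w) \<and> \<xi> (Y r w) < 1) \<longrightarrow>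
          (\<forall>e>0. \<exists>r. u < r \<and> r < u + e \<and> \<xi> (Y r w) > 1)"
        using exceed_immediately[of 1 1 0] by simp
      have eq: "AE w in M. ent 0 (real (Suc n)) (\<lambda>r. \<bar>\<xi> (Y r w)\<bar> \<ge> 1) = ent 0 (real (Suc n)) (\<lambda>r. \<bar>\<xi> (Y r w)\<bar> > 1)"
        using exit_closed_eq_open[OF order_refl sT] by (simp only: add_0)
      show "AE w in M. f (Y (exit_time n m w) w) \<le> exp (- rate) + exp rate * indicator G w"
        using f(3) imm eq AE_space
      proof eventually_elim
        case (elim w)
        let ?T = "real (Suc n)"
        have fe: "f (Y (exit_time n m w) w) = exp (rate * \<xi> (Y (exit_time n m w) w))" using elim by (intro f(1)) simp
        show ?case
        proof (cases "w \<in> G")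
          case True
          have "rate * \<xi> (Y (exit_time n m w) w) \<le> rate * 1" using elim rate_pos by (intro mult_left_mono) auto
          then have "f (Y (exit_time n m w) w) \<le> exp rate" unfolding fe by simp
          then show ?thesis using True by (simp add: add_increasing)
        next
          case False
          let ?v = "ent 0 ?T (\<lambda>r. \<bar>\<xi> (Y r w)\<bar> \<ge> 1)"
          have ve: "?v = ent 0 ?T (\<lambda>r. \<bar>\<xi> (Y r w)\<bar> > 1)" using elim by simp
          have w: "w \<in> space M" "w \<notin> B" "w \<notin> inside_event n" "w \<in> bounded_event n m" using False elim by (auto simp: G_def)
          obtain r where r: "0 \<le> r" "r < ?T" "\<bar>\<xi> (Y r w)\<bar> > 1" using w by (auto simp: inside_event_def simp del: of_nat_Suc)
          have vT: "?v < ?T" unfolding ve using ent_le[of 0 r ?T "\<lambda>r. \<bar>\<xi> (Y r w)\<bar> > 1"] r by simp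
          have v0: "0 \<le> ?v" by (rule ent_ge_s) simp
          have "?T \<le> ent 0 ?T (\<lambda>r. norm (Y r w) > real (Suc m))" by (rule ent_geI) (use w in \<open>auto simp: bounded_event_def\<close>)
          then have ex: "exit_time n m w = ?v" unfolding exit_time_def ve[symmetric] using vT by simp
          have ge: "\<bar>\<xi> (Y ?v w)\<bar> \<ge> 1" by (rule ent_closed_ge[OF gY_cont[OF abs_\<xi>_cont w(1) order_refl]]) (use vT in auto)
          have before: "\<bar>\<xi> (Y r w)\<bar> < 1" if "0 \<le> r" "r < ?v" for r using not_before_ent[OF that] by simp
          \<comment> \<open>At the value \<open>1\<close> the path would exceed the level within
            every time span, while for a span \<open>d\<close> it stays above \<open>0\<close> and
            thus away from \<open>A\<close>; it would then belong to \<open>B\<close>.\<close>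
          have "\<xi> (Y ?v w) \<noteq> 1"
          proof
            assume v1: "\<xi> (Y ?v w) = 1"
            obtain d where d: "d > 0" "\<And>r. 0 \<le> r \<Longrightarrow> \<bar>r - ?v\<bar> < d \<Longrightarrow> \<bar>\<xi> (Y r w) - \<xi> (Y ?v w)\<bar> < 1"
              by (rule \<xi>Y_near[OF w(1) v0, of 1]) auto
            have "\<exists>r. ?v < r \<and> r < ?v + d \<and> 1 < \<xi> (Y r w)"
              by (rule elim(2)[rule_format, OF v0 _ d(1)]) (use v1 before in \<open>force simp: abs_less_iff\<close>)
            then obtain r where r: "?v < r" "r < ?v + d" "1 < \<xi> (Y r w)" by blast
            have "hit_level \<xi> (\<lambda>s. Y s w) 1 \<le> ereal r" unfolding hit_level_def using r v0 by (intro hit_le) auto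
            also have "\<dots> < ereal (?v + d)" using r by simp
            also have "\<dots> \<le> hit (\<lambda>s. Y s w) A"
            proof (rule hit_ge)
              fix s assume s: "0 \<le> s" "Y s w \<in> A"
              have "\<not> s < ?v + d"
              proof
                assume "s < ?v + d"
                then show False using s before[of s] d(2)[of s] v1 by (cases "s < ?v") (auto simp: A)
              qed
              then show "ereal (?v + d) \<le> ereal s" by simp
            qed
            finally show False using w by (simp add: B_def)
          qed
          then have "\<xi> (Y ?v w) = -1" using ge elim unfolding ex by auto
          then show ?thesis using False fe unfolding ex by simp
        qed
      qed
    qed (use G in \<open>auto simp: emeasure_eq_measure\<close>)
    also have "\<dots> = exp (- rate) + exp rate * prob G"
      using G by (subst Bochner_Integration.integral_add) (auto simp: prob_space emeasure_eq_measure)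
    also have "\<dots> \<le> exp (- rate) + exp rate * (prob B + prob (inside_event n) + prob (space M - bounded_event n m))"
    proof (intro add_left_mono mult_left_mono)
      show "prob G \<le> prob B + prob (inside_event n) + prob (space M - bounded_event n m)"
        unfolding G_def by (intro order_trans[OF measure_Un_le] add_mono order_refl) (use B events in auto)
    qed simp
    finally show ?thesis .
  qed
  obtain m0 where m0: "norm y \<le> real m0" using real_arch_simple by blast
  have "1 \<le> exp (- rate) + exp rate * (prob B + prob (inside_event n) + 0)" for n
  proof (rule tendsto_lowerbound)
    show "(\<lambda>m. exp (- rate) + exp rate * (prob B + prob (inside_event n) + prob (space M - bounded_event n m))) \<longlonglongrightarrow>
      exp (- rate) + exp rate * (prob B + prob (inside_event n) + 0)"
      by (intro tendsto_intros prob_unbounded)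
    show "\<forall>\<^sub>F m in sequentially. 1 \<le> exp (- rate) + exp rate * (prob B + prob (inside_event n) + prob (space M - bounded_event n m))"
      by (rule eventually_sequentiallyI[of m0]) (use m0 in \<open>auto intro!: bound\<close>)
  qed simp
  then have "1 \<le> exp (- rate) + exp rate * (prob B + 0)"
    by (intro tendsto_lowerbound[where f="\<lambda>n. exp (- rate) + exp rate * (prob B + prob (inside_event n))" and F=sequentially]
        tendsto_intros prob_inside_tendsto[OF Y0 y1]) auto
  then show ?thesis unfolding B_def[symmetric] by (simp add: divide_le_eq mult.commute)
qed

text \<open>Replacing the entrance into \<open>\<bar>\<xi>\<bar> > 1\<close> by the one into \<open>\<bar>\<xi>\<bar> \<ge> 1\<close> changes this only on a null set.\<close>

definition stopped :: "real \<Rightarrow> real \<Rightarrow> 'w \<Rightarrow> real^'d" where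
  "stopped s T w = Y (ent s (s + T) (\<lambda>r. \<bar>\<xi> (Y r w)\<bar> \<ge> 1)) w"

lemma stopped_measurable:
  assumes "0 \<le> s" "0 \<le> T" shows "stopped s T \<in> borel_measurable M"
  unfolding stopped_def[abs_def]
  by (rule Y_at_optional_measurable[OF assms(1), where t="s + T"])
    (use assms ent_ge_s[of s "s + T"] ent_le_T[of s "s + T"] opt_closed[OF abs_\<xi>_cont assms(1)] in auto)

text \<open>Dynkin's inequality for a bump around the starting point: its mean starts at
  \<open>1\<close>, falls at a rate of order \<open>1 / r\<close>, and no contribution comes from
  paths at distance \<open>r\<close>.\<close>

lemma stopped_far:
  assumes Y0: "AE w in M. Y 0 w = y" and y: "\<bar>\<xi> y\<bar> \<le> 1" and T: "0 < T" and r: "1 \<le> r"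
  shows "\<P>(w in M. dist (stopped 0 T w) y \<ge> r) \<le> (6 * C + 30 * real CARD('n) * C\<^sup>2) * T / r"
proof -
  note [measurable] = stopped_measurable[OF order_refl less_imp_le[OF T]]
  obtain f f' f'' where f: "C2b f f' f''" "f y = 1" "\<And>x. 0 \<le> f x" "\<And>x. f x \<le> 1" "\<And>x. r \<le> dist x y \<Longrightarrow> f x = 0"
    "\<And>x. norm (f' x) \<le> 6 / r" "\<And>x. norm (f'' x) \<le> 30 / r\<^sup>2"
    using bump_exists[of r y] r by auto
  define c where "c = (6 * C + 30 * real CARD('n) * C\<^sup>2) / r"
  have c0: "0 \<le> c" using C r by (simp add: c_def)
  let ?\<rho> = "\<lambda>w. ent 0 (0 + T) (\<lambda>r. \<bar>\<xi> (Y r w)\<bar> \<ge> 1)"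
  have \<rho>b: "0 \<le> ?\<rho> w" "?\<rho> w \<le> T" for w using ent_ge_s[of 0 "0 + T"] ent_le_T[of 0 "0 + T"] T by auto
  have gen: "generator f' f'' x \<ge> - c" if "\<bar>\<xi> x\<bar> \<le> 1" for x
  proof -
    have "\<bar>generator f' f'' x\<bar> \<le> 6 / r * C + real CARD('n) * (30 / r\<^sup>2 * C\<^sup>2)"
      using bounds[OF that] f(6,7) by (intro generator_bound) auto
    \<comment> \<open>Since \<open>r\<close> is at least \<open>1\<close>, the second order term is
      brought to the order \<open>1 / r\<close> of the first.\<close>
    also have "real CARD('n) * (30 / r\<^sup>2 * C\<^sup>2) \<le> real CARD('n) * (30 / r * C\<^sup>2)"
      using r by (intro mult_left_mono mult_right_mono divide_left_mono) (auto simp: power2_eq_square mult_le_cancel_left1)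
    finally show ?thesis by (simp add: c_def add_divide_distrib mult_ac)
  qed
  have "(- c) * expectation (\<lambda>w. ?\<rho> w - 0) \<le> expectation (\<lambda>w. f (Y (?\<rho> w) w)) - expectation (\<lambda>w. f (Y 0 w))"
  proof (rule dynkin_ge[OF order_refl T f(1) strip_closed, of C])
    show "{w\<in>space M. u \<le> 0} \<in> sets (F u)" for u :: real using sets.top[of "F u"] by (cases "u \<le> 0") auto
    show "{w\<in>space M. u \<le> ?\<rho> w} \<in> sets (F u)" if "0 \<le> u" for u by (rule opt_closed[OF abs_\<xi>_cont order_refl that])
    show "Y r w \<in> {x. \<bar>\<xi> x\<bar> \<le> 1}" if "0 \<le> r" "r < ?\<rho> w" for r w using not_before_ent[OF that] by simp
  qed (use bounds gen \<rho>b in auto)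
  moreover have "expectation (\<lambda>w. f (Y 0 w)) = 1"
  proof -
    have fc: "continuous_on UNIV f" using f(1) has_derivative_continuous by (force simp: C2b_def continuous_on_eq_continuous_at)
    have [measurable]: "f \<in> borel_measurable borel" by (rule borel_measurable_continuous_onI[OF fc])
    have [measurable]: "Y 0 \<in> borel_measurable M" by simp
    have "expectation (\<lambda>w. f (Y 0 w)) = expectation (\<lambda>w. 1)"
      by (rule integral_cong_AE) (use Y0 f(2) in auto)
    then show ?thesis by (simp add: prob_space)
  qed
  moreover have "c * expectation (\<lambda>w. ?\<rho> w - 0) \<le> c * T"
  proof (rule mult_left_mono[OF _ c0])
    have "expectation (\<lambda>w. ?\<rho> w - 0) \<le> expectation (\<lambda>w. T)"
      by (rule integral_mono_AE, rule integrable_const_bound[where B=T])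
        (use \<rho>b optional_measurable[OF order_refl \<rho>b(1) opt_closed[OF abs_\<xi>_cont order_refl]] in auto)
    then show "expectation (\<lambda>w. ?\<rho> w - 0) \<le> T" by (simp add: prob_space)
  qed
  moreover have "expectation (\<lambda>w. f (Y (?\<rho> w) w)) \<le> 1 - \<P>(w in M. dist (stopped 0 T w) y \<ge> r)"
  proof -
    have fc: "continuous_on UNIV f" using f(1) has_derivative_continuous by (force simp: C2b_def continuous_on_eq_continuous_at)
    have [measurable]: "f \<in> borel_measurable borel" by (rule borel_measurable_continuous_onI[OF fc])
    let ?E = "{w\<in>space M. dist (stopped 0 T w) y \<ge> r}"
    have E: "?E \<in> events" by measurable
    have "expectation (\<lambda>w. f (stopped 0 T w)) \<le> expectation (\<lambda>w. 1 - indicator ?E w)"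
    proof (rule integral_mono)
      show "integrable M (\<lambda>w. f (stopped 0 T w))" by (rule integrable_const_bound[where B=1]) (use f(3,4) in auto)
      show "f (stopped 0 T w) \<le> 1 - indicator ?E w" if "w \<in> space M" for w
        using f(4,5)[of "stopped 0 T w"] by (auto simp: indicator_def)
    qed (use E in \<open>auto simp: emeasure_eq_measure\<close>)
    also have "\<dots> = 1 - prob ?E" using E by (simp add: prob_space emeasure_eq_measure)
    finally show ?thesis by (simp add: stopped_def)
  qed
  ultimately have "\<P>(w in M. dist (stopped 0 T w) y \<ge> r) \<le> c * T" by linarith
  then show ?thesis by (simp add: c_def)
qed

end


section \<open>Convergence of the Euler scheme\<close>

locale lipschitz_strip_process = strip_process M F W b \<sigma> Y \<xi> \<xi>' \<xi>'' \<delta> C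
  for M :: "'w measure" and F and W :: "real \<Rightarrow> 'w \<Rightarrow> real^'n"
    and b :: "real^'d \<Rightarrow> real^'d" and \<sigma> :: "real^'d \<Rightarrow> real^'n^'d" and Y :: "real \<Rightarrow> 'w \<Rightarrow> real^'d"
    and \<xi> \<xi>' \<xi>'' \<delta> C +
  assumes locally_lipschitz: "\<And>R. \<exists>L\<ge>0. \<forall>x\<in>cball 0 R. \<forall>z\<in>cball 0 R. norm (b x - b z) \<le> L * norm (x - z) \<and> norm (\<sigma> x - \<sigma> z) \<le> L * norm (x - z)"
begin

text \<open>The initial value is random: \<open>Y s\<close> itself is used for the Markov property,
  and constants near the starting point for continuity.\<close>

primrec euler :: "('w \<Rightarrow> real^'d) \<Rightarrow> real \<Rightarrow> real \<Rightarrow> nat \<Rightarrow> 'w \<Rightarrow> real^'d" where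
  "euler V s h 0 w = V w"
| "euler V s h (Suc k) w = euler V s h k w + (h *\<^sub>R b (euler V s h k w) +
     \<sigma> (euler V s h k w) *v (W (s + real (Suc k) * h) w - W (s + real k * h) w))"

lemma euler_measurable_F:
  assumes V: "V \<in> borel_measurable (F s)" and s: "0 \<le> s" and h: "0 \<le> h"
  shows "euler V s h k \<in> borel_measurable (F (s + real k * h))"
proof (induction k)
  case 0
  have "euler V s h 0 = V" by (rule ext) simp
  then show ?case using V by simp
next
  case (Suc k)
  have le: "s + real k * h \<le> s + real (Suc k) * h" using h by (simp add: mult_right_mono)
  have nn: "0 \<le> s + real k * h" using s h by simp
  have [measurable]: "euler V s h k \<in> borel_measurable (F (s + real (Suc k) * h))"
    by (rule measurable_F_mono[OF Suc le])
  have [measurable]: "W (s + real (Suc k) * h) \<in> borel_measurable (F (s + real (Suc k) * h))"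
    "W (s + real k * h) \<in> borel_measurable (F (s + real (Suc k) * h))"
    using W_measurable_F nn le by auto
  have "(\<lambda>w. b (euler V s h k w)) \<in> borel_measurable (F (s + real (Suc k) * h))"
    "(\<lambda>w. \<sigma> (euler V s h k w)) \<in> borel_measurable (F (s + real (Suc k) * h))"
    by (rule measurable_compose[OF _ b_measurable] measurable_compose[OF _ \<sigma>_measurable]; measurable)+
  then have "(\<lambda>w. euler V s h k w + (h *\<^sub>R b (euler V s h k w) +
     \<sigma> (euler V s h k w) *v (W (s + real (Suc k) * h) w - W (s + real k * h) w))) \<in> borel_measurable (F (s + real (Suc k) * h))"
    by (intro borel_measurable_add borel_measurable_scaleR borel_measurable_const borel_measurable_matrix_vector_mult borel_measurable_diff) measurable
  then show ?case unfolding euler.simps(2)[abs_def] .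
qed

definition euler_err :: "('w \<Rightarrow> real^'d) \<Rightarrow> real \<Rightarrow> real \<Rightarrow> nat \<Rightarrow> 'w \<Rightarrow> real" where
  "euler_err V s T N w = Max ((\<lambda>k. norm (euler V s (T / real (Suc N)) k w - Y (s + real k * (T / real (Suc N))) w)) ` {..Suc N})"

lemma euler_err_ge: "k \<le> Suc N \<Longrightarrow> norm (euler V s (T / real (Suc N)) k w - Y (s + real k * (T / real (Suc N))) w) \<le> euler_err V s T N w"
  unfolding euler_err_def by (rule Max_ge) auto

lemma euler_err_gtE:
  assumes "euler_err V s T N w > e"
  obtains k where "k \<le> Suc N" "norm (euler V s (T / real (Suc N)) k w - Y (s + real k * (T / real (Suc N))) w) > e"
proof -
  have "\<exists>x\<in>(\<lambda>k. norm (euler V s (T / real (Suc N)) k w - Y (s + real k * (T / real (Suc N))) w)) ` {..Suc N}. e < x"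
    using assms unfolding euler_err_def by (subst (asm) Max_gr_iff) auto
  then show ?thesis using that by auto
qed

lemma euler_err_measurable:
  assumes V: "V \<in> borel_measurable (F s)" and s: "0 \<le> s" and T: "0 < T"
  shows "euler_err V s T N \<in> borel_measurable M"
  unfolding euler_err_def[abs_def]
proof (intro borel_measurable_Max)
  fix k
  have nn: "0 \<le> T / real (Suc N)" "0 \<le> s + real k * (T / real (Suc N))" using s T by auto
  note [measurable] = measurable_F_M[OF euler_measurable_F[OF V s nn(1), of k]] Y_measurable[OF nn(2)]
  show "(\<lambda>w. norm (euler V s (T / real (Suc N)) k w - Y (s + real k * (T / real (Suc N))) w)) \<in> borel_measurable M"
    by measurable
qed simp

text \<open>The growth of the second moment over one step in the form suited to a discrete Gronwall
  argument. \<open>3 * L\<close> comes from the cross term with the drift,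
  \<open>2 * T * L\<^sup>2\<close> from its square and \<open>2 * L\<^sup>2\<close> from the
  noise.\<close>

lemma sq_step_le:
  fixes Z c :: "real^'d" and H :: "real^'n^'d"
  assumes c: "norm c \<le> h * (L * (norm Z + e))" and H: "norm H \<le> L * (norm Z + e)"
    and h: "0 \<le> h" "h \<le> T" and L: "0 \<le> L" and e: "0 \<le> e"
  shows "(norm (Z + c))\<^sup>2 - (norm Z)\<^sup>2 + h * (norm H)\<^sup>2 \<le> h * (3 * L + 2 * (T + 1) * L\<^sup>2) * ((norm Z)\<^sup>2 + e\<^sup>2)"
proof -
  define z where "z = norm Z"
  have z: "0 \<le> z" by (simp add: z_def)
  have ineq: "(z + e)\<^sup>2 \<le> 2 * (z\<^sup>2 + e\<^sup>2)" using sum_squares_bound[of z e] by (simp add: power2_sum)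
  have ineq2: "2 * z * (z + e) \<le> 3 * (z\<^sup>2 + e\<^sup>2)" 
  proof -
    have "2 * z * (z + e) = 2 * z\<^sup>2 + 2 * z * e" by (simp add: power2_eq_square algebra_simps)
    then show ?thesis using sum_squares_bound[of z e] zero_le_power2[of e] zero_le_power2[of z] unfolding distrib_left by linarith
  qed
  have H2: "(norm H)\<^sup>2 \<le> L\<^sup>2 * (z + e)\<^sup>2"
    using power_mono[OF H norm_ge_zero, of 2] by (simp add: z_def power_mult_distrib)
  have "(norm (Z + c))\<^sup>2 \<le> (z + norm c)\<^sup>2" by (rule power_mono) (auto simp: z_def norm_triangle_ineq)
  also have "\<dots> \<le> (z + h * (L * (z + e)))\<^sup>2" by (rule power_mono) (use c z in \<open>auto simp: z_def\<close>)
  also have "\<dots> = z\<^sup>2 + h * L * (2 * z * (z + e)) + h * (h * L\<^sup>2 * (z + e)\<^sup>2)" by (simp add: power2_eq_square algebra_simps)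
  also have "\<dots> \<le> z\<^sup>2 + h * L * (3 * (z\<^sup>2 + e\<^sup>2)) + h * (T * L\<^sup>2 * (2 * (z\<^sup>2 + e\<^sup>2)))"
  proof -
    have "h * L * (2 * z * (z + e)) \<le> h * L * (3 * (z\<^sup>2 + e\<^sup>2))" using ineq2 h L by (intro mult_left_mono) auto
    moreover have "h * L\<^sup>2 * (z + e)\<^sup>2 \<le> T * L\<^sup>2 * (2 * (z\<^sup>2 + e\<^sup>2))"
      by (rule mult_mono[OF mult_right_mono ineq]) (use h in auto)
    then have "h * (h * L\<^sup>2 * (z + e)\<^sup>2) \<le> h * (T * L\<^sup>2 * (2 * (z\<^sup>2 + e\<^sup>2)))" using h by (intro mult_left_mono) auto
    ultimately show ?thesis by linarith
  qed
  finally have "(norm (Z + c))\<^sup>2 \<le> z\<^sup>2 + h * L * (3 * (z\<^sup>2 + e\<^sup>2)) + h * (T * L\<^sup>2 * (2 * (z\<^sup>2 + e\<^sup>2)))" .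
  moreover have "h * (norm H)\<^sup>2 \<le> h * (L\<^sup>2 * (2 * (z\<^sup>2 + e\<^sup>2)))"
    by (rule mult_left_mono[OF order_trans[OF H2 mult_left_mono[OF ineq]] h(1)]) simp
  ultimately show ?thesis unfolding z_def by (simp add: algebra_simps)
qed

text \<open>The error is measured against the Riemann sums of the It\^o integrals, which have the same form as the scheme,
  and the difference is stopped as soon as anything is large; the coefficients then are Lipschitz.\<close>

lemma euler_stopped_bound:
  assumes V: "V \<in> borel_measurable (F s)" and s: "0 \<le> s" and T: "0 < T" and N: "0 < (N::nat)"
    and Vd: "AE w in M. norm (V w - Y s w) \<le> d" and d: "0 \<le> d"
    and R: "0 \<le> R" and e: "0 < \<epsilon>" "\<epsilon> \<le> 1" "0 \<le> e" "e \<le> \<epsilon>"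
    and L: "0 \<le> L" "\<forall>x\<in>cball 0 (R + 2). \<forall>z\<in>cball 0 (R + 2). norm (b x - b z) \<le> L * norm (x - z) \<and> norm (\<sigma> x - \<sigma> z) \<le> L * norm (x - z)"
  defines "h \<equiv> T / real N"
  defines "K \<equiv> 3 * L + 2 * (T + 1) * L\<^sup>2"
  defines "G \<equiv> {w\<in>space M. \<forall>k\<le>N. norm (Y (s + real k * h) w) \<le> R \<and> norm (rsum s h k w - (Y (s + real k * h) w - Y s w)) \<le> e}"
  shows "\<P>(w in M. w \<in> G \<and> (\<exists>k\<le>N. norm (euler V s h k w - Y s w - rsum s h k w) > \<epsilon>)) \<le> exp (K * T) * (d\<^sup>2 + e\<^sup>2) / \<epsilon>\<^sup>2"
proof -
  have h: "0 < h" "h \<le> T" "real N * h = T" using T N by (auto simp: h_def divide_le_eq)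
  define t where "t k = s + real k * h" for k
  have tn: "0 \<le> t k" "t k < t (Suc k)" "s \<le> t k" for k using s h by (auto simp: t_def algebra_simps)
  have tm: "j \<le> k \<Longrightarrow> t j \<le> t k" for j k using h by (simp add: t_def mult_right_mono)
  define X where "X = euler V s h"
  \<comment> \<open>The increments of this difference involve the coefficients at the scheme minus
    those along the path, so they are small when the scheme is close; the approximation of the path
    by Riemann sums enters through \<open>e\<close>.\<close>
  define E where "E k w = X k w - Y s w - rsum s h k w" for k w
  have h0: "0 \<le> h" using h by simp
  have Xm: "X k \<in> borel_measurable (F (t j))" if "k \<le> j" for j k
    using measurable_F_mono[OF euler_measurable_F[OF V s h0, of k] tm[OF that, unfolded t_def]] by (simp add: X_def t_def)
  have rm: "rsum s h k \<in> borel_measurable (F (t j))" if "k \<le> j" for j k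
    using measurable_F_mono[OF rsum_measurable_F[OF s h0, of k] tm[OF that, unfolded t_def]] by (simp add: t_def)
  have Ym: "Y (t k) \<in> borel_measurable (F (t j))" "Y s \<in> borel_measurable (F (t j))" if "k \<le> j" for j k
    using Y_measurable_F tn tm[OF that] s by auto
  have Em: "E k \<in> borel_measurable (F (t j))" if "k \<le> j" for j k
    unfolding E_def[abs_def] using Xm[OF that] rm[OF that] Ym[OF that] by measurable
  \<comment> \<open>The step is taken as long as the path is in the ball, its Riemann sums are
    accurate and the difference is small; all this is known at time \<open>t k\<close>.\<close>
  define D where "D k = {w\<in>space M. \<forall>j\<le>k. norm (Y (t j) w) \<le> R \<and> norm (rsum s h j w - (Y (t j) w - Y s w)) \<le> e \<and> norm (E j w) \<le> \<epsilon>}" for k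
  have spF: "space (F u) = space M" for u using subalg[of u] by (simp add: subalgebra_def)
  have Dm: "D k \<in> sets (F (t k))" for k
  proof -
    have "{w\<in>space (F (t k)). \<forall>j\<in>{..k}. norm (Y (t j) w) \<le> R \<and> norm (rsum s h j w - (Y (t j) w - Y s w)) \<le> e \<and> norm (E j w) \<le> \<epsilon>} \<in> sets (F (t k))"
    proof (rule sets.sets_Collect_finite_All')
      fix j assume "j \<in> {..k}"
      then have j: "j \<le> k" by simp
      note [measurable] = Ym[OF j] rm[OF j] Em[OF j]
      show "{w\<in>space (F (t k)). norm (Y (t j) w) \<le> R \<and> norm (rsum s h j w - (Y (t j) w - Y s w)) \<le> e \<and> norm (E j w) \<le> \<epsilon>} \<in> sets (F (t k))"
        by measurable
    qed auto
    then show ?thesis unfolding spF D_def Ball_def atMost_iff .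
  qed
  define c where "c k w = h *\<^sub>R (b (X k w) - b (Y (t k) w))" for k w
  define H where "H k w = \<sigma> (X k w) - \<sigma> (Y (t k) w)" for k w
  have cm: "c k \<in> borel_measurable (F (t k))" and Hm: "H k \<in> borel_measurable (F (t k))" for k
    unfolding c_def[abs_def] H_def[abs_def]
    using Xm[of k k] Ym(1)[of k k]
    by (auto intro!: borel_measurable_scaleR borel_measurable_diff measurable_compose[OF _ b_measurable] measurable_compose[OF _ \<sigma>_measurable])
  have E0: "E 0 w = V w - Y s w" for w by (simp add: E_def X_def)
  have ESuc: "E (Suc k) w = E k w + (c k w + H k w *v (W (t (Suc k)) w - W (t k) w))" for k w
    by (simp add: E_def X_def c_def H_def t_def rsum_Suc matrix_vector_mult_diff_rdistrib algebra_simps)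
  define Z where "Z = rec_nat (E 0) (\<lambda>k z w. z w + indicator (D k) w *\<^sub>R (c k w + H k w *v (W (t (Suc k)) w - W (t k) w)))"
  have Z0: "Z 0 = E 0" and ZSuc: "Z (Suc k) w = Z k w + indicator (D k) w *\<^sub>R (c k w + H k w *v (W (t (Suc k)) w - W (t k) w))" for k w
    by (simp_all add: Z_def)
  have Dmono: "w \<in> D k \<Longrightarrow> j \<le> k \<Longrightarrow> w \<in> D j" for w j k by (auto simp: D_def)
  have ZE: "Z k w = E k w" if "\<And>j. j < k \<Longrightarrow> w \<in> D j" for k w
    using that by (induction k) (auto simp: Z0 ZSuc ESuc)
  have ZED: "Z k w = E k w" if "w \<in> D k" for k w using Dmono[OF that] by (intro ZE) auto
  have Zm: "Z k \<in> borel_measurable (F (t k))" for k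
  proof (induction k)
    case 0 then show ?case using Em[of 0 0] by (simp add: Z0)
  next
    case (Suc k)
    note le = less_imp_le[OF tn(2)[of k]]
    have "D k \<in> sets (F (t (Suc k)))" using Dm[of k] F_mono[OF le] by auto
    then show ?case unfolding ZSuc[abs_def]
      using measurable_F_mono[OF Suc le] measurable_F_mono[OF cm[of k] le] measurable_F_mono[OF Hm[of k] le]
        W_measurable_F[OF tn(1)[of k] le] W_measurable_F[OF tn(1)[of "Suc k"] order_refl]
      by (intro borel_measurable_add borel_measurable_scaleR borel_measurable_indicator borel_measurable_matrix_vector_mult borel_measurable_diff) auto
  qed
  have near: "norm (c k w) \<le> h * (L * (norm (Z k w) + e))" "norm (H k w) \<le> L * (norm (Z k w) + e)" "norm (Z k w) \<le> \<epsilon>"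
    if "w \<in> D k" for k w
  proof -
    have D: "norm (Y (t k) w) \<le> R" "norm (rsum s h k w - (Y (t k) w - Y s w)) \<le> e" "norm (E k w) \<le> \<epsilon>"
      using that by (auto simp: D_def)
    have XY: "X k w - Y (t k) w = E k w + (rsum s h k w - (Y (t k) w - Y s w))" by (simp add: E_def)
    have n: "norm (X k w - Y (t k) w) \<le> norm (Z k w) + e"
      unfolding XY ZED[OF that] using D(2) norm_triangle_ineq[of "E k w" "rsum s h k w - (Y (t k) w - Y s w)"] by linarith
    show zb: "norm (Z k w) \<le> \<epsilon>" using D(3) ZED[OF that] by simp
    \<comment> \<open>\<open>\<epsilon>\<close> and \<open>e\<close> are at most \<open>1\<close>,
      so the scheme remains in the ball on which \<open>L\<close> is a Lipschitz constant.\<close>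
    have "norm (X k w) \<le> R + 2"
      using n zb e D(1) norm_triangle_ineq2[of "X k w" "Y (t k) w"] by linarith
    then have l: "norm (b (X k w) - b (Y (t k) w)) \<le> L * norm (X k w - Y (t k) w)" "norm (\<sigma> (X k w) - \<sigma> (Y (t k) w)) \<le> L * norm (X k w - Y (t k) w)"
      using L(2) D(1) by auto
    have n': "L * norm (X k w - Y (t k) w) \<le> L * (norm (Z k w) + e)" by (rule mult_left_mono[OF n L(1)])
    show "norm (H k w) \<le> L * (norm (Z k w) + e)" unfolding H_def using l(2) n' by linarith
    have "norm (c k w) = h * norm (b (X k w) - b (Y (t k) w))" using h by (simp add: c_def)
    also have "\<dots> \<le> h * (L * (norm (Z k w) + e))" using l(1) n' h by (intro mult_left_mono) auto
    finally show "norm (c k w) \<le> h * (L * (norm (Z k w) + e))" .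
  qed
  have K: "0 \<le> K" using L T by (simp add: K_def)
  have Z0i: "integrable M (\<lambda>w. (norm (Z 0 w))\<^sup>2)" "expectation (\<lambda>w. (norm (Z 0 w))\<^sup>2) \<le> d\<^sup>2"
  proof -
    have bd: "AE w in M. (norm (Z 0 w))\<^sup>2 \<le> d\<^sup>2" using Vd by eventually_elim (auto simp: Z0 E0 intro: power_mono)
    have [measurable]: "Z 0 \<in> borel_measurable M" by (rule measurable_F_M[OF Zm])
    show i: "integrable M (\<lambda>w. (norm (Z 0 w))\<^sup>2)" by (rule integrable_const_bound[where B="d\<^sup>2"]) (use bd in auto)
    have "expectation (\<lambda>w. (norm (Z 0 w))\<^sup>2) \<le> expectation (\<lambda>w. d\<^sup>2)" by (rule integral_mono_AE[OF i _ bd]) simp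
    then show "expectation (\<lambda>w. (norm (Z 0 w))\<^sup>2) \<le> d\<^sup>2" by (simp add: prob_space)
  qed
  define B where "B = max \<epsilon> (max (h * (L * (\<epsilon> + e))) (L * (\<epsilon> + e)))"
  \<comment> \<open>Adding \<open>e\<^sup>2\<close> to the second moment makes the recursion purely
    multiplicative.\<close>
  have step: "integrable M (\<lambda>w. (norm (Z (Suc k) w))\<^sup>2) \<and>
      expectation (\<lambda>w. (norm (Z (Suc k) w))\<^sup>2) + e\<^sup>2 \<le> (1 + h * K) * (expectation (\<lambda>w. (norm (Z k w))\<^sup>2) + e\<^sup>2)"
    if i: "integrable M (\<lambda>w. (norm (Z k w))\<^sup>2)" for k
  proof -
    have bd: "norm (Z k w) \<le> B \<and> norm (c k w) \<le> B \<and> norm (H k w) \<le> B" if "w \<in> D k" for w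
    proof -
      have "L * (norm (Z k w) + e) \<le> L * (\<epsilon> + e)" using near(3)[OF that] L(1) by (intro mult_left_mono) auto
      moreover from this have "h * (L * (norm (Z k w) + e)) \<le> h * (L * (\<epsilon> + e))" using h by (rule_tac mult_left_mono) auto
      ultimately show ?thesis using near[OF that] by (auto simp: B_def)
    qed
    from stopped_step_norm_sq[OF tn(1,2) Zm cm Hm Dm bd i]
    have hb: "has_bochner_integral M (\<lambda>w. (norm (Z (Suc k) w))\<^sup>2)
     (expectation (\<lambda>w. (norm (Z k w))^2) + expectation (\<lambda>w. indicator (D k) w * ((norm (Z k w + c k w))^2 - (norm (Z k w))^2))
      + (t (Suc k) - t k) * expectation (\<lambda>w. indicator (D k) w * (norm (H k w))^2))"
      by (simp only: ZSuc)
    have th: "t (Suc k) - t k = h" by (simp add: t_def algebra_simps)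
    note [measurable] = measurable_F_M[OF Zm[of k]] measurable_F_M[OF cm[of k]] measurable_F_M[OF Hm[of k]] sets_F_M[OF Dm[of k]]
    have i1: "integrable M (\<lambda>w. indicator (D k) w * ((norm (Z k w + c k w))^2 - (norm (Z k w))^2))"
    proof (rule integrable_const_bound[where B="(B + B)\<^sup>2"], rule AE_I2)
      fix w
      show "norm (indicator (D k) w * ((norm (Z k w + c k w))^2 - (norm (Z k w))^2)) \<le> (B + B)\<^sup>2"
      proof (cases "w \<in> D k")
        case True
        have "norm (Z k w + c k w) \<le> B + B" using bd[OF True] norm_triangle_ineq[of "Z k w" "c k w"] by linarith
        then have "(norm (Z k w + c k w))^2 \<le> (B + B)\<^sup>2" by (intro power_mono) auto
        moreover have "norm (Z k w) \<le> B + B" using bd[OF True] norm_ge_zero[of "Z k w"] by linarith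
        then have "(norm (Z k w))^2 \<le> (B + B)\<^sup>2" by (intro power_mono) auto
        ultimately have "\<bar>(norm (Z k w + c k w))^2 - (norm (Z k w))^2\<bar> \<le> (B + B)\<^sup>2"
          using zero_le_power2[of "norm (Z k w + c k w)"] zero_le_power2[of "norm (Z k w)"] by linarith
        then show ?thesis using True by simp
      qed simp
    qed measurable
    have i2: "integrable M (\<lambda>w. indicator (D k) w * (norm (H k w))^2)"
    proof (rule integrable_const_bound[where B="B\<^sup>2"], rule AE_I2)
      fix w show "norm (indicator (D k) w * (norm (H k w))^2) \<le> B\<^sup>2"
        using bd[of w] by (cases "w \<in> D k") (auto intro: power_mono)
    qed measurable
    have "expectation (\<lambda>w. indicator (D k) w * ((norm (Z k w + c k w))^2 - (norm (Z k w))^2))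
       + h * expectation (\<lambda>w. indicator (D k) w * (norm (H k w))^2)
      = expectation (\<lambda>w. indicator (D k) w * ((norm (Z k w + c k w))^2 - (norm (Z k w))^2) + h * (indicator (D k) w * (norm (H k w))^2))"
      using i1 i2 by simp
    also have "\<dots> \<le> expectation (\<lambda>w. h * K * ((norm (Z k w))\<^sup>2 + e\<^sup>2))"
    proof (rule integral_mono)
      show "integrable M (\<lambda>w. h * K * ((norm (Z k w))\<^sup>2 + e\<^sup>2))" using i by simp
      fix w
      show "indicator (D k) w * ((norm (Z k w + c k w))^2 - (norm (Z k w))^2) + h * (indicator (D k) w * (norm (H k w))^2)
         \<le> h * K * ((norm (Z k w))\<^sup>2 + e\<^sup>2)"
      proof (cases "w \<in> D k")
        case True
        show ?thesis using sq_step_le[OF near(1,2)[OF True] less_imp_le[OF h(1)] h(2) L(1) e(3)] True by (simp add: K_def)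
      qed (use K h in simp)
    qed (use i1 i2 in simp)
    also have "\<dots> = h * K * (expectation (\<lambda>w. (norm (Z k w))\<^sup>2) + e\<^sup>2)" using i by (simp add: prob_space)
    finally show ?thesis using hb by (simp add: has_bochner_integral_iff th algebra_simps)
  qed
  have all: "integrable M (\<lambda>w. (norm (Z k w))\<^sup>2) \<and> expectation (\<lambda>w. (norm (Z k w))\<^sup>2) + e\<^sup>2 \<le> (1 + h * K) ^ k * (d\<^sup>2 + e\<^sup>2)" for k
  proof (induction k)
    case 0 then show ?case using Z0i by simp
  next
    case (Suc k)
    then have i: "integrable M (\<lambda>w. (norm (Z k w))\<^sup>2)" and I: "expectation (\<lambda>w. (norm (Z k w))\<^sup>2) + e\<^sup>2 \<le> (1 + h * K) ^ k * (d\<^sup>2 + e\<^sup>2)" by auto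
    have "(1 + h * K) * (expectation (\<lambda>w. (norm (Z k w))\<^sup>2) + e\<^sup>2) \<le> (1 + h * K) * ((1 + h * K) ^ k * (d\<^sup>2 + e\<^sup>2))"
      using I h K by (intro mult_left_mono) auto
    then show ?case using step[OF i] by simp
  qed
  \<comment> \<open>The factors over all \<open>N\<close> steps stay below
    \<open>exp (K * T)\<close>, whatever the number of steps.\<close>
  have "(1 + h * K) ^ N \<le> exp (h * K) ^ N" using h K by (intro power_mono) auto
  also have "\<dots> = exp (K * T)" by (simp add: exp_of_nat_mult[symmetric] h(3)[symmetric] mult_ac)
  finally have gr: "(1 + h * K) ^ N \<le> exp (K * T)" .
  have mom: "expectation (\<lambda>w. (norm (Z N w))\<^sup>2) \<le> exp (K * T) * (d\<^sup>2 + e\<^sup>2)"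
  proof -
    have "(1 + h * K) ^ N * (d\<^sup>2 + e\<^sup>2) \<le> exp (K * T) * (d\<^sup>2 + e\<^sup>2)" using gr by (intro mult_right_mono) auto
    then show ?thesis using all[of N] zero_le_power2[of e] by linarith
  qed
  have ZmM: "Z N \<in> borel_measurable M" by (rule measurable_F_M[OF Zm])
  have stay: "Z (k + i) w = Z k w" if "w \<notin> D k" for k i w
  proof (induction i)
    case (Suc i)
    have "w \<notin> D (k + i)" using Dmono[of w "k + i" k] that by auto
    then show ?case using Suc by (simp add: ZSuc)
  qed simp
  \<comment> \<open>On \<open>G\<close> only the size of the difference can stop the recursion. It
    stops at the first exceedance and keeps that value, so the terminal value is large too.\<close>
  have sub: "\<epsilon>\<^sup>2 \<le> (norm (Z N w))\<^sup>2" if w: "w \<in> G" "\<exists>k\<le>N. norm (E k w) > \<epsilon>" for w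
  proof -
    obtain k where k: "k \<le> N" "norm (E k w) > \<epsilon>" "\<And>j. j < k \<Longrightarrow> norm (E j w) \<le> \<epsilon>"
      using w(2) exists_least_iff[of "\<lambda>k. k \<le> N \<and> norm (E k w) > \<epsilon>"] by (metis less_imp_le less_le_trans not_le)
    have "Z k w = E k w"
      by (rule ZE) (use w(1) k in \<open>auto simp: D_def G_def t_def\<close>)
    moreover have "w \<notin> D k" using k(2) by (auto simp: D_def not_le)
    then have "Z (k + (N - k)) w = Z k w" by (rule stay)
    ultimately have "\<epsilon> \<le> norm (Z N w)" using k by simp
    then show ?thesis using e by (intro power_mono) auto
  qed
  have "\<P>(w in M. w \<in> G \<and> (\<exists>k\<le>N. norm (E k w) > \<epsilon>)) \<le> \<P>(w in M. \<epsilon>\<^sup>2 \<le> (norm (Z N w))\<^sup>2)"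
    by (rule finite_measure_mono) (use sub ZmM in auto)
  also have "\<dots> \<le> expectation (\<lambda>w. (norm (Z N w))\<^sup>2) / \<epsilon>\<^sup>2"
    by (rule integral_Markov_inequality_measure[where A="{}"]) (use all[of N] e in auto)
  also have "\<dots> \<le> exp (K * T) * (d\<^sup>2 + e\<^sup>2) / \<epsilon>\<^sup>2" by (rule divide_right_mono[OF mom]) simp
  finally show ?thesis by (simp add: E_def X_def)
qed

text \<open>The number of steps and the tolerance for the initial value are found before
  \<open>V\<close> is chosen, so that both may vary along a sequence afterwards.\<close>

theorem euler_converges_uniformly:
  assumes s: "0 \<le> s" and T: "0 < T" and \<epsilon>: "0 < \<epsilon>" and \<kappa>: "0 < \<kappa>"
  shows "\<exists>N0. \<exists>d>0. \<forall>N\<ge>N0. \<forall>V\<in>borel_measurable (F s). (AE w in M. norm (V w - Y s w) \<le> d) \<longrightarrow>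
    \<P>(w in M. euler_err V s T N w > \<epsilon>) < \<kappa>"
proof -
  define \<epsilon>1 where "\<epsilon>1 = min \<epsilon> 1 / 2"
  have \<epsilon>1: "0 < \<epsilon>1" "\<epsilon>1 \<le> 1" "2 * \<epsilon>1 \<le> \<epsilon>" using \<epsilon> by (auto simp: \<epsilon>1_def)
  obtain n :: nat where n: "s + T < real n" using reals_Archimedean2 by blast
  have "\<forall>\<^sub>F m in sequentially. prob (space M - bounded_event n m) < \<kappa> / 3"
    using order_tendstoD(2)[OF prob_unbounded, of "\<kappa> / 3" n] \<kappa> by simp
  then obtain m where m: "prob (space M - bounded_event n m) < \<kappa> / 3" by (auto simp: eventually_sequentially)
  define R where "R = real (Suc m)"
  obtain L where L: "0 \<le> L" "\<forall>x\<in>cball 0 (R + 2). \<forall>z\<in>cball 0 (R + 2). norm (b x - b z) \<le> L * norm (x - z) \<and> norm (\<sigma> x - \<sigma> z) \<le> L * norm (x - z)"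
    using locally_lipschitz by blast
  define K where "K = 3 * L + 2 * (T + 1) * L\<^sup>2"
  define q where "q = exp (K * T)"
  have q: "0 < q" by (simp add: q_def)
  \<comment> \<open>Makes the bound of \<open>euler_stopped_bound\<close> with \<open>d = e\<close>
    at most \<open>\<kappa> / 6\<close>; the remaining room is for paths leaving the ball and for
    inaccurate Riemann sums.\<close>
  define e where "e = min \<epsilon>1 (\<epsilon>1 * sqrt (\<kappa> / (12 * q)))"
  have e: "0 < e" "e \<le> \<epsilon>1" using \<epsilon>1 \<kappa> q by (auto simp: e_def)
  have small: "q * (e\<^sup>2 + e\<^sup>2) / \<epsilon>1\<^sup>2 < \<kappa> / 3"
  proof -
    have "e\<^sup>2 \<le> (\<epsilon>1 * sqrt (\<kappa> / (12 * q)))\<^sup>2" by (rule power_mono) (use e in \<open>auto simp: e_def\<close>)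
    also have "\<dots> = \<epsilon>1\<^sup>2 * (\<kappa> / (12 * q))" using \<kappa> q by (simp add: power_mult_distrib)
    finally have "q * (e\<^sup>2 + e\<^sup>2) \<le> \<epsilon>1\<^sup>2 * (\<kappa> / 6)" using q by (simp add: field_simps)
    then have "q * (e\<^sup>2 + e\<^sup>2) / \<epsilon>1\<^sup>2 \<le> \<kappa> / 6" using \<epsilon>1 by (simp add: pos_divide_le_eq mult.commute)
    then show ?thesis using \<kappa> by simp
  qed
  have "\<forall>\<^sub>F N in sequentially. \<P>(w in M. rerr s T N w > e) < \<kappa> / 3"
    by (rule tends0_eventually[OF riemann_uniform[OF s T] e(1)]) (use \<kappa> in simp)
  then obtain N0 where N0: "\<And>N. N0 \<le> N \<Longrightarrow> \<P>(w in M. rerr s T N w > e) < \<kappa> / 3" by (auto simp: eventually_sequentially)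
  show ?thesis
  proof (intro exI[of _ N0] exI[of _ e] conjI allI ballI impI)
    fix N V assume N: "N0 \<le> N" and V: "V \<in> borel_measurable (F s)" and Vd: "AE w in M. norm (V w - Y s w) \<le> e"
    define h where "h = T / real (Suc N)"
    have h: "0 < h" "real (Suc N) * h = T" using T by (simp_all add: h_def)
    let ?G = "{w\<in>space M. \<forall>k\<le>Suc N. norm (Y (s + real k * h) w) \<le> R \<and> norm (rsum s h k w - (Y (s + real k * h) w - Y s w)) \<le> e}"
    let ?B = "{w\<in>space M. w \<in> ?G \<and> (\<exists>k\<le>Suc N. norm (euler V s h k w - Y s w - rsum s h k w) > \<epsilon>1)}"
    have B: "prob ?B \<le> exp (K * T) * (e\<^sup>2 + e\<^sup>2) / \<epsilon>1\<^sup>2"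
      unfolding K_def h_def
      by (rule euler_stopped_bound[OF V s T zero_less_Suc Vd]) (use e \<epsilon>1 L in \<open>auto simp: R_def\<close>)
    have Bm: "?B \<in> events"
    proof -
      have m1: "Y (s + real k * h) \<in> borel_measurable M" "rsum s h k \<in> borel_measurable M" "euler V s h k \<in> borel_measurable M" "Y s \<in> borel_measurable M" for k
        using s h(1) V by (auto intro!: Y_measurable rsum_measurable measurable_F_M[OF euler_measurable_F])
      note [measurable] = m1
      have "?B = {w\<in>space M. (\<forall>k\<in>{..Suc N}. norm (Y (s + real k * h) w) \<le> R \<and> norm (rsum s h k w - (Y (s + real k * h) w - Y s w)) \<le> e)
          \<and> (\<exists>k\<in>{..Suc N}. norm (euler V s h k w - Y s w - rsum s h k w) > \<epsilon>1)}" by auto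
      also have "\<dots> \<in> events" by measurable
      finally show ?thesis .
    qed
    have um: "space M - bounded_event n m \<in> events" by (rule sets.compl_sets[OF events(1)])
    have rm: "{w\<in>space M. rerr s T N w > e} \<in> events" using rerr_measurable[OF s T] by measurable
    have "\<P>(w in M. euler_err V s T N w > \<epsilon>) \<le> prob (((space M - bounded_event n m) \<union> {w\<in>space M. rerr s T N w > e}) \<union> ?B)"
    proof (rule finite_measure_mono[OF subsetI])
      fix w assume "w \<in> {w\<in>space M. euler_err V s T N w > \<epsilon>}"
      then obtain k where w: "w \<in> space M" and k: "k \<le> Suc N" "norm (euler V s h k w - Y (s + real k * h) w) > \<epsilon>"
        unfolding h_def by (blast elim: euler_err_gtE)
      show "w \<in> ((space M - bounded_event n m) \<union> {w\<in>space M. rerr s T N w > e}) \<union> ?B"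
      proof (cases "w \<in> bounded_event n m \<and> rerr s T N w \<le> e")
        case True
        have YR: "norm (Y (s + real j * h) w) \<le> R" if "j \<le> Suc N" for j
        proof -
          have "real j * h \<le> T" unfolding h(2)[symmetric] using that h(1) by (intro mult_right_mono) auto
          then have "s + real j * h < real (Suc n)" using n by simp
          moreover have "0 \<le> s + real j * h" using s h(1) by simp
          ultimately show ?thesis using True by (auto simp: bounded_event_def R_def not_less)
        qed
        have re: "norm (rsum s h j w - (Y (s + real j * h) w - Y s w)) \<le> e" if "j \<le> Suc N" for j
          using rerr_ge[OF that, of s T w] True by (simp add: h_def)
        have eq: "euler V s h k w - Y (s + real k * h) w = (euler V s h k w - Y s w - rsum s h k w) + (rsum s h k w - (Y (s + real k * h) w - Y s w))" by simp
        have "norm (euler V s h k w - Y s w - rsum s h k w) > \<epsilon>1"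
          using k(2) re[OF k(1)] norm_triangle_ineq[of "euler V s h k w - Y s w - rsum s h k w" "rsum s h k w - (Y (s + real k * h) w - Y s w)"] \<epsilon>1(3) e(2)
          unfolding eq by linarith
        then have "w \<in> ?B" using w YR re k(1) by blast
        then show ?thesis by blast
      qed (use w in auto)
    next
      show "((space M - bounded_event n m) \<union> {w\<in>space M. rerr s T N w > e}) \<union> ?B \<in> events"
        by (rule sets.Un[OF sets.Un[OF um rm] Bm])
    qed
    also have "\<dots> \<le> prob ((space M - bounded_event n m) \<union> {w\<in>space M. rerr s T N w > e}) + prob ?B"
      by (rule measure_Un_le[OF sets.Un[OF um rm] Bm])
    finally have 1: "\<P>(w in M. euler_err V s T N w > \<epsilon>) \<le> prob ((space M - bounded_event n m) \<union> {w\<in>space M. rerr s T N w > e}) + prob ?B" .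
    have "prob ((space M - bounded_event n m) \<union> {w\<in>space M. rerr s T N w > e}) \<le> prob (space M - bounded_event n m) + \<P>(w in M. rerr s T N w > e)"
      by (rule measure_Un_le[OF um rm])
    then show "\<P>(w in M. euler_err V s T N w > \<epsilon>) < \<kappa>"
      using 1 B[folded q_def] small m N0[OF N] by linarith
  qed (rule e(1))
qed

theorem euler_converges:
  assumes s: "0 \<le> s" and T: "0 < T" and N: "filterlim N at_top sequentially" and d: "d \<longlonglongrightarrow> 0"
    and V: "\<And>j. V j \<in> borel_measurable (F s)" and Vd: "\<And>j. AE w in M. norm (V j w - Y s w) \<le> d j"
  shows "tends0 (\<lambda>j. euler_err (V j) s T (N j))"
  unfolding tends0_def
proof (intro conjI allI impI)
  show "euler_err (V j) s T (N j) \<in> borel_measurable M" for j by (rule euler_err_measurable[OF V s T])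
  fix \<epsilon> :: real assume \<epsilon>: "\<epsilon> > 0"
  show "(\<lambda>j. \<P>(w in M. euler_err (V j) s T (N j) w > \<epsilon>)) \<longlonglongrightarrow> 0"
  proof (rule order_tendstoI)
    fix \<kappa> :: real assume \<kappa>: "0 < \<kappa>"
    obtain N0 d0 where d0: "0 < d0" and E: "\<And>n V. N0 \<le> n \<Longrightarrow> V \<in> borel_measurable (F s) \<Longrightarrow> (AE w in M. norm (V w - Y s w) \<le> d0) \<Longrightarrow>
      \<P>(w in M. euler_err V s T n w > \<epsilon>) < \<kappa>"
      using euler_converges_uniformly[OF s T \<epsilon> \<kappa>] by blast
    have "\<forall>\<^sub>F j in sequentially. N0 \<le> N j" using N by (simp add: filterlim_at_top)
    moreover have "\<forall>\<^sub>F j in sequentially. d j < d0" by (rule order_tendstoD(2)[OF d d0])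
    ultimately show "\<forall>\<^sub>F j in sequentially. \<P>(w in M. euler_err (V j) s T (N j) w > \<epsilon>) < \<kappa>"
    proof eventually_elim
      case (elim j)
      have "AE w in M. norm (V j w - Y s w) \<le> d0" using Vd[of j] by eventually_elim (use elim in simp)
      then show ?case by (rule E[OF elim(1) V])
    qed
  qed (auto intro!: always_eventually less_le_trans[OF _ measure_nonneg])
qed

end


lemma tendsto_subsubseq:
  assumes sub: "\<And>r. strict_mono (r :: nat \<Rightarrow> nat) \<Longrightarrow> \<exists>q. strict_mono q \<and> (\<lambda>n. a (r (q n))) \<longlonglongrightarrow> l"
  shows "a \<longlonglongrightarrow> l"
proof (rule ccontr)
  assume "\<not> a \<longlonglongrightarrow> l"
  then obtain S where S: "open S" "l \<in> S" "\<not> (\<forall>\<^sub>F n in sequentially. a n \<in> S)" by (auto simp: tendsto_def)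
  then have "infinite {n. a n \<notin> S}" by (simp add: eventually_cofinite flip: cofinite_eq_sequentially)
  then obtain r :: "nat \<Rightarrow> nat" where r: "strict_mono r" "\<And>n. a (r n) \<notin> S" using infinite_enumerate[of "{n. a n \<notin> S}"] by auto
  obtain q where q: "(\<lambda>n. a (r (q n))) \<longlonglongrightarrow> l" using sub[OF r(1)] by blast
  from topological_tendstoD[OF q S(1,2)] show False using r(2) by (auto simp: eventually_sequentially)
qed

text \<open>A deterministic statement about grid functions close to a continuous path. The discrete
  entrance times have limit points, and each of these is the entrance time of the path: not earlier,
  because \<open>g \<ge> c\<close> is a closed condition, and not later, because
  \<open>g > c\<close> is an open one; the two entrance times agree by \<open>eq\<close>.\<close>

lemma entrance_converges:
  fixes y :: "real \<Rightarrow> 'a::euclidean_space" and g :: "'a \<Rightarrow> real" and x :: "nat \<Rightarrow> nat \<Rightarrow> 'a"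
  assumes y: "continuous_on {s..s + T} y" and g: "continuous_on UNIV g" and T: "0 < T"
    and N: "filterlim N at_top sequentially" and e: "e \<longlonglongrightarrow> 0"
    and close: "\<And>j k. k \<le> Suc (N j) \<Longrightarrow> norm (x j k - y (s + real k * (T / real (Suc (N j))))) \<le> e j"
    and eq: "ent s (s + T) (\<lambda>r. g (y r) \<ge> c) = ent s (s + T) (\<lambda>r. g (y r) > c)"
    and \<kappa>: "\<And>j. \<kappa> j \<le> Suc (N j)" "\<And>j k. k < \<kappa> j \<Longrightarrow> g (x j k) < c" "\<And>j. \<kappa> j < Suc (N j) \<Longrightarrow> g (x j (\<kappa> j)) \<ge> c"
  shows "(\<lambda>j. x j (\<kappa> j)) \<longlonglongrightarrow> y (ent s (s + T) (\<lambda>r. g (y r) \<ge> c))"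
proof -
  let ?u = "ent s (s + T) (\<lambda>r. g (y r) \<ge> c)"
  have uI: "s \<le> ?u" "?u \<le> s + T" using ent_ge_s[of s "s + T"] ent_le_T[of s "s + T"] T by auto
  define h where "h j = T / real (Suc (N j))" for j
  have h: "0 < h j" "real (Suc (N j)) * h j = T" for j using T by (simp_all add: h_def)
  have h0: "h \<longlonglongrightarrow> 0"
    unfolding h_def[abs_def] by (rule filterlim_compose[OF LIMSEQ_Suc[OF lim_const_over_n] N])
  define t where "t j = s + real (\<kappa> j) * h j" for j
  have grid: "s + real k * h j \<in> {s..s + T}" if "k \<le> Suc (N j)" for k j
  proof -
    have "real k * h j \<le> real (Suc (N j)) * h j" by (rule mult_right_mono) (use that h(1)[of j] in auto)
    then have "real k * h j \<le> T" unfolding h(2) .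
    then show ?thesis using h(1)[of j] by simp
  qed
  have xy: "(\<lambda>n. x (p n) (k n)) \<longlonglongrightarrow> y z"
    if p: "filterlim p at_top sequentially" and k: "\<And>n. k n \<le> Suc (N (p n))"
      and z: "(\<lambda>n. s + real (k n) * h (p n)) \<longlonglongrightarrow> z" "z \<in> {s..s + T}" for p :: "nat \<Rightarrow> nat" and k z
  proof -
    have "(\<lambda>n. y (s + real (k n) * h (p n))) \<longlonglongrightarrow> y z"
      by (rule continuous_on_tendsto_compose[OF y z]) (use grid k in auto)
    moreover have "(\<lambda>n. x (p n) (k n) - y (s + real (k n) * h (p n))) \<longlonglongrightarrow> 0"
    proof (rule Lim_null_comparison)
      show "\<forall>\<^sub>F n in sequentially. norm (x (p n) (k n) - y (s + real (k n) * h (p n))) \<le> e (p n)"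
        unfolding h_def by (intro always_eventually allI close k)
      show "(\<lambda>n. e (p n)) \<longlonglongrightarrow> 0" by (rule filterlim_compose[OF e p])
    qed
    ultimately show ?thesis using tendsto_add by fastforce
  qed
  have "t \<longlonglongrightarrow> ?u"
  proof (rule tendsto_subsubseq)
    fix r :: "nat \<Rightarrow> nat" assume r: "strict_mono r"
    have tI: "\<forall>n. t (r n) \<in> {s..s + T}" unfolding t_def by (intro allI grid \<kappa>(1))
    then have "\<exists>v\<in>{s..s + T}. \<exists>q. strict_mono q \<and> ((\<lambda>n. t (r n)) \<circ> q) \<longlonglongrightarrow> v"
      by (rule compact_Icc[unfolded compact_def, THEN spec, THEN mp])
    then obtain v q where v: "v \<in> {s..s + T}" and q: "strict_mono (q :: nat \<Rightarrow> nat)" and lim: "((\<lambda>n. t (r n)) \<circ> q) \<longlonglongrightarrow> v"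
      by blast
    define p where "p n = r (q n)" for n
    have p: "filterlim p at_top sequentially"
      unfolding p_def using filterlim_subseq[OF strict_mono_o[OF r q]] by (simp add: o_def)
    have tl: "(\<lambda>n. t (p n)) \<longlonglongrightarrow> v" using lim by (simp add: p_def o_def)
    have h0': "(\<lambda>n. h (p n)) \<longlonglongrightarrow> 0" by (rule filterlim_compose[OF h0 p])
    have gy: "(\<lambda>n. g (x (p n) (k n))) \<longlonglongrightarrow> g (y z)"
      if "\<And>n. k n \<le> Suc (N (p n))" "(\<lambda>n. s + real (k n) * h (p n)) \<longlonglongrightarrow> z" "z \<in> {s..s + T}" for k z
      by (rule continuous_on_tendsto_compose[OF g xy[OF p that]]) auto
    \<comment> \<open>Before the horizon the discrete entrance is genuine, and in the limit the path
      would satisfy \<open>g \<ge> c\<close> before its entrance time.\<close>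
    have "\<not> v < ?u"
    proof
      assume vu: "v < ?u"
      then have "\<forall>\<^sub>F n in sequentially. t (p n) < s + T" using uI by (intro order_tendstoD(2)[OF tl]) simp
      then have "\<forall>\<^sub>F n in sequentially. c \<le> g (x (p n) (\<kappa> (p n)))"
      proof eventually_elim
        case (elim n)
        then have "\<kappa> (p n) \<noteq> Suc (N (p n))" using h(2)[of "p n"] by (auto simp: t_def)
        then show ?case using \<kappa>(1)[of "p n"] by (intro \<kappa>(3)) simp
      qed
      moreover have "(\<lambda>n. g (x (p n) (\<kappa> (p n)))) \<longlonglongrightarrow> g (y v)"
        by (rule gy[OF \<kappa>(1) _ v]) (use tl in \<open>simp add: t_def\<close>)
      ultimately have "c \<le> g (y v)" by (intro tendsto_lowerbound) auto
      then show False using not_before_ent[of s v "s + T" "\<lambda>r. g (y r) \<ge> c"] vu v by simp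
    qed
    moreover have "\<not> ?u < v"
    proof
      assume uv: "?u < v"
      then obtain z where z: "?u \<le> z" "z < v" "g (y z) > c"
        using ent_less[of s "s + T" "\<lambda>r. g (y r) > c" v] v T unfolding eq by auto
      have wI: "z \<in> {s..s + T}" using z v uI by auto
      define k where "k n = nat \<lfloor>(z - s) / h (p n)\<rfloor>" for n
      have kb: "real (k n) * h (p n) \<le> z - s" "z - s < (real (k n) + 1) * h (p n)" for n
      proof -
        have nn: "0 \<le> (z - s) / h (p n)" using wI h(1)[of "p n"] by auto
        then have "real (k n) \<le> (z - s) / h (p n)" "(z - s) / h (p n) < real (k n) + 1" unfolding k_def by linarith+
        then show "real (k n) * h (p n) \<le> z - s" "z - s < (real (k n) + 1) * h (p n)"
          using h(1)[of "p n"] by (simp_all add: pos_le_divide_eq pos_divide_less_eq)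
      qed
      have kN: "k n \<le> Suc (N (p n))" for n
      proof -
        have "real (k n) * h (p n) \<le> real (Suc (N (p n))) * h (p n)" using kb(1)[of n] wI unfolding h(2) by simp
        then show ?thesis using h(1)[of "p n"] by (simp only: mult_le_cancel_right_pos of_nat_le_iff)
      qed
      have kl: "(\<lambda>n. s + real (k n) * h (p n)) \<longlonglongrightarrow> z"
      proof (rule LIM_zero_cancel, rule Lim_null_comparison[OF _ h0'])
        show "\<forall>\<^sub>F n in sequentially. norm (s + real (k n) * h (p n) - z) \<le> h (p n)"
          using kb by (intro always_eventually allI) (auto simp: abs_le_iff algebra_simps less_imp_le)
      qed
      have "(\<lambda>n. t (p n) - (s + real (k n) * h (p n))) \<longlonglongrightarrow> v - z" by (rule tendsto_diff[OF tl kl])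
      then have "\<forall>\<^sub>F n in sequentially. 0 < t (p n) - (s + real (k n) * h (p n))" using z by (intro order_tendstoD(1)) auto
      then have "\<forall>\<^sub>F n in sequentially. g (x (p n) (k n)) \<le> c"
      proof eventually_elim
        case (elim n)
        then have "real (k n) * h (p n) < real (\<kappa> (p n)) * h (p n)" by (simp add: t_def)
        then have "k n < \<kappa> (p n)" using h(1)[of "p n"] by (simp only: mult_less_cancel_right_pos of_nat_less_iff)
        then show ?case using \<kappa>(2) less_imp_le by blast
      qed
      then have "g (y z) \<le> c" using gy[OF kN kl wI] by (intro tendsto_upperbound) auto
      then show False using z by simp
    qed
    ultimately have "v = ?u" by simp
    then show "\<exists>q. strict_mono q \<and> (\<lambda>n. t (r (q n))) \<longlonglongrightarrow> ?u" using q tl by (auto simp: p_def)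
  qed
  then show ?thesis
    using xy[of "\<lambda>n. n" \<kappa> ?u] \<kappa>(1) uI by (simp add: t_def[abs_def] filterlim_ident)
qed

section \<open>The stopped Euler scheme and its transition operator\<close>

text \<open>Points with \<open>\<bar>\<xi>\<bar> \<ge> 1\<close> are absorbing, so the stopped
  scheme is a Markov chain without memory of its stopping index.\<close>

definition euler_step :: "(real^'d \<Rightarrow> real^'d) \<Rightarrow> (real^'d \<Rightarrow> real^'n^'d) \<Rightarrow> (real^'d \<Rightarrow> real) \<Rightarrow> real \<Rightarrow> real^'d \<Rightarrow> real^'n \<Rightarrow> real^'d" where
  "euler_step b \<sigma> \<xi> h x z = (if \<bar>\<xi> x\<bar> \<ge> 1 then x else x + (h *\<^sub>R b x + \<sigma> x *v z))"

text \<open>The transition operator of that chain. It refers to the coefficients and a Gaussian law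
  only, not to any of the probability spaces.\<close>

definition euler_op :: "(real^'d \<Rightarrow> real^'d) \<Rightarrow> (real^'d \<Rightarrow> real^'n^'d) \<Rightarrow> (real^'d \<Rightarrow> real) \<Rightarrow> real \<Rightarrow> (real^'d \<Rightarrow> real) \<Rightarrow> real^'d \<Rightarrow> real" where
  "euler_op b \<sigma> \<xi> h \<phi> x = (\<integral>z. \<phi> (euler_step b \<sigma> \<xi> h x z) \<partial>gauss h)"

definition euler_semigroup :: "(real^'d \<Rightarrow> real^'d) \<Rightarrow> (real^'d \<Rightarrow> real^'n^'d) \<Rightarrow> (real^'d \<Rightarrow> real) \<Rightarrow> real \<Rightarrow> nat \<Rightarrow> (real^'d \<Rightarrow> real) \<Rightarrow> real^'d \<Rightarrow> real" where
  "euler_semigroup b \<sigma> \<xi> T N \<phi> = (euler_op b \<sigma> \<xi> (T / real (Suc N)) ^^ Suc N) \<phi>"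

context lipschitz_strip_process
begin

abbreviation "step \<equiv> euler_step b \<sigma> \<xi>"
abbreviation "op \<equiv> euler_op b \<sigma> \<xi>"

lemma step_measurable[measurable]: "(\<lambda>(x, z). step h x z) \<in> borel_measurable (borel \<Otimes>\<^sub>M borel)"
proof -
  have [measurable]: "\<xi> \<in> borel_measurable borel" by (rule borel_measurable_continuous_onI[OF \<xi>_cont])
  note [measurable] = b_measurable \<sigma>_measurable
  have "(\<lambda>p. snd p :: real^'n) \<in> borel_measurable (borel \<Otimes>\<^sub>M borel)" "(\<lambda>p. fst p :: real^'d) \<in> borel_measurable (borel \<Otimes>\<^sub>M borel)"
    by measurable
  note [measurable] = borel_measurable_matrix_vector_mult[OF measurable_compose[OF this(2) \<sigma>_measurable] this(1)]
  show ?thesis unfolding euler_step_def case_prod_beta by measurable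
qed

lemma op_bounded:
  assumes \<phi>[measurable]: "\<phi> \<in> borel_measurable borel" and B: "\<And>x. \<bar>\<phi> x\<bar> \<le> B" and h: "0 < h"
  shows "op h \<phi> \<in> borel_measurable borel" "\<And>x. \<bar>op h \<phi> x\<bar> \<le> B"
proof -
  interpret G: prob_space "gauss h :: (real^'n) measure" by (rule prob_space_gauss[OF h])
  have sg: "sets (gauss h :: (real^'n) measure) = sets borel" by (rule sets_gauss)
  have "(\<lambda>(x, z). step h x z) \<in> borel_measurable (borel \<Otimes>\<^sub>M (gauss h :: (real^'n) measure))"
    using step_measurable[of h] by (simp cong: measurable_cong_sets sets_pair_measure_cong add: sg)
  from measurable_compose[OF this \<phi>]
  have "(\<lambda>(x, z). \<phi> (step h x z)) \<in> borel_measurable (borel \<Otimes>\<^sub>M (gauss h :: (real^'n) measure))"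
    by (simp add: case_prod_beta)
  from G.borel_measurable_lebesgue_integral[OF this]
  show "op h \<phi> \<in> borel_measurable borel" unfolding euler_op_def[abs_def] by simp
  show "\<bar>op h \<phi> x\<bar> \<le> B" for x
  proof -
    have "(\<lambda>z. step h x z) \<in> borel_measurable borel" using measurable_Pair2[OF step_measurable[of h], of x] by simp
    then have [measurable]: "(\<lambda>z. step h x z) \<in> borel_measurable (gauss h)" by (simp cong: measurable_cong_sets add: sg)
    have i: "integrable (gauss h) (\<lambda>z. \<phi> (step h x z))"
      by (rule G.integrable_const_bound[where B=B]) (use B in auto)
    have "\<bar>op h \<phi> x\<bar> \<le> (\<integral>z. \<bar>\<phi> (step h x z)\<bar> \<partial>gauss h)" unfolding euler_op_def by (rule integral_abs_bound)
    also have "\<dots> \<le> (\<integral>z. B \<partial>(gauss h :: (real^'n) measure))" by (rule integral_mono) (use i B in auto)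
    also have "\<dots> = B" using G.prob_space by (simp del: space_gauss)
    finally show ?thesis .
  qed
qed

lemma op_pow_bounded:
  assumes \<phi>: "\<phi> \<in> borel_measurable borel" and B: "\<And>x. \<bar>\<phi> x\<bar> \<le> B" and h: "0 < h"
  shows "(op h ^^ k) \<phi> \<in> borel_measurable borel \<and> (\<forall>x. \<bar>(op h ^^ k) \<phi> x\<bar> \<le> B)"
  by (induction k) (use \<phi> B op_bounded[OF _ _ h] in auto)

primrec stopped_euler :: "('w \<Rightarrow> real^'d) \<Rightarrow> real \<Rightarrow> real \<Rightarrow> nat \<Rightarrow> 'w \<Rightarrow> real^'d" where
  "stopped_euler V s h 0 w = V w"
| "stopped_euler V s h (Suc k) w = step h (stopped_euler V s h k w) (W (s + real (Suc k) * h) w - W (s + real k * h) w)"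

text \<open>The absorbing chain is the ordinary scheme at its first index with
  \<open>\<bar>\<xi>\<bar> \<ge> 1\<close>, or at the last index if there is none: the shape that
  \<open>entrance_converges\<close> expects.\<close>

lemma stopped_euler_eq:
  "\<exists>\<kappa>\<le>n. (\<forall>k<\<kappa>. \<bar>\<xi> (euler V s h k w)\<bar> < 1) \<and> (\<kappa> < n \<longrightarrow> \<bar>\<xi> (euler V s h \<kappa> w)\<bar> \<ge> 1) \<and> stopped_euler V s h n w = euler V s h \<kappa> w"
proof (induction n)
  case 0 then show ?case by simp
next
  case (Suc n)
  then obtain \<kappa> where \<kappa>: "\<kappa> \<le> n" "\<And>k. k < \<kappa> \<Longrightarrow> \<bar>\<xi> (euler V s h k w)\<bar> < 1" "\<kappa> < n \<Longrightarrow> \<bar>\<xi> (euler V s h \<kappa> w)\<bar> \<ge> 1"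
    "stopped_euler V s h n w = euler V s h \<kappa> w" by blast
  show ?case
  proof (cases "\<bar>\<xi> (euler V s h \<kappa> w)\<bar> \<ge> 1")
    case True
    then show ?thesis using \<kappa> by (intro exI[of _ \<kappa>]) (simp add: euler_step_def)
  next
    case False
    then have n: "\<kappa> = n" using \<kappa>(1,3) by force
    have "\<bar>\<xi> (euler V s h k w)\<bar> < 1" if "k < Suc n" for k using that \<kappa>(2)[of k] False n by (cases "k = n") auto
    then show ?thesis using \<kappa>(4) False n by (intro exI[of _ "Suc n"]) (simp add: euler_step_def)
  qed
qed

lemma stopped_euler_measurable_F:
  assumes V: "V \<in> borel_measurable (F s)" and s: "0 \<le> s" and h: "0 \<le> h"
  shows "stopped_euler V s h k \<in> borel_measurable (F (s + real k * h))"
proof (induction k)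
  case 0
  have "stopped_euler V s h 0 = V" by (rule ext) simp
  then show ?case using V by simp
next
  case (Suc k)
  have le: "s + real k * h \<le> s + real (Suc k) * h" using h by (simp add: mult_right_mono)
  have nn: "0 \<le> s + real k * h" using s h by simp
  have [measurable]: "stopped_euler V s h k \<in> borel_measurable (F (s + real (Suc k) * h))"
    by (rule measurable_F_mono[OF Suc le])
  have [measurable]: "W (s + real (Suc k) * h) \<in> borel_measurable (F (s + real (Suc k) * h))"
    "W (s + real k * h) \<in> borel_measurable (F (s + real (Suc k) * h))"
    using W_measurable_F nn le by auto
  have "(\<lambda>w. (stopped_euler V s h k w, W (s + real (Suc k) * h) w - W (s + real k * h) w)) \<in> F (s + real (Suc k) * h) \<rightarrow>\<^sub>M borel \<Otimes>\<^sub>M borel"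
    by measurable
  from measurable_compose[OF this step_measurable[of h]] show ?case unfolding stopped_euler.simps(2)[abs_def] by simp
qed

text \<open>The last increment is integrated out first, which replaces \<open>\<phi>\<close> by its
  image under the operator. The event \<open>A\<close> from the past of \<open>s\<close> is carried
  along for the Markov property.\<close>

lemma expectation_stopped_euler:
  assumes V: "V \<in> borel_measurable (F s)" and s: "0 \<le> s" and h: "0 < h" and A: "A \<in> sets (F s)"
    and \<phi>: "\<phi> \<in> borel_measurable borel" "\<And>x. \<bar>\<phi> x\<bar> \<le> B"
  shows "expectation (\<lambda>w. indicator A w * \<phi> (stopped_euler V s h k w)) = expectation (\<lambda>w. indicator A w * (op h ^^ k) \<phi> (V w))"
  using \<phi>
proof (induction k arbitrary: \<phi>)
  case (Suc k)
  let ?t = "s + real k * h" and ?t' = "s + real (Suc k) * h"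
  let ?g = "\<lambda>w z. indicator A w * \<phi> (step h (stopped_euler V s h k w) z)"
  have t: "0 \<le> ?t" "?t < ?t'" "?t' - ?t = h" "s \<le> ?t" using s h by (auto simp: algebra_simps)
  have Am: "A \<in> sets (F ?t)" using A F_mono[OF t(4)] by auto
  note [measurable] = stopped_euler_measurable_F[OF V s less_imp_le[OF h], of k] Am Suc.prems(1)
  have "(\<lambda>p. (stopped_euler V s h k (fst p), snd p)) \<in> F ?t \<Otimes>\<^sub>M borel \<rightarrow>\<^sub>M borel \<Otimes>\<^sub>M (borel :: (real^'n) measure)"
    by measurable
  note [measurable] = measurable_compose[OF this step_measurable[of h], simplified]
  have gm: "(\<lambda>(w, z). ?g w z) \<in> borel_measurable (F ?t \<Otimes>\<^sub>M borel)" unfolding case_prod_beta by measurable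
  have gb: "\<bar>?g w z\<bar> \<le> B" for w z using Suc.prems(2) abs_ge_zero[THEN order_trans] by (auto simp: indicator_def)
  from expectation_increment[OF t(1,2) gm gb]
  have "expectation (\<lambda>w. indicator A w * \<phi> (stopped_euler V s h (Suc k) w)) = expectation (\<lambda>w. indicator A w * op h \<phi> (stopped_euler V s h k w))"
    by (simp add: t(3)[simplified] euler_op_def)
  also have "\<dots> = expectation (\<lambda>w. indicator A w * (op h ^^ k) (op h \<phi>) (V w))"
    by (rule Suc.IH) (use op_bounded[OF Suc.prems h] in auto)
  also have "(op h ^^ k) (op h \<phi>) = (op h ^^ Suc k) \<phi>" by (simp add: funpow_swap1)
  finally show ?case .
qed simp

text \<open>Along a subsequence the scheme converges to the path uniformly on the grid almost
  surely, hence so do the stopped values by \<open>entrance_converges\<close>. The limit does not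
  depend on the subsequence, and the expectations of the scheme are those of the iterated
  operator.\<close>

theorem euler_weak_limit:
  assumes s: "0 \<le> s" and T: "0 < T" and N: "filterlim N at_top sequentially" and d: "d \<longlonglongrightarrow> 0"
    and V: "\<And>j. V j \<in> borel_measurable (F s)" and Vd: "\<And>j. AE w in M. norm (V j w - Y s w) \<le> d j"
    and A: "A \<in> sets (F s)" and \<phi>: "continuous_on UNIV \<phi>" "\<And>x. \<bar>\<phi> x\<bar> \<le> B"
  shows "(\<lambda>j. expectation (\<lambda>w. indicator A w * euler_semigroup b \<sigma> \<xi> T (N j) \<phi> (V j w)))
    \<longlonglongrightarrow> expectation (\<lambda>w. indicator A w * \<phi> (stopped s T w))"
proof -
  define X where "X j = stopped_euler (V j) s (T / real (Suc (N j))) (Suc (N j))" for j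
  have h: "0 < T / real (Suc n)" for n using T by simp
  have \<phi>m[measurable]: "\<phi> \<in> borel_measurable borel" by (rule borel_measurable_continuous_onI[OF \<phi>(1)])
  have Xm[measurable]: "X j \<in> borel_measurable M" for j
    unfolding X_def by (rule measurable_F_M[OF stopped_euler_measurable_F[OF V s less_imp_le[OF h]]])
  have Sm[measurable]: "stopped s T \<in> borel_measurable M" by (rule stopped_measurable[OF s less_imp_le[OF T]])
  have Am[measurable]: "A \<in> events" by (rule sets_F_M[OF A])
  have "(\<lambda>j. expectation (\<lambda>w. indicator A w * \<phi> (X j w))) \<longlonglongrightarrow> expectation (\<lambda>w. indicator A w * \<phi> (stopped s T w))"
  proof (rule tendsto_subsubseq)
    fix r :: "nat \<Rightarrow> nat" assume r: "strict_mono r"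
    have nn: "0 \<le> euler_err (V (r n)) s T (N (r n)) w" for n w
      using euler_err_ge[of 0 "N (r n)"] norm_ge_zero order_trans by blast
    obtain q where q: "strict_mono q" and lim: "AE w in M. (\<lambda>n. euler_err (V (r (q n))) s T (N (r (q n))) w) \<longlonglongrightarrow> 0"
      using tends0_AE_subseq[OF tends0_subseq[OF euler_converges[OF s T N d V Vd] r] nn] by blast
    define p where "p n = r (q n)" for n
    have p: "filterlim p at_top sequentially"
      unfolding p_def using filterlim_subseq[OF strict_mono_o[OF r q]] by (simp add: o_def)
    have "(\<lambda>n. expectation (\<lambda>w. indicator A w * \<phi> (X (p n) w))) \<longlonglongrightarrow> expectation (\<lambda>w. indicator A w * \<phi> (stopped s T w))"
    proof (rule integral_dominated_convergence[where w="\<lambda>_. B"])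
      show "AE w in M. (\<lambda>n. indicator A w * \<phi> (X (p n) w)) \<longlonglongrightarrow> indicator A w * \<phi> (stopped s T w)"
        using lim exit_closed_eq_open[OF s T] AE_space
      proof eventually_elim
        case (elim w)
        have "\<forall>n. \<exists>\<kappa>\<le>Suc (N (p n)). (\<forall>k<\<kappa>. \<bar>\<xi> (euler (V (p n)) s (T / real (Suc (N (p n)))) k w)\<bar> < 1) \<and>
            (\<kappa> < Suc (N (p n)) \<longrightarrow> \<bar>\<xi> (euler (V (p n)) s (T / real (Suc (N (p n)))) \<kappa> w)\<bar> \<ge> 1) \<and>
            X (p n) w = euler (V (p n)) s (T / real (Suc (N (p n)))) \<kappa> w"
          unfolding X_def by (intro allI stopped_euler_eq)
        then obtain \<kappa> where \<kappa>: "\<And>n. \<kappa> n \<le> Suc (N (p n))"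
          "\<And>n k. k < \<kappa> n \<Longrightarrow> \<bar>\<xi> (euler (V (p n)) s (T / real (Suc (N (p n)))) k w)\<bar> < 1"
          "\<And>n. \<kappa> n < Suc (N (p n)) \<Longrightarrow> \<bar>\<xi> (euler (V (p n)) s (T / real (Suc (N (p n)))) (\<kappa> n) w)\<bar> \<ge> 1"
          "\<And>n. X (p n) w = euler (V (p n)) s (T / real (Suc (N (p n)))) (\<kappa> n) w" by metis
        have "(\<lambda>n. X (p n) w) \<longlonglongrightarrow> stopped s T w"
          unfolding \<kappa>(4) stopped_def
        proof (rule entrance_converges[where N="\<lambda>n. N (p n)" and e="\<lambda>n. euler_err (V (p n)) s T (N (p n)) w"])
          show "continuous_on {s..s + T} (\<lambda>r. Y r w)" by (rule continuous_on_subset[OF Y_cont[OF elim(3)]]) (use s in auto)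
          show "filterlim (\<lambda>n. N (p n)) at_top sequentially" by (rule filterlim_compose[OF N p])
        qed (use abs_\<xi>_cont T elim(1,2) euler_err_ge \<kappa> in \<open>auto simp: p_def\<close>)
        then have "(\<lambda>n. \<phi> (X (p n) w)) \<longlonglongrightarrow> \<phi> (stopped s T w)" by (rule continuous_on_tendsto_compose[OF \<phi>(1)]) auto
        then show ?case by (intro tendsto_intros)
      qed
      show "AE w in M. norm (indicator A w * \<phi> (X (p n) w)) \<le> B" for n
        using \<phi>(2) abs_ge_zero[THEN order_trans, OF \<phi>(2)] by (auto simp: indicator_def)
    qed simp_all
    then show "\<exists>q. strict_mono q \<and> (\<lambda>n. expectation (\<lambda>w. indicator A w * \<phi> (X (r (q n)) w))) \<longlonglongrightarrow> expectation (\<lambda>w. indicator A w * \<phi> (stopped s T w))"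
      using q by (auto simp: p_def)
  qed
  moreover have "expectation (\<lambda>w. indicator A w * \<phi> (X j w)) = expectation (\<lambda>w. indicator A w * euler_semigroup b \<sigma> \<xi> T (N j) \<phi> (V j w))" for j
    unfolding X_def euler_semigroup_def by (rule expectation_stopped_euler[OF V s h A \<phi>m \<phi>(2)])
  ultimately show ?thesis by simp
qed

end


section \<open>The Feller property\<close>

text \<open>The link between extended-real hitting times in the definitions and the real-valued
  times used above.\<close>

lemma min_hit_eq_ent:
  assumes t: "0 \<le> t" shows "min (ereal t) (hit p B) = ereal (ent 0 t (\<lambda>r. p r \<in> B))"
proof (rule antisym)
  have "0 \<le> min (ereal t) (hit p B)" "min (ereal t) (hit p B) \<le> ereal t" using t hit_nonneg[of p B] by auto
  then obtain m where m: "min (ereal t) (hit p B) = ereal m" by (cases "min (ereal t) (hit p B)") auto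
  have "m \<le> ent 0 t (\<lambda>r. p r \<in> B)"
  proof (rule ent_geI)
    have "ereal m \<le> ereal t" "ereal m \<le> hit p B" unfolding m[symmetric] by auto
    then show "p r \<notin> B" if "0 \<le> r" "r < m" for r using hit_le[of r p B] that by (auto dest: order_trans)
    show "m \<le> t" using \<open>ereal m \<le> ereal t\<close> by simp
  qed
  then show "min (ereal t) (hit p B) \<le> ereal (ent 0 t (\<lambda>r. p r \<in> B))" by (simp add: m)
  show "ereal (ent 0 t (\<lambda>r. p r \<in> B)) \<le> min (ereal t) (hit p B)"
    unfolding min.bounded_iff
  proof (intro conjI hit_ge)
    show "ereal (ent 0 t (\<lambda>r. p r \<in> B)) \<le> ereal r" if "0 \<le> r" "p r \<in> B" for r
      using ent_le[of 0 r t "\<lambda>r. p r \<in> B"] ent_le_T[of 0 t "\<lambda>r. p r \<in> B"] that by (cases "r \<le> t") auto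
  qed (simp add: ent_le_T)
qed

lemma hit_Un: "hit p (A \<union> B) = min (hit p A) (hit p B)"
proof -
  have "{s. 0 \<le> s \<and> p s \<in> A \<union> B} = {s. 0 \<le> s \<and> p s \<in> A} \<union> {s. 0 \<le> s \<and> p s \<in> B}" by auto
  then show ?thesis unfolding hit_def by (simp add: INF_union inf_min)
qed

context strip_process
begin

lemma stopped_process_eq:
  assumes "0 \<le> t"
  shows "stopped_process \<xi> {x. \<xi> x \<le> -1} Y t w = Y (ent 0 t (\<lambda>r. Y r w \<in> {x. \<xi> x > 1} \<union> {x. \<xi> x \<le> -1})) w"
  unfolding stopped_process_def hit_level_def hit_Un[symmetric] min_hit_eq_ent[OF assms] by simp

text \<open>The set prescribed for stopping lies between \<open>\<bar>\<xi>\<bar> > 1\<close> and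
  \<open>\<bar>\<xi>\<bar> \<ge> 1\<close>, whose entrance times agree almost surely.\<close>

lemma stopped_process_AE:
  assumes t: "0 \<le> t"
  shows "AE w in M. stopped_process \<xi> {x. \<xi> x \<le> -1} Y t w = stopped 0 t w"
proof (cases "t = 0")
  case True
  have "ent 0 0 P = 0" for P using ent_ge_s[of 0 0 P] ent_le_T[of 0 0 P] by simp
  then show ?thesis using True by (simp add: stopped_process_eq stopped_def)
next
  case False
  then have t0: "0 < t" using t by simp
  show ?thesis using exit_closed_eq_open[OF order_refl t0]
  proof eventually_elim
    case (elim w)
    let ?B = "\<lambda>r. Y r w \<in> {x. \<xi> x > 1} \<union> {x. \<xi> x \<le> -1}"
    have "ent 0 t (\<lambda>r. \<bar>\<xi> (Y r w)\<bar> \<ge> 1) \<le> ent 0 t ?B" "ent 0 t ?B \<le> ent 0 t (\<lambda>r. \<bar>\<xi> (Y r w)\<bar> > 1)"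
      using t by (auto intro!: ent_antimono)
    then have "ent 0 t ?B = ent 0 t (\<lambda>r. \<bar>\<xi> (Y r w)\<bar> \<ge> 1)" using elim by simp
    then show ?case using t by (simp add: stopped_process_eq stopped_def)
  qed
qed

text \<open>Adaptedness is an exact requirement and \<open>F t\<close> need not contain the null
  sets, so the almost sure identity with \<open>stopped\<close> is not enough; the half open, half
  closed stopping set is treated directly.\<close>

lemma stopped_process_measurable_F:
  assumes t: "0 \<le> t"
  shows "stopped_process \<xi> {x. \<xi> x \<le> -1} Y t \<in> borel_measurable (F t)"
proof -
  let ?\<rho> = "\<lambda>w. ent 0 t (\<lambda>r. Y r w \<in> {x. \<xi> x > 1} \<union> {x. \<xi> x \<le> -1})"
  have spF: "space (F u) = space M" for u using subalg[of u] by (simp add: subalgebra_def)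
  have b: "0 \<le> ?\<rho> w" "?\<rho> w \<le> t" for w using ent_ge_s[OF t] ent_le_T[of 0 t] by auto
  have nc: "continuous_on UNIV (\<lambda>x. - \<xi> x)" by (intro continuous_intros \<xi>_cont)
  have opt: "{w\<in>space M. u \<le> ?\<rho> w} \<in> sets (F u)" if u: "0 \<le> u" "u \<le> t" for u
  proof -
    have "{w\<in>space M. u \<le> ?\<rho> w} = {w\<in>space M. \<forall>r. 0 \<le> r \<and> r < u \<longrightarrow> \<not> \<xi> (Y r w) > 1} \<inter> {w\<in>space M. \<forall>r. 0 \<le> r \<and> r < u \<longrightarrow> \<not> - \<xi> (Y r w) \<ge> 1}"
      by (auto simp: ent_ge_iff[OF u(1)] u(2))
    then show ?thesis using not_open_before[OF \<xi>_cont order_refl u(1), of 1] not_closed_before[OF nc order_refl u(1), of 1] by simp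
  qed
  have \<rho>m: "?\<rho> \<in> borel_measurable (F t)"
    unfolding borel_measurable_iff_ge spF
  proof
    fix u
    consider "u < 0" | "0 \<le> u" "u \<le> t" | "t < u" by linarith
    then show "{w\<in>space M. u \<le> ?\<rho> w} \<in> sets (F t)"
    proof cases
      case 1
      then have "{w\<in>space M. u \<le> ?\<rho> w} = space (F t)" using b(1) spF by (auto intro: order_trans less_imp_le)
      then show ?thesis by (simp only: sets.top)
    next
      case 2 then show ?thesis using opt[OF 2] F_mono[of u t] by auto
    next
      case 3
      then have "{w\<in>space M. u \<le> ?\<rho> w} = {}" using b(2) by (auto simp: not_le intro: le_less_trans)
      then show ?thesis by (simp only: sets.empty_sets)
    qed
  qed
  have "(\<lambda>w. Y (?\<rho> w) w) \<in> borel_measurable (F t)"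
  proof (rule measurable_at_random_time[where t=t and X=Y and N="F t", OF _ _ \<rho>m _ t])
    show "continuous_on {0..t} (\<lambda>u. Y u w)" if "w \<in> space (F t)" for w
      by (rule continuous_on_subset[OF Y_cont]) (use that spF in auto)
  qed (use b Y_measurable_F in auto)
  moreover have "stopped_process \<xi> {x. \<xi> x \<le> -1} Y t = (\<lambda>w. Y (?\<rho> w) w)" by (rule ext) (rule stopped_process_eq[OF t])
  ultimately show ?thesis by (simp only:)
qed

text \<open>While the path has not reached the boundary, stopping can be restarted at time
  \<open>s\<close>.\<close>

lemma stopped_split_inside:
  assumes "0 \<le> s" "0 \<le> T" "\<And>r. 0 \<le> r \<Longrightarrow> r < s \<Longrightarrow> \<bar>\<xi> (Y r w)\<bar> < 1" "\<bar>\<xi> (Y s w)\<bar> < 1"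
  shows "stopped 0 (s + T) w = stopped s T w" "stopped 0 s w = Y s w"
proof -
  let ?P = "\<lambda>r. \<bar>\<xi> (Y r w)\<bar> \<ge> 1"
  have "ent 0 (s + T) ?P = ent s (s + T) ?P"
  proof (rule antisym)
    show "ent 0 (s + T) ?P \<le> ent s (s + T) ?P"
      by (rule ent_geI[OF ent_le_T]) (use not_before_ent[of 0 _ "s + T" ?P] assms(1) in fastforce)
    show "ent s (s + T) ?P \<le> ent 0 (s + T) ?P"
    proof (rule ent_geI[OF ent_le_T])
      fix r assume "0 \<le> r" "r < ent s (s + T) ?P"
      then show "\<not> ?P r" using not_before_ent[of s r "s + T" ?P] assms(3)[of r] by (cases "r < s") auto
    qed
  qed
  then show "stopped 0 (s + T) w = stopped s T w" by (simp add: stopped_def)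
  have "s \<le> ent 0 s ?P" by (rule ent_geI) (use assms(3) in force)+
  then have "ent 0 s ?P = s" using ent_le_T[of 0 s ?P] by simp
  then show "stopped 0 s w = Y s w" by (simp add: stopped_def)
qed

text \<open>Once the boundary has been reached by time \<open>s\<close>, the position is frozen and
  has \<open>\<bar>\<xi>\<bar> \<ge> 1\<close>, a starting point that the stopped process never
  leaves.\<close>

lemma stopped_split_outside:
  assumes w: "w \<in> space M" and s: "0 \<le> s" "0 \<le> T" and out: "\<not> ((\<forall>r. 0 \<le> r \<and> r < s \<longrightarrow> \<bar>\<xi> (Y r w)\<bar> < 1) \<and> \<bar>\<xi> (Y s w)\<bar> < 1)"
  shows "stopped 0 (s + T) w = stopped 0 s w" "\<bar>\<xi> (stopped 0 s w)\<bar> \<ge> 1"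
proof -
  let ?P = "\<lambda>r. \<bar>\<xi> (Y r w)\<bar> \<ge> 1"
  let ?v = "ent 0 s ?P"
  have v: "0 \<le> ?v" "?v \<le> s" using ent_ge_s[OF s(1)] ent_le_T[of 0 s] by auto
  have Pv: "?P ?v"
  proof (cases "?v < s")
    case True then show ?thesis by (rule ent_closed_ge[OF gY_cont[OF abs_\<xi>_cont w order_refl] s(1)])
  next
    case False
    then have "?v = s" using v by simp
    moreover from this have "\<bar>\<xi> (Y r w)\<bar> < 1" if "0 \<le> r" "r < s" for r using not_before_ent[of 0 r s ?P] that by simp
    ultimately show ?thesis using out by force
  qed
  have "ent 0 (s + T) ?P = ?v" by (rule ent_eqI) (use v s Pv not_before_ent[of 0 _ s ?P] in auto)
  then show "stopped 0 (s + T) w = stopped 0 s w" "\<bar>\<xi> (stopped 0 s w)\<bar> \<ge> 1" using Pv by (simp_all add: stopped_def)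
qed

end

text \<open>One solution for each starting point, with \<open>\<delta>\<close> and \<open>C\<close>
  common to all of them, so that estimates are uniform in the starting point.\<close>

locale sde_family =
  fixes M :: "real^'d \<Rightarrow> 'w measure" and F and W :: "real^'d \<Rightarrow> real \<Rightarrow> 'w \<Rightarrow> real^'n" and Y :: "real^'d \<Rightarrow> real \<Rightarrow> 'w \<Rightarrow> real^'d"
    and b :: "real^'d \<Rightarrow> real^'d" and \<sigma> :: "real^'d \<Rightarrow> real^'n^'d" and \<xi> :: "real^'d \<Rightarrow> real" and \<xi>' \<xi>'' \<delta> C
  assumes process: "\<And>y. lipschitz_strip_process (M y) (F y) (W y) b \<sigma> (Y y) \<xi> \<xi>' \<xi>'' \<delta> C"
    and start: "\<And>y. AE w in M y. Y y 0 w = y"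
begin

abbreviation stop :: "real^'d \<Rightarrow> real \<Rightarrow> real \<Rightarrow> 'w \<Rightarrow> real^'d" where
  "stop y \<equiv> strip_process.stopped (Y y) \<xi>"

definition P :: "real \<Rightarrow> (real^'d \<Rightarrow> real) \<Rightarrow> real^'d \<Rightarrow> real" where
  "P T \<phi> y = (\<integral>w. \<phi> (stop y 0 T w) \<partial>M y)"

lemma stop_measurable: "0 \<le> s \<Longrightarrow> 0 \<le> T \<Longrightarrow> stop y s T \<in> borel_measurable (M y)"
proof -
  interpret lipschitz_strip_process "M y" "F y" "W y" b \<sigma> "Y y" \<xi> \<xi>' \<xi>'' \<delta> C by (rule process)
  show "0 \<le> s \<Longrightarrow> 0 \<le> T \<Longrightarrow> stop y s T \<in> borel_measurable (M y)" by (rule stopped_measurable)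
qed

lemma prob_space_M: "prob_space (M y)"
proof -
  interpret lipschitz_strip_process "M y" "F y" "W y" b \<sigma> "Y y" \<xi> \<xi>' \<xi>'' \<delta> C by (rule process)
  show ?thesis by unfold_locales
qed

lemma P_const:
  assumes T: "0 \<le> T" and \<phi>: "continuous_on UNIV \<phi>" and AE: "AE w in M z. stop z 0 T w = z"
  shows "P T \<phi> z = \<phi> z"
proof -
  interpret prob_space "M z" by (rule prob_space_M)
  note [measurable] = borel_measurable_continuous_onI[OF \<phi>] stop_measurable[OF order_refl T, of z]
  have "P T \<phi> z = (\<integral>w. \<phi> z \<partial>M z)" unfolding P_def
    by (rule integral_cong_AE) (use AE in auto)
  then show ?thesis by (simp add: prob_space)
qed

lemma P_0: "continuous_on UNIV \<phi> \<Longrightarrow> P 0 \<phi> z = \<phi> z"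
proof (rule P_const)
  interpret lipschitz_strip_process "M z" "F z" "W z" b \<sigma> "Y z" \<xi> \<xi>' \<xi>'' \<delta> C by (rule process)
  have "ent 0 0 P = 0" for P using ent_ge_s[of 0 0 P] ent_le_T[of 0 0 P] by simp
  then show "AE w in M z. stop z 0 0 w = z" using start[of z] by (simp add: stopped_def)
qed simp_all

text \<open>Starting points outside the open strip are stopped at time \<open>0\<close>; in
  particular points far out with \<open>\<bar>\<xi>\<bar> > 1\<close> cause no difficulty at
  infinity.\<close>

lemma P_frozen:
  assumes "continuous_on UNIV \<phi>" "0 \<le> T" "\<bar>\<xi> z\<bar> \<ge> 1"
  shows "P T \<phi> z = \<phi> z"
proof (rule P_const)
  interpret lipschitz_strip_process "M z" "F z" "W z" b \<sigma> "Y z" \<xi> \<xi>' \<xi>'' \<delta> C by (rule process)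
  show "AE w in M z. stop z 0 T w = z" using start[of z]
  proof eventually_elim
    case (elim w)
    have "ent 0 (0 + T) (\<lambda>r. \<bar>\<xi> (Y z r w)\<bar> \<ge> 1) = 0" by (rule ent_eqI) (use assms elim in auto)
    then show ?case using elim by (simp add: stopped_def)
  qed
qed (use assms in auto)

text \<open>The schemes started at the constants \<open>x j\<close> are all run with the noise of
  the space for \<open>y\<close>, where they start close to \<open>Y y 0\<close>. Their expectations
  are the same on every space, so no relation between the solutions from different points is
  needed.\<close>

lemma P_limit_moving:
  assumes T: "0 < T" and \<phi>: "continuous_on UNIV \<phi>" "\<And>x. \<bar>\<phi> x\<bar> \<le> B"
    and x: "x \<longlonglongrightarrow> y" and N: "filterlim N at_top sequentially"
  shows "(\<lambda>j. euler_semigroup b \<sigma> \<xi> T (N j) \<phi> (x j)) \<longlonglongrightarrow> P T \<phi> y"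
proof -
  interpret lipschitz_strip_process "M y" "F y" "W y" b \<sigma> "Y y" \<xi> \<xi>' \<xi>'' \<delta> C by (rule process)
  have sp: "space (M y) \<in> sets (F y 0)" using sets.top[of "F y 0"] subalg[of 0] by (simp add: subalgebra_def)
  have d: "(\<lambda>j. norm (x j - y)) \<longlonglongrightarrow> 0" using x by (simp add: tendsto_norm_zero_iff LIM_zero_iff)
  have V: "AE w in M y. norm (x j - Y y 0 w) \<le> norm (x j - y)" for j using start[of y] by eventually_elim simp
  have "(\<lambda>j. expectation (\<lambda>w. indicator (space (M y)) w * euler_semigroup b \<sigma> \<xi> T (N j) \<phi> (x j))) \<longlonglongrightarrow>
      expectation (\<lambda>w. indicator (space (M y)) w * \<phi> (stop y 0 T w))"
    by (rule euler_weak_limit[OF order_refl T N d _ V sp \<phi>]) simp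
  moreover have "expectation (\<lambda>w. indicator (space (M y)) w * c) = c" for c :: real
  proof -
    have "expectation (\<lambda>w. indicator (space (M y)) w * c) = expectation (\<lambda>w. c)" by (rule Bochner_Integration.integral_cong) auto
    then show ?thesis by (simp add: prob_space)
  qed
  moreover have "expectation (\<lambda>w. indicator (space (M y)) w * \<phi> (stop y 0 T w)) = P T \<phi> y"
    unfolding P_def by (rule Bochner_Integration.integral_cong) auto
  ultimately show ?thesis by (simp only:)
qed

lemma P_limit:
  assumes "0 < T" "continuous_on UNIV \<phi>" "\<And>x. \<bar>\<phi> x\<bar> \<le> B"
  shows "(\<lambda>N. euler_semigroup b \<sigma> \<xi> T N \<phi> y) \<longlonglongrightarrow> P T \<phi> y"
  using P_limit_moving[OF assms tendsto_const, of "\<lambda>N. N"] by (simp add: filterlim_ident)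

text \<open>The approximation at a moving starting point is compared with the limit for that point along a diagonal.\<close>

lemma P_continuous:
  assumes T: "0 < T" and \<phi>: "continuous_on UNIV \<phi>" "\<And>x. \<bar>\<phi> x\<bar> \<le> B"
  shows "continuous_on UNIV (P T \<phi>)"
  unfolding continuous_on_sequentially
proof (intro allI ballI impI, elim conjE)
  fix x :: "nat \<Rightarrow> real^'d" and y assume x: "x \<longlonglongrightarrow> y"
  have "\<exists>N\<ge>j. \<bar>euler_semigroup b \<sigma> \<xi> T N \<phi> (x j) - P T \<phi> (x j)\<bar> < 1 / real (Suc j)" for j
  proof -
    obtain n where n: "\<And>N. n \<le> N \<Longrightarrow> \<bar>euler_semigroup b \<sigma> \<xi> T N \<phi> (x j) - P T \<phi> (x j)\<bar> < 1 / real (Suc j)"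
      using LIMSEQ_D[OF P_limit[OF T \<phi>, of "x j"], of "1 / real (Suc j)"] by auto
    show ?thesis by (intro exI[of _ "max j n"] conjI n) auto
  qed
  then obtain N where N: "\<And>j. j \<le> N j" "\<And>j. \<bar>euler_semigroup b \<sigma> \<xi> T (N j) \<phi> (x j) - P T \<phi> (x j)\<bar> < 1 / real (Suc j)"
    by metis
  have "filterlim N at_top sequentially" by (rule filterlim_at_top_mono[OF filterlim_ident]) (use N(1) in auto)
  from P_limit_moving[OF T \<phi> x this]
  have "(\<lambda>j. euler_semigroup b \<sigma> \<xi> T (N j) \<phi> (x j)) \<longlonglongrightarrow> P T \<phi> y" .
  moreover have "(\<lambda>j. P T \<phi> (x j) - euler_semigroup b \<sigma> \<xi> T (N j) \<phi> (x j)) \<longlonglongrightarrow> 0"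
  proof (rule Lim_null_comparison)
    show "\<forall>\<^sub>F j in sequentially. norm (P T \<phi> (x j) - euler_semigroup b \<sigma> \<xi> T (N j) \<phi> (x j)) \<le> 1 / real (Suc j)"
      using N(2) by (intro always_eventually allI) (simp add: abs_minus_commute less_imp_le)
  qed (rule LIMSEQ_Suc[OF lim_const_over_n])
  ultimately show "(P T \<phi> \<circ> x) \<longlonglongrightarrow> P T \<phi> y" using tendsto_add by (fastforce simp: o_def)
qed

lemma P_abs_le:
  assumes "0 \<le> T" "continuous_on UNIV \<phi>" "\<And>x. \<bar>\<phi> x\<bar> \<le> B"
  shows "\<bar>P T \<phi> y\<bar> \<le> B"
proof -
  interpret prob_space "M y" by (rule prob_space_M)
  note [measurable] = borel_measurable_continuous_onI[OF assms(2)] stop_measurable[OF order_refl assms(1), of y]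
  have i: "integrable (M y) (\<lambda>w. \<phi> (stop y 0 T w))" by (rule integrable_const_bound[where B=B]) (use assms in auto)
  have "\<bar>P T \<phi> y\<bar> \<le> (\<integral>w. \<bar>\<phi> (stop y 0 T w)\<bar> \<partial>M y)" unfolding P_def by (rule integral_abs_bound)
  also have "\<dots> \<le> (\<integral>w. B \<partial>M y)" by (rule integral_mono) (use i assms in auto)
  finally show ?thesis by (simp add: prob_space)
qed

lemma C0_bounded:
  assumes "\<phi> \<in> C0" obtains B where "\<And>x::'a::euclidean_space. \<bar>\<phi> x\<bar> \<le> B"
proof -
  have c: "continuous_on UNIV \<phi>" and l: "(\<phi> \<longlongrightarrow> 0) at_infinity" using assms by (auto simp: C0_def)
  have "\<forall>\<^sub>F x in at_infinity. dist (\<phi> x) 0 < 1" by (rule tendstoD[OF l]) simp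
  then obtain R where R: "\<And>x. R \<le> norm x \<Longrightarrow> \<bar>\<phi> x\<bar> < 1" by (auto simp: eventually_at_infinity)
  have "bounded (\<phi> ` cball 0 R)"
    by (intro compact_imp_bounded compact_continuous_image continuous_on_subset[OF c]) auto
  then obtain B where B: "\<And>x. x \<in> cball 0 R \<Longrightarrow> \<bar>\<phi> x\<bar> \<le> B" by (force simp: bounded_iff)
  show ?thesis
  proof (rule that)
    show "\<bar>\<phi> x\<bar> \<le> max 1 B" for x using R[of x] B[of x] by (cases "norm x \<le> R") auto
  qed
qed

text \<open>Far out, a point outside the strip does not move, and from a point in the strip the
  process travels the distance \<open>r\<close> with probability of order \<open>1 / r\<close>;
  otherwise it remains where \<open>\<phi>\<close> is small.\<close>

lemma P_C0:
  assumes \<phi>: "\<phi> \<in> C0" and T: "0 \<le> T" shows "P T \<phi> \<in> C0"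
proof (cases "T = 0")
  case True
  have "P 0 \<phi> = \<phi>" using \<phi> by (intro ext P_0) (simp add: C0_def)
  then show ?thesis using True \<phi> by simp
next
  case False
  then have T0: "0 < T" using T by simp
  have c: "continuous_on UNIV \<phi>" and l: "(\<phi> \<longlongrightarrow> 0) at_infinity" using \<phi> by (auto simp: C0_def)
  obtain B where B: "\<And>x. \<bar>\<phi> x\<bar> \<le> B" using C0_bounded[OF \<phi>] by blast
  have B0: "0 \<le> B" using B[of 0] by linarith
  have "(P T \<phi> \<longlongrightarrow> 0) at_infinity"
  proof (rule tendstoI)
    fix \<epsilon> :: real assume \<epsilon>: "0 < \<epsilon>"
    define c where "c = (6 * C + 30 * real CARD('n) * C\<^sup>2) * T"
    \<comment> \<open>Some starting point has to be named to access the sign of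
      \<open>C\<close>.\<close>
    interpret L0: lipschitz_strip_process "M 0" "F 0" "W 0" b \<sigma> "Y 0" \<xi> \<xi>' \<xi>'' \<delta> C by (rule process)
    have c0: "0 \<le> c" using L0.C T by (simp add: c_def)
    \<comment> \<open>Makes the contribution \<open>B * (c / r)\<close> of long excursions less than
      \<open>\<epsilon> / 2\<close>; the added ones give strictness when \<open>B\<close> or
      \<open>c\<close> is \<open>0\<close>.\<close>
    define r where "r = max 1 (2 * (B + 1) * (c + 1) / \<epsilon>)"
    have r: "1 \<le> r" by (simp add: r_def)
    have "2 * (B + 1) * (c + 1) \<le> r * \<epsilon>" using \<epsilon> unfolding r_def by (simp add: pos_divide_le_eq[symmetric])
    moreover have "B * c < (B + 1) * (c + 1)" using B0 c0 by (simp add: algebra_simps)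
    ultimately have "B * c < r * (\<epsilon> / 2)" by (simp add: algebra_simps)
    then have small: "B * (c / r) < \<epsilon> / 2" using r by (simp add: pos_divide_less_eq mult.commute)
    have "\<forall>\<^sub>F x in at_infinity. dist (\<phi> x) 0 < \<epsilon> / 2" by (rule tendstoD[OF l]) (use \<epsilon> in simp)
    then obtain R where R: "\<And>x. R \<le> norm x \<Longrightarrow> \<bar>\<phi> x\<bar> < \<epsilon> / 2" by (auto simp: eventually_at_infinity)
    have "\<bar>P T \<phi> y\<bar> < \<epsilon>" if y: "R + r \<le> norm y" for y
    proof (cases "\<bar>\<xi> y\<bar> \<le> 1")
      case False
      then have "P T \<phi> y = \<phi> y" by (intro P_frozen c T) simp
      then show ?thesis using R[of y] y r \<epsilon> by simp
    next
      case True
      interpret lipschitz_strip_process "M y" "F y" "W y" b \<sigma> "Y y" \<xi> \<xi>' \<xi>'' \<delta> C by (rule process)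
      note [measurable] = borel_measurable_continuous_onI[OF c] stop_measurable[OF order_refl T, of y]
      let ?E = "{w\<in>space (M y). dist (stop y 0 T w) y \<ge> r}"
      have E: "?E \<in> events" by measurable
      have "\<bar>P T \<phi> y\<bar> \<le> expectation (\<lambda>w. \<bar>\<phi> (stop y 0 T w)\<bar>)" unfolding P_def by (rule integral_abs_bound)
      also have "\<dots> \<le> expectation (\<lambda>w. \<epsilon> / 2 + B * indicator ?E w)"
      proof (rule integral_mono)
        show "integrable (M y) (\<lambda>w. \<bar>\<phi> (stop y 0 T w)\<bar>)" by (rule integrable_const_bound[where B=B]) (use B in auto)
        fix w assume w: "w \<in> space (M y)"
        show "\<bar>\<phi> (stop y 0 T w)\<bar> \<le> \<epsilon> / 2 + B * indicator ?E w"
        proof (cases "w \<in> ?E")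
          case True then show ?thesis using B[of "stop y 0 T w"] \<epsilon> by simp
        next
          case False
          then have "norm (y - stop y 0 T w) < r" using w by (simp add: dist_norm norm_minus_commute)
          then have "R \<le> norm (stop y 0 T w)" using y norm_triangle_ineq2[of y "stop y 0 T w"] by linarith
          then show ?thesis using R[of "stop y 0 T w"] False by simp
        qed
      qed (use E in \<open>auto simp: emeasure_eq_measure\<close>)
      also have "\<dots> = \<epsilon> / 2 + B * prob ?E"
        using E by (subst Bochner_Integration.integral_add) (auto simp: prob_space emeasure_eq_measure)
      also have "\<dots> \<le> \<epsilon> / 2 + B * (c / r)"
        using stopped_far[OF start True T0 r] B0 by (intro add_left_mono mult_left_mono) (auto simp: c_def)
      finally show ?thesis using small by linarith
    qed
    then show "\<forall>\<^sub>F y in at_infinity. dist (P T \<phi> y) 0 < \<epsilon>" by (auto simp: eventually_at_infinity)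
  qed
  then show ?thesis using P_continuous[OF T0 c B] by (simp add: C0_def)
qed

text \<open>The scheme started at \<open>Y y s\<close> with the noise after \<open>s\<close> has one
  sequence of expectations with two limits: the stopped solution from time \<open>s\<close>, and
  pointwise the operator \<open>P T\<close> evaluated at \<open>Y y s\<close>.\<close>

lemma markov_from:
  assumes T: "0 < T" and s: "0 \<le> s" and A: "A \<in> sets (F y s)" and \<phi>: "continuous_on UNIV \<phi>" "\<And>x. \<bar>\<phi> x\<bar> \<le> B"
  shows "(\<integral>w. indicator A w * \<phi> (stop y s T w) \<partial>M y) = (\<integral>w. indicator A w * P T \<phi> (Y y s w) \<partial>M y)"
proof -
  interpret lipschitz_strip_process "M y" "F y" "W y" b \<sigma> "Y y" \<xi> \<xi>' \<xi>'' \<delta> C by (rule process)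
  have \<phi>m: "\<phi> \<in> borel_measurable borel" by (rule borel_measurable_continuous_onI[OF \<phi>(1)])
  have Pm[measurable]: "P T \<phi> \<in> borel_measurable borel" by (rule borel_measurable_continuous_onI[OF P_continuous[OF T \<phi>]])
  have sg: "euler_semigroup b \<sigma> \<xi> T N \<phi> \<in> borel_measurable borel \<and> (\<forall>x. \<bar>euler_semigroup b \<sigma> \<xi> T N \<phi> x\<bar> \<le> B)" for N
    unfolding euler_semigroup_def by (rule op_pow_bounded[OF \<phi>m \<phi>(2)]) (use T in simp)
  note [measurable] = sets_F_M[OF A] Y_measurable[OF s] sg[THEN conjunct1]
  have B0: "0 \<le> B" using \<phi>(2)[of 0] by linarith
  have "(\<lambda>N. expectation (\<lambda>w. indicator A w * euler_semigroup b \<sigma> \<xi> T N \<phi> (Y y s w))) \<longlonglongrightarrow> expectation (\<lambda>w. indicator A w * \<phi> (stop y s T w))"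
    by (rule euler_weak_limit[OF s T filterlim_ident tendsto_const[of 0], OF _ _ A \<phi>]) (use Y_adapted[OF s] in auto)
  moreover have "(\<lambda>N. expectation (\<lambda>w. indicator A w * euler_semigroup b \<sigma> \<xi> T N \<phi> (Y y s w))) \<longlonglongrightarrow> expectation (\<lambda>w. indicator A w * P T \<phi> (Y y s w))"
  proof (rule integral_dominated_convergence[where w="\<lambda>_. B"])
    show "AE w in M y. (\<lambda>N. indicator A w * euler_semigroup b \<sigma> \<xi> T N \<phi> (Y y s w)) \<longlonglongrightarrow> indicator A w * P T \<phi> (Y y s w)"
      by (intro AE_I2 tendsto_intros P_limit[OF T \<phi>])
    show "AE w in M y. norm (indicator A w * euler_semigroup b \<sigma> \<xi> T N \<phi> (Y y s w)) \<le> B" for N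
      using sg[of N] B0 by (auto simp: indicator_def)
  qed simp_all
  ultimately show ?thesis by (rule LIMSEQ_unique)
qed

lemma markov:
  assumes T: "0 \<le> T" and s: "0 \<le> s" and A: "A \<in> sets (F y s)" and \<phi>: "continuous_on UNIV \<phi>" "\<And>x. \<bar>\<phi> x\<bar> \<le> B"
  shows "(\<integral>w. indicator A w * \<phi> (stop y 0 (s + T) w) \<partial>M y) = (\<integral>w. indicator A w * P T \<phi> (stop y 0 s w) \<partial>M y)"
proof (cases "T = 0")
  case True
  then show ?thesis by (simp add: P_0[OF \<phi>(1)])
next
  case False
  then have T0: "0 < T" using T by simp
  interpret lipschitz_strip_process "M y" "F y" "W y" b \<sigma> "Y y" \<xi> \<xi>' \<xi>'' \<delta> C by (rule process)
  \<comment> \<open>The path has not reached the boundary up to and including time \<open>s\<close>;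
    the event is known at time \<open>s\<close>, so it may be intersected with
    \<open>A\<close>.\<close>
  define D where "D = {w\<in>space (M y). (\<forall>r. 0 \<le> r \<and> r < s \<longrightarrow> \<not> \<bar>\<xi> (Y y r w)\<bar> \<ge> 1)} \<inter> {w\<in>space (M y). \<bar>\<xi> (Y y s w)\<bar> < 1}"
  have D: "D \<in> sets (F y s)"
  proof -
    have "(\<lambda>w. \<bar>\<xi> (Y y s w)\<bar>) \<in> borel_measurable (F y s)" by (rule gY_measurable_F[OF abs_\<xi>_cont s order_refl])
    then have "{w\<in>space (F y s). \<bar>\<xi> (Y y s w)\<bar> < 1} \<in> sets (F y s)" by measurable
    moreover have "space (F y s) = space (M y)" using subalg[of s] by (simp add: subalgebra_def)
    ultimately show ?thesis unfolding D_def using not_closed_before[OF abs_\<xi>_cont order_refl s, of 1] by simp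
  qed
  have B0: "0 \<le> B" using \<phi>(2)[of 0] by linarith
  have sT: "0 \<le> s + T" using s T by simp
  note [measurable] = sets_F_M[OF A] sets_F_M[OF D] borel_measurable_continuous_onI[OF \<phi>(1)] borel_measurable_continuous_onI[OF P_continuous[OF T0 \<phi>]]
    stop_measurable[OF order_refl s, of y] stop_measurable[OF order_refl sT, of y] stop_measurable[OF s T, of y] Y_measurable[OF s]
  have int: "integrable (M y) (\<lambda>w. indicator E w * f w)" if "E \<in> events" "f \<in> borel_measurable (M y)" "\<And>w. \<bar>f w\<bar> \<le> B" for E and f :: "'w \<Rightarrow> real"
  proof (rule integrable_const_bound[where B=B])
    show "(\<lambda>w. indicator E w * f w) \<in> borel_measurable (M y)" using that(1,2) by measurable
  qed (use that B0 in \<open>auto simp: indicator_def\<close>)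
  have AD: "A \<inter> D \<in> events" "A - D \<in> events" by measurable
  have Pb: "\<bar>P T \<phi> x\<bar> \<le> B" for x by (rule P_abs_le[OF T \<phi>])
  have i: "integrable (M y) (\<lambda>w. indicator (A \<inter> D) w * \<phi> (stop y s T w))" "integrable (M y) (\<lambda>w. indicator (A - D) w * \<phi> (stop y 0 s w))"
    "integrable (M y) (\<lambda>w. indicator (A \<inter> D) w * P T \<phi> (Y y s w))"
    by (intro int AD \<phi>(2) Pb; measurable)+
  have pw: "indicator A w * \<phi> (stop y 0 (s + T) w) = indicator (A \<inter> D) w * \<phi> (stop y s T w) + indicator (A - D) w * \<phi> (stop y 0 s w)"
    "indicator A w * P T \<phi> (stop y 0 s w) = indicator (A \<inter> D) w * P T \<phi> (Y y s w) + indicator (A - D) w * \<phi> (stop y 0 s w)"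
    if w: "w \<in> space (M y)" for w
  proof (atomize (full), cases "w \<in> D")
    case True
    then have "stop y 0 (s + T) w = stop y s T w" "stop y 0 s w = Y y s w"
      by (intro stopped_split_inside s T; force simp: D_def not_le)+
    then show "indicator A w * \<phi> (stop y 0 (s + T) w) = indicator (A \<inter> D) w * \<phi> (stop y s T w) + indicator (A - D) w * \<phi> (stop y 0 s w) \<and>
      indicator A w * P T \<phi> (stop y 0 s w) = indicator (A \<inter> D) w * P T \<phi> (Y y s w) + indicator (A - D) w * \<phi> (stop y 0 s w)"
      using True by (simp add: indicator_def)
  next
    case False
    then have "\<not> ((\<forall>r. 0 \<le> r \<and> r < s \<longrightarrow> \<bar>\<xi> (Y y r w)\<bar> < 1) \<and> \<bar>\<xi> (Y y s w)\<bar> < 1)" using w by (auto simp: D_def not_le)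
    note out = stopped_split_outside[OF w s T this]
    show "indicator A w * \<phi> (stop y 0 (s + T) w) = indicator (A \<inter> D) w * \<phi> (stop y s T w) + indicator (A - D) w * \<phi> (stop y 0 s w) \<and>
      indicator A w * P T \<phi> (stop y 0 s w) = indicator (A \<inter> D) w * P T \<phi> (Y y s w) + indicator (A - D) w * \<phi> (stop y 0 s w)"
      using False out P_frozen[OF \<phi>(1) T out(2)] by (simp add: indicator_def)
  qed
  have "expectation (\<lambda>w. indicator A w * \<phi> (stop y 0 (s + T) w)) =
      expectation (\<lambda>w. indicator (A \<inter> D) w * \<phi> (stop y s T w) + indicator (A - D) w * \<phi> (stop y 0 s w))"
    by (rule Bochner_Integration.integral_cong[OF refl pw(1)])
  also have "\<dots> = expectation (\<lambda>w. indicator (A \<inter> D) w * P T \<phi> (Y y s w)) + expectation (\<lambda>w. indicator (A - D) w * \<phi> (stop y 0 s w))"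
    by (simp only: Bochner_Integration.integral_add[OF i(1,2)] markov_from[OF T0 s sets.Int[OF A D] \<phi>])
  also have "\<dots> = expectation (\<lambda>w. indicator A w * P T \<phi> (stop y 0 s w))"
    unfolding Bochner_Integration.integral_add[OF i(3,2), symmetric] by (rule Bochner_Integration.integral_cong[OF refl pw(2)[symmetric]])
  finally show ?thesis .
qed

text \<open>The statements about \<open>stop\<close> are transferred to the prescribed stopped
  process by almost sure equality, except adaptedness. The conditional expectation is identified by
  integrating over events of \<open>F y s\<close>.\<close>

theorem stopped_feller:
  assumes filtered: "\<And>y. filtered_prob_space (M y) (F y)"
  shows "feller_process M F (\<lambda>y. stopped_process \<xi> {x. \<xi> x \<le> -1} (Y y))"
proof -
  let ?Z = "\<lambda>y. stopped_process \<xi> {x. \<xi> x \<le> -1} (Y y)"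
  have Z_AE: "AE w in M y. ?Z y t w = stop y 0 t w" and Z_F: "?Z y t \<in> borel_measurable (F y t)" if "0 \<le> t" for y t
  proof -
    interpret lipschitz_strip_process "M y" "F y" "W y" b \<sigma> "Y y" \<xi> \<xi>' \<xi>'' \<delta> C by (rule process)
    show "AE w in M y. ?Z y t w = stop y 0 t w" by (rule stopped_process_AE[OF that])
    show "?Z y t \<in> borel_measurable (F y t)" by (rule stopped_process_measurable_F[OF that])
  qed
  have Z_M: "?Z y t \<in> borel_measurable (M y)" if "0 \<le> t" for y t
  proof -
    interpret lipschitz_strip_process "M y" "F y" "W y" b \<sigma> "Y y" \<xi> \<xi>' \<xi>'' \<delta> C by (rule process)
    show ?thesis by (rule measurable_F_M[OF Z_F[OF that]])
  qed
  have P_eq: "(\<integral>w. \<phi> (?Z y t w) \<partial>M y) = P t \<phi> y" if \<phi>: "continuous_on UNIV \<phi>" and t: "0 \<le> t" for \<phi> :: "real^'d \<Rightarrow> real" and y t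
  proof -
    note [measurable] = borel_measurable_continuous_onI[OF \<phi>] Z_M[OF t, of y] stop_measurable[OF order_refl t, of y]
    show ?thesis unfolding P_def by (rule integral_cong_AE) (use Z_AE[OF t, of y] in auto)
  qed
  have start': "AE w in M y. ?Z y 0 w = y" for y
  proof -
    interpret lipschitz_strip_process "M y" "F y" "W y" b \<sigma> "Y y" \<xi> \<xi>' \<xi>'' \<delta> C by (rule process)
    have "ent 0 0 P = 0" for P using ent_ge_s[of 0 0 P] ent_le_T[of 0 0 P] by simp
    then show ?thesis using start[of y] by (simp add: stopped_process_eq)
  qed
  have cond: "AE w in M y. real_cond_exp (M y) (F y s) (\<lambda>w'. \<phi> (?Z y (s + t) w')) w = (\<integral>w'. \<phi> (?Z (?Z y s w) t w') \<partial>M (?Z y s w))"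
    if \<phi>: "\<phi> \<in> C0" and s: "0 \<le> s" and t: "0 \<le> t" for \<phi> :: "real^'d \<Rightarrow> real" and y s t
  proof -
    interpret lipschitz_strip_process "M y" "F y" "W y" b \<sigma> "Y y" \<xi> \<xi>' \<xi>'' \<delta> C by (rule process)
    interpret S: finite_measure_subalgebra "M y" "F y s" by unfold_locales (rule subalg)
    have c: "continuous_on UNIV \<phi>" using \<phi> by (simp add: C0_def)
    obtain B where B: "\<And>x. \<bar>\<phi> x\<bar> \<le> B" using C0_bounded[OF \<phi>] by blast
    have Pc: "continuous_on UNIV (P t \<phi>)" using P_C0[OF \<phi> t] by (simp add: C0_def)
    have st: "0 \<le> s + t" using s t by simp
    note [measurable] = borel_measurable_continuous_onI[OF c] borel_measurable_continuous_onI[OF Pc] Z_M[OF s, of y] Z_M[OF st, of y] Z_F[OF s, of y]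
      stop_measurable[OF order_refl s, of y] stop_measurable[OF order_refl st, of y]
    have "AE w in M y. real_cond_exp (M y) (F y s) (\<lambda>w'. \<phi> (?Z y (s + t) w')) w = P t \<phi> (?Z y s w)"
    proof (rule S.real_cond_exp_charact)
      fix A assume A: "A \<in> sets (F y s)"
      have Am[measurable]: "A \<in> events" by (rule sets_F_M[OF A])
      have "expectation (\<lambda>w. indicator A w * \<phi> (?Z y (s + t) w)) = expectation (\<lambda>w. indicator A w * \<phi> (stop y 0 (s + t) w))"
        by (rule integral_cong_AE) (use Z_AE[OF st, of y] in auto)
      also have "\<dots> = expectation (\<lambda>w. indicator A w * P t \<phi> (stop y 0 s w))" by (rule markov[OF t s A c B])
      also have "\<dots> = expectation (\<lambda>w. indicator A w * P t \<phi> (?Z y s w))"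
        by (rule integral_cong_AE) (use Z_AE[OF s, of y] in auto)
      finally show "set_lebesgue_integral (M y) A (\<lambda>w. \<phi> (?Z y (s + t) w)) = set_lebesgue_integral (M y) A (\<lambda>w. P t \<phi> (?Z y s w))"
        by (simp add: set_lebesgue_integral_def)
    next
      show "integrable (M y) (\<lambda>w. \<phi> (?Z y (s + t) w))" by (rule integrable_const_bound[where B=B]) (use B in auto)
      show "integrable (M y) (\<lambda>w. P t \<phi> (?Z y s w))" by (rule integrable_const_bound[where B=B]) (use P_abs_le[OF t c B] in auto)
      show "(\<lambda>w. P t \<phi> (?Z y s w)) \<in> borel_measurable (F y s)" by measurable
    qed
    then show ?thesis by (simp only: P_eq[OF c t])
  qed
  show ?thesis
    unfolding feller_process_def markov_family_def adapted_def
  proof (intro conjI allI ballI impI)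
    show "(\<lambda>y. \<integral>w. \<phi> (?Z y s w) \<partial>M y) \<in> C0" if "\<phi> \<in> C0" "0 \<le> s" for \<phi> s
      using P_C0[OF that] P_eq[OF _ that(2), of \<phi>] that(1) by (simp add: C0_def)
  qed (use filtered Z_F start' cond in auto)
qed

end


section \<open>From the hypotheses of the theorem to the locales\<close>

lemma C2_locally_lipschitz:
  fixes f :: "'a::euclidean_space \<Rightarrow> 'b::real_normed_vector"
  assumes f: "C2 f"
  shows "\<exists>L\<ge>0. \<forall>x\<in>cball 0 R. \<forall>z\<in>cball 0 R. norm (f x - f z) \<le> L * norm (x - z)"
proof -
  have "continuous_on UNIV (D1 f)" using f by (auto simp: C2_def intro: differentiable_imp_continuous_on)
  then have "bounded (D1 f ` cball 0 R)"
    by (intro compact_imp_bounded compact_continuous_image) (auto intro: continuous_on_subset)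
  then obtain L where L: "\<And>x. x \<in> cball 0 R \<Longrightarrow> norm (D1 f x) \<le> L" by (force simp: bounded_iff)
  show ?thesis
  proof (intro exI[of _ "max 0 L"] conjI ballI)
    fix x z :: 'a assume "x \<in> cball 0 R" "z \<in> cball 0 R"
    then show "norm (f x - f z) \<le> max 0 L * norm (x - z)"
      by (intro differentiable_bound[OF convex_cball[of 0 R], where f'="\<lambda>x. blinfun_apply (D1 f x)"])
        (auto simp: norm_blinfun.rep_eq[symmetric] le_max_iff_disj L intro: has_derivative_at_withinI C2_has_derivative(1)[OF f])
  qed simp
qed

text \<open>With \<open>a\<close> the product of \<open>S\<close> and its transpose, the form is the
  squared length of the transpose applied to the gradient, whose coordinates are the derivatives of
  \<open>f\<close> along the columns of \<open>S\<close>.\<close>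

lemma grad_quadratic_form:
  fixes S :: "real^'n^'d"
  assumes "f differentiable (at x)"
  shows "grad f x \<bullet> ((S ** transpose S) *v grad f x) = (\<Sum>j\<in>UNIV. (frechet_derivative f (at x) (column j S))\<^sup>2)"
proof -
  let ?f' = "frechet_derivative f (at x)"
  have lin: "linear ?f'" using assms linear_frechet_derivative by blast
  have "(transpose S *v grad f x) $ j = ?f' (column j S)" for j
  proof -
    have "(\<Sum>i\<in>UNIV. column j S $ i *\<^sub>R axis i 1) = column j S" using basis_expansion[of "column j S"] by (simp only: scalar_mult_eq_scaleR)
    then have "?f' (column j S) = ?f' (\<Sum>i\<in>UNIV. column j S $ i *\<^sub>R axis i 1)" by (simp only:)
    also have "\<dots> = (\<Sum>i\<in>UNIV. column j S $ i * ?f' (axis i 1))" by (simp add: linear_sum[OF lin] linear_scale[OF lin])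
    finally show ?thesis by (simp add: matrix_vector_mult_def transpose_def column_def grad_def)
  qed
  moreover have "grad f x \<bullet> ((S ** transpose S) *v grad f x) = (transpose S *v grad f x) \<bullet> (transpose S *v grad f x)"
    by (simp add: matrix_vector_mul_assoc[symmetric] dot_lmul_matrix[symmetric])
  ultimately show ?thesis by (simp add: inner_vec_def power2_eq_square)
qed

theorem lemma2p3:
  fixes b :: "real^'d \<Rightarrow> real^'d"
    and \<sigma> :: "real^'d \<Rightarrow> real^'n^'d"
    and \<xi> :: "real^'d \<Rightarrow> real"
    and A :: "(real^'d) set"
    and \<eta>0 :: "(real^'d) measure"
    and M :: "real^'d \<Rightarrow> 'w measure"
    and F :: "real^'d \<Rightarrow> real \<Rightarrow> 'w measure"
    and W :: "real^'d \<Rightarrow> real \<Rightarrow> 'w \<Rightarrow> real^'n"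
    and Y :: "real^'d \<Rightarrow> real \<Rightarrow> 'w \<Rightarrow> real^'d"
  defines "strip \<equiv> {x. -1 \<le> \<xi> x \<and> \<xi> x \<le> 1}"
  assumes initial_law: "prob_space \<eta>0" "sets \<eta>0 = sets borel" "measure \<eta>0 {x. \<xi> x = 0} = 1"
    and solution: "\<And>y. sde_solution b \<sigma> y (M y) (F y) (W y) (Y y)"
    and b_C2: "C2 b" "bounded (b ` strip)" "bounded (D1 b ` strip)" "bounded (D2 b ` strip)"
    and \<sigma>_C2: "C2 \<sigma>" "bounded (\<sigma> ` strip)" "bounded (D1 \<sigma> ` strip)" "bounded (D2 \<sigma> ` strip)"
    and \<xi>_C2: "C2 \<xi>" "bounded (D1 \<xi> ` strip)" "bounded (D2 \<xi> ` strip)"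
    and A_eq: "A = closure A" "A = {x. \<xi> x \<le> -1}"
    and nondegenerate: "\<exists>\<delta>>0. \<forall>x\<in>strip.
      grad \<xi> x \<bullet> ((\<sigma> x ** transpose (\<sigma> x)) *v grad \<xi> x) \<ge> \<delta>"
  shows "assumption1 \<xi> A \<eta>0 M F Y \<and> assumption2 \<xi> A M Y \<and> assumption3 \<xi> A M Y"
proof -
  have in_strip: "x \<in> strip \<longleftrightarrow> \<bar>\<xi> x\<bar> \<le> 1" for x by (auto simp: strip_def)
  from nondegenerate obtain \<delta> where d: "\<delta> > 0 \<and> (\<forall>x\<in>strip. grad \<xi> x \<bullet> ((\<sigma> x ** transpose (\<sigma> x)) *v grad \<xi> x) \<ge> \<delta>)" ..
  have \<delta>: "\<delta> > 0" "\<And>x. \<bar>\<xi> x\<bar> \<le> 1 \<Longrightarrow> grad \<xi> x \<bullet> ((\<sigma> x ** transpose (\<sigma> x)) *v grad \<xi> x) \<ge> \<delta>"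
    by (rule conjunct1[OF d], rule bspec[OF conjunct2[OF d] in_strip[THEN iffD2]])
  have "\<exists>C\<ge>0. \<forall>x\<in>strip. norm (b x) \<le> C \<and> norm (\<sigma> x) \<le> C \<and> norm (D1 \<xi> x) \<le> C \<and> norm (D2 \<xi> x) \<le> C"
  proof -
    have bdd: "\<exists>c. \<forall>x\<in>strip. norm (f x) \<le> c" if "bounded (f ` strip)" for f :: "real^'d \<Rightarrow> 'z::real_normed_vector"
      using that by (simp add: bounded_iff)
    obtain c1 c2 c3 c4 where c: "\<forall>x\<in>strip. norm (b x) \<le> c1" "\<forall>x\<in>strip. norm (\<sigma> x) \<le> c2"
      "\<forall>x\<in>strip. norm (D1 \<xi> x) \<le> c3" "\<forall>x\<in>strip. norm (D2 \<xi> x) \<le> c4"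
      using bdd[OF b_C2(2)] bdd[OF \<sigma>_C2(2)] bdd[OF \<xi>_C2(2)] bdd[OF \<xi>_C2(3)] by (elim exE)
    let ?C = "max 0 (max (max c1 c2) (max c3 c4))"
    have "norm (b x) \<le> ?C \<and> norm (\<sigma> x) \<le> ?C \<and> norm (D1 \<xi> x) \<le> ?C \<and> norm (D2 \<xi> x) \<le> ?C" if "x \<in> strip" for x
      using c[THEN bspec, OF that] by (simp add: le_max_iff_disj)
    then show ?thesis by (intro exI[of _ ?C]) auto
  qed
  then obtain C where C: "C \<ge> 0" "\<And>x. \<bar>\<xi> x\<bar> \<le> 1 \<Longrightarrow> norm (b x) \<le> C \<and> norm (\<sigma> x) \<le> C \<and> norm (D1 \<xi> x) \<le> C \<and> norm (D2 \<xi> x) \<le> C"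
    unfolding Ball_def in_strip by auto
  have D1_eq: "blinfun_apply (D1 \<xi> x) = frechet_derivative \<xi> (at x)" for x
    using frechet_derivative_at[OF C2_has_derivative(1)[OF \<xi>_C2(1), of x]] .
  have "\<xi> differentiable (at x)" for x using C2_has_derivative(1)[OF \<xi>_C2(1), of x] by (rule differentiableI)
  then have nondeg: "(\<Sum>j\<in>UNIV. (D1 \<xi> x (column j (\<sigma> x)))\<^sup>2) \<ge> \<delta>" if "\<bar>\<xi> x\<bar> \<le> 1" for x
    using \<delta>(2)[OF that] by (simp add: grad_quadratic_form D1_eq)
  have lip: "\<exists>L\<ge>0. \<forall>x\<in>cball 0 R. \<forall>z\<in>cball 0 R. norm (b x - b z) \<le> L * norm (x - z) \<and> norm (\<sigma> x - \<sigma> z) \<le> L * norm (x - z)" for R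
  proof -
    obtain L1 where L1: "L1 \<ge> 0" "\<forall>x\<in>cball 0 R. \<forall>z\<in>cball 0 R. norm (b x - b z) \<le> L1 * norm (x - z)"
      using C2_locally_lipschitz[OF b_C2(1)] by blast
    obtain L2 where L2: "L2 \<ge> 0" "\<forall>x\<in>cball 0 R. \<forall>z\<in>cball 0 R. norm (\<sigma> x - \<sigma> z) \<le> L2 * norm (x - z)"
      using C2_locally_lipschitz[OF \<sigma>_C2(1)] by blast
    have "L1 * norm (x - z) \<le> (L1 + L2) * norm (x - z)" "L2 * norm (x - z) \<le> (L1 + L2) * norm (x - z)" for x z :: "real^'d"
      using L1 L2 by (auto intro!: mult_right_mono)
    then show ?thesis using L1 L2 by (intro exI[of _ "L1 + L2"]) (meson add_nonneg_nonneg order_trans)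
  qed
  have process: "lipschitz_strip_process (M y) (F y) (W y) b \<sigma> (Y y) \<xi> (D1 \<xi>) (D2 \<xi>) \<delta> C" for y
    unfolding lipschitz_strip_process_def lipschitz_strip_process_axioms_def strip_process_def strip_process_axioms_def
    using sde_solution_sde_process[OF solution C2_continuous_on[OF b_C2(1)] C2_continuous_on[OF \<sigma>_C2(1)], of y]
      C2_C2f[OF \<xi>_C2(1)] C \<delta>(1) nondeg lip by blast
  have start: "AE w in M y. Y y 0 w = y" for y using solution[of y] by (simp add: sde_solution_def)
  interpret sde_family M F W Y b \<sigma> \<xi> "D1 \<xi>" "D2 \<xi>" \<delta> C by (rule sde_family.intro[OF process start])
  have A1: "assumption1 \<xi> A \<eta>0 M F Y"
    unfolding assumption1_def
  proof (intro conjI allI)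
    show "locally compact (UNIV :: (real^'d) set)" by (rule open_imp_locally_compact[OF open_UNIV])
    show "continuous_on UNIV \<xi>" by (rule C2_continuous_on[OF \<xi>_C2(1)])
    show "A \<subseteq> {x. \<xi> x < 0}" unfolding A_eq(2) by auto
    show "feller_process M F (\<lambda>y. stopped_process \<xi> A (Y y))"
      unfolding A_eq(2) by (rule stopped_feller) (use solution in \<open>simp add: sde_solution_def\<close>)
    show "continuous_paths (M y) (Y y)" for y using solution[of y] by (simp add: sde_solution_def)
  qed (rule initial_law(3))
  have A2: "assumption2 \<xi> A M Y"
    unfolding assumption2_def
  proof (intro conjI ballI allI impI)
    fix t y assume "t \<in> {0..1}" "\<xi> y = t"
    interpret L: lipschitz_strip_process "M y" "F y" "W y" b \<sigma> "Y y" \<xi> "D1 \<xi>" "D2 \<xi>" \<delta> C by (rule process)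
    show "\<P>(w in M y. hit_level \<xi> (\<lambda>s. Y y s w) t = 0) = 1"
      by (rule L.hit_level_0[OF start]) (use \<open>t \<in> {0..1}\<close> \<open>\<xi> y = t\<close> in auto)
  next
    fix y assume y: "\<xi> y = 0"
    interpret L: lipschitz_strip_process "M y" "F y" "W y" b \<sigma> "Y y" \<xi> "D1 \<xi>" "D2 \<xi>" \<delta> C by (rule process)
    show "\<P>(w in M y. hit (\<lambda>s. Y y s w) (closure A) = hit (\<lambda>s. Y y s w) (interior A)) = 1"
      by (rule L.hit_closure_interior[OF start y A_eq(2)])
  qed
  \<comment> \<open>The value of \<open>rate\<close>, written out so that the lower bound visibly
    does not depend on the starting point over which the infimum is taken.\<close>
  define r where "r = 2 * (C * C + real CARD('n) * (C * C\<^sup>2) + 1) / \<delta>"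
  have r: "r > 0" unfolding r_def using C(1) \<delta>(1) by (intro divide_pos_pos mult_pos_pos add_nonneg_pos add_nonneg_nonneg mult_nonneg_nonneg) auto
  have above: "(1 - exp (- r)) / exp r \<le> \<P>(w in M y. hit_level \<xi> (\<lambda>s. Y y s w) 1 < hit (\<lambda>s. Y y s w) A)" if "\<xi> y = 0" for y
  proof -
    interpret L: lipschitz_strip_process "M y" "F y" "W y" b \<sigma> "Y y" \<xi> "D1 \<xi>" "D2 \<xi>" \<delta> C by (rule process)
    show ?thesis using L.exit_above_prob[OF start that A_eq(2)] by (simp add: L.rate_def r_def)
  qed
  have A3: "assumption3 \<xi> A M Y"
    unfolding assumption3_def
  proof (intro conjI allI impI)
    fix y assume y: "0 \<le> \<xi> y \<and> \<xi> y \<le> 1"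
    interpret L: lipschitz_strip_process "M y" "F y" "W y" b \<sigma> "Y y" \<xi> "D1 \<xi>" "D2 \<xi>" \<delta> C by (rule process)
    show "\<P>(w in M y. min (hit (\<lambda>s. Y y s w) A) (hit_level \<xi> (\<lambda>s. Y y s w) 1) < \<infinity>) = 1"
      by (rule L.exit_finite[OF start _ A_eq(2)]) (use y in auto)
  next
    \<comment> \<open>An infimum of reals over the empty set would be an unspecified value; the
      initial law, which gives this set mass one, excludes that.\<close>
    have "{x. \<xi> x = 0} \<noteq> {}" using initial_law(3) measure_empty[of \<eta>0] by (metis zero_neq_one)
    then have "(1 - exp (- r)) / exp r \<le> (INF y\<in>{y. \<xi> y = 0}. \<P>(w in M y. hit_level \<xi> (\<lambda>s. Y y s w) 1 < hit (\<lambda>s. Y y s w) A))"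
      by (rule cINF_greatest) (use above in auto)
    moreover have "0 < (1 - exp (- r)) / exp r" using r by simp
    ultimately show "0 < (INF y\<in>{y. \<xi> y = 0}. \<P>(w in M y. hit_level \<xi> (\<lambda>s. Y y s w) 1 < hit (\<lambda>s. Y y s w) A))" by linarith
  qed
  show ?thesis using A1 A2 A3 by blast
qed

end
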